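(* Let $\mu\in\mathcal M_a(\mathcal N')$ be a non-degenerate probability measure. The Wick product $\diamond$ is continuous on $(\mathcal N)^{-1}_\mu$. In particular, for $\Phi\in(\mathcal H_{-p_1})^{-1}_{-q_1,\mu}$, $\Psi\in(\mathcal H_{-p_2})^{-1}_{-q_2,\mu}$ and $p=\max(p_1,p_2)$, $q=q_1+q_2+1$, the following estimate holds: $$\|\Phi\diamond\Psi\|_{-p,-q,\mu}\le\|\Phi\|_{-p_1,-q_1,\mu}\,\|\Psi\|_{-p_2,-q_2,\mu}.$$
   Context: Nuclear triple: $\mathcal H$ is a real separable Hilbert space with norm $|\cdot|$; $\mathcal N\subset\mathcal H$ is a separable nuclear Fréchet space, densely and continuously embedded, $\mathcal N=\bigcap_{p\in\mathbb N}\mathcal H_p$ with the projective limit topology, where the $\mathcal H_p$ are Hilbert spaces with norms $|\cdot|_p$, $|\cdot|\le|\cdot|_p\le|\cdot|_q$ for $p<q$, and for every $p$ there is $p'>p$ such that the embedding $\mathcal H_{p'}\hookrightarrow\mathcal H_p$ is Hilbert–Schmidt. $\mathcal N'=\bigcup_p\mathcal H_{-p}$ is the dual, $\mathcal H_{-p}$ being the dual of $\mathcal H_p$ with respect to $\mathcal H$, with norm $|\cdot|_{-p}$; $\langle\cdot,\cdot\rangle$ is the bilinear dual pairing. A subscript $\mathbb C$ denotes complexification, $\hat\otimes$ the symmetric tensor product; $|\cdot|_{\pm p}$ also denotes the norm on $\mathcal H_{\pm p,\mathbb C}^{\hat\otimes n}$ (complex modulus if $n=0$); $\mathcal N_{\mathbb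 C}^{\hat\otimes n}$ is the projective limit of the $\mathcal H_{p,\mathbb C}^{\hat\otimes n}$, and its dual is the inductive limit of the $\mathcal H_{-p,\mathbb C}^{\hat\otimes n}$. Measures: $\mathcal M_a(\mathcal N')$ is the set of measures $\mu$ on the cylinder $\sigma$-algebra of $\mathcal N'$ whose Laplace transform $l_\mu(\theta)=\int_{\mathcal N'}e^{\langle x,\theta\rangle}\,d\mu(x)$ is holomorphic in a neighborhood of $0\in\mathcal N_{\mathbb C}$. $\mathcal P(\mathcal N')$ is the set of functions $\varphi(x)=\sum_{n=0}^N\langle x^{\otimes n},\tilde\varphi^{(n)}\rangle$ on $\mathcal N'$ with $\tilde\varphi^{(n)}\in\mathcal N_{\mathbb C}^{\hat\otimes n}$, topologized as the topological direct sum $\bigoplus_n\mathcal N_{\mathbb C}^{\hat\otimes n}$; $\mu$ is non-degenerate if $\varphi\in\mathcal P(\mathcal N')$, $\varphi=0$ $\mu$-a.e. implies $\varphi\equiv0$. Appell system: $e_\mu(\theta;z)=e^{\langle z,\theta\rangle}/l_\mu(\theta)=\sum_{n}\frac1{n!}\langle P_n^\mu(z),\theta^{\otimes n}\rangle$ ($\theta$ near $0$ in $\mathcal N_{\mathbb C}$, $z\in\mathcal N'_{\mathbb C}$) defines $P_n^\mu(z)\in(\mathcal N_{\mathbb C}^{\hat\otimes n})'$. Every $\varphi\in\mathcal P(\mathcal N')$ is uniquely $\sum_{n=0}^N\langle P_n^\mu,\varphi^{(n)}\rangle$ with $\varphi^{(n)}\in\mathcal N_{\mathbb C}^{\hat\otimes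 n}$. $\mathcal P'_\mu(\mathcal N')$ is the dual of $\mathcal P(\mathcal N')$, with bilinear pairing $\langle\!\langle\cdot,\cdot\rangle\!\rangle_\mu$ extending $\langle\!\langle f,\varphi\rangle\!\rangle_\mu=\int f\varphi\,d\mu$ ($f\in L^2(\mu)$). Every $\Phi\in\mathcal P'_\mu(\mathcal N')$ is uniquely of the form $\Phi=\sum_nQ_n^\mu(\Phi^{(n)})$, $\Phi^{(n)}\in(\mathcal N_{\mathbb C}^{\hat\otimes n})'$, acting by $\langle\!\langle\Phi,\varphi\rangle\!\rangle_\mu=\sum_nn!\langle\Phi^{(n)},\varphi^{(n)}\rangle$. Distributions: $(\mathcal H_{-p})^{-1}_{-q,\mu}$ is the Hilbert space of $\Phi\in\mathcal P'_\mu(\mathcal N')$ with $\|\Phi\|^2_{-p,-q,\mu}=\sum_n2^{-qn}|\Phi^{(n)}|_{-p}^2<\infty$; $(\mathcal N)^{-1}_\mu=\bigcup_{p,q\in\mathbb N}(\mathcal H_{-p})^{-1}_{-q,\mu}$ with the inductive limit topology. $S_\mu$-transform and Wick product: $S_\mu\Phi(\theta)=\langle\!\langle\Phi,e_\mu(\theta;\cdot)\rangle\!\rangle_\mu=\sum_n\langle\Phi^{(n)},\theta^{\otimes n}\rangle$ for $\theta$ in a suitable neighborhood of $0$ in $\mathcal N_{\mathbb C}$; $S_\mu$ is a bijection from $(\mathcal N)^{-1}_\mu$ onto the algebra of germs of functions holomorphic at $0\in\mathcal N_{\mathbb C}$. The Wick product $\Phi\diamond\Psi\in(\mathcal N)^{-1}_\mu$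 of $\Phi,\Psi\in(\mathcal N)^{-1}_\mu$ is defined by $S_\mu(\Phi\diamond\Psi)=S_\mu\Phi\cdot S_\mu\Psi$; equivalently $\Phi\diamond\Psi=\sum_nQ_n^\mu(\Xi^{(n)})$ with $\Xi^{(n)}=\sum_{k=0}^n\Phi^{(k)}\hat\otimes\Psi^{(n-k)}$. *)

theory Defs
  imports "HOL-Complex_Analysis.Complex_Analysis" "HOL-Probability.Probability"
begin

text \<open>
  Spaces of functionals, kernels and polynomials are represented by total functions that vanish
  outside their domain, so that the vector space operations are pointwise.
\<close>

definition vanishes_outside :: "'a set \<Rightarrow> ('a \<Rightarrow> 'b::zero) \<Rightarrow> bool" where
  "vanishes_outside A f \<longleftrightarrow> (\<forall>x. x \<notin> A \<longrightarrow> f x = 0)"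

definition linear_functional_on :: "('a \<Rightarrow> complex) set \<Rightarrow> (('a \<Rightarrow> complex) \<Rightarrow> complex) \<Rightarrow> bool" where
  "linear_functional_on E L \<longleftrightarrow> vanishes_outside E L \<and>
     (\<forall>u\<in>E. \<forall>v\<in>E. \<forall>a b. L (\<lambda>x. a * u x + b * v x) = a * L u + b * L v)"

definition absolutely_convex :: "('a \<Rightarrow> complex) set \<Rightarrow> bool" where
  "absolutely_convex V \<longleftrightarrow>
     (\<forall>u\<in>V. \<forall>v\<in>V. \<forall>a b. cmod a + cmod b \<le> 1 \<longrightarrow> (\<lambda>x. a * u x + b * v x) \<in> V)"

text \<open>
  \<open>W i\<close> is (the image in \<open>E\<close> of) a base of neighbourhoods of zero of the \<open>i\<close>-th space. The finest
  locally convex topology on \<open>E\<close> that makes all the maps into \<open>E\<close> continuous has as base at zero the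
  absolutely convex sets that contain, for each \<open>i\<close>, a member of \<open>W i\<close>. Inductive limits and
  topological direct sums are instances.
\<close>

definition lc_final_open :: "('a \<Rightarrow> complex) set \<Rightarrow> ('i \<Rightarrow> ('a \<Rightarrow> complex) set set) \<Rightarrow> ('a \<Rightarrow> complex) set \<Rightarrow> bool" where
  "lc_final_open E W U \<longleftrightarrow> U \<subseteq> E \<and>
     (\<forall>u\<in>U. \<exists>V. V \<subseteq> E \<and> absolutely_convex V \<and> (\<forall>i. \<exists>w\<in>W i. w \<subseteq> V) \<and>
        (\<forall>v\<in>V. (\<lambda>x. u x + v x) \<in> U))"

definition lc_final_topology :: "('a \<Rightarrow> complex) set \<Rightarrow> ('i \<Rightarrow> ('a \<Rightarrow> complex) set set) \<Rightarrow> ('a \<Rightarrow> complex) topology" where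
  "lc_final_topology E W = topology (lc_final_open E W)"

lemma openin_lc_final_topology:
  assumes directed: "\<And>i v w. v \<in> W i \<Longrightarrow> w \<in> W i \<Longrightarrow> \<exists>z\<in>W i. z \<subseteq> v \<inter> w"
  shows "openin (lc_final_topology E W) U \<longleftrightarrow> lc_final_open E W U"
proof -
  have "istopology (lc_final_open E W)"
    unfolding istopology_def
  proof (intro conjI allI impI)
    fix S T assume S: "lc_final_open E W S" and T: "lc_final_open E W T"
    show "lc_final_open E W (S \<inter> T)"
      unfolding lc_final_open_def
    proof (intro conjI ballI)
      show "S \<inter> T \<subseteq> E" using S unfolding lc_final_open_def by blast
      fix u assume u: "u \<in> S \<inter> T"
      obtain V1 where V1: "V1 \<subseteq> E" "absolutely_convex V1" "\<forall>i. \<exists>w\<in>W i. w \<subseteq> V1"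
        "\<forall>v\<in>V1. (\<lambda>x. u x + v x) \<in> S"
        using S u unfolding lc_final_open_def by blast
      obtain V2 where V2: "V2 \<subseteq> E" "absolutely_convex V2" "\<forall>i. \<exists>w\<in>W i. w \<subseteq> V2"
        "\<forall>v\<in>V2. (\<lambda>x. u x + v x) \<in> T"
        using T u unfolding lc_final_open_def by blast
      have "absolutely_convex (V1 \<inter> V2)"
        using V1(2) V2(2) unfolding absolutely_convex_def by blast
      moreover have "\<forall>i. \<exists>w\<in>W i. w \<subseteq> V1 \<inter> V2"
      proof
        fix i
        obtain w1 w2 where "w1 \<in> W i" "w1 \<subseteq> V1" "w2 \<in> W i" "w2 \<subseteq> V2"
          using V1(3) V2(3) by meson
        then show "\<exists>w\<in>W i. w \<subseteq> V1 \<inter> V2"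
          using directed[of w1 i w2] by blast
      qed
      ultimately show "\<exists>V. V \<subseteq> E \<and> absolutely_convex V \<and> (\<forall>i. \<exists>w\<in>W i. w \<subseteq> V) \<and>
          (\<forall>v\<in>V. (\<lambda>x. u x + v x) \<in> S \<inter> T)"
        using V1 V2 by (intro exI[of _ "V1 \<inter> V2"]) blast
    qed
  next
    fix K assume K: "\<forall>S\<in>K. lc_final_open E W S"
    show "lc_final_open E W (\<Union>K)"
      unfolding lc_final_open_def
    proof (intro conjI ballI)
      show "\<Union>K \<subseteq> E" using K unfolding lc_final_open_def by blast
      fix u assume "u \<in> \<Union>K"
      then obtain S where S: "S \<in> K" "u \<in> S" by blast
      then obtain V where "V \<subseteq> E" "absolutely_convex V" "\<forall>i. \<exists>w\<in>W i. w \<subseteq> V"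
        "\<forall>v\<in>V. (\<lambda>x. u x + v x) \<in> S"
        using K unfolding lc_final_open_def by meson
      then show "\<exists>V. V \<subseteq> E \<and> absolutely_convex V \<and> (\<forall>i. \<exists>w\<in>W i. w \<subseteq> V) \<and>
          (\<forall>v\<in>V. (\<lambda>x. u x + v x) \<in> \<Union>K)"
        using S(1) by (intro exI[of _ V]) blast
    qed
  qed
  then show ?thesis
    by (simp add: lc_final_topology_def)
qed

definition hilbert_on :: "'h::real_vector set \<Rightarrow> ('h \<Rightarrow> 'h \<Rightarrow> real) \<Rightarrow> bool" where
  "hilbert_on S g \<longleftrightarrow> subspace S \<and>
     (\<forall>x\<in>S. \<forall>y\<in>S. g x y = g y x) \<and>
     (\<forall>x\<in>S. \<forall>y\<in>S. \<forall>z\<in>S. g (x + y) z = g x z + g y z) \<and>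
     (\<forall>x\<in>S. \<forall>y\<in>S. \<forall>c. g (c *\<^sub>R x) y = c * g x y) \<and>
     (\<forall>x\<in>S. x \<noteq> 0 \<longrightarrow> 0 < g x x) \<and>
     (\<forall>X. (\<forall>n. X n \<in> S) \<longrightarrow>
        (\<forall>e>0. \<exists>M. \<forall>m\<ge>M. \<forall>n\<ge>M. sqrt (g (X m - X n) (X m - X n)) < e) \<longrightarrow>
        (\<exists>x\<in>S. (\<lambda>n. sqrt (g (X n - x) (X n - x))) \<longlonglongrightarrow> 0))"

definition is_onb :: "'h::real_vector set \<Rightarrow> ('h \<Rightarrow> 'h \<Rightarrow> real) \<Rightarrow> 'h set \<Rightarrow> bool" where
  "is_onb S g B \<longleftrightarrow> B \<subseteq> S \<and>
     (\<forall>e\<in>B. \<forall>f\<in>B. g e f = (if e = f then 1 else 0)) \<and>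
     (\<forall>v\<in>S. \<forall>\<epsilon>>0. \<exists>w\<in>span B. sqrt (g (v - w) (v - w)) < \<epsilon>)"

type_synonym 'h kernel = "('h \<Rightarrow> real) list \<Rightarrow> complex"
type_synonym 'h functional = "(('h \<Rightarrow> real) \<Rightarrow> complex) \<Rightarrow> complex"

text \<open>
  The ambient Hilbert space is the type \<open>'h\<close>; its sort makes it real, complete and separable.
  \<open>Hp p\<close> with inner product \<open>ip p\<close> is the \<open>p\<close>-th space of the chain. Density of the intersection
  in every \<open>Hp p\<close> is what makes restriction embed the dual of \<open>Hp p\<close> into the dual of the
  intersection.
\<close>

locale nuclear_triple =
  fixes Hp :: "nat \<Rightarrow> 'h::{real_inner, polish_space} set"
    and ip :: "nat \<Rightarrow> 'h \<Rightarrow> 'h \<Rightarrow> real"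
  assumes hilbert: "hilbert_on (Hp p) (ip p)"
    and norm_le: "\<xi> \<in> Hp p \<Longrightarrow> norm \<xi> \<le> sqrt (ip p \<xi> \<xi>)"
    and decreasing: "p < q \<Longrightarrow> Hp q \<subseteq> Hp p"
    and increasing_norms: "p < q \<Longrightarrow> \<xi> \<in> Hp q \<Longrightarrow> sqrt (ip p \<xi> \<xi>) \<le> sqrt (ip q \<xi> \<xi>)"
    and dense: "closure (\<Inter>p. Hp p) = UNIV"
    and dense_Hp: "v \<in> Hp p \<Longrightarrow> 0 < \<epsilon> \<Longrightarrow>
      \<exists>\<xi>\<in>(\<Inter>r. Hp r). sqrt (ip p (v - \<xi>) (v - \<xi>)) < \<epsilon>"
    and hilbert_schmidt: "\<exists>p'>p. \<exists>B. is_onb (Hp p') (ip p') B \<and> (\<lambda>e. ip p e e) summable_on B"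
begin

definition N :: "'h set" where
  "N = (\<Inter>p. Hp p)"

definition pnorm :: "nat \<Rightarrow> 'h \<Rightarrow> real" where
  "pnorm p \<xi> = sqrt (ip p \<xi> \<xi>)"

definition onb :: "nat \<Rightarrow> 'h set" where
  "onb p = (SOME B. is_onb (Hp p) (ip p) B)"

definition Hneg :: "nat \<Rightarrow> ('h \<Rightarrow> real) set" where
  "Hneg p = {x. vanishes_outside N x \<and>
     (\<forall>\<xi>\<in>N. \<forall>\<eta>\<in>N. \<forall>a b. x (a *\<^sub>R \<xi> + b *\<^sub>R \<eta>) = a * x \<xi> + b * x \<eta>) \<and>
     (\<exists>C. \<forall>\<xi>\<in>N. \<bar>x \<xi>\<bar> \<le> C * pnorm p \<xi>)}"

definition negnorm :: "nat \<Rightarrow> ('h \<Rightarrow> real) \<Rightarrow> real" where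
  "negnorm p x = Sup {\<bar>x \<xi>\<bar> |\<xi>. \<xi> \<in> N \<and> pnorm p \<xi> \<le> 1}"

definition N' :: "('h \<Rightarrow> real) set" where
  "N' = (\<Union>p. Hneg p)"

text \<open>The Riesz image in \<open>Hneg p\<close> of a vector of \<open>Hp p\<close>.\<close>

definition riesz :: "nat \<Rightarrow> 'h \<Rightarrow> 'h \<Rightarrow> real" where
  "riesz p e = (\<lambda>\<xi>. if \<xi> \<in> N then ip p e \<xi> else 0)"

text \<open>The pair \<open>(\<xi>, \<eta>)\<close> stands for the vector \<open>\<xi> + i \<eta>\<close> of the complexification of \<open>N\<close>.\<close>

definition NC :: "('h \<times> 'h) set" where
  "NC = N \<times> N"

definition cscale :: "complex \<Rightarrow> 'h \<times> 'h \<Rightarrow> 'h \<times> 'h" where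
  "cscale z \<theta> = (Re z *\<^sub>R fst \<theta> - Im z *\<^sub>R snd \<theta>, Re z *\<^sub>R snd \<theta> + Im z *\<^sub>R fst \<theta>)"

definition cpnorm :: "nat \<Rightarrow> 'h \<times> 'h \<Rightarrow> real" where
  "cpnorm p \<theta> = sqrt ((pnorm p (fst \<theta>))\<^sup>2 + (pnorm p (snd \<theta>))\<^sup>2)"

definition pairing :: "('h \<Rightarrow> real) \<Rightarrow> 'h \<times> 'h \<Rightarrow> complex" where
  "pairing x \<theta> = Complex (x (fst \<theta>)) (x (snd \<theta>))"

text \<open>
  The \<open>n\<close>-th Hilbert tensor power of the complexified \<open>Hp p\<close> is realised in the standard way as the
  space of complex valued Hilbert--Schmidt \<open>n\<close>-linear forms on the dual \<open>Hneg p\<close>; the tensor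
  \<open>v\<^sub>1 \<otimes> \<dots> \<otimes> v\<^sub>n\<close> is the form mapping \<open>[x\<^sub>1, \<dots>, x\<^sub>n]\<close> to the product of the \<open>\<langle>x\<^sub>i, v\<^sub>i\<rangle>\<close>. Symmetric tensors
  are the symmetric forms, the embeddings between the tensor powers are restrictions of forms,
  and the projective limit consists of the forms on \<open>N'\<close> that are Hilbert--Schmidt on each \<open>Hneg p\<close>.
\<close>

definition sym_form :: "nat \<Rightarrow> 'h kernel \<Rightarrow> bool" where
  "sym_form n \<kappa> \<longleftrightarrow>
     vanishes_outside {xs. length xs = n \<and> set xs \<subseteq> N'} \<kappa> \<and>
     (\<forall>us vs x y a b. set us \<subseteq> N' \<longrightarrow> set vs \<subseteq> N' \<longrightarrow> length us + length vs + 1 = n \<longrightarrow>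
        x \<in> N' \<longrightarrow> y \<in> N' \<longrightarrow>
        \<kappa> (us @ [\<lambda>\<xi>. a * x \<xi> + b * y \<xi>] @ vs) =
          complex_of_real a * \<kappa> (us @ [x] @ vs) + complex_of_real b * \<kappa> (us @ [y] @ vs)) \<and>
     (\<forall>xs ys. mset xs = mset ys \<longrightarrow> \<kappa> xs = \<kappa> ys)"

definition hilbert_schmidt_form :: "nat \<Rightarrow> nat \<Rightarrow> 'h kernel \<Rightarrow> bool" where
  "hilbert_schmidt_form p n \<kappa> \<longleftrightarrow>
     (\<exists>C. \<forall>xs. length xs = n \<longrightarrow> set xs \<subseteq> Hneg p \<longrightarrow>
        cmod (\<kappa> xs) \<le> C * prod_list (map (negnorm p) xs)) \<and>
     (\<lambda>es. (cmod (\<kappa> (map (riesz p) es)))\<^sup>2) summable_on {es. length es = n \<and> set es \<subseteq> onb p}"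

definition tnorm :: "nat \<Rightarrow> nat \<Rightarrow> 'h kernel \<Rightarrow> real" where
  "tnorm p n \<kappa> =
     sqrt (\<Sum>\<^sub>\<infinity>es\<in>{es. length es = n \<and> set es \<subseteq> onb p}. (cmod (\<kappa> (map (riesz p) es)))\<^sup>2)"

definition NC_tensor :: "nat \<Rightarrow> 'h kernel set" where
  "NC_tensor n = {\<kappa>. sym_form n \<kappa> \<and> (\<forall>p. hilbert_schmidt_form p n \<kappa>)}"

definition tensor_power :: "nat \<Rightarrow> 'h \<times> 'h \<Rightarrow> 'h kernel" where
  "tensor_power n \<theta> = (\<lambda>xs. if length xs = n \<and> set xs \<subseteq> N'
     then prod_list (map (\<lambda>x. pairing x \<theta>) xs) else 0)"

text \<open>
  The \<open>n\<close>-th symmetric tensor power of the complexified \<open>Hneg p\<close> is the dual of the one of \<open>Hp p\<close>,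
  with the dual norm; its elements are given by their restrictions to the dense subspace
  \<open>NC_tensor n\<close>.
\<close>

definition Hneg_tensor :: "nat \<Rightarrow> nat \<Rightarrow> ('h kernel \<Rightarrow> complex) set" where
  "Hneg_tensor p n = {F. linear_functional_on (NC_tensor n) F \<and>
     (\<exists>C. \<forall>\<kappa>\<in>NC_tensor n. cmod (F \<kappa>) \<le> C * tnorm p n \<kappa>)}"

definition negtnorm :: "nat \<Rightarrow> nat \<Rightarrow> ('h kernel \<Rightarrow> complex) \<Rightarrow> real" where
  "negtnorm p n F = Sup {cmod (F \<kappa>) |\<kappa>. \<kappa> \<in> NC_tensor n \<and> tnorm p n \<kappa> \<le> 1}"

definition NC_tensor_dual :: "nat \<Rightarrow> ('h kernel \<Rightarrow> complex) set" where
  "NC_tensor_dual n = (\<Union>p. Hneg_tensor p n)"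

definition cylinder_sets :: "('h \<Rightarrow> real) set set" where
  "cylinder_sets = sigma_sets N' {{x \<in> N'. x \<xi> \<in> A} |\<xi> A. \<xi> \<in> N \<and> A \<in> sets borel}"

definition laplace :: "('h \<Rightarrow> real) measure \<Rightarrow> 'h \<times> 'h \<Rightarrow> complex" where
  "laplace \<mu> \<theta> = (\<integral>x. exp (pairing x \<theta>) \<partial>\<mu>)"

text \<open>Holomorphic means Gateaux holomorphic and locally bounded.\<close>

definition holomorphic_on_NC :: "('h \<times> 'h \<Rightarrow> complex) \<Rightarrow> ('h \<times> 'h) set \<Rightarrow> bool" where
  "holomorphic_on_NC F U \<longleftrightarrow>
     (\<forall>\<theta>\<^sub>0\<in>U. \<forall>\<theta>\<in>NC. \<exists>r>0. (\<lambda>z. F (\<theta>\<^sub>0 + cscale z \<theta>)) holomorphic_on ball 0 r) \<and>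
     (\<forall>\<theta>\<^sub>0\<in>U. \<exists>p. \<exists>\<delta>>0. \<exists>C. \<forall>\<theta>\<in>U. cpnorm p (\<theta> - \<theta>\<^sub>0) < \<delta> \<longrightarrow> cmod (F \<theta>) \<le> C)"

definition M_a :: "('h \<Rightarrow> real) measure set" where
  "M_a = {\<mu>. space \<mu> = N' \<and> sets \<mu> = cylinder_sets \<and>
     (\<exists>p. \<exists>\<epsilon>>0.
        (\<forall>\<theta>\<in>NC. cpnorm p \<theta> < \<epsilon> \<longrightarrow> integrable \<mu> (\<lambda>x. exp (pairing x \<theta>))) \<and>
        holomorphic_on_NC (laplace \<mu>) {\<theta> \<in> NC. cpnorm p \<theta> < \<epsilon>})}"

definition monomial :: "nat \<Rightarrow> 'h kernel \<Rightarrow> ('h \<Rightarrow> real) \<Rightarrow> complex" where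
  "monomial n \<kappa> = (\<lambda>x. if x \<in> N' then \<kappa> (replicate n x) else 0)"

definition polys :: "(('h \<Rightarrow> real) \<Rightarrow> complex) set" where
  "polys = {\<phi>. \<exists>M \<kappa>. (\<forall>n\<le>M. \<kappa> n \<in> NC_tensor n) \<and> \<phi> = (\<lambda>x. \<Sum>n\<le>M. monomial n (\<kappa> n) x)}"

definition poly_nbhds :: "nat \<Rightarrow> (('h \<Rightarrow> real) \<Rightarrow> complex) set set" where
  "poly_nbhds n = {monomial n ` {\<kappa> \<in> NC_tensor n. \<forall>p\<le>m. tnorm p n \<kappa> < \<epsilon>} |m \<epsilon>. 0 < \<epsilon>}"

definition poly_topology :: "(('h \<Rightarrow> real) \<Rightarrow> complex) topology" where
  "poly_topology = lc_final_topology polys poly_nbhds"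

definition poly_dual :: "'h functional set" where
  "poly_dual = {\<Phi>. linear_functional_on polys \<Phi> \<and> continuous_map poly_topology euclidean \<Phi>}"

definition nondegenerate :: "('h \<Rightarrow> real) measure \<Rightarrow> bool" where
  "nondegenerate \<mu> \<longleftrightarrow> (\<forall>\<phi>\<in>polys. (AE x in \<mu>. \<phi> x = 0) \<longrightarrow> (\<forall>x\<in>N'. \<phi> x = 0))"

definition e_mu :: "('h \<Rightarrow> real) measure \<Rightarrow> 'h \<times> 'h \<Rightarrow> ('h \<Rightarrow> real) \<Rightarrow> complex" where
  "e_mu \<mu> \<theta> x = exp (pairing x \<theta>) / laplace \<mu> \<theta>"

definition appell :: "('h \<Rightarrow> real) measure \<Rightarrow> ('h \<Rightarrow> real) \<Rightarrow> nat \<Rightarrow>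
    'h kernel \<Rightarrow> complex" where
  "appell \<mu> x = (THE P. (\<forall>n. P n \<in> NC_tensor_dual n) \<and>
     (\<exists>p. \<exists>\<epsilon>>0. \<forall>\<theta>\<in>NC. cpnorm p \<theta> < \<epsilon> \<longrightarrow>
        (\<lambda>n. P n (tensor_power n \<theta>) / fact n) sums e_mu \<mu> \<theta> x))"

definition appell_coeffs :: "('h \<Rightarrow> real) measure \<Rightarrow> (('h \<Rightarrow> real) \<Rightarrow> complex) \<Rightarrow> nat \<Rightarrow>
    'h kernel" where
  "appell_coeffs \<mu> \<phi> = (THE \<kappa>. (\<forall>n. \<kappa> n \<in> NC_tensor n) \<and>
     (\<exists>M. (\<forall>n>M. \<kappa> n = (\<lambda>_. 0)) \<and> (\<forall>x\<in>N'. \<phi> x = (\<Sum>n\<le>M. appell \<mu> x n (\<kappa> n)))))"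

definition Q_mu :: "('h \<Rightarrow> real) measure \<Rightarrow> nat \<Rightarrow> ('h kernel \<Rightarrow> complex) \<Rightarrow>
    'h functional" where
  "Q_mu \<mu> n F = (\<lambda>\<phi>. if \<phi> \<in> polys then fact n * F (appell_coeffs \<mu> \<phi> n) else 0)"

definition kernels :: "('h \<Rightarrow> real) measure \<Rightarrow> 'h functional \<Rightarrow> nat \<Rightarrow>
    'h kernel \<Rightarrow> complex" where
  "kernels \<mu> \<Phi> = (THE F. (\<forall>n. F n \<in> NC_tensor_dual n) \<and>
     (\<forall>\<phi>\<in>polys. (\<lambda>n. Q_mu \<mu> n (F n) \<phi>) sums \<Phi> \<phi>))"

definition dist_space :: "('h \<Rightarrow> real) measure \<Rightarrow> nat \<Rightarrow> nat \<Rightarrow> 'h functional set" where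
  "dist_space \<mu> p q = {\<Phi> \<in> poly_dual. (\<forall>n. kernels \<mu> \<Phi> n \<in> Hneg_tensor p n) \<and>
     summable (\<lambda>n. (1/2) ^ (q * n) * (negtnorm p n (kernels \<mu> \<Phi> n))\<^sup>2)}"

definition dist_norm :: "('h \<Rightarrow> real) measure \<Rightarrow> nat \<Rightarrow> nat \<Rightarrow> 'h functional \<Rightarrow> real" where
  "dist_norm \<mu> p q \<Phi> = sqrt (\<Sum>n. (1/2) ^ (q * n) * (negtnorm p n (kernels \<mu> \<Phi> n))\<^sup>2)"

definition distributions :: "('h \<Rightarrow> real) measure \<Rightarrow> 'h functional set" where
  "distributions \<mu> = (\<Union>p q. dist_space \<mu> p q)"

definition dist_nbhds :: "('h \<Rightarrow> real) measure \<Rightarrow> nat \<times> nat \<Rightarrow> 'h functional set set" where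
  "dist_nbhds \<mu> = (\<lambda>(p, q). {{\<Phi> \<in> dist_space \<mu> p q. dist_norm \<mu> p q \<Phi> < \<epsilon>} |\<epsilon>. 0 < \<epsilon>})"

definition dist_topology :: "('h \<Rightarrow> real) measure \<Rightarrow> 'h functional topology" where
  "dist_topology \<mu> = lc_final_topology (distributions \<mu>) (dist_nbhds \<mu>)"

text \<open>
  The expansion of the pairing of \<open>\<Phi>\<close> with \<open>e_mu \<mu> \<theta>\<close>, whose \<open>n\<close>-th Appell coefficient is
  \<open>tensor_power n \<theta> / fact n\<close>. The series converges for \<open>\<theta>\<close> near zero if \<open>\<Phi>\<close> is a distribution.
\<close>

definition S_transform :: "('h \<Rightarrow> real) measure \<Rightarrow> 'h functional \<Rightarrow> 'h \<times> 'h \<Rightarrow> complex" where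
  "S_transform \<mu> \<Phi> \<theta> = (\<Sum>n. kernels \<mu> \<Phi> n (tensor_power n \<theta>))"

definition wick :: "('h \<Rightarrow> real) measure \<Rightarrow> 'h functional \<Rightarrow>
    'h functional \<Rightarrow> 'h functional" where
  "wick \<mu> \<Phi> \<Psi> = (THE \<Xi>. \<Xi> \<in> distributions \<mu> \<and>
     (\<exists>p. \<exists>\<epsilon>>0. \<forall>\<theta>\<in>NC. cpnorm p \<theta> < \<epsilon> \<longrightarrow>
        S_transform \<mu> \<Xi> \<theta> = S_transform \<mu> \<Phi> \<theta> * S_transform \<mu> \<Psi> \<theta>))"

lemma openin_poly_topology: "openin poly_topology U \<longleftrightarrow> lc_final_open polys poly_nbhds U"
  unfolding poly_topology_def
proof (rule openin_lc_final_topology)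
  fix n v w assume "v \<in> poly_nbhds n" "w \<in> poly_nbhds n"
  then obtain m1 \<epsilon>1 m2 \<epsilon>2 where
    v: "v = monomial n ` {\<kappa> \<in> NC_tensor n. \<forall>p\<le>m1. tnorm p n \<kappa> < \<epsilon>1}" "0 < \<epsilon>1" and
    w: "w = monomial n ` {\<kappa> \<in> NC_tensor n. \<forall>p\<le>m2. tnorm p n \<kappa> < \<epsilon>2}" "0 < \<epsilon>2"
    unfolding poly_nbhds_def by blast
  let ?z = "monomial n ` {\<kappa> \<in> NC_tensor n. \<forall>p\<le>max m1 m2. tnorm p n \<kappa> < min \<epsilon>1 \<epsilon>2}"
  have "0 < min \<epsilon>1 \<epsilon>2" using v(2) w(2) by simp
  then have "?z \<in> poly_nbhds n" unfolding poly_nbhds_def by blast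
  moreover have "?z \<subseteq> v \<inter> w" unfolding v(1) w(1) by auto
  ultimately show "\<exists>z\<in>poly_nbhds n. z \<subseteq> v \<inter> w" by blast
qed

lemma openin_dist_topology:
  "openin (dist_topology \<mu>) U \<longleftrightarrow> lc_final_open (distributions \<mu>) (dist_nbhds \<mu>) U"
  unfolding dist_topology_def
proof (rule openin_lc_final_topology)
  fix i v w assume vw: "v \<in> dist_nbhds \<mu> i" "w \<in> dist_nbhds \<mu> i"
  obtain p q where i: "i = (p, q)" by fastforce
  from vw obtain \<epsilon>1 \<epsilon>2 where
    v: "v = {\<Phi> \<in> dist_space \<mu> p q. dist_norm \<mu> p q \<Phi> < \<epsilon>1}" "0 < \<epsilon>1" and
    w: "w = {\<Phi> \<in> dist_space \<mu> p q. dist_norm \<mu> p q \<Phi> < \<epsilon>2}" "0 < \<epsilon>2"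
    unfolding dist_nbhds_def i by auto
  let ?z = "{\<Phi> \<in> dist_space \<mu> p q. dist_norm \<mu> p q \<Phi> < min \<epsilon>1 \<epsilon>2}"
  have "0 < min \<epsilon>1 \<epsilon>2" using v(2) w(2) by simp
  then have "?z \<in> dist_nbhds \<mu> i" unfolding dist_nbhds_def i by blast
  moreover have "?z \<subseteq> v \<inter> w" unfolding v(1) w(1) by auto
  ultimately show "\<exists>z\<in>dist_nbhds \<mu> i. z \<subseteq> v \<inter> w" by blast
qed

end

end

theory Submission
  imports Defs
begin

text \<open>
  A distribution is determined by its kernels: the tensor powers of test vectors are total in every
  tensor power, by truncation to finitely many vectors of an orthonormal basis in \<open>N\<close> and polarization.
  Hence the Wick product has as \<open>n\<close>-th kernel the sum of the products of the \<open>k\<close>-th kernel of \<open>\<Phi>\<close> and the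
  \<open>(n - k)\<close>-th kernel of \<open>\<Psi>\<close>. A product of kernels is a contraction of forms, and its norm is at most
  the product of the norms since Hilbert--Schmidt norms increase with \<open>p\<close>; the sum over \<open>k\<close> costs the
  factor \<open>n + 1 \<le> 2\<^sup>n\<close> in the Cauchy--Schwarz inequality, which is the summand \<open>1\<close> in \<open>q\<close>.

  For the Appell system itself, local boundedness of the Laplace transform bounds the mixed moments
  of \<open>\<mu>\<close> by products of \<open>p\<close>-norms, and the Hilbert--Schmidt embedding turns these into moment functionals on
  the tensor powers. Inverting the moment series gives the values at zero of the Appell polynomials.
  The Appell polynomial of a kernel is the monomial of that kernel up to lower degree terms, so that
  expansions of polynomials exist and are unique.

  Continuity is a statement about a countable inductive limit of normed spaces, in which a bilinear
  map that is bounded on the steps is jointly continuous.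
\<close>

subsection \<open>Sums, polarization and pre-Hilbert spaces\<close>

text \<open>Appell kernels, expansion coefficients, kernels of functionals and the Wick product are
  all given by definite descriptions. The estimate is short once each of them is known to exist and
  to be unique; most of the work lies there. The recurring obstacle is evaluation. An element of a
  dual space is known on test vectors only, whereas the basis \<open>onb p\<close> inside
  \<open>tnorm\<close> is an arbitrary basis of \<open>Hp p\<close>. So bases inside
  \<open>N\<close> are built, and Hilbert-Schmidt sums are shown to be the same for every basis.
  This and the monotonicity in \<open>p\<close> both rest on one fact: the squared values of a
  bounded functional on an orthonormal basis add up to the square of its norm. The sums are taken in
  \<open>ennreal\<close>, where they can be interchanged at will and finiteness is a conclusion
  instead of a side condition. The estimate gives separate continuity at once. Joint continuity asks
  for neighbourhoods that work for all steps of the inductive limit simultaneously, and these have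
  to be chosen with care.\<close>

lemma infsum_ennreal_le_iff:
  fixes f :: "'a \<Rightarrow> ennreal"
  shows "infsum f A \<le> c \<longleftrightarrow> (\<forall>F. finite F \<longrightarrow> F \<subseteq> A \<longrightarrow> sum f F \<le> c)"
  by (subst nonneg_infsum_complete) (auto simp: SUP_le_iff)

lemma sum_le_infsum_ennreal:
  fixes f :: "'a \<Rightarrow> ennreal"
  assumes "finite F" "F \<subseteq> A"
  shows "sum f F \<le> infsum f A"
  using infsum_ennreal_le_iff[of f A "infsum f A"] assms by auto

lemma infsum_ennreal_mono:
  fixes f g :: "'a \<Rightarrow> ennreal"
  assumes "\<And>x. x \<in> A \<Longrightarrow> f x \<le> g x"
  shows "infsum f A \<le> infsum g A"
  using assms by (intro infsum_mono nonneg_summable_on_complete) auto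

lemma infsum_ennreal_cmult_le:
  fixes f :: "'a \<Rightarrow> ennreal"
  shows "infsum (\<lambda>x. c * f x) A \<le> c * infsum f A"
  unfolding infsum_ennreal_le_iff sum_distrib_left[symmetric]
  by (auto intro!: mult_left_mono sum_le_infsum_ennreal)

lemma sum_infsum_ennreal:
  fixes f :: "'a \<Rightarrow> 'b \<Rightarrow> ennreal"
  assumes "finite F"
  shows "(\<Sum>x\<in>F. infsum (f x) B) = infsum (\<lambda>y. \<Sum>x\<in>F. f x y) B"
  using assms
  by (induction F) (auto simp: infsum_add nonneg_summable_on_complete)

text \<open>Tonelli without summability conditions: a finite set of pairs lies in a finite
  rectangle, and iterated sums are suprema over finite rectangles.\<close>

lemma infsum_ennreal_Times:
  fixes f :: "'a \<Rightarrow> 'b \<Rightarrow> ennreal"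
  shows "infsum (\<lambda>(x, y). f x y) (A \<times> B) = infsum (\<lambda>x. infsum (f x) B) A"
proof (rule antisym)
  show "infsum (\<lambda>(x, y). f x y) (A \<times> B) \<le> infsum (\<lambda>x. infsum (f x) B) A"
    unfolding infsum_ennreal_le_iff[of _ "A \<times> B"]
  proof (intro allI impI)
    fix F assume F: "finite F" "F \<subseteq> A \<times> B"
    have "(\<Sum>(x, y)\<in>F. f x y) \<le> (\<Sum>(x, y)\<in>fst ` F \<times> snd ` F. f x y)"
      using F by (intro sum_mono2) force+
    also have "\<dots> = (\<Sum>x\<in>fst ` F. \<Sum>y\<in>snd ` F. f x y)"
      by (simp add: sum.cartesian_product)
    also have "\<dots> \<le> (\<Sum>x\<in>fst ` F. infsum (f x) B)"
      using F by (intro sum_mono sum_le_infsum_ennreal) auto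
    also have "\<dots> \<le> infsum (\<lambda>x. infsum (f x) B) A"
      using F by (intro sum_le_infsum_ennreal) auto
    finally show "(\<Sum>(x, y)\<in>F. f x y) \<le> infsum (\<lambda>x. infsum (f x) B) A" .
  qed
  show "infsum (\<lambda>x. infsum (f x) B) A \<le> infsum (\<lambda>(x, y). f x y) (A \<times> B)"
    unfolding infsum_ennreal_le_iff[of _ A]
  proof (intro allI impI)
    fix F assume F: "finite F" "F \<subseteq> A"
    show "(\<Sum>x\<in>F. infsum (f x) B) \<le> infsum (\<lambda>(x, y). f x y) (A \<times> B)"
      unfolding sum_infsum_ennreal[OF F(1)] infsum_ennreal_le_iff[of _ B]
    proof (intro allI impI)
      fix G assume G: "finite G" "G \<subseteq> B"
      have "(\<Sum>y\<in>G. \<Sum>x\<in>F. f x y) = (\<Sum>(x, y)\<in>F \<times> G. f x y)"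
        by (subst sum.swap) (simp add: sum.cartesian_product)
      also have "\<dots> \<le> infsum (\<lambda>(x, y). f x y) (A \<times> B)"
        using F G by (intro sum_le_infsum_ennreal) auto
      finally show "(\<Sum>y\<in>G. \<Sum>x\<in>F. f x y) \<le> infsum (\<lambda>(x, y). f x y) (A \<times> B)" .
    qed
  qed
qed

lemma infsum_ennreal_swap:
  fixes f :: "'a \<Rightarrow> 'b \<Rightarrow> ennreal"
  shows "infsum (\<lambda>x. infsum (f x) B) A = infsum (\<lambda>y. infsum (\<lambda>x. f x y) A) B"
proof -
  have "infsum (\<lambda>x. infsum (f x) B) A = infsum (\<lambda>(x, y). f x y) (A \<times> B)"
    by (rule infsum_ennreal_Times[symmetric])
  also have "\<dots> = infsum (\<lambda>(y, x). f x y) (B \<times> A)"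
    by (subst infsum_reindex_bij_betw[of prod.swap "B \<times> A" "A \<times> B", symmetric])
       (auto simp: bij_betw_def inj_on_def case_prod_unfold)
  also have "\<dots> = infsum (\<lambda>y. infsum (\<lambda>x. f x y) A) B"
    by (rule infsum_ennreal_Times)
  finally show ?thesis .
qed

text \<open>The bridge between the real sums of the definitions and the extended sums in which the
  estimates are made.\<close>

lemma summable_on_iff_infsum_ennreal:
  fixes f :: "'a \<Rightarrow> real"
  assumes nn: "\<And>x. x \<in> A \<Longrightarrow> 0 \<le> f x"
  shows "f summable_on A \<longleftrightarrow> infsum (\<lambda>x. ennreal (f x)) A < \<infinity>"
    and "f summable_on A \<Longrightarrow> infsum (\<lambda>x. ennreal (f x)) A = ennreal (infsum f A)"
proof -
  have eq: "infsum (\<lambda>x. ennreal (f x)) A = ennreal (infsum f A)" if "f summable_on A"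
  proof -
    have "ennreal (infsum f A) = (SUP F\<in>{F. finite F \<and> F \<subseteq> A}. (ennreal (sum f F)))"
      using infsum_nonneg_is_SUPREMUM_ennreal[OF that nn] by simp
    also have "\<dots> = (SUP F\<in>{F. finite F \<and> F \<subseteq> A}. (\<Sum>x\<in>F. ennreal (f x)))"
      using nn by (intro SUP_cong refl) (auto simp: subset_iff)
    also have "\<dots> = infsum (\<lambda>x. ennreal (f x)) A"
      by (rule nonneg_infsum_complete[symmetric]) simp
    finally show ?thesis by simp
  qed
  then show "f summable_on A \<Longrightarrow> infsum (\<lambda>x. ennreal (f x)) A = ennreal (infsum f A)" .
  show "f summable_on A \<longleftrightarrow> infsum (\<lambda>x. ennreal (f x)) A < \<infinity>"
  proof
    assume fin: "infsum (\<lambda>x. ennreal (f x)) A < \<infinity>"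
    show "f summable_on A"
    proof (rule nonneg_bdd_above_summable_on[OF nn])
      show "bdd_above (sum f ` {F. F \<subseteq> A \<and> finite F})"
      proof (rule bdd_aboveI2)
        fix F assume F: "F \<in> {F. F \<subseteq> A \<and> finite F}"
        have "ennreal (sum f F) = (\<Sum>x\<in>F. ennreal (f x))"
          using nn F by (auto simp: subset_iff)
        also have "\<dots> \<le> infsum (\<lambda>x. ennreal (f x)) A"
          using F by (intro sum_le_infsum_ennreal) auto
        finally have "enn2real (ennreal (sum f F)) \<le> enn2real (infsum (\<lambda>x. ennreal (f x)) A)"
          using fin by (intro enn2real_mono) auto
        moreover have "0 \<le> sum f F" using nn F by (auto intro!: sum_nonneg)
        ultimately show "sum f F \<le> enn2real (infsum (\<lambda>x. ennreal (f x)) A)" by simp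
      qed
    qed
  qed (auto simp: eq)
qed

text \<open>The value is named as a square because its root \<open>s\<close> will serve as the norm
  of a functional.\<close>

lemma finite_ennreal_sum_bound:
  fixes f :: "'a \<Rightarrow> real"
  assumes fin: "infsum (\<lambda>e. ennreal ((f e)\<^sup>2)) B < \<infinity>"
  obtains s where "0 \<le> s" "infsum (\<lambda>e. ennreal ((f e)\<^sup>2)) B = ennreal (s\<^sup>2)"
    "\<And>J. finite J \<Longrightarrow> J \<subseteq> B \<Longrightarrow> (\<Sum>e\<in>J. (f e)\<^sup>2) \<le> s\<^sup>2"
proof -
  define t where "t = enn2real (infsum (\<lambda>e. ennreal ((f e)\<^sup>2)) B)"
  have t: "infsum (\<lambda>e. ennreal ((f e)\<^sup>2)) B = ennreal t" "0 \<le> t"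
    using fin by (auto simp: t_def)
  have "(\<Sum>e\<in>J. (f e)\<^sup>2) \<le> (sqrt t)\<^sup>2" if J: "finite J" "J \<subseteq> B" for J
  proof -
    have "ennreal (\<Sum>e\<in>J. (f e)\<^sup>2) = (\<Sum>e\<in>J. ennreal ((f e)\<^sup>2))" by simp
    also have "\<dots> \<le> ennreal t" unfolding t(1)[symmetric] by (rule sum_le_infsum_ennreal[OF J])
    finally show ?thesis using t(2) by simp
  qed
  then show ?thesis using that[of "sqrt t"] t by simp
qed

section \<open>Multi-indices as lists, and iterated sums over them\<close>

definition nlists :: "nat \<Rightarrow> 'a set \<Rightarrow> 'a list set" where
  "nlists n A = {xs. length xs = n \<and> set xs \<subseteq> A}"

lemma nlists_0 [simp]: "nlists 0 A = {[]}"
  by (auto simp: nlists_def)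

lemma in_nlists_Suc: "xs \<in> nlists (Suc n) A \<longleftrightarrow> (\<exists>x\<in>A. \<exists>ys\<in>nlists n A. xs = x # ys)"
  by (auto simp: nlists_def length_Suc_conv)

lemma finite_nlists: "finite A \<Longrightarrow> finite (nlists n A)"
  using finite_lists_length_eq[of A n] by (simp add: nlists_def conj_commute)

lemma bij_betw_Cons_nlists: "bij_betw (\<lambda>(x, xs). x # xs) (A \<times> nlists n A) (nlists (Suc n) A)"
  by (force simp: bij_betw_def inj_on_def in_nlists_Suc)

lemma bij_betw_append_nlists:
  "bij_betw (\<lambda>(xs, ys). xs @ ys) (nlists k A \<times> nlists m A) (nlists (k + m) A)"
proof (rule bij_betw_imageI)
  show "inj_on (\<lambda>(xs, ys). xs @ ys) (nlists k A \<times> nlists m A)"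
    by (auto simp: inj_on_def nlists_def)
  show "(\<lambda>(xs, ys). xs @ ys) ` (nlists k A \<times> nlists m A) = nlists (k + m) A"
  proof
    show "nlists (k + m) A \<subseteq> (\<lambda>(xs, ys). xs @ ys) ` (nlists k A \<times> nlists m A)"
    proof
      fix zs assume "zs \<in> nlists (k + m) A"
      then have "(take k zs, drop k zs) \<in> nlists k A \<times> nlists m A"
        by (auto simp: nlists_def dest: in_set_takeD in_set_dropD)
      then show "zs \<in> (\<lambda>(xs, ys). xs @ ys) ` (nlists k A \<times> nlists m A)"
        by (metis (mono_tags, lifting) append_take_drop_id case_prod_conv image_eqI)
    qed
  qed (auto simp: nlists_def)
qed

lemma infsum_nlists_Suc:
  fixes f :: "'a list \<Rightarrow> ennreal"
  shows "infsum f (nlists (Suc n) A) = infsum (\<lambda>x. infsum (\<lambda>xs. f (x # xs)) (nlists n A)) A"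
  by (subst infsum_reindex_bij_betw[OF bij_betw_Cons_nlists, symmetric])
     (simp add: case_prod_unfold flip: infsum_ennreal_Times)

lemma infsum_nlists_add:
  fixes f :: "'a list \<Rightarrow> ennreal"
  shows "infsum f (nlists (k + m) A) =
    infsum (\<lambda>xs. infsum (\<lambda>ys. f (xs @ ys)) (nlists m A)) (nlists k A)"
  by (subst infsum_reindex_bij_betw[OF bij_betw_append_nlists, symmetric])
     (simp add: case_prod_unfold flip: infsum_ennreal_Times)

text \<open>
  Replacing \<open>x\<close> by \<open>x + t y\<close> on the diagonal gives a polynomial in \<open>t\<close> whose linear coefficient is a
  multiple of \<open>\<kappa> (y, x, \<dots>, x)\<close>; so vanishing on the diagonal passes to the forms \<open>\<kappa> (y, \<dots>)\<close>.
\<close>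

lemma polarization_vanish:
  fixes \<kappa> :: "'v list \<Rightarrow> complex" and cmb :: "real \<Rightarrow> 'v \<Rightarrow> real \<Rightarrow> 'v \<Rightarrow> 'v"
  assumes closed: "\<And>x y a b. x \<in> D \<Longrightarrow> y \<in> D \<Longrightarrow> cmb a x b y \<in> D"
    and lin: "\<And>x y a b vs. x \<in> D \<Longrightarrow> y \<in> D \<Longrightarrow> set vs \<subseteq> D \<Longrightarrow> length vs + 1 = n \<Longrightarrow>
      \<kappa> (cmb a x b y # vs) = of_real a * \<kappa> (x # vs) + of_real b * \<kappa> (y # vs)"
    and sym: "\<And>xs ys. set xs \<subseteq> D \<Longrightarrow> length xs = n \<Longrightarrow> mset xs = mset ys \<Longrightarrow> \<kappa> xs = \<kappa> ys"
    and diag: "\<And>x. x \<in> D \<Longrightarrow> \<kappa> (replicate n x) = 0"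
    and nonempty: "D \<noteq> {}"
    and xs: "set xs \<subseteq> D" "length xs = n"
  shows "\<kappa> xs = 0"
  using lin sym diag xs
proof (induction n arbitrary: \<kappa> xs)
  case 0
  then show ?case using nonempty by auto
next
  case (Suc n)
  note lin = Suc.prems(1) and sym = Suc.prems(2) and diag = Suc.prems(3)
  have key: "\<kappa> (y # replicate n x) = 0" if x: "x \<in> D" and y: "y \<in> D" for x y
  proof -
    \<comment> \<open>The list \<open>r\<close> collects the arguments that are already expanded.
      Each step expands one more copy of the combination and moves the resulting \<open>x\<close> or
      \<open>y\<close> into \<open>r\<close> by symmetry.\<close>
    have ex: "\<exists>P. (\<forall>t. \<kappa> (replicate k (cmb 1 x t y) @ r) = poly P (of_real t)) \<and>
      coeff P 0 = \<kappa> (replicate k x @ r) \<and> coeff P 1 = of_nat k * \<kappa> (y # replicate (k - 1) x @ r)"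
      if "set r \<subseteq> D" "length r + k = Suc n" for k r
      using that
    proof (induction k arbitrary: r)
      case 0
      then show ?case by (intro exI[of _ "[:\<kappa> r:]"]) auto
    next
      case (Suc k)
      obtain P where P: "\<forall>t. \<kappa> (replicate k (cmb 1 x t y) @ x # r) = poly P (of_real t)"
        "coeff P 0 = \<kappa> (replicate k x @ x # r)"
        "coeff P 1 = of_nat k * \<kappa> (y # replicate (k - 1) x @ x # r)"
        using Suc.IH[of "x # r"] Suc.prems x by auto
      obtain Q where Q: "\<forall>t. \<kappa> (replicate k (cmb 1 x t y) @ y # r) = poly Q (of_real t)"
        "coeff Q 0 = \<kappa> (replicate k x @ y # r)"
        using Suc.IH[of "y # r"] Suc.prems y by auto
      have "\<kappa> (replicate (Suc k) (cmb 1 x t y) @ r) = poly (P + pCons 0 Q) (of_real t)" for t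
      proof -
        have D: "set (replicate k (cmb 1 x t y) @ r) \<subseteq> D"
          using Suc.prems closed[OF x y] by auto
        have "\<kappa> (replicate (Suc k) (cmb 1 x t y) @ r) =
            \<kappa> (x # replicate k (cmb 1 x t y) @ r) + of_real t * \<kappa> (y # replicate k (cmb 1 x t y) @ r)"
          using lin[OF x y D, of 1 t] Suc.prems by simp
        also have "\<kappa> (x # replicate k (cmb 1 x t y) @ r) = \<kappa> (replicate k (cmb 1 x t y) @ x # r)"
          using D x Suc.prems by (intro sym) auto
        also have "\<kappa> (y # replicate k (cmb 1 x t y) @ r) = \<kappa> (replicate k (cmb 1 x t y) @ y # r)"
          using D y Suc.prems by (intro sym) auto
        finally show ?thesis using P(1) Q(1) by simp
      qed
      moreover have "coeff (P + pCons 0 Q) 0 = \<kappa> (replicate (Suc k) x @ r)"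
      proof -
        have "\<kappa> (replicate k x @ x # r) = \<kappa> (x # replicate k x @ r)"
          using x Suc.prems by (intro sym) auto
        then show ?thesis using P(2) by simp
      qed
      moreover have "coeff (P + pCons 0 Q) 1 =
          of_nat (Suc k) * \<kappa> (y # replicate (Suc k - 1) x @ r)"
      proof (cases k)
        case 0
        then show ?thesis using P(3) Q(2) by simp
      next
        case (Suc l)
        have 1: "\<kappa> (y # replicate (k - 1) x @ x # r) = \<kappa> (y # replicate k x @ r)"
          using x y Suc Suc.prems by (intro sym) (auto)
        have 2: "\<kappa> (replicate k x @ y # r) = \<kappa> (y # replicate k x @ r)"
          using x y Suc Suc.prems by (intro sym) (auto)
        show ?thesis using P(3) Q(2) 1 2 by (simp add: algebra_simps)
      qed
      ultimately show ?case by blast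
    qed
    obtain P where P: "\<forall>t. \<kappa> (replicate (Suc n) (cmb 1 x t y) @ []) = poly P (of_real t)"
      "coeff P 1 = of_nat (Suc n) * \<kappa> (y # replicate (Suc n - 1) x @ [])"
      using ex[of "[]" "Suc n"] by auto
    have "poly P (of_real t) = 0" for t
      using P(1) diag[OF closed[OF x y]] by simp
    then have "range complex_of_real \<subseteq> {z. poly P z = 0}" by auto
    moreover have "infinite (range complex_of_real)"
      using infinite_UNIV_char_0[where 'a=real] finite_imageD[of complex_of_real UNIV]
      by (auto simp: inj_on_def)
    ultimately have "P = 0"
      using poly_roots_finite infinite_super by blast
    with P(2) show ?thesis by (simp del: of_nat_Suc)
  qed
  obtain y ys where xs: "xs = y # ys" "y \<in> D" "set ys \<subseteq> D" "length ys = n"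
    using Suc.prems by (cases xs) auto
  have "\<kappa> (y # ys) = 0"
  proof (rule Suc.IH[of "\<lambda>zs. \<kappa> (y # zs)"])
    fix u v a b and vs :: "'v list"
    assume uv: "u \<in> D" "v \<in> D" "set vs \<subseteq> D" "length vs + 1 = n"
    have "\<kappa> (y # cmb a u b v # vs) = \<kappa> (cmb a u b v # y # vs)"
      using uv xs closed by (intro sym) auto
    also have "\<dots> = of_real a * \<kappa> (u # y # vs) + of_real b * \<kappa> (v # y # vs)"
      using uv xs by (intro lin) auto
    also have "\<kappa> (u # y # vs) = \<kappa> (y # u # vs)" using uv xs by (intro sym) auto
    also have "\<kappa> (v # y # vs) = \<kappa> (y # v # vs)" using uv xs by (intro sym) auto
    finally show "\<kappa> (y # cmb a u b v # vs) =
      of_real a * \<kappa> (y # u # vs) + of_real b * \<kappa> (y # v # vs)" .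
  next
    fix us vs :: "'v list"
    assume "set us \<subseteq> D" "length us = n" "mset us = mset vs"
    then show "\<kappa> (y # us) = \<kappa> (y # vs)" using xs by (intro sym) auto
  qed (use key xs in auto)
  then show ?case using xs by simp
qed

text \<open>The spaces of the chain are subspaces of a single type, each with its own inner product,
  so the geometry is developed relative to a carrier \<open>S\<close> and a form
  \<open>g\<close>.\<close>

locale pre_hilbert =
  fixes S :: "'h::real_vector set" and g :: "'h \<Rightarrow> 'h \<Rightarrow> real"
  assumes subspace: "subspace S"
    and commute: "x \<in> S \<Longrightarrow> y \<in> S \<Longrightarrow> g x y = g y x"
    and add_left: "x \<in> S \<Longrightarrow> y \<in> S \<Longrightarrow> z \<in> S \<Longrightarrow> g (x + y) z = g x z + g y z"
    and scale_left: "x \<in> S \<Longrightarrow> y \<in> S \<Longrightarrow> g (c *\<^sub>R x) y = c * g x y"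
    and pos: "x \<in> S \<Longrightarrow> x \<noteq> 0 \<Longrightarrow> 0 < g x x"
begin

definition nrm :: "'h \<Rightarrow> real" where "nrm v = sqrt (g v v)"

definition orthonormal :: "'h set \<Rightarrow> bool" where
  "orthonormal J \<longleftrightarrow> J \<subseteq> S \<and> (\<forall>e\<in>J. \<forall>f\<in>J. g e f = (if e = f then 1 else 0))"

definition lin_on :: "('h \<Rightarrow> real) \<Rightarrow> bool" where
  "lin_on l \<longleftrightarrow> (\<forall>u\<in>S. \<forall>v\<in>S. \<forall>a b. l (a *\<^sub>R u + b *\<^sub>R v) = a * l u + b * l v)"

section \<open>Elementary geometry of a pre-Hilbert space\<close>

lemma S_zero [simp]: "0 \<in> S" and S_add: "x \<in> S \<Longrightarrow> y \<in> S \<Longrightarrow> x + y \<in> S"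
  and S_scale: "x \<in> S \<Longrightarrow> c *\<^sub>R x \<in> S" and S_diff: "x \<in> S \<Longrightarrow> y \<in> S \<Longrightarrow> x - y \<in> S"
  and S_sum: "(\<And>j. j \<in> J \<Longrightarrow> f j \<in> S) \<Longrightarrow> sum f J \<in> S"
  using subspace by (auto intro: subspace_0 subspace_add subspace_scale subspace_diff subspace_sum)

lemma zero_left [simp]: "y \<in> S \<Longrightarrow> g 0 y = 0"
  using scale_left[of 0 y 0] by simp

lemma add_right: "x \<in> S \<Longrightarrow> y \<in> S \<Longrightarrow> z \<in> S \<Longrightarrow> g z (x + y) = g z x + g z y"
  using add_left commute S_add by metis

lemma scale_right: "x \<in> S \<Longrightarrow> y \<in> S \<Longrightarrow> g x (c *\<^sub>R y) = c * g x y"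
  using scale_left commute S_scale by metis

lemma diff_left: "x \<in> S \<Longrightarrow> y \<in> S \<Longrightarrow> z \<in> S \<Longrightarrow> g (x - y) z = g x z - g y z"
  using add_left[of x "(-1) *\<^sub>R y" z] scale_left[of y z "-1"] S_scale[of y "-1"] by simp

lemma diff_right: "x \<in> S \<Longrightarrow> y \<in> S \<Longrightarrow> z \<in> S \<Longrightarrow> g z (x - y) = g z x - g z y"
  using diff_left commute S_diff by metis

lemma sum_left: "finite J \<Longrightarrow> (\<And>j. j \<in> J \<Longrightarrow> f j \<in> S) \<Longrightarrow> y \<in> S \<Longrightarrow> g (sum f J) y = (\<Sum>j\<in>J. g (f j) y)"
  by (induction J rule: finite_induct) (auto simp: add_left S_sum)

lemma sum_right: "finite J \<Longrightarrow> (\<And>j. j \<in> J \<Longrightarrow> f j \<in> S) \<Longrightarrow> y \<in> S \<Longrightarrow> g y (sum f J) = (\<Sum>j\<in>J. g y (f j))"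
  by (induction J rule: finite_induct) (auto simp: add_right S_sum commute[of y 0])

lemma self_nonneg: "x \<in> S \<Longrightarrow> 0 \<le> g x x"
  using pos[of x] by (cases "x = 0") auto

lemma nrm_nonneg: "x \<in> S \<Longrightarrow> 0 \<le> nrm x"
  by (simp add: nrm_def self_nonneg)

lemma nrm_sq: "x \<in> S \<Longrightarrow> (nrm x)\<^sup>2 = g x x"
  by (simp add: nrm_def self_nonneg)

lemma nrm_zero [simp]: "nrm 0 = 0"
  by (simp add: nrm_def)

lemma nrm_eq_0: "x \<in> S \<Longrightarrow> nrm x = 0 \<longleftrightarrow> x = 0"
  using pos[of x] by (cases "x = 0") (auto simp: nrm_def)

lemma nrm_scale: "x \<in> S \<Longrightarrow> nrm (c *\<^sub>R x) = \<bar>c\<bar> * nrm x"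
  by (simp add: nrm_def scale_left scale_right S_scale real_sqrt_mult)

lemma nrm_minus: "x \<in> S \<Longrightarrow> y \<in> S \<Longrightarrow> nrm (x - y) = nrm (y - x)"
  using nrm_scale[of "x - y" "-1"] S_diff by simp

lemma Cauchy_Schwarz: assumes "x \<in> S" "y \<in> S" shows "\<bar>g x y\<bar> \<le> nrm x * nrm y"
proof (cases "y = 0")
  case True
  then show ?thesis using assms commute[of x 0] by simp
next
  case False
  define t where "t = g x y / g y y"
  have p: "0 < g y y" using pos False assms by simp
  have "0 \<le> g (x - t *\<^sub>R y) (x - t *\<^sub>R y)"
    using assms by (intro self_nonneg S_diff S_scale)
  also have "\<dots> = g x x - 2 * t * g x y + t\<^sup>2 * g y y"
    using assms by (simp add: diff_left diff_right scale_left scale_right S_scale S_diff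
      commute[of y x] power2_eq_square algebra_simps)
  also have "\<dots> = g x x - (g x y)\<^sup>2 / g y y"
    using p by (simp add: t_def power2_eq_square field_simps)
  finally have "(g x y)\<^sup>2 \<le> g x x * g y y"
    using p by (simp add: field_simps)
  then have "sqrt ((g x y)\<^sup>2) \<le> sqrt (g x x * g y y)" by (rule real_sqrt_le_mono)
  then show ?thesis by (simp add: nrm_def real_sqrt_mult)
qed

lemma nrm_triangle: assumes "x \<in> S" "y \<in> S" shows "nrm (x + y) \<le> nrm x + nrm y"
proof -
  have "(nrm (x + y))\<^sup>2 = (nrm x)\<^sup>2 + 2 * g x y + (nrm y)\<^sup>2"
    using assms by (simp add: nrm_sq S_add add_left add_right commute[of y x])
  also have "\<dots> \<le> (nrm x + nrm y)\<^sup>2"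
    using Cauchy_Schwarz[OF assms] by (simp add: power2_sum)
  finally show ?thesis
    using nrm_nonneg[OF assms(1)] nrm_nonneg[OF assms(2)] by (auto intro: power2_le_imp_le[of "nrm (x + y)"])
qed

section \<open>Orthonormal sets and functionals\<close>

lemma lin_on_sum:
  assumes "lin_on l" "finite J" "\<And>j. j \<in> J \<Longrightarrow> f j \<in> S"
  shows "l (\<Sum>j\<in>J. c j *\<^sub>R f j) = (\<Sum>j\<in>J. c j * l (f j))"
proof -
  have "l (0 *\<^sub>R 0 + 0 *\<^sub>R 0) = 0 * l 0 + 0 * l 0"
    using assms(1) S_zero unfolding lin_on_def by blast
  then have z: "l 0 = 0" by simp
  show ?thesis using assms(2,3)
  proof (induction J rule: finite_induct)
    case (insert j J)
    have "l (c j *\<^sub>R f j + 1 *\<^sub>R (\<Sum>j\<in>J. c j *\<^sub>R f j)) = c j * l (f j) + 1 * l (\<Sum>j\<in>J. c j *\<^sub>R f j)"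
      using insert assms(1) unfolding lin_on_def by (meson S_scale S_sum insertCI)
    then show ?case using insert by simp
  qed (simp add: z)
qed

lemma orthonormal_coeff:
  assumes "orthonormal J" "finite J" "e \<in> J"
  shows "g e (\<Sum>f\<in>J. c f *\<^sub>R f) = c e"
proof -
  have J: "J \<subseteq> S" using assms orthonormal_def by auto
  have "g e (\<Sum>f\<in>J. c f *\<^sub>R f) = (\<Sum>f\<in>J. c f * g e f)"
    using assms J by (subst sum_right) (auto simp: S_scale scale_right subset_iff intro!: sum.cong)
  also have "\<dots> = (\<Sum>f\<in>J. if e = f then c f else 0)"
    using assms by (intro sum.cong) (auto simp: orthonormal_def)
  also have "\<dots> = c e" using assms by simp
  finally show ?thesis .
qed

lemma orthonormal_nrm_sum:
  assumes "orthonormal J" "finite J"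
  shows "(nrm (\<Sum>f\<in>J. c f *\<^sub>R f))\<^sup>2 = (\<Sum>f\<in>J. (c f)\<^sup>2)"
proof -
  have J: "J \<subseteq> S" using assms orthonormal_def by auto
  have "(nrm (\<Sum>f\<in>J. c f *\<^sub>R f))\<^sup>2 = (\<Sum>f\<in>J. c f * g f (\<Sum>f\<in>J. c f *\<^sub>R f))"
    using assms J by (subst nrm_sq, (intro S_sum S_scale, blast), subst sum_left)
      (auto simp: subset_iff intro!: S_sum S_scale sum.cong scale_left)
  also have "\<dots> = (\<Sum>f\<in>J. (c f)\<^sup>2)"
    using assms by (intro sum.cong) (auto simp: orthonormal_coeff power2_eq_square)
  finally show ?thesis .
qed

text \<open>The functional is tested on the vector \<open>w\<close> with coefficients
  \<open>l e\<close>: both \<open>l w\<close> and the squared norm of \<open>w\<close> equal the sum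
  \<open>s\<close>, so \<open>s\<close> is at most \<open>C\<close> times the root of
  \<open>s\<close>. No representing vector is needed.\<close>

lemma bessel_functional:
  assumes l: "lin_on l" "\<And>v. v \<in> S \<Longrightarrow> \<bar>l v\<bar> \<le> C * nrm v" and J: "orthonormal J" "finite J"
  shows "(\<Sum>e\<in>J. (l e)\<^sup>2) \<le> C\<^sup>2"
proof -
  define s where "s = (\<Sum>e\<in>J. (l e)\<^sup>2)"
  define w where "w = (\<Sum>e\<in>J. l e *\<^sub>R e)"
  have JS: "J \<subseteq> S" using J orthonormal_def by auto
  then have w: "w \<in> S" unfolding w_def by (intro S_sum S_scale) auto
  have "s = l w" unfolding s_def w_def using lin_on_sum[OF l(1) J(2), of "\<lambda>x. x" l] JS
    by (simp add: power2_eq_square subset_iff)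
  moreover have nw: "(nrm w)\<^sup>2 = s"
    unfolding w_def s_def by (rule orthonormal_nrm_sum[OF J])
  moreover have "\<bar>l w\<bar> \<le> C * nrm w" by (rule l(2)[OF w])
  moreover have "0 \<le> s" unfolding s_def by (simp add: sum_nonneg)
  ultimately have "(nrm w)\<^sup>2 \<le> C * nrm w" by simp
  show ?thesis
  proof (cases "nrm w = 0")
    case True
    then show ?thesis using nw by (simp add: s_def)
  next
    case False
    then have "0 < nrm w" using nrm_nonneg[OF w] by simp
    then have "nrm w \<le> C" using \<open>(nrm w)\<^sup>2 \<le> C * nrm w\<close> by (simp add: power2_eq_square)
    then have "(nrm w)\<^sup>2 \<le> C\<^sup>2" using \<open>0 < nrm w\<close> by (intro power_mono) auto
    then show ?thesis using nw by (simp add: s_def)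
  qed
qed

lemma is_onb_orthonormal: "is_onb S g B \<Longrightarrow> J \<subseteq> B \<Longrightarrow> orthonormal J"
  unfolding is_onb_def orthonormal_def by blast

lemma span_finite_sum:
  assumes "w \<in> span B" obtains J c where "finite J" "J \<subseteq> B" "w = (\<Sum>e\<in>J. c e *\<^sub>R e)"
  using assms unfolding span_explicit by blast

text \<open>The converse of \<open>bessel_functional\<close>. Cauchy-Schwarz for the coefficients
  gives the bound on the span of \<open>B\<close>; the crude constant \<open>C\<close> serves to
  pass from the span to the whole space, and it does not survive in the result.\<close>

lemma onb_functional_bound:
  assumes l: "lin_on l" "\<And>v. v \<in> S \<Longrightarrow> \<bar>l v\<bar> \<le> C * nrm v" and B: "is_onb S g B"
    and s: "\<And>J. finite J \<Longrightarrow> J \<subseteq> B \<Longrightarrow> (\<Sum>e\<in>J. (l e)\<^sup>2) \<le> s\<^sup>2" "0 \<le> s" and v: "v \<in> S"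
  shows "\<bar>l v\<bar> \<le> s * nrm v"
proof -
  have BS: "B \<subseteq> S" using B by (simp add: is_onb_def)
  have sp: "\<bar>l w\<bar> \<le> s * nrm w" if w: "w \<in> span B" for w
  proof -
    obtain J c where J: "finite J" "J \<subseteq> B" "w = (\<Sum>e\<in>J. c e *\<^sub>R e)"
      using span_finite_sum[OF w] by blast
    have wS: "w \<in> S" using J BS by (auto intro!: S_sum S_scale)
    have "\<bar>l w\<bar> = \<bar>\<Sum>e\<in>J. c e * l e\<bar>"
      using lin_on_sum[OF l(1) J(1), of "\<lambda>x. x" c] J BS by (simp add: subset_iff)
    also have "\<dots> \<le> (\<Sum>e\<in>J. \<bar>c e\<bar> * \<bar>l e\<bar>)"
      using sum_abs[of "\<lambda>e. c e * l e" J] by (simp add: abs_mult)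
    also have "\<dots> \<le> sqrt (\<Sum>e\<in>J. (c e)\<^sup>2) * sqrt (\<Sum>e\<in>J. (l e)\<^sup>2)"
      using L2_set_mult_ineq[of c l J] by (simp add: L2_set_def)
    also have "\<dots> \<le> nrm w * s"
    proof (intro mult_mono)
      show "sqrt (\<Sum>e\<in>J. (c e)\<^sup>2) \<le> nrm w"
        using orthonormal_nrm_sum[OF is_onb_orthonormal[OF B J(2)] J(1), of c, symmetric]
          nrm_nonneg[OF wS] by (simp add: J(3))
      show "sqrt (\<Sum>e\<in>J. (l e)\<^sup>2) \<le> s"
        using s(1)[OF J(1,2)] s(2) by (simp add: real_le_lsqrt)
    qed (auto intro: nrm_nonneg wS sum_nonneg)
    finally show ?thesis by (simp add: mult.commute)
  qed
  have spS: "span B \<subseteq> S" using BS subspace by (simp add: span_minimal)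
  have "\<bar>l v\<bar> \<le> s * nrm v + \<epsilon>" if \<epsilon>: "0 < \<epsilon>" for \<epsilon>
  proof -
    \<comment> \<open>The approximation costs at most \<open>(\<bar>C\<bar> + s) * d\<close>; the
      summand 1 keeps the denominator positive.\<close>
    define d where "d = \<epsilon> / (\<bar>C\<bar> + s + 1)"
    have cs: "0 < \<bar>C\<bar> + s + 1" using s by simp
    then have "0 < d" using \<epsilon> by (simp add: d_def)
    then obtain w where w: "w \<in> span B" "nrm (v - w) < d"
      using B v unfolding is_onb_def nrm_def by blast
    then have wS: "w \<in> S" using spS by auto
    have "l (1 *\<^sub>R (v - w) + 1 *\<^sub>R w) = 1 * l (v - w) + 1 * l w"
      using l(1) S_diff[OF v wS] wS unfolding lin_on_def by blast
    then have eq: "l v = l (v - w) + l w" by simp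
    have "nrm w \<le> nrm v + nrm (v - w)"
      using nrm_triangle[of v "w - v"] nrm_minus[of v w] v wS S_diff by simp
    then have "s * nrm w \<le> s * (nrm v + nrm (v - w))" using s by (intro mult_left_mono)
    moreover have "\<bar>l (v - w)\<bar> \<le> \<bar>C\<bar> * nrm (v - w)"
      using l(2)[of "v - w"] v wS S_diff nrm_nonneg[of "v - w"]
      by (meson abs_ge_self mult_right_mono order_trans)
    moreover have "\<bar>l v\<bar> \<le> \<bar>l (v - w)\<bar> + \<bar>l w\<bar>" using eq by linarith
    moreover have "\<bar>l w\<bar> \<le> s * nrm w" by (rule sp[OF w(1)])
    ultimately have "\<bar>l v\<bar> \<le> s * nrm v + (\<bar>C\<bar> + s) * nrm (v - w)"
      by (simp add: algebra_simps)
    also have "(\<bar>C\<bar> + s) * nrm (v - w) \<le> (\<bar>C\<bar> + s) * d"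
      using w s by (intro mult_left_mono) auto
    also have "\<dots> \<le> \<epsilon>" using cs \<epsilon> s by (simp add: d_def field_simps)
    finally show ?thesis by simp
  qed
  then show ?thesis by (rule field_le_epsilon)
qed

lemma orthonormal_residual:
  assumes J: "orthonormal J" "finite J" and v: "v \<in> S" and f: "f \<in> J"
  shows "g f (v - (\<Sum>e\<in>J. g e v *\<^sub>R e)) = 0"
proof -
  have "J \<subseteq> S" using J orthonormal_def by auto
  then have "(\<Sum>e\<in>J. g e v *\<^sub>R e) \<in> S" "f \<in> S" using f by (auto intro!: S_sum S_scale)
  then show ?thesis using v orthonormal_coeff[OF J f, of "\<lambda>e. g e v"] by (simp add: diff_right)
qed

text \<open>Pythagoras: the residual is orthogonal to the span of \<open>J\<close>, which contains
  the difference of the two approximations.\<close>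

lemma nrm_residual_le:
  assumes J: "orthonormal J" "finite J" and v: "v \<in> S"
  shows "nrm (v - (\<Sum>e\<in>J. g e v *\<^sub>R e)) \<le> nrm (v - (\<Sum>e\<in>J. c e *\<^sub>R e))"
proof -
  define r where "r = v - (\<Sum>e\<in>J. g e v *\<^sub>R e)"
  define u where "u = (\<Sum>e\<in>J. (g e v - c e) *\<^sub>R e)"
  have JS: "J \<subseteq> S" using J orthonormal_def by auto
  have S: "r \<in> S" "u \<in> S" unfolding r_def u_def using v JS by (auto intro!: S_sum S_scale S_diff)
  have "v - (\<Sum>e\<in>J. c e *\<^sub>R e) = r + u"
    unfolding r_def u_def by (simp add: scaleR_left_diff_distrib sum_subtractf)
  moreover have "g u r = 0"
    unfolding u_def using J JS S
    by (subst sum_left) (auto simp: S_scale scale_left subset_iff r_def intro!: sum.neutral orthonormal_residual[OF J v])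
  ultimately have "(nrm (v - (\<Sum>e\<in>J. c e *\<^sub>R e)))\<^sup>2 = (nrm r)\<^sup>2 + (nrm u)\<^sup>2"
    using S by (simp add: nrm_sq S_add add_left add_right commute[of r u])
  then have "(nrm r)\<^sup>2 \<le> (nrm (v - (\<Sum>e\<in>J. c e *\<^sub>R e)))\<^sup>2" by simp
  then show ?thesis unfolding r_def[symmetric]
    using \<open>v - (\<Sum>e\<in>J. c e *\<^sub>R e) = r + u\<close> S by (intro power2_le_imp_le[of "nrm r"]) (auto intro: nrm_nonneg S_add)
qed

text \<open>Density of the span gives one good finite combination. Best approximation makes the
  Fourier sum over every larger finite set at least as good, which is convergence along the net of
  finite sets.\<close>

lemma onb_expansion_converges:
  assumes B: "is_onb S g B" and v: "v \<in> S"
  shows "((\<lambda>J. nrm (v - (\<Sum>e\<in>J. g e v *\<^sub>R e))) \<longlongrightarrow> 0) (finite_subsets_at_top B)"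
proof (rule tendstoI)
  fix \<epsilon> :: real assume "0 < \<epsilon>"
  then obtain w where w: "w \<in> span B" "nrm (v - w) < \<epsilon>"
    using B v unfolding is_onb_def nrm_def by blast
  obtain J c where J: "finite J" "J \<subseteq> B" "w = (\<Sum>e\<in>J. c e *\<^sub>R e)"
    using span_finite_sum[OF w(1)] by blast
  show "\<forall>\<^sub>F K in finite_subsets_at_top B. dist (nrm (v - (\<Sum>e\<in>K. g e v *\<^sub>R e))) 0 < \<epsilon>"
    unfolding eventually_finite_subsets_at_top
  proof (intro exI[of _ J] conjI allI impI)
    fix K assume K: "finite K \<and> J \<subseteq> K \<and> K \<subseteq> B"
    define d where "d e = (if e \<in> J then c e else 0)" for e
    have "w = (\<Sum>e\<in>K. d e *\<^sub>R e)"
      unfolding J(3) d_def using K by (intro sum.mono_neutral_cong_left) auto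
    moreover have o: "orthonormal K" using is_onb_orthonormal[OF B] K by blast
    ultimately have "nrm (v - (\<Sum>e\<in>K. g e v *\<^sub>R e)) \<le> nrm (v - w)"
      using nrm_residual_le[OF o _ v, of d] K by simp
    moreover have "K \<subseteq> S" using K B by (auto simp: is_onb_def)
    then have "0 \<le> nrm (v - (\<Sum>e\<in>K. g e v *\<^sub>R e))"
      using v by (intro nrm_nonneg S_diff S_sum S_scale) auto
    ultimately show "dist (nrm (v - (\<Sum>e\<in>K. g e v *\<^sub>R e))) 0 < \<epsilon>"
      using w(2) by simp
  qed (use J in auto)
qed

section \<open>Gram-Schmidt inside a subspace\<close>

lemma gram_schmidt_step:
  assumes D: "subspace D" "D \<subseteq> S" and J: "orthonormal J" "finite J" "J \<subseteq> D" and d: "d \<in> D"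
  shows "\<exists>J'. J \<subseteq> J' \<and> orthonormal J' \<and> finite J' \<and> J' \<subseteq> D \<and> d \<in> span J'"
proof -
  define r where "r = d - (\<Sum>e\<in>J. g e d *\<^sub>R e)"
  have s: "(\<Sum>e\<in>J. g e d *\<^sub>R e) \<in> span J"
    by (intro span_sum span_scale span_base)
  have "(\<Sum>e\<in>J. g e d *\<^sub>R e) \<in> D" using D J by (intro subspace_sum subspace_scale) auto
  then have r: "r \<in> D" "r \<in> S" unfolding r_def using D d by (auto intro: subspace_diff)
  have dS: "d \<in> S" using d D by auto
  show ?thesis
  proof (cases "r = 0")
    case True
    then show ?thesis using s J by (intro exI[of _ J]) (auto simp: r_def)
  next
    case False
    define u where "u = (1 / nrm r) *\<^sub>R r"
    have nr: "0 < nrm r" using nrm_nonneg[OF r(2)] nrm_eq_0[OF r(2)] False by simp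
    have u: "u \<in> D" "u \<in> S" unfolding u_def using r D by (auto intro: subspace_scale S_scale)
    have uu: "g u u = 1"
      using nrm_sq[OF u(2)] nrm_scale[OF r(2), of "1 / nrm r"] nr by (simp add: u_def)
    have ju: "g f u = 0" if "f \<in> J" for f
      unfolding u_def using that J D r orthonormal_residual[OF J(1,2) dS that]
      by (subst scale_right) (auto simp: r_def)
    have uj: "g u f = 0" if "f \<in> J" for f
      using ju[OF that] commute[of u f] u that J D by auto
    have o: "orthonormal (insert u J)"
      using J u uu ju uj unfolding orthonormal_def by auto
    have "d = nrm r *\<^sub>R u + (\<Sum>e\<in>J. g e d *\<^sub>R e)"
      using nr by (simp add: u_def r_def)
    moreover have "(\<Sum>e\<in>J. g e d *\<^sub>R e) \<in> span (insert u J)"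
      using s span_mono[of J "insert u J"] by auto
    ultimately have "d \<in> span (insert u J)"
      by (metis insertI1 span_add span_base span_scale)
    then show ?thesis using o J u by (intro exI[of _ "insert u J"]) auto
  qed
qed

text \<open>The point is that the orthonormal set stays inside \<open>D\<close>, because residuals
  of elements of \<open>D\<close> are again in \<open>D\<close>. With \<open>D\<close> equal to
  \<open>N\<close> this produces orthonormal test vectors.\<close>

lemma gram_schmidt:
  fixes d :: "nat \<Rightarrow> 'h"
  assumes D: "subspace D" "D \<subseteq> S" and d: "\<And>n. d n \<in> D"
  shows "\<exists>B. orthonormal B \<and> B \<subseteq> D \<and> range d \<subseteq> span B"
proof -
  obtain J where J: "\<And>n. (orthonormal (J n) \<and> finite (J n) \<and> J n \<subseteq> D) \<and>
      (\<forall>m<n. d m \<in> span (J n))" "\<And>n. J n \<subseteq> J (Suc n)"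
  proof -
    have "\<exists>J. \<forall>n. ((orthonormal (J n) \<and> finite (J n) \<and> J n \<subseteq> D) \<and> (\<forall>m<n. d m \<in> span (J n))) \<and>
        J n \<subseteq> J (Suc n)"
    proof (rule dependent_nat_choice)
      show "\<exists>J. (orthonormal J \<and> finite J \<and> J \<subseteq> D) \<and> (\<forall>m<0. d m \<in> span J)"
        by (intro exI[of _ "{}"]) (auto simp: orthonormal_def)
      fix J n assume J: "(orthonormal J \<and> finite J \<and> J \<subseteq> D) \<and> (\<forall>m<n. d m \<in> span J)"
      obtain J' where "J \<subseteq> J'" "orthonormal J'" "finite J'" "J' \<subseteq> D" "d n \<in> span J'"
        using gram_schmidt_step[OF D, of J "d n"] J d by blast
      then show "\<exists>J'. ((orthonormal J' \<and> finite J' \<and> J' \<subseteq> D) \<and> (\<forall>m<Suc n. d m \<in> span J')) \<and> J \<subseteq> J'"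
        using J span_mono[of J J'] by (intro exI[of _ J']) (auto simp: less_Suc_eq)
    qed
    then show ?thesis using that by blast
  qed
  have mono: "J m \<subseteq> J n" if "m \<le> n" for m n
    using lift_Suc_mono_le[of J, OF J(2) that] .
  have "orthonormal (\<Union>n. J n)"
    unfolding orthonormal_def
  proof (intro conjI ballI)
    show "(\<Union>n. J n) \<subseteq> S" using J(1) D by blast
    fix e f assume "e \<in> (\<Union>n. J n)" "f \<in> (\<Union>n. J n)"
    then obtain m n where "e \<in> J m" "f \<in> J n" by auto
    then have "e \<in> J (max m n)" "f \<in> J (max m n)"
      using mono[of m "max m n"] mono[of n "max m n"] by auto
    then show "g e f = (if e = f then 1 else 0)"
      using J(1)[of "max m n"] unfolding orthonormal_def by blast
  qed
  moreover have "d n \<in> span (\<Union>n. J n)" for n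
    using J(1)[of "Suc n"] span_mono[of "J (Suc n)" "\<Union>n. J n"] by blast
  ultimately show ?thesis using J(1) by (intro exI[of _ "\<Union>n. J n"]) blast
qed

text \<open>The sum over \<open>B\<close> bounds the norm of \<open>l\<close> by
  \<open>onb_functional_bound\<close>, and the norm bounds the sum over \<open>B'\<close> by
  \<open>bessel_functional\<close>. Exchanging the bases gives equality.\<close>

lemma onb_sum_le:
  assumes l: "lin_on l" "\<And>v. v \<in> S \<Longrightarrow> \<bar>l v\<bar> \<le> C * nrm v"
    and B: "is_onb S g B" and B': "is_onb S g B'"
  shows "infsum (\<lambda>e. ennreal ((l e)\<^sup>2)) B' \<le> infsum (\<lambda>e. ennreal ((l e)\<^sup>2)) B"
proof (cases "infsum (\<lambda>e. ennreal ((l e)\<^sup>2)) B < \<infinity>")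
  case True
  obtain s where s: "0 \<le> s" "infsum (\<lambda>e. ennreal ((l e)\<^sup>2)) B = ennreal (s\<^sup>2)"
    "\<And>J. finite J \<Longrightarrow> J \<subseteq> B \<Longrightarrow> (\<Sum>e\<in>J. (l e)\<^sup>2) \<le> s\<^sup>2"
    using finite_ennreal_sum_bound[OF True] by blast
  have b: "\<bar>l v\<bar> \<le> s * nrm v" if "v \<in> S" for v
    by (rule onb_functional_bound[OF l B s(3) s(1) that])
  have "(\<Sum>e\<in>J. (l e)\<^sup>2) \<le> s\<^sup>2" if J: "finite J" "J \<subseteq> B'" for J
    by (rule bessel_functional[OF l(1) b is_onb_orthonormal[OF B' J(2)] J(1)])
  then show ?thesis unfolding s(2) infsum_ennreal_le_iff by (auto intro!: ennreal_leI)
qed (simp add: not_less top_unique)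

text \<open>For the functional \<open>\<lambda>u. g u v\<close> the norm is attained at
  \<open>v\<close> itself, so the two bounds on the sum meet.\<close>

lemma parseval:
  assumes v: "v \<in> S" and B: "is_onb S g B"
  shows "infsum (\<lambda>e. ennreal ((g e v)\<^sup>2)) B = ennreal ((nrm v)\<^sup>2)"
proof -
  have lin: "lin_on (\<lambda>u. g u v)" using v by (auto simp: lin_on_def add_left scale_left S_scale)
  have b: "\<bar>g u v\<bar> \<le> nrm v * nrm u" if "u \<in> S" for u
    using Cauchy_Schwarz[OF that v] by (simp add: mult.commute)
  have fin: "(\<Sum>e\<in>J. (g e v)\<^sup>2) \<le> (nrm v)\<^sup>2" if "finite J" "J \<subseteq> B" for J
    using bessel_functional[OF lin b is_onb_orthonormal[OF B that(2)] that(1)] .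
  then have le: "infsum (\<lambda>e. ennreal ((g e v)\<^sup>2)) B \<le> ennreal ((nrm v)\<^sup>2)"
    unfolding infsum_ennreal_le_iff by (auto intro!: ennreal_leI)
  then have "infsum (\<lambda>e. ennreal ((g e v)\<^sup>2)) B < \<infinity>"
    using le_less_trans[of _ "ennreal ((nrm v)\<^sup>2)" "\<infinity>"] by simp
  from finite_ennreal_sum_bound[OF this]
  obtain s where s: "0 \<le> s" "infsum (\<lambda>e. ennreal ((g e v)\<^sup>2)) B = ennreal (s\<^sup>2)"
    "\<And>J. finite J \<Longrightarrow> J \<subseteq> B \<Longrightarrow> (\<Sum>e\<in>J. (g e v)\<^sup>2) \<le> s\<^sup>2"
    by blast
  have "\<bar>g v v\<bar> \<le> s * nrm v"
    by (rule onb_functional_bound[OF lin b B s(3) s(1) v])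
  then have "nrm v * nrm v \<le> s * nrm v"
    using nrm_sq[OF v] self_nonneg[OF v] by (simp add: power2_eq_square)
  then have "nrm v \<le> s" using nrm_nonneg[OF v] s(1) by (cases "nrm v = 0") auto
  then have "(nrm v)\<^sup>2 \<le> s\<^sup>2" using nrm_nonneg[OF v] by (intro power_mono)
  then show ?thesis using le s(2) by (simp add: ennreal_leI antisym)
qed

end

subsection \<open>The dual spaces and orthonormal bases of test vectors\<close>

context nuclear_triple
begin

sublocale H: pre_hilbert "Hp p" "ip p" for p
  using hilbert[of p] unfolding hilbert_on_def by unfold_locales auto

lemma pnorm_eq_nrm: "pnorm p = H.nrm p"
  by (simp add: fun_eq_iff pnorm_def H.nrm_def)

lemma N_subset_Hp: "N \<subseteq> Hp p"
  by (auto simp: N_def)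

lemma N_Hp: "\<xi> \<in> N \<Longrightarrow> \<xi> \<in> Hp p"
  using N_subset_Hp by blast

lemma subspace_N: "subspace N"
  unfolding N_def using H.subspace by (intro subspace_Inter) auto

lemma N_zero [simp]: "0 \<in> N" and N_add: "x \<in> N \<Longrightarrow> y \<in> N \<Longrightarrow> x + y \<in> N"
  and N_scale: "x \<in> N \<Longrightarrow> c *\<^sub>R x \<in> N" and N_diff: "x \<in> N \<Longrightarrow> y \<in> N \<Longrightarrow> x - y \<in> N"
  and N_sum: "(\<And>j. j \<in> J \<Longrightarrow> f j \<in> N) \<Longrightarrow> sum f J \<in> N"
  using subspace_N by (auto intro: subspace_0 subspace_add subspace_scale subspace_diff subspace_sum)

lemma Hp_mono: "p \<le> q \<Longrightarrow> Hp q \<subseteq> Hp p"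
  using decreasing[of p q] by (cases "p = q") auto

lemma pnorm_mono: "p \<le> q \<Longrightarrow> \<xi> \<in> Hp q \<Longrightarrow> pnorm p \<xi> \<le> pnorm q \<xi>"
  using increasing_norms[of p q \<xi>] by (cases "p = q") (auto simp: pnorm_def)

lemma pnorm_nonneg: "\<xi> \<in> Hp p \<Longrightarrow> 0 \<le> pnorm p \<xi>"
  by (simp add: pnorm_eq_nrm H.nrm_nonneg)

lemma pnorm_pos: "\<xi> \<in> Hp p \<Longrightarrow> \<xi> \<noteq> 0 \<Longrightarrow> 0 < pnorm p \<xi>"
  using H.pos[of \<xi> p] by (simp add: pnorm_def)

lemma pnorm_scale: "\<xi> \<in> Hp p \<Longrightarrow> pnorm p (c *\<^sub>R \<xi>) = \<bar>c\<bar> * pnorm p \<xi>"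
  by (simp add: pnorm_eq_nrm H.nrm_scale)

lemma pnorm_triangle: "x \<in> Hp p \<Longrightarrow> y \<in> Hp p \<Longrightarrow> pnorm p (x + y) \<le> pnorm p x + pnorm p y"
  by (simp add: pnorm_eq_nrm H.nrm_triangle)

lemma N_dense_Hp: "v \<in> Hp p \<Longrightarrow> 0 < \<epsilon> \<Longrightarrow> \<exists>\<xi>\<in>N. pnorm p (v - \<xi>) < \<epsilon>"
  using dense_Hp[of v p \<epsilon>] by (simp add: N_def pnorm_def)

section \<open>Functionals on test vectors and their dual norms\<close>

lemma Hneg_linear: "x \<in> Hneg p \<Longrightarrow> \<xi> \<in> N \<Longrightarrow> \<eta> \<in> N \<Longrightarrow> x (a *\<^sub>R \<xi> + b *\<^sub>R \<eta>) = a * x \<xi> + b * x \<eta>"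
  by (auto simp: Hneg_def)

lemma Hneg_add: "x \<in> Hneg p \<Longrightarrow> \<xi> \<in> N \<Longrightarrow> \<eta> \<in> N \<Longrightarrow> x (\<xi> + \<eta>) = x \<xi> + x \<eta>"
  using Hneg_linear[of x p \<xi> \<eta> 1 1] by simp

lemma Hneg_diff: "x \<in> Hneg p \<Longrightarrow> \<xi> \<in> N \<Longrightarrow> \<eta> \<in> N \<Longrightarrow> x (\<xi> - \<eta>) = x \<xi> - x \<eta>"
  using Hneg_linear[of x p \<xi> \<eta> 1 "-1"] by simp

lemma Hneg_scale: "x \<in> Hneg p \<Longrightarrow> \<xi> \<in> N \<Longrightarrow> x (a *\<^sub>R \<xi>) = a * x \<xi>"
  using Hneg_linear[of x p \<xi> \<xi> a 0] by simp

lemma Hneg_zero: "x \<in> Hneg p \<Longrightarrow> x 0 = 0"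
  using Hneg_scale[of x p 0 0] by simp

lemma Hneg_sum:
  assumes "x \<in> Hneg p" "finite J" "\<And>j. j \<in> J \<Longrightarrow> f j \<in> N"
  shows "x (\<Sum>j\<in>J. c j *\<^sub>R f j) = (\<Sum>j\<in>J. c j * x (f j))"
  using assms(2,3)
  by (induction J rule: finite_induct)
     (auto simp: Hneg_zero[OF assms(1)] Hneg_add[OF assms(1)] Hneg_scale[OF assms(1)] N_scale N_sum)

lemma negnorm_bound:
  assumes "x \<in> Hneg p" "\<xi> \<in> N"
  shows "\<bar>x \<xi>\<bar> \<le> negnorm p x * pnorm p \<xi>"
proof -
  obtain C where C: "\<And>\<xi>. \<xi> \<in> N \<Longrightarrow> \<bar>x \<xi>\<bar> \<le> C * pnorm p \<xi>"
    using assms(1) unfolding Hneg_def by blast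
  have bdd: "bdd_above {\<bar>x \<xi>\<bar> |\<xi>. \<xi> \<in> N \<and> pnorm p \<xi> \<le> 1}"
  proof (rule bdd_aboveI)
    fix t assume "t \<in> {\<bar>x \<xi>\<bar> |\<xi>. \<xi> \<in> N \<and> pnorm p \<xi> \<le> 1}"
    then obtain \<zeta> where z: "t = \<bar>x \<zeta>\<bar>" "\<zeta> \<in> N" "pnorm p \<zeta> \<le> 1" by auto
    have "t \<le> \<bar>C\<bar> * pnorm p \<zeta>"
      using C[OF z(2)] z(1) pnorm_nonneg[OF N_Hp[OF z(2)], of p]
      by (meson abs_ge_self mult_right_mono order_trans)
    also have "\<dots> \<le> \<bar>C\<bar>" using z(3) by (simp add: mult_left_le)
    finally show "t \<le> \<bar>C\<bar>" .
  qed
  show ?thesis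
  proof (cases "\<xi> = 0")
    case True
    then show ?thesis using Hneg_zero[OF assms(1)] by (simp add: pnorm_def)
  next
    case False
    then have p: "0 < pnorm p \<xi>" using pnorm_pos N_Hp assms by blast
    have "\<bar>x ((1 / pnorm p \<xi>) *\<^sub>R \<xi>)\<bar> \<le> negnorm p x"
      unfolding negnorm_def using p assms
      by (intro cSup_upper[OF _ bdd]) (auto simp: pnorm_scale N_Hp intro!: exI[of _ "(1 / pnorm p \<xi>) *\<^sub>R \<xi>"] N_scale)
    then show ?thesis
      using p by (simp add: Hneg_scale[OF assms] abs_mult field_simps)
  qed
qed

lemma negnorm_le:
  assumes "\<And>\<xi>. \<xi> \<in> N \<Longrightarrow> \<bar>x \<xi>\<bar> \<le> C * pnorm p \<xi>" "0 \<le> C"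
  shows "negnorm p x \<le> C"
  unfolding negnorm_def
proof (rule cSup_least)
  show "{\<bar>x \<xi>\<bar> |\<xi>. \<xi> \<in> N \<and> pnorm p \<xi> \<le> 1} \<noteq> {}"
    using N_zero by (auto simp: pnorm_def intro!: exI[of _ 0])
  fix t assume "t \<in> {\<bar>x \<xi>\<bar> |\<xi>. \<xi> \<in> N \<and> pnorm p \<xi> \<le> 1}"
  then obtain \<zeta> where z: "t = \<bar>x \<zeta>\<bar>" "\<zeta> \<in> N" "pnorm p \<zeta> \<le> 1" by auto
  then show "t \<le> C" using assms(1)[OF z(2)] assms(2) by (meson dual_order.trans mult_left_le)
qed

lemma negnorm_nonneg: "x \<in> Hneg p \<Longrightarrow> 0 \<le> negnorm p x"
proof -
  assume x: "x \<in> Hneg p"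
  show ?thesis
  proof (cases "\<exists>\<xi>\<in>N. pnorm p \<xi> \<noteq> 0")
    case True
    then obtain \<xi> where "\<xi> \<in> N" "0 < pnorm p \<xi>" using pnorm_nonneg N_Hp by (metis less_eq_real_def)
    then show ?thesis using negnorm_bound[OF x \<open>\<xi> \<in> N\<close>]
      by (meson abs_ge_zero order_trans zero_le_mult_iff not_less)
  next
    case False
    then have "{\<bar>x \<xi>\<bar> |\<xi>. \<xi> \<in> N \<and> pnorm p \<xi> \<le> 1} = {0}"
      using negnorm_bound[OF x] N_zero by (auto intro!: exI[of _ 0] simp: Hneg_zero[OF x])
    then show ?thesis by (simp add: negnorm_def)
  qed
qed

lemma Hneg_lincomb:
  assumes "x \<in> Hneg p" "y \<in> Hneg p"
  shows "(\<lambda>\<xi>. a * x \<xi> + b * y \<xi>) \<in> Hneg p"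
  unfolding Hneg_def mem_Collect_eq
proof (intro conjI)
  show "vanishes_outside N (\<lambda>\<xi>. a * x \<xi> + b * y \<xi>)"
    using assms by (auto simp: Hneg_def vanishes_outside_def)
  show "\<forall>\<xi>\<in>N. \<forall>\<eta>\<in>N. \<forall>c d. a * x (c *\<^sub>R \<xi> + d *\<^sub>R \<eta>) + b * y (c *\<^sub>R \<xi> + d *\<^sub>R \<eta>) =
      c * (a * x \<xi> + b * y \<xi>) + d * (a * x \<eta> + b * y \<eta>)"
    using assms by (auto simp: Hneg_linear algebra_simps)
  show "\<exists>C. \<forall>\<xi>\<in>N. \<bar>a * x \<xi> + b * y \<xi>\<bar> \<le> C * pnorm p \<xi>"
  proof (intro exI[of _ "\<bar>a\<bar> * negnorm p x + \<bar>b\<bar> * negnorm p y"] ballI)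
    fix \<xi> assume \<xi>: "\<xi> \<in> N"
    have "\<bar>a * x \<xi> + b * y \<xi>\<bar> \<le> \<bar>a\<bar> * \<bar>x \<xi>\<bar> + \<bar>b\<bar> * \<bar>y \<xi>\<bar>"
      using abs_triangle_ineq[of "a * x \<xi>" "b * y \<xi>"] by (simp add: abs_mult)
    also have "\<dots> \<le> \<bar>a\<bar> * (negnorm p x * pnorm p \<xi>) + \<bar>b\<bar> * (negnorm p y * pnorm p \<xi>)"
      using negnorm_bound[OF assms(1) \<xi>] negnorm_bound[OF assms(2) \<xi>]
      by (intro add_mono mult_left_mono) auto
    finally show "\<bar>a * x \<xi> + b * y \<xi>\<bar> \<le> (\<bar>a\<bar> * negnorm p x + \<bar>b\<bar> * negnorm p y) * pnorm p \<xi>"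
      by (simp add: algebra_simps)
  qed
qed

lemma Hneg_mono: "p \<le> q \<Longrightarrow> Hneg p \<subseteq> Hneg q"
proof
  fix x assume pq: "p \<le> q" and x: "x \<in> Hneg p"
  have "\<forall>\<xi>\<in>N. \<bar>x \<xi>\<bar> \<le> negnorm p x * pnorm q \<xi>"
    using negnorm_bound[OF x] pnorm_mono[OF pq] negnorm_nonneg[OF x] N_Hp
    by (meson mult_left_mono order_trans)
  then show "x \<in> Hneg q" using x by (auto simp: Hneg_def)
qed

lemma negnorm_antimono: "p \<le> q \<Longrightarrow> x \<in> Hneg p \<Longrightarrow> negnorm q x \<le> negnorm p x"
  using negnorm_bound[of x p] pnorm_mono[of p q] negnorm_nonneg[of x p] N_Hp
  by (intro negnorm_le) (meson mult_left_mono order_trans)+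

lemma Hneg_N': "x \<in> Hneg p \<Longrightarrow> x \<in> N'"
  by (auto simp: N'_def)

lemma finite_N'_Hneg:
  assumes "finite X" "X \<subseteq> N'"
  shows "\<exists>p. X \<subseteq> Hneg p"
  using assms
proof (induction X rule: finite_induct)
  case (insert x X)
  then obtain p q where "X \<subseteq> Hneg p" "x \<in> Hneg q" by (auto simp: N'_def)
  then have "insert x X \<subseteq> Hneg (max p q)"
    using Hneg_mono[of p "max p q"] Hneg_mono[of q "max p q"] by auto
  then show ?case by blast
qed auto

lemma N'_lincomb:
  assumes "x \<in> N'" "y \<in> N'"
  shows "(\<lambda>\<xi>. a * x \<xi> + b * y \<xi>) \<in> N'"
proof -
  obtain p where "{x, y} \<subseteq> Hneg p" using finite_N'_Hneg[of "{x, y}"] assms by auto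
  then show ?thesis using Hneg_N'[OF Hneg_lincomb[of x p y a b]] by simp
qed

section \<open>Riesz images of vectors\<close>

lemma riesz_bound: "v \<in> Hp p \<Longrightarrow> \<xi> \<in> N \<Longrightarrow> \<bar>riesz p v \<xi>\<bar> \<le> pnorm p v * pnorm p \<xi>"
  using H.Cauchy_Schwarz[of v p \<xi>] by (auto simp: riesz_def pnorm_eq_nrm N_Hp)

lemma riesz_Hneg: "v \<in> Hp p \<Longrightarrow> riesz p v \<in> Hneg p"
  unfolding Hneg_def mem_Collect_eq
  using riesz_bound[of v p]
  by (auto simp: vanishes_outside_def riesz_def N_add N_scale H.add_right H.scale_right H.S_scale N_Hp)

lemma riesz_N': "v \<in> Hp p \<Longrightarrow> riesz p v \<in> N'"
  using riesz_Hneg Hneg_N' by blast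

lemma negnorm_riesz_le: "v \<in> Hp p \<Longrightarrow> negnorm p (riesz p v) \<le> pnorm p v"
  by (intro negnorm_le riesz_bound pnorm_nonneg)

lemma riesz_lincomb:
  "u \<in> Hp p \<Longrightarrow> v \<in> Hp p \<Longrightarrow>
    riesz p (a *\<^sub>R u + b *\<^sub>R v) = (\<lambda>\<xi>. a * riesz p u \<xi> + b * riesz p v \<xi>)"
  by (auto simp: riesz_def fun_eq_iff H.add_left H.scale_left H.S_scale N_Hp)

text \<open>The supremum in \<open>negnorm\<close> runs over test vectors, and \<open>v\<close> need
  not be one. It is tested on test vectors close to \<open>v\<close> instead of on
  \<open>v\<close>.\<close>

lemma pnorm_le_negnorm_riesz:
  assumes v: "v \<in> Hp p"
  shows "pnorm p v \<le> negnorm p (riesz p v)"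
proof (cases "v = 0")
  case True
  then show ?thesis using negnorm_nonneg[OF riesz_Hneg[OF v]] by (simp add: pnorm_def)
next
  case False
  then have p: "0 < pnorm p v" using pnorm_pos v by blast
  let ?n = "negnorm p (riesz p v)"
  have nn: "0 \<le> ?n" using negnorm_nonneg[OF riesz_Hneg[OF v]] .
  have "(pnorm p v)\<^sup>2 \<le> ?n * pnorm p v + \<epsilon>" if e: "0 < \<epsilon>" for \<epsilon>
  proof -
    \<comment> \<open>Replacing \<open>v\<close> by a test vector at distance \<open>d\<close> costs
      at most \<open>(pnorm p v + ?n) * d\<close>, which is at most
      \<open>\<epsilon>\<close>.\<close>
    define d where "d = \<epsilon> / (pnorm p v + ?n + 1)"
    have "0 < d" using e p nn by (simp add: d_def add_pos_nonneg)
    then obtain \<xi> where \<xi>: "\<xi> \<in> N" "pnorm p (v - \<xi>) < d" using N_dense_Hp v by blast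
    have S: "\<xi> \<in> Hp p" "v - \<xi> \<in> Hp p" using \<xi> v N_Hp H.S_diff by auto
    have "pnorm p \<xi> \<le> pnorm p v + pnorm p (v - \<xi>)"
      using H.nrm_triangle[of v p "\<xi> - v"] H.nrm_minus[of v p \<xi>] v S H.S_diff
      by (simp add: pnorm_eq_nrm)
    then have 1: "?n * pnorm p \<xi> \<le> ?n * (pnorm p v + pnorm p (v - \<xi>))"
      using nn by (intro mult_left_mono)
    have 2: "ip p v \<xi> \<le> ?n * pnorm p \<xi>"
      using negnorm_bound[OF riesz_Hneg[OF v] \<xi>(1)] \<xi>(1) by (simp add: riesz_def)
    have 3: "ip p v (v - \<xi>) \<le> pnorm p v * pnorm p (v - \<xi>)"
      using H.Cauchy_Schwarz[OF v S(2)] by (simp add: pnorm_eq_nrm)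
    have "(pnorm p v)\<^sup>2 = ip p v \<xi> + ip p v (v - \<xi>)"
      using v S by (simp add: pnorm_eq_nrm H.nrm_sq H.diff_right)
    also have "\<dots> \<le> ?n * pnorm p v + (pnorm p v + ?n) * pnorm p (v - \<xi>)"
      using 1 2 3 by (simp add: algebra_simps)
    also have "(pnorm p v + ?n) * pnorm p (v - \<xi>) \<le> (pnorm p v + ?n) * d"
      using \<xi>(2) nn p by (intro mult_left_mono) auto
    also have "\<dots> \<le> \<epsilon>" using e p nn by (simp add: d_def field_simps)
    finally show ?thesis by simp
  qed
  then have "(pnorm p v)\<^sup>2 \<le> ?n * pnorm p v" by (rule field_le_epsilon)
  then show ?thesis using p by (simp add: power2_eq_square)
qed

lemma negnorm_riesz: "v \<in> Hp p \<Longrightarrow> negnorm p (riesz p v) = pnorm p v"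
  using negnorm_riesz_le pnorm_le_negnorm_riesz by (simp add: antisym)

section \<open>Orthonormal bases consisting of test vectors\<close>

lemma hilbert_schmidt_countable_onb:
  obtains p' B where "p < p'" "is_onb (Hp p') (ip p') B" "(\<lambda>e. ip p e e) summable_on B" "countable B"
proof -
  obtain p' B where B: "p < p'" "is_onb (Hp p') (ip p') B" "(\<lambda>e. ip p e e) summable_on B"
    using hilbert_schmidt by blast
  \<comment> \<open>A summable family has only countably many nonzero terms, and here no term
    vanishes: a basis vector of the smaller space is nonzero, hence has positive norm in the larger
    one.\<close>
  have "countable {e \<in> B. ip p e e \<noteq> 0}"
    using B(3) by (rule summable_countable_real)
  moreover have "{e \<in> B. ip p e e \<noteq> 0} = B"
  proof -
    have "ip p e e \<noteq> 0" if e: "e \<in> B" for e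
    proof -
      have eS: "e \<in> Hp p'" and e1: "ip p' e e = 1" using B(2) e by (auto simp: is_onb_def)
      have "e \<noteq> 0" using e1 eS by auto
      moreover have "e \<in> Hp p" using eS Hp_mono[of p p'] B(1) by auto
      ultimately show ?thesis using H.pos[of e p] by simp
    qed
    then show ?thesis by auto
  qed
  ultimately show ?thesis using that B by simp
qed

text \<open>The Hilbert-Schmidt embedding supplies a countable basis \<open>E\<close> of a smaller
  space. Test vectors approximating the elements of \<open>E\<close> form a countable set
  \<open>D\<close>, and orthonormalizing \<open>D\<close> with respect to \<open>ip p\<close> does
  not leave \<open>N\<close>.\<close>

lemma onb_in_N_exists: "\<exists>B. B \<subseteq> N \<and> is_onb (Hp p) (ip p) B"
proof -
  obtain p' E where E: "p < p'" "is_onb (Hp p') (ip p') E" "countable E"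
    using hilbert_schmidt_countable_onb[of p] by metis
  have ES: "E \<subseteq> Hp p'" using E(2) by (simp add: is_onb_def)
  define X where "X e k = (SOME \<xi>. \<xi> \<in> N \<and> pnorm p' (e - \<xi>) < 1 / real (Suc k))" for e k
  have X: "X e k \<in> N \<and> pnorm p' (e - X e k) < 1 / real (Suc k)" if "e \<in> E" for e k
  proof -
    have "\<exists>\<xi>. \<xi> \<in> N \<and> pnorm p' (e - \<xi>) < 1 / real (Suc k)"
      using N_dense_Hp[of e p' "1 / real (Suc k)"] that ES by (auto simp del: of_nat_Suc)
    then show ?thesis unfolding X_def by (rule someI_ex)
  qed
  \<comment> \<open>The zero vector makes \<open>D\<close> nonempty, so that
    \<open>from_nat_into\<close> enumerates it.\<close>
  define D where "D = insert 0 ((\<lambda>(e, k). X e k) ` (E \<times> UNIV))"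
  have "countable D" using E(3) unfolding D_def by auto
  then have d: "range (from_nat_into D) = D" by (intro range_from_nat_into) (simp add: D_def)
  have DN: "D \<subseteq> N" using X by (auto simp: D_def)
  have "from_nat_into D n \<in> N" for n using d DN by blast
  then obtain B where B: "H.orthonormal p B" "B \<subseteq> N" "range (from_nat_into D) \<subseteq> span B"
    using H.gram_schmidt[OF subspace_N N_subset_Hp] by blast
  have spB: "span D \<subseteq> span B" using B(3) d by (simp add: span_minimal)
  have spN: "span B \<subseteq> N" using B(2) subspace_N by (simp add: span_minimal)
  have near_span: "u \<in> Hp p' \<and> (\<exists>w\<in>span D. pnorm p' (u - w) < \<epsilon>)"
    if u: "u \<in> span E" and e: "0 < \<epsilon>" for u \<epsilon>
    using u e
  proof (induction arbitrary: \<epsilon> rule: span_induct_alt)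
    case base
    then show ?case by (auto intro!: bexI[of _ 0] simp: pnorm_def span_zero)
  next
    case (step c e u)
    have eS: "e \<in> Hp p'" using step ES by auto
    obtain w where w: "w \<in> span D" "pnorm p' (u - w) < \<epsilon> / 2"
      using step.IH[of "\<epsilon> / 2"] step.prems by auto
    \<comment> \<open>The error in replacing \<open>e\<close> is multiplied by
      \<open>\<bar>c\<bar>\<close>; the denominator uses \<open>\<bar>c\<bar> + 1\<close> to allow
      \<open>c = 0\<close>.\<close>
    obtain k where k: "1 / real (Suc k) < \<epsilon> / (2 * (\<bar>c\<bar> + 1))"
      using step.prems nat_approx_posE[of "\<epsilon> / (2 * (\<bar>c\<bar> + 1))"] by (auto simp: add_pos_nonneg)
    have XD: "X e k \<in> D" using step by (auto simp: D_def)
    then have XS: "X e k \<in> Hp p'" using DN N_Hp by blast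
    have wS: "w \<in> Hp p'" using w(1) spB spN N_Hp by blast
    have uS: "u \<in> Hp p'" using step.IH[OF step.prems] by blast
    have "pnorm p' (c *\<^sub>R e + u - (c *\<^sub>R X e k + w)) = pnorm p' (c *\<^sub>R (e - X e k) + (u - w))"
      by (simp add: algebra_simps)
    also have "\<dots> \<le> \<bar>c\<bar> * pnorm p' (e - X e k) + pnorm p' (u - w)"
      using pnorm_triangle[of "c *\<^sub>R (e - X e k)" p' "u - w"] eS XS wS uS
      by (simp add: pnorm_scale H.S_scale H.S_diff)
    also have "\<bar>c\<bar> * pnorm p' (e - X e k) \<le> (\<bar>c\<bar> + 1) * (\<epsilon> / (2 * (\<bar>c\<bar> + 1)))"
      using X[OF step.hyps(1), of k] k pnorm_nonneg[of "e - X e k" p'] eS XS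
      by (intro mult_mono) (auto simp: H.S_diff)
    also have "\<dots> = \<epsilon> / 2" by (simp add: add_pos_nonneg less_imp_neq[symmetric] field_simps)
    finally have "pnorm p' (c *\<^sub>R e + u - (c *\<^sub>R X e k + w)) < \<epsilon>" using w(2) by simp
    moreover have "c *\<^sub>R X e k + w \<in> span D" using XD w(1) by (auto intro: span_add span_scale span_base)
    ultimately show ?case using eS uS H.S_add H.S_scale by blast
  qed
  have "\<exists>w\<in>span B. sqrt (ip p (v - w) (v - w)) < \<epsilon>" if v: "v \<in> Hp p" and e: "0 < \<epsilon>" for v \<epsilon>
  proof -
    \<comment> \<open>Three approximations follow: \<open>v\<close> by a test vector in the norm of
      \<open>p\<close>, that vector by the span of \<open>E\<close>, and this by the span of
      \<open>D\<close>. The last two are made in the finer norm of \<open>p'\<close>.\<close>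
    obtain \<xi> where \<xi>: "\<xi> \<in> N" "pnorm p (v - \<xi>) < \<epsilon> / 3" using N_dense_Hp[OF v, of "\<epsilon> / 3"] e by auto
    have \<xi>S: "\<xi> \<in> Hp q" for q using \<xi> N_Hp by blast
    obtain u where u: "u \<in> span E" "pnorm p' (\<xi> - u) < \<epsilon> / 3"
    proof -
      have "0 < \<epsilon> / 3" using e by simp
      then show ?thesis using that E(2) \<xi>S[of p'] unfolding is_onb_def pnorm_def by blast
    qed
    obtain w where w: "w \<in> span D" "pnorm p' (u - w) < \<epsilon> / 3"
      using near_span[OF u(1), of "\<epsilon> / 3"] e by auto
    have wN: "w \<in> N" using w spB spN by blast
    have uS: "u \<in> Hp p'" using u ES H.subspace[of p'] span_minimal by blast
    have "pnorm p' (\<xi> - w) \<le> pnorm p' (\<xi> - u) + pnorm p' (u - w)"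
      using pnorm_triangle[of "\<xi> - u" p' "u - w"] \<xi>S uS N_Hp[OF wN] by (simp add: H.S_diff)
    moreover have "pnorm p (\<xi> - w) \<le> pnorm p' (\<xi> - w)"
      using E(1) \<xi> wN by (intro pnorm_mono) (auto intro: N_Hp N_diff)
    moreover have "pnorm p (v - w) \<le> pnorm p (v - \<xi>) + pnorm p (\<xi> - w)"
      using pnorm_triangle[of "v - \<xi>" p "\<xi> - w"] \<xi>S v N_Hp[OF wN] by (simp add: H.S_diff)
    ultimately have "pnorm p (v - w) < \<epsilon>" using \<xi> u w by linarith
    then show ?thesis using w spB unfolding pnorm_def by blast
  qed
  then have "is_onb (Hp p) (ip p) B"
    using B(1) unfolding is_onb_def H.orthonormal_def by blast
  then show ?thesis using B(2) by blast
qed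

text \<open>Elements of the dual can be evaluated on this basis; \<open>onb p\<close> is arbitrary
  and may leave \<open>N\<close>.\<close>

definition onbN :: "nat \<Rightarrow> 'h set" where
  "onbN p = (SOME B. B \<subseteq> N \<and> is_onb (Hp p) (ip p) B)"

lemma onbN: "onbN p \<subseteq> N" "is_onb (Hp p) (ip p) (onbN p)"
  using someI_ex[OF onb_in_N_exists[of p]] unfolding onbN_def by auto

lemma onb: "is_onb (Hp p) (ip p) (onb p)"
  unfolding onb_def using onb_in_N_exists[of p] by (intro someI_ex[of "is_onb (Hp p) (ip p)"]) auto

lemma onb_Hp: "is_onb (Hp p) (ip p) B \<Longrightarrow> e \<in> B \<Longrightarrow> e \<in> Hp p"
  by (auto simp: is_onb_def)

lemma bessel:
  assumes \<xi>: "\<xi> \<in> Hp p" and J: "finite J" "J \<subseteq> B" and B: "is_onb (Hp p) (ip p) B"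
  shows "(\<Sum>e\<in>J. (ip p e \<xi>)\<^sup>2) \<le> (pnorm p \<xi>)\<^sup>2"
  unfolding pnorm_eq_nrm
proof (rule H.bessel_functional[OF _ _ H.is_onb_orthonormal[OF B J(2)] J(1)])
  show "H.lin_on p (\<lambda>v. ip p v \<xi>)"
    using \<xi> by (auto simp: H.lin_on_def H.add_left H.scale_left H.S_scale)
  show "\<bar>ip p v \<xi>\<bar> \<le> H.nrm p \<xi> * H.nrm p v" if "v \<in> Hp p" for v
    using H.Cauchy_Schwarz[OF that \<xi>] by (simp add: mult.commute)
qed

text \<open>
  Expanding \<open>x\<close> along an orthonormal basis inside \<open>N\<close>, where \<open>x\<close> can be evaluated, avoids the Riesz
  representation theorem.
\<close>

lemma riesz_dense:
  assumes x: "x \<in> Hneg p" and \<epsilon>: "0 < \<epsilon>"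
  shows "\<exists>v\<in>N. negnorm p (\<lambda>\<xi>. 1 * x \<xi> + (-1) * riesz p v \<xi>) \<le> \<epsilon>"
proof -
  let ?B = "onbN p"
  have B: "is_onb (Hp p) (ip p) ?B" "?B \<subseteq> N" using onbN by auto
  \<comment> \<open>Here \<open>x\<close> is linear on \<open>N\<close> only, so the argument of
    \<open>bessel_functional\<close> is repeated with a test function \<open>w\<close> inside
    \<open>N\<close>.\<close>
  have bound: "(\<Sum>e\<in>J. (x e)\<^sup>2) \<le> (negnorm p x)\<^sup>2" if J: "finite J" "J \<subseteq> ?B" for J
  proof -
    have JN: "J \<subseteq> N" using J B by auto
    define w where "w = (\<Sum>e\<in>J. x e *\<^sub>R e)"
    have o: "H.orthonormal p J" using H.is_onb_orthonormal[OF B(1) J(2)] .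
    have wN: "w \<in> N" unfolding w_def using JN by (intro N_sum N_scale) auto
    define s where "s = (\<Sum>e\<in>J. (x e)\<^sup>2)"
    have s0: "0 \<le> s" unfolding s_def by (simp add: sum_nonneg)
    have xw: "x w = s"
      unfolding w_def s_def using Hneg_sum[OF x J(1), of "\<lambda>e. e" x] JN
      by (simp add: power2_eq_square subset_iff)
    have "pnorm p w = sqrt s"
      using H.orthonormal_nrm_sum[OF o J(1), of x] H.nrm_nonneg[OF N_Hp[OF wN]]
      unfolding w_def[symmetric] s_def[symmetric] pnorm_eq_nrm by (metis real_sqrt_unique)
    then have "s \<le> negnorm p x * sqrt s" using negnorm_bound[OF x wN] xw s0 by simp
    then have "sqrt s * sqrt s \<le> negnorm p x * sqrt s" using s0 by simp
    then have "sqrt s \<le> negnorm p x"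
      using negnorm_nonneg[OF x] s0 by (cases "s = 0") (auto simp del: real_sqrt_mult_self)
    then have "(sqrt s)\<^sup>2 \<le> (negnorm p x)\<^sup>2" using s0 by (intro power_mono) auto
    then show ?thesis using s0 by (simp add: s_def)
  qed
  have "(\<lambda>e. (x e)\<^sup>2) summable_on ?B"
    using bound by (intro nonneg_bdd_above_summable_on) (auto intro!: bdd_aboveI2)
  then have "((\<lambda>J. \<Sum>e\<in>J. (x e)\<^sup>2) \<longlongrightarrow> infsum (\<lambda>e. (x e)\<^sup>2) ?B) (finite_subsets_at_top ?B)"
    using has_sum_infsum has_sum_def by blast
  then have ev: "\<forall>\<^sub>F J in finite_subsets_at_top ?B. dist (\<Sum>e\<in>J. (x e)\<^sup>2) (infsum (\<lambda>e. (x e)\<^sup>2) ?B) < \<epsilon>\<^sup>2"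
    using \<epsilon> by (intro tendstoD) auto
  then obtain J where J: "finite J" "J \<subseteq> ?B"
    "\<forall>K. finite K \<and> J \<subseteq> K \<and> K \<subseteq> ?B \<longrightarrow> dist (\<Sum>e\<in>K. (x e)\<^sup>2) (infsum (\<lambda>e. (x e)\<^sup>2) ?B) < \<epsilon>\<^sup>2"
    unfolding eventually_finite_subsets_at_top by (elim exE conjE)
  \<comment> \<open>The finite set \<open>J\<close> already carries the whole sum up to
    \<open>\<epsilon>\<^sup>2\<close>, so the basis vectors outside \<open>J\<close> share at most
    that much.\<close>
  have tail: "(\<Sum>e\<in>K - J. (x e)\<^sup>2) \<le> \<epsilon>\<^sup>2" if K: "finite K" "J \<subseteq> K" "K \<subseteq> ?B" for K
  proof -
    have "(\<Sum>e\<in>K - J. (x e)\<^sup>2) = (\<Sum>e\<in>K. (x e)\<^sup>2) - (\<Sum>e\<in>J. (x e)\<^sup>2)"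
      using K J by (simp add: sum_diff)
    also have "\<dots> \<le> infsum (\<lambda>e. (x e)\<^sup>2) ?B - (\<Sum>e\<in>J. (x e)\<^sup>2)"
      using K \<open>(\<lambda>e. (x e)\<^sup>2) summable_on ?B\<close>
      by (intro diff_right_mono finite_sum_le_infsum) auto
    also have "\<dots> \<le> \<epsilon>\<^sup>2" using J(3)[rule_format, of J] J(1,2) by (auto simp: dist_real_def)
    finally show ?thesis .
  qed
  have JN: "J \<subseteq> N" using J B by auto
  define v where "v = (\<Sum>e\<in>J. x e *\<^sub>R e)"
  have vN: "v \<in> N" unfolding v_def using JN by (intro N_sum N_scale) auto
  have "\<bar>x \<xi> - ip p v \<xi>\<bar> \<le> \<epsilon> * pnorm p \<xi>" if \<xi>: "\<xi> \<in> N" for \<xi>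
  proof -
    define r where "r K = pnorm p (\<xi> - (\<Sum>e\<in>K. ip p e \<xi> *\<^sub>R e))" for K
    have "(r \<longlongrightarrow> 0) (finite_subsets_at_top ?B)"
      unfolding r_def pnorm_eq_nrm by (rule H.onb_expansion_converges[OF B(1) N_Hp[OF \<xi>]])
    then have lim: "((\<lambda>K. negnorm p x * r K + \<epsilon> * pnorm p \<xi>) \<longlongrightarrow> negnorm p x * 0 + \<epsilon> * pnorm p \<xi>)
        (finite_subsets_at_top ?B)"
      by (intro tendsto_intros)
    \<comment> \<open>The vector \<open>\<xi>\<close> is split into its Fourier sum \<open>w\<close>
      over \<open>K\<close> and a remainder. On the remainder \<open>x\<close> is controlled by its
      norm; on \<open>w\<close> the two functionals differ only in the coefficients over
      \<open>K - J\<close>, where Cauchy-Schwarz meets \<open>tail\<close>. The limit over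
      \<open>K\<close> removes the remainder.\<close>
    have est: "\<bar>x \<xi> - ip p v \<xi>\<bar> \<le> negnorm p x * r K + \<epsilon> * pnorm p \<xi>"
      if K: "finite K" "J \<subseteq> K" "K \<subseteq> ?B" for K
    proof -
      have KN: "K \<subseteq> N" using K B by auto
      define w where "w = (\<Sum>e\<in>K. ip p e \<xi> *\<^sub>R e)"
      have wN: "w \<in> N" unfolding w_def using KN by (intro N_sum N_scale) auto
      have "x \<xi> = x (\<xi> - w) + x w" using Hneg_diff[OF x \<xi> wN] by simp
      moreover have "\<bar>x (\<xi> - w)\<bar> \<le> negnorm p x * r K"
        unfolding r_def w_def[symmetric] by (intro negnorm_bound x N_diff \<xi> wN)
      moreover have "\<bar>x w - ip p v \<xi>\<bar> \<le> \<epsilon> * pnorm p \<xi>"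
      proof -
        have "x w = (\<Sum>e\<in>K. ip p e \<xi> * x e)"
          unfolding w_def using Hneg_sum[OF x K(1), of "\<lambda>e. e"] KN by (simp add: subset_iff)
        moreover have "ip p v \<xi> = (\<Sum>e\<in>J. ip p e \<xi> * x e)"
          unfolding v_def using JN J \<xi>
          by (subst H.sum_left) (auto simp: N_Hp H.S_scale H.scale_left subset_iff mult.commute intro!: sum.cong)
        ultimately have "x w - ip p v \<xi> = (\<Sum>e\<in>K - J. ip p e \<xi> * x e)"
          using K J by (simp add: sum_diff)
        then have "\<bar>x w - ip p v \<xi>\<bar> \<le> (\<Sum>e\<in>K - J. \<bar>ip p e \<xi>\<bar> * \<bar>x e\<bar>)"
          using sum_abs[of "\<lambda>e. ip p e \<xi> * x e" "K - J"] by (simp add: abs_mult)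
        also have "\<dots> \<le> sqrt (\<Sum>e\<in>K - J. (ip p e \<xi>)\<^sup>2) * sqrt (\<Sum>e\<in>K - J. (x e)\<^sup>2)"
          using L2_set_mult_ineq[of "\<lambda>e. ip p e \<xi>" x "K - J"] by (simp add: L2_set_def)
        also have "\<dots> \<le> pnorm p \<xi> * \<epsilon>"
        proof (intro mult_mono)
          have "(\<Sum>e\<in>K - J. (ip p e \<xi>)\<^sup>2) \<le> (pnorm p \<xi>)\<^sup>2"
            by (rule bessel[OF N_Hp[OF \<xi>] _ _ B(1)]) (use K in auto)
          then show "sqrt (\<Sum>e\<in>K - J. (ip p e \<xi>)\<^sup>2) \<le> pnorm p \<xi>"
            using pnorm_nonneg[OF N_Hp[OF \<xi>]] by (simp add: real_le_lsqrt)
          show "sqrt (\<Sum>e\<in>K - J. (x e)\<^sup>2) \<le> \<epsilon>"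
            using tail[OF K] \<epsilon> by (simp add: real_le_lsqrt)
        qed (auto intro: pnorm_nonneg N_Hp \<xi> sum_nonneg)
        finally show ?thesis by (simp add: mult.commute)
      qed
      ultimately show ?thesis by linarith
    qed
    have ev: "\<forall>\<^sub>F K in finite_subsets_at_top ?B. \<bar>x \<xi> - ip p v \<xi>\<bar> \<le> negnorm p x * r K + \<epsilon> * pnorm p \<xi>"
      unfolding eventually_finite_subsets_at_top using J(1,2) est by (intro exI[of _ J]) auto
    show ?thesis
      using tendsto_lowerbound[OF lim ev] by simp
  qed
  then have "negnorm p (\<lambda>\<xi>. 1 * x \<xi> + (-1) * riesz p v \<xi>) \<le> \<epsilon>"
    using \<epsilon> by (intro negnorm_le) (auto simp: riesz_def)
  then show ?thesis using vN by blast
qed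

end

subsection \<open>Hilbert--Schmidt forms\<close>

context nuclear_triple
begin

text \<open>The difference is spelled with factors \<open>1\<close> and \<open>-1\<close> so that it
  is literally an instance of \<open>Hneg_lincomb\<close>.\<close>

lemma negnorm_triangle_riesz:
  assumes "x \<in> Hneg p" "v \<in> Hp p" "negnorm p (\<lambda>\<xi>. 1 * x \<xi> + (-1) * riesz p v \<xi>) \<le> \<epsilon>"
  shows "pnorm p v \<le> negnorm p x + \<epsilon>"
proof -
  let ?y = "\<lambda>\<xi>. 1 * x \<xi> + (-1) * riesz p v \<xi>"
  have y: "?y \<in> Hneg p" using Hneg_lincomb[OF assms(1) riesz_Hneg[OF assms(2)], of 1 "-1"] .
  have "0 \<le> \<epsilon>" using negnorm_nonneg[OF y] assms(3) by simp
  have "negnorm p (riesz p v) \<le> negnorm p x + \<epsilon>"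
  proof (rule negnorm_le)
    fix \<xi> assume \<xi>: "\<xi> \<in> N"
    have "\<bar>riesz p v \<xi>\<bar> \<le> \<bar>x \<xi>\<bar> + \<bar>?y \<xi>\<bar>" by simp
    also have "\<dots> \<le> negnorm p x * pnorm p \<xi> + \<epsilon> * pnorm p \<xi>"
      using negnorm_bound[OF assms(1) \<xi>] negnorm_bound[OF y \<xi>]
        mult_right_mono[OF assms(3) pnorm_nonneg[OF N_Hp[OF \<xi>], of p]] by linarith
    finally show "\<bar>riesz p v \<xi>\<bar> \<le> (negnorm p x + \<epsilon>) * pnorm p \<xi>" by (simp add: algebra_simps)
  qed (use negnorm_nonneg[OF assms(1)] \<open>0 \<le> \<epsilon>\<close> in auto)
  then show ?thesis using negnorm_riesz[OF assms(2)] by simp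
qed

text \<open>Such functionals arise as real and imaginary parts of a form in which all arguments but
  one are frozen.\<close>

definition bounded_functional :: "nat \<Rightarrow> (('h \<Rightarrow> real) \<Rightarrow> real) \<Rightarrow> bool" where
  "bounded_functional p l \<longleftrightarrow>
     (\<forall>x\<in>Hneg p. \<forall>y\<in>Hneg p. \<forall>a b. l (\<lambda>\<xi>. a * x \<xi> + b * y \<xi>) = a * l x + b * l y) \<and>
     (\<exists>C. \<forall>x\<in>Hneg p. \<bar>l x\<bar> \<le> C * negnorm p x)"

text \<open>On Riesz images this is \<open>onb_functional_bound\<close>, because
  \<open>riesz p\<close> is isometric; Riesz images of test vectors are dense in
  \<open>Hneg p\<close> by \<open>riesz_dense\<close>.\<close>

lemma bounded_functional_le:
  assumes l: "bounded_functional p l" and B: "is_onb (Hp p) (ip p) B"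
    and s: "\<And>J. finite J \<Longrightarrow> J \<subseteq> B \<Longrightarrow> (\<Sum>e\<in>J. (l (riesz p e))\<^sup>2) \<le> s\<^sup>2" "0 \<le> s"
    and x: "x \<in> Hneg p"
  shows "\<bar>l x\<bar> \<le> s * negnorm p x"
proof -
  obtain C where C: "\<And>x. x \<in> Hneg p \<Longrightarrow> \<bar>l x\<bar> \<le> C * negnorm p x"
    using l unfolding bounded_functional_def by blast
  have C': "\<bar>l x\<bar> \<le> \<bar>C\<bar> * negnorm p x" if "x \<in> Hneg p" for x
    using C[OF that] negnorm_nonneg[OF that] by (meson abs_ge_self mult_right_mono order_trans)
  have lin: "l (\<lambda>\<xi>. a * x \<xi> + b * y \<xi>) = a * l x + b * l y" if "x \<in> Hneg p" "y \<in> Hneg p" for x y a b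
    using l that unfolding bounded_functional_def by blast
  have rz: "\<bar>l (riesz p v)\<bar> \<le> s * pnorm p v" if v: "v \<in> Hp p" for v
    unfolding pnorm_eq_nrm
  proof (rule H.onb_functional_bound[where l = "\<lambda>v. l (riesz p v)", OF _ _ B s v])
    show "H.lin_on p (\<lambda>v. l (riesz p v))"
      by (auto simp: H.lin_on_def riesz_lincomb lin riesz_Hneg)
    show "\<bar>l (riesz p v)\<bar> \<le> \<bar>C\<bar> * H.nrm p v" if "v \<in> Hp p" for v
      using C'[OF riesz_Hneg[OF that]] by (simp add: negnorm_riesz that pnorm_eq_nrm)
  qed
  have "\<bar>l x\<bar> \<le> s * negnorm p x + \<epsilon>" if \<epsilon>: "0 < \<epsilon>" for \<epsilon>
  proof -
    define d where "d = \<epsilon> / (\<bar>C\<bar> + s + 1)"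
    have pos: "0 < \<bar>C\<bar> + s + 1" using s by simp
    then have d: "0 < d" using \<epsilon> by (simp add: d_def)
    obtain v where v: "v \<in> N" "negnorm p (\<lambda>\<xi>. 1 * x \<xi> + (-1) * riesz p v \<xi>) \<le> d"
      using riesz_dense[OF x d] by blast
    let ?y = "\<lambda>\<xi>. 1 * x \<xi> + (-1) * riesz p v \<xi>"
    have vS: "v \<in> Hp p" using v N_Hp by blast
    have y: "?y \<in> Hneg p" using Hneg_lincomb[OF x riesz_Hneg[OF vS], of 1 "-1"] .
    have "l ?y = 1 * l x + (-1) * l (riesz p v)" by (rule lin[OF x riesz_Hneg[OF vS]])
    then have "\<bar>l x\<bar> \<le> \<bar>l ?y\<bar> + \<bar>l (riesz p v)\<bar>" by linarith
    also have "\<dots> \<le> \<bar>C\<bar> * d + s * (negnorm p x + d)"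
    proof (rule add_mono)
      show "\<bar>l ?y\<bar> \<le> \<bar>C\<bar> * d"
        using C'[OF y] mult_left_mono[OF v(2), of "\<bar>C\<bar>"] by linarith
      show "\<bar>l (riesz p v)\<bar> \<le> s * (negnorm p x + d)"
        using rz[OF vS] mult_left_mono[OF negnorm_triangle_riesz[OF x vS v(2)] s(2)] by linarith
    qed
    also have "\<dots> = s * negnorm p x + (\<bar>C\<bar> + s) * d" by (simp add: algebra_simps)
    also have "(\<bar>C\<bar> + s) * d \<le> \<epsilon>" using pos \<epsilon> s by (simp add: d_def field_simps)
    finally show ?thesis by simp
  qed
  then show ?thesis by (rule field_le_epsilon)
qed

lemma bounded_functional_sq_le:
  assumes l: "bounded_functional p l" and B: "is_onb (Hp p) (ip p) B" and x: "x \<in> Hneg p"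
  shows "ennreal ((l x)\<^sup>2) \<le>
    ennreal ((negnorm p x)\<^sup>2) * infsum (\<lambda>e. ennreal ((l (riesz p e))\<^sup>2)) B"
proof (cases "infsum (\<lambda>e. ennreal ((l (riesz p e))\<^sup>2)) B < \<infinity>")
  case True
  obtain s where s: "0 \<le> s" "infsum (\<lambda>e. ennreal ((l (riesz p e))\<^sup>2)) B = ennreal (s\<^sup>2)"
    "\<And>J. finite J \<Longrightarrow> J \<subseteq> B \<Longrightarrow> (\<Sum>e\<in>J. (l (riesz p e))\<^sup>2) \<le> s\<^sup>2"
    using finite_ennreal_sum_bound[OF True] by blast
  have "\<bar>l x\<bar> \<le> s * negnorm p x"
    by (rule bounded_functional_le[OF l B s(3) s(1) x])
  then have "\<bar>l x\<bar>\<^sup>2 \<le> (s * negnorm p x)\<^sup>2" by (intro power_mono) auto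
  then show ?thesis unfolding s(2)
    by (simp add: power_mult_distrib mult.commute flip: ennreal_mult)
next
  case False
  then have inf: "infsum (\<lambda>e. ennreal ((l (riesz p e))\<^sup>2)) B = top"
    by (simp add: not_less top_unique)
  obtain C where C: "\<And>x. x \<in> Hneg p \<Longrightarrow> \<bar>l x\<bar> \<le> C * negnorm p x"
    using l unfolding bounded_functional_def by blast
  show ?thesis
  \<comment> \<open>The sum is infinite here, and in \<open>ennreal\<close> zero times infinity is
    zero. So for vanishing norm of \<open>x\<close> the value \<open>l x\<close> itself must vanish,
    which boundedness provides.\<close>
  proof (cases "negnorm p x = 0")
    case True
    then show ?thesis using C[OF x] by simp
  next
    case False
    then show ?thesis by (simp add: inf ennreal_mult_top)
  qed
qed

lemma bounded_functional_mono:
  assumes "bounded_functional q l" "p \<le> q"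
  shows "bounded_functional p l"
proof -
  obtain C where C: "\<And>x. x \<in> Hneg q \<Longrightarrow> \<bar>l x\<bar> \<le> C * negnorm q x"
    using assms unfolding bounded_functional_def by blast
  have "\<bar>l x\<bar> \<le> \<bar>C\<bar> * negnorm p x" if x: "x \<in> Hneg p" for x
  proof -
    have "x \<in> Hneg q" using x Hneg_mono[OF assms(2)] by blast
    then show ?thesis using C[of x] negnorm_antimono[OF assms(2) x] negnorm_nonneg[of x q]
      by (meson abs_ge_self abs_ge_zero mult_left_mono mult_right_mono order_trans)
  qed
  then show ?thesis using assms(1) Hneg_mono[OF assms(2)] unfolding bounded_functional_def by blast
qed

text \<open>For \<open>p = q\<close> this says that the sum does not depend on the basis.\<close>

lemma bounded_functional_onb_le:
  assumes l: "bounded_functional q l" and pq: "p \<le> q"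
    and B': "is_onb (Hp p) (ip p) B'" and B: "is_onb (Hp q) (ip q) B"
  shows "infsum (\<lambda>e. ennreal ((l (riesz p e))\<^sup>2)) B' \<le> infsum (\<lambda>e. ennreal ((l (riesz q e))\<^sup>2)) B"
proof (cases "infsum (\<lambda>e. ennreal ((l (riesz q e))\<^sup>2)) B < \<infinity>")
  case True
  obtain s where s: "0 \<le> s" "infsum (\<lambda>e. ennreal ((l (riesz q e))\<^sup>2)) B = ennreal (s\<^sup>2)"
    "\<And>J. finite J \<Longrightarrow> J \<subseteq> B \<Longrightarrow> (\<Sum>e\<in>J. (l (riesz q e))\<^sup>2) \<le> s\<^sup>2"
    using finite_ennreal_sum_bound[OF True] by blast
  have lp: "bounded_functional p l" by (rule bounded_functional_mono[OF l pq])
  \<comment> \<open>The Riesz map of the index \<open>p\<close> is followed by the inclusion of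
    \<open>Hneg p\<close> into \<open>Hneg q\<close>, which does not increase norms; hence the bound
    from the basis of \<open>Hp q\<close> holds for \<open>p\<close>.\<close>
  have "\<bar>l (riesz p v)\<bar> \<le> s * H.nrm p v" if v: "v \<in> Hp p" for v
  proof -
    have x: "riesz p v \<in> Hneg q" using riesz_Hneg[OF v] Hneg_mono[OF pq] by blast
    have "\<bar>l (riesz p v)\<bar> \<le> s * negnorm q (riesz p v)"
      by (rule bounded_functional_le[OF l B s(3) s(1) x])
    also have "\<dots> \<le> s * pnorm p v"
      using negnorm_antimono[OF pq riesz_Hneg[OF v]] s(1) negnorm_riesz[OF v]
      by (intro mult_left_mono) auto
    finally show ?thesis by (simp add: pnorm_eq_nrm)
  qed
  moreover have "H.lin_on p (\<lambda>v. l (riesz p v))"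
    using lp by (auto simp: H.lin_on_def riesz_lincomb riesz_Hneg bounded_functional_def)
  ultimately have bes: "(\<Sum>e\<in>J. (l (riesz p e))\<^sup>2) \<le> s\<^sup>2" if "finite J" "J \<subseteq> B'" for J
    using H.bessel_functional[of p "\<lambda>v. l (riesz p v)" s J] H.is_onb_orthonormal[OF B' that(2)] that(1)
    by blast
  show ?thesis unfolding s(2) infsum_ennreal_le_iff
  proof (intro allI impI)
    fix J assume "finite J" "J \<subseteq> B'"
    then show "(\<Sum>e\<in>J. ennreal ((l (riesz p e))\<^sup>2)) \<le> ennreal (s\<^sup>2)"
      using bes[of J] by (simp add: ennreal_leI)
  qed
qed (simp add: not_less top_unique)

definition bounded_functional_C :: "nat \<Rightarrow> (('h \<Rightarrow> real) \<Rightarrow> complex) \<Rightarrow> bool" where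
  "bounded_functional_C p l \<longleftrightarrow>
     (\<forall>x\<in>Hneg p. \<forall>y\<in>Hneg p. \<forall>a b. l (\<lambda>\<xi>. a * x \<xi> + b * y \<xi>) =
        complex_of_real a * l x + complex_of_real b * l y) \<and>
     (\<exists>C. \<forall>x\<in>Hneg p. cmod (l x) \<le> C * negnorm p x)"

lemma bounded_functional_C_parts:
  assumes "bounded_functional_C p l"
  shows "bounded_functional p (\<lambda>x. Re (l x))" "bounded_functional p (\<lambda>x. Im (l x))"
proof -
  obtain C where C: "\<And>x. x \<in> Hneg p \<Longrightarrow> cmod (l x) \<le> C * negnorm p x"
    using assms unfolding bounded_functional_C_def by blast
  have "\<bar>Re (l x)\<bar> \<le> C * negnorm p x" "\<bar>Im (l x)\<bar> \<le> C * negnorm p x" if "x \<in> Hneg p" for x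
    using C[OF that] abs_Re_le_cmod[of "l x"] abs_Im_le_cmod[of "l x"] by linarith+
  then show "bounded_functional p (\<lambda>x. Re (l x))" "bounded_functional p (\<lambda>x. Im (l x))"
    using assms unfolding bounded_functional_C_def bounded_functional_def by (auto simp del: One_nat_def)
qed

text \<open>Squared moduli split exactly, so the real estimates carry over to complex functionals
  with the same constants.\<close>

lemma infsum_cmod_sq:
  "infsum (\<lambda>e. ennreal ((cmod (l e))\<^sup>2)) B =
    infsum (\<lambda>e. ennreal ((Re (l e))\<^sup>2)) B + infsum (\<lambda>e. ennreal ((Im (l e))\<^sup>2)) B"
  by (simp add: cmod_power2 nonneg_summable_on_complete flip: infsum_add)

lemma bounded_functional_C_sq_le:
  assumes l: "bounded_functional_C p l" and B: "is_onb (Hp p) (ip p) B" and x: "x \<in> Hneg p"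
  shows "ennreal ((cmod (l x))\<^sup>2) \<le>
    ennreal ((negnorm p x)\<^sup>2) * infsum (\<lambda>e. ennreal ((cmod (l (riesz p e)))\<^sup>2)) B"
  using add_mono[OF bounded_functional_sq_le[OF bounded_functional_C_parts(1)[OF l] B x]
      bounded_functional_sq_le[OF bounded_functional_C_parts(2)[OF l] B x]]
  unfolding infsum_cmod_sq by (simp add: cmod_power2 distrib_left)

lemma bounded_functional_C_onb_le:
  assumes l: "bounded_functional_C q l" and pq: "p \<le> q"
    and B': "is_onb (Hp p) (ip p) B'" and B: "is_onb (Hp q) (ip q) B"
  shows "infsum (\<lambda>e. ennreal ((cmod (l (riesz p e)))\<^sup>2)) B' \<le>
    infsum (\<lambda>e. ennreal ((cmod (l (riesz q e)))\<^sup>2)) B"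
  unfolding infsum_cmod_sq
  by (intro add_mono bounded_functional_onb_le[OF _ pq B' B] bounded_functional_C_parts l)

definition bounded_form :: "nat \<Rightarrow> nat \<Rightarrow> 'h kernel \<Rightarrow> bool" where
  "bounded_form p n \<kappa> \<longleftrightarrow> (\<exists>C. \<forall>xs. length xs = n \<longrightarrow> set xs \<subseteq> Hneg p \<longrightarrow>
        cmod (\<kappa> xs) \<le> C * prod_list (map (negnorm p) xs))"

text \<open>The squared Hilbert-Schmidt norm as an extended number and for a free basis:
  \<open>tnorm\<close> is tied to \<open>onb p\<close>, but computations with test vectors need
  \<open>onbN p\<close>.\<close>

definition hs_sum :: "nat \<Rightarrow> 'h set \<Rightarrow> nat \<Rightarrow> 'h kernel \<Rightarrow> ennreal" where
  "hs_sum p B n \<kappa> = infsum (\<lambda>es. ennreal ((cmod (\<kappa> (map (riesz p) es)))\<^sup>2)) (nlists n B)"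

section \<open>Symmetric and bounded forms\<close>

lemma sym_form_mset: "sym_form n \<kappa> \<Longrightarrow> mset xs = mset ys \<Longrightarrow> \<kappa> xs = \<kappa> ys"
  unfolding sym_form_def by blast

lemma sym_form_vanish: "sym_form n \<kappa> \<Longrightarrow> length xs \<noteq> n \<or> \<not> set xs \<subseteq> N' \<Longrightarrow> \<kappa> xs = 0"
  unfolding sym_form_def vanishes_outside_def by blast

lemma sym_form_linear:
  assumes "sym_form n \<kappa>" "length vs + 1 = n" "set vs \<subseteq> N'" "x \<in> N'" "y \<in> N'"
  shows "\<kappa> ((\<lambda>\<xi>. a * x \<xi> + b * y \<xi>) # vs) =
    complex_of_real a * \<kappa> (x # vs) + complex_of_real b * \<kappa> (y # vs)"
proof -
  have "\<forall>us vs x y a b. set us \<subseteq> N' \<longrightarrow> set vs \<subseteq> N' \<longrightarrow> length us + length vs + 1 = n \<longrightarrow>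
        x \<in> N' \<longrightarrow> y \<in> N' \<longrightarrow>
        \<kappa> (us @ [\<lambda>\<xi>. a * x \<xi> + b * y \<xi>] @ vs) =
          complex_of_real a * \<kappa> (us @ [x] @ vs) + complex_of_real b * \<kappa> (us @ [y] @ vs)"
    using assms(1) unfolding sym_form_def by blast
  from this[rule_format, of "[]" vs x y a b] show ?thesis using assms by simp
qed

text \<open>By symmetry any slot can be moved to the front, so linearity in the first slot
  suffices.\<close>

lemma sym_formI:
  assumes van: "\<And>xs. length xs \<noteq> n \<or> \<not> set xs \<subseteq> N' \<Longrightarrow> \<kappa> xs = 0"
    and lin: "\<And>vs x y a b. length vs + 1 = n \<Longrightarrow> set vs \<subseteq> N' \<Longrightarrow> x \<in> N' \<Longrightarrow> y \<in> N' \<Longrightarrow>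
      \<kappa> ((\<lambda>\<xi>. a * x \<xi> + b * y \<xi>) # vs) =
        complex_of_real a * \<kappa> (x # vs) + complex_of_real b * \<kappa> (y # vs)"
    and sym: "\<And>xs ys. length xs = n \<Longrightarrow> set xs \<subseteq> N' \<Longrightarrow> mset xs = mset ys \<Longrightarrow> \<kappa> xs = \<kappa> ys"
  shows "sym_form n \<kappa>"
proof -
  have S: "\<kappa> xs = \<kappa> ys" if "mset xs = mset ys" for xs ys
  proof (cases "length xs = n \<and> set xs \<subseteq> N'")
    case False
    moreover have "length xs = length ys" "set xs = set ys"
      using that by (auto dest: mset_eq_length mset_eq_setD)
    ultimately show ?thesis using van[of xs] van[of ys] by auto
  qed (use sym that in auto)
  show ?thesis unfolding sym_form_def
  proof (intro conjI allI impI)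
    show "vanishes_outside {xs. length xs = n \<and> set xs \<subseteq> N'} \<kappa>"
      using van by (auto simp: vanishes_outside_def)
    fix us vs :: "('h \<Rightarrow> real) list" and x y :: "'h \<Rightarrow> real" and a b :: real
    assume H: "set us \<subseteq> N'" "set vs \<subseteq> N'" "length us + length vs + 1 = n" "x \<in> N'" "y \<in> N'"
    have e: "\<kappa> (us @ [z] @ vs) = \<kappa> (z # us @ vs)" for z by (rule S) simp
    show "\<kappa> (us @ [\<lambda>\<xi>. a * x \<xi> + b * y \<xi>] @ vs) =
       complex_of_real a * \<kappa> (us @ [x] @ vs) + complex_of_real b * \<kappa> (us @ [y] @ vs)"
      unfolding e using H by (intro lin) auto
  qed (rule S)
qed

lemma sym_form_Cons:
  assumes "sym_form (Suc n) \<kappa>" "x \<in> N'"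
  shows "sym_form n (\<lambda>xs. \<kappa> (x # xs))"
proof (rule sym_formI)
  fix vs u v and a b :: real
  assume H: "length vs + 1 = n" "set vs \<subseteq> N'" "u \<in> N'" "v \<in> N'"
  have e: "\<kappa> (x # z # vs) = \<kappa> (z # x # vs)" for z by (rule sym_form_mset[OF assms(1)]) simp
  show "\<kappa> (x # (\<lambda>\<xi>. a * u \<xi> + b * v \<xi>) # vs) =
       complex_of_real a * \<kappa> (x # u # vs) + complex_of_real b * \<kappa> (x # v # vs)"
    unfolding e using H assms by (intro sym_form_linear) auto
next
  fix xs :: "('h \<Rightarrow> real) list" assume "length xs \<noteq> n \<or> \<not> set xs \<subseteq> N'"
  then show "\<kappa> (x # xs) = 0" by (intro sym_form_vanish[OF assms(1)]) auto
next
  fix xs ys :: "('h \<Rightarrow> real) list" assume "mset xs = mset ys"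
  then show "\<kappa> (x # xs) = \<kappa> (x # ys)" by (intro sym_form_mset[OF assms(1)]) auto
qed

lemma sym_form_append:
  assumes "sym_form (length xs + m) \<kappa>" "set xs \<subseteq> N'"
  shows "sym_form m (\<lambda>ys. \<kappa> (xs @ ys))"
  using assms
proof (induction xs arbitrary: \<kappa>)
  case (Cons x xs)
  then show ?case using Cons.IH[of "\<lambda>ys. \<kappa> (x # ys)"] sym_form_Cons[of "length xs + m" \<kappa> x] by simp
qed simp

lemma bounded_form_Cons:
  assumes "bounded_form p (Suc n) \<kappa>" "x \<in> Hneg p"
  shows "bounded_form p n (\<lambda>xs. \<kappa> (x # xs))"
proof -
  obtain C where C: "\<And>xs. length xs = Suc n \<Longrightarrow> set xs \<subseteq> Hneg p \<Longrightarrow>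
        cmod (\<kappa> xs) \<le> C * prod_list (map (negnorm p) xs)"
    using assms unfolding bounded_form_def by blast
  show ?thesis unfolding bounded_form_def
  proof (intro exI[of _ "C * negnorm p x"] allI impI)
    fix xs :: "('h \<Rightarrow> real) list" assume "length xs = n" "set xs \<subseteq> Hneg p"
    then show "cmod (\<kappa> (x # xs)) \<le> C * negnorm p x * prod_list (map (negnorm p) xs)"
      using C[of "x # xs"] assms(2) by (simp add: mult.assoc)
  qed
qed

lemma bounded_form_append:
  assumes "bounded_form p (length xs + m) \<kappa>" "set xs \<subseteq> Hneg p"
  shows "bounded_form p m (\<lambda>ys. \<kappa> (xs @ ys))"
  using assms
proof (induction xs arbitrary: \<kappa>)
  case (Cons x xs)
  then show ?case using Cons.IH[of "\<lambda>ys. \<kappa> (x # ys)"] bounded_form_Cons[of p "length xs + m" \<kappa> x] by simp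
qed simp

lemma prod_list_negnorm_nonneg: "set xs \<subseteq> Hneg p \<Longrightarrow> 0 \<le> prod_list (map (negnorm p) xs)"
  by (induction xs) (auto intro: mult_nonneg_nonneg negnorm_nonneg)

lemma prod_list_negnorm_antimono:
  "p \<le> q \<Longrightarrow> set xs \<subseteq> Hneg p \<Longrightarrow> prod_list (map (negnorm q) xs) \<le> prod_list (map (negnorm p) xs)"
proof (induction xs)
  case (Cons x xs)
  then have "set xs \<subseteq> Hneg q" using Hneg_mono by (metis order_trans set_subset_Cons)
  then show ?case using Cons
    by (auto intro!: mult_mono negnorm_antimono negnorm_nonneg prod_list_negnorm_nonneg)
qed simp

lemma bounded_form_mono:
  assumes "bounded_form q n \<kappa>" "p \<le> q"
  shows "bounded_form p n \<kappa>"
proof -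
  obtain C where C: "\<And>xs. length xs = n \<Longrightarrow> set xs \<subseteq> Hneg q \<Longrightarrow>
        cmod (\<kappa> xs) \<le> C * prod_list (map (negnorm q) xs)"
    using assms unfolding bounded_form_def by blast
  show ?thesis unfolding bounded_form_def
  proof (intro exI[of _ "\<bar>C\<bar>"] allI impI)
    fix xs :: "('h \<Rightarrow> real) list" assume xs: "length xs = n" "set xs \<subseteq> Hneg p"
    then have xq: "set xs \<subseteq> Hneg q" using Hneg_mono[OF assms(2)] by blast
    have "cmod (\<kappa> xs) \<le> \<bar>C\<bar> * prod_list (map (negnorm q) xs)"
      using C[OF xs(1) xq] prod_list_negnorm_nonneg[OF xq]
      by (meson abs_ge_self mult_right_mono order_trans)
    also have "\<dots> \<le> \<bar>C\<bar> * prod_list (map (negnorm p) xs)"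
      by (intro mult_left_mono prod_list_negnorm_antimono assms xs) auto
    finally show "cmod (\<kappa> xs) \<le> \<bar>C\<bar> * prod_list (map (negnorm p) xs)" .
  qed
qed

lemma bounded_functional_C_form:
  assumes \<kappa>: "sym_form (Suc n) \<kappa>" "bounded_form p (Suc n) \<kappa>" and vs: "length vs = n" "set vs \<subseteq> Hneg p"
  shows "bounded_functional_C p (\<lambda>x. \<kappa> (x # vs))"
  unfolding bounded_functional_C_def
proof (intro conjI ballI allI)
  have vsN: "set vs \<subseteq> N'" using vs Hneg_N' by blast
  show "\<kappa> ((\<lambda>\<xi>. a * x \<xi> + b * y \<xi>) # vs) = complex_of_real a * \<kappa> (x # vs) + complex_of_real b * \<kappa> (y # vs)"
    if "x \<in> Hneg p" "y \<in> Hneg p" for x y a b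
    using that vs vsN Hneg_N' by (intro sym_form_linear[OF \<kappa>(1)]) auto
  obtain C where C: "\<And>xs. length xs = Suc n \<Longrightarrow> set xs \<subseteq> Hneg p \<Longrightarrow>
        cmod (\<kappa> xs) \<le> C * prod_list (map (negnorm p) xs)"
    using \<kappa>(2) unfolding bounded_form_def by blast
  show "\<exists>C. \<forall>x\<in>Hneg p. cmod (\<kappa> (x # vs)) \<le> C * negnorm p x"
    using C[of "_ # vs"] vs by (intro exI[of _ "C * prod_list (map (negnorm p) vs)"]) (simp add: mult_ac)
qed

section \<open>Hilbert-Schmidt sums, slot by slot\<close>

lemma hs_sum_Suc:
  "hs_sum p B (Suc n) \<kappa> = infsum (\<lambda>e. hs_sum p B n (\<lambda>xs. \<kappa> (riesz p e # xs))) B"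
  unfolding hs_sum_def by (simp add: infsum_nlists_Suc)

text \<open>With the first slot summed innermost, estimates for functionals of one variable apply to
  it for each choice of the other arguments.\<close>

lemma hs_sum_Suc':
  "hs_sum p B (Suc n) \<kappa> =
    infsum (\<lambda>es. infsum (\<lambda>e. ennreal ((cmod (\<kappa> (riesz p e # map (riesz p) es)))\<^sup>2)) B) (nlists n B)"
  unfolding hs_sum_def by (subst infsum_ennreal_swap) (simp add: infsum_nlists_Suc)

lemma hs_sum_add:
  "hs_sum p B (k + m) \<kappa> =
    infsum (\<lambda>es. hs_sum p B m (\<lambda>ys. \<kappa> (map (riesz p) es @ ys))) (nlists k B)"
  unfolding hs_sum_def by (simp add: infsum_nlists_add)

lemma map_riesz_Hneg: "es \<in> nlists n B \<Longrightarrow> B \<subseteq> Hp p \<Longrightarrow> set (map (riesz p) es) \<subseteq> Hneg p"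
  using riesz_Hneg by (auto simp: nlists_def)

lemma map_riesz_N': "es \<in> nlists n B \<Longrightarrow> B \<subseteq> Hp p \<Longrightarrow> set (map (riesz p) es) \<subseteq> N'"
  using map_riesz_Hneg[of es n B p] Hneg_N' by blast

lemma length_nlists: "es \<in> nlists n B \<Longrightarrow> length es = n"
  by (simp add: nlists_def)

lemma hs_sum_Cons_le:
  assumes \<kappa>: "sym_form (Suc n) \<kappa>" "bounded_form p (Suc n) \<kappa>" and x: "x \<in> Hneg p"
    and B: "is_onb (Hp p) (ip p) B"
  shows "hs_sum p B n (\<lambda>xs. \<kappa> (x # xs)) \<le> ennreal ((negnorm p x)\<^sup>2) * hs_sum p B (Suc n) \<kappa>"
proof -
  have BS: "B \<subseteq> Hp p" using B by (simp add: is_onb_def)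
  have "hs_sum p B n (\<lambda>xs. \<kappa> (x # xs)) \<le> infsum (\<lambda>es. ennreal ((negnorm p x)\<^sup>2) *
      infsum (\<lambda>e. ennreal ((cmod (\<kappa> (riesz p e # map (riesz p) es)))\<^sup>2)) B) (nlists n B)"
    unfolding hs_sum_def
    by (intro infsum_ennreal_mono bounded_functional_C_sq_le[OF _ B x] bounded_functional_C_form[OF \<kappa>])
       (use map_riesz_Hneg[OF _ BS] in \<open>auto simp: length_nlists\<close>)
  also have "\<dots> \<le> ennreal ((negnorm p x)\<^sup>2) * hs_sum p B (Suc n) \<kappa>"
    unfolding hs_sum_Suc' by (rule infsum_ennreal_cmult_le)
  finally show ?thesis .
qed

lemma hs_sum_append_le:
  assumes "sym_form (length xs + m) \<kappa>" "bounded_form p (length xs + m) \<kappa>" "set xs \<subseteq> Hneg p"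
    and B: "is_onb (Hp p) (ip p) B"
  shows "hs_sum p B m (\<lambda>ys. \<kappa> (xs @ ys)) \<le>
    ennreal ((prod_list (map (negnorm p) xs))\<^sup>2) * hs_sum p B (length xs + m) \<kappa>"
  using assms(1-3)
proof (induction xs arbitrary: \<kappa>)
  case (Cons x xs)
  have x: "x \<in> Hneg p" "x \<in> N'" using Cons.prems Hneg_N' by auto
  let ?\<kappa> = "\<lambda>ys. \<kappa> (x # ys)"
  have "hs_sum p B m (\<lambda>ys. ?\<kappa> (xs @ ys)) \<le>
      ennreal ((prod_list (map (negnorm p) xs))\<^sup>2) * hs_sum p B (length xs + m) ?\<kappa>"
    using Cons.prems x by (intro Cons.IH sym_form_Cons bounded_form_Cons) auto
  also have "\<dots> \<le> ennreal ((prod_list (map (negnorm p) xs))\<^sup>2) *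
      (ennreal ((negnorm p x)\<^sup>2) * hs_sum p B (Suc (length xs + m)) \<kappa>)"
    using Cons.prems x by (intro mult_left_mono hs_sum_Cons_le B) auto
  also have "\<dots> = ennreal ((prod_list (map (negnorm p) (x # xs)))\<^sup>2) * hs_sum p B (length (x # xs) + m) \<kappa>"
    by (simp add: power_mult_distrib ennreal_mult mult_ac)
  finally show ?case by simp
qed simp

text \<open>The slots change from \<open>p\<close> to \<open>q\<close> one after another: the tail
  by induction, then, after interchanging the sums, the head by
  \<open>bounded_functional_C_onb_le\<close>. The case \<open>p = q\<close> is independence of the
  basis.\<close>

lemma hs_sum_mono:
  assumes "sym_form n \<kappa>" "bounded_form q n \<kappa>" and pq: "p \<le> q"
    and B': "is_onb (Hp p) (ip p) B'" and B: "is_onb (Hp q) (ip q) B"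
  shows "hs_sum p B' n \<kappa> \<le> hs_sum q B n \<kappa>"
  using assms(1,2)
proof (induction n arbitrary: \<kappa>)
  case 0
  then show ?case by (simp add: hs_sum_def)
next
  case (Suc n)
  have S: "B' \<subseteq> Hp p" "B \<subseteq> Hp q" using B B' by (auto simp: is_onb_def)
  have "hs_sum p B' (Suc n) \<kappa> \<le> infsum (\<lambda>e. hs_sum q B n (\<lambda>xs. \<kappa> (riesz p e # xs))) B'"
    unfolding hs_sum_Suc
  proof (intro infsum_ennreal_mono Suc.IH)
    fix e assume "e \<in> B'"
    then have "riesz p e \<in> Hneg p" using S riesz_Hneg by blast
    then have e: "riesz p e \<in> Hneg q" using Hneg_mono[OF pq] by blast
    show "sym_form n (\<lambda>xs. \<kappa> (riesz p e # xs))" "bounded_form q n (\<lambda>xs. \<kappa> (riesz p e # xs))"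
      using Suc.prems e Hneg_N'[OF e] by (auto intro: sym_form_Cons bounded_form_Cons)
  qed
  also have "\<dots> = infsum (\<lambda>es. infsum (\<lambda>e. ennreal ((cmod (\<kappa> (riesz p e # map (riesz q) es)))\<^sup>2)) B')
      (nlists n B)"
    unfolding hs_sum_def by (rule infsum_ennreal_swap)
  also have "\<dots> \<le> hs_sum q B (Suc n) \<kappa>"
    unfolding hs_sum_Suc'
    by (intro infsum_ennreal_mono bounded_functional_C_onb_le[OF _ pq B' B]
        bounded_functional_C_form[OF Suc.prems])
       (use map_riesz_Hneg[OF _ S(2)] in \<open>auto simp: length_nlists\<close>)
  finally show ?case .
qed

lemma hilbert_schmidt_form_iff:
  "hilbert_schmidt_form p n \<kappa> \<longleftrightarrow> bounded_form p n \<kappa> \<and> hs_sum p (onb p) n \<kappa> < \<infinity>"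
  unfolding hilbert_schmidt_form_def bounded_form_def hs_sum_def nlists_def
  by (subst summable_on_iff_infsum_ennreal) auto

lemma hs_sum_tnorm:
  assumes "hilbert_schmidt_form p n \<kappa>"
  shows "hs_sum p (onb p) n \<kappa> = ennreal ((tnorm p n \<kappa>)\<^sup>2)"
proof -
  have "(\<lambda>es. (cmod (\<kappa> (map (riesz p) es)))\<^sup>2) summable_on nlists n (onb p)"
    using assms unfolding hilbert_schmidt_form_def nlists_def by blast
  then have "hs_sum p (onb p) n \<kappa> = ennreal (\<Sum>\<^sub>\<infinity>es\<in>nlists n (onb p). (cmod (\<kappa> (map (riesz p) es)))\<^sup>2)"
    unfolding hs_sum_def by (intro summable_on_iff_infsum_ennreal) auto
  then show ?thesis by (simp add: tnorm_def nlists_def infsum_nonneg)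
qed

lemma tnorm_nonneg: "0 \<le> tnorm p n \<kappa>"
  by (simp add: tnorm_def infsum_nonneg)

lemma tnorm_le:
  assumes "hilbert_schmidt_form p n \<kappa>" "hs_sum p (onb p) n \<kappa> \<le> ennreal (C\<^sup>2)" "0 \<le> C"
  shows "tnorm p n \<kappa> \<le> C"
proof -
  have "(tnorm p n \<kappa>)\<^sup>2 \<le> C\<^sup>2" using assms by (simp add: hs_sum_tnorm)
  then show ?thesis using assms(3) power2_le_imp_le by blast
qed

text \<open>It is enough to control arbitrarily large indices, since the sums increase with the
  index. This matters when some arguments are frozen at elements of \<open>Hneg r\<close>: there the
  estimates are available from \<open>r\<close> on.\<close>

lemma NC_tensorI:
  assumes sym: "sym_form n \<kappa>"
    and cof: "\<And>p. \<exists>q\<ge>p. bounded_form q n \<kappa> \<and> hs_sum q (onb q) n \<kappa> < \<infinity>"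
  shows "\<kappa> \<in> NC_tensor n"
proof -
  have "hilbert_schmidt_form p n \<kappa>" for p
  proof -
    obtain q where q: "p \<le> q" "bounded_form q n \<kappa>" "hs_sum q (onb q) n \<kappa> < \<infinity>" using cof by blast
    have "hs_sum p (onb p) n \<kappa> \<le> hs_sum q (onb q) n \<kappa>"
      by (rule hs_sum_mono[OF sym q(2,1) onb onb])
    then show ?thesis unfolding hilbert_schmidt_form_iff
      using q bounded_form_mono by (auto intro: le_less_trans)
  qed
  then show ?thesis using sym by (simp add: NC_tensor_def)
qed

lemma NC_tensorI':
  assumes "sym_form n \<kappa>" "\<And>p. bounded_form p n \<kappa>" "\<And>p. hs_sum p (onb p) n \<kappa> < \<infinity>"
  shows "\<kappa> \<in> NC_tensor n"
  using assms by (intro NC_tensorI) auto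

lemma NC_tensorD:
  assumes "\<kappa> \<in> NC_tensor n"
  shows "sym_form n \<kappa>" "hilbert_schmidt_form p n \<kappa>" "bounded_form p n \<kappa>"
    "hs_sum p (onb p) n \<kappa> = ennreal ((tnorm p n \<kappa>)\<^sup>2)"
  using assms by (auto simp: NC_tensor_def hilbert_schmidt_form_iff hs_sum_tnorm)

text \<open>This frees the norm from the basis chosen in its definition.\<close>

lemma hs_sum_NC_tensor:
  assumes "\<kappa> \<in> NC_tensor n" "is_onb (Hp p) (ip p) B"
  shows "hs_sum p B n \<kappa> = ennreal ((tnorm p n \<kappa>)\<^sup>2)"
  using hs_sum_mono[OF NC_tensorD(1,3)[OF assms(1)] order_refl assms(2) onb]
    hs_sum_mono[OF NC_tensorD(1,3)[OF assms(1)] order_refl onb assms(2)] NC_tensorD(4)[OF assms(1), of p]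
  by simp

lemma tnorm_mono:
  assumes "\<kappa> \<in> NC_tensor n" "p \<le> q"
  shows "tnorm p n \<kappa> \<le> tnorm q n \<kappa>"
  using hs_sum_mono[OF NC_tensorD(1,3)[OF assms(1)] assms(2) onb onb]
  by (intro tnorm_le NC_tensorD assms) (auto simp: NC_tensorD(4)[OF assms(1)] tnorm_nonneg)

lemma NC_tensor_append:
  assumes \<kappa>: "\<kappa> \<in> NC_tensor (length xs + m)" and xs: "set xs \<subseteq> N'"
  shows "(\<lambda>ys. \<kappa> (xs @ ys)) \<in> NC_tensor m"
proof (rule NC_tensorI)
  show "sym_form m (\<lambda>ys. \<kappa> (xs @ ys))" using \<kappa> xs by (intro sym_form_append NC_tensorD)
  fix p
  obtain r where r: "set xs \<subseteq> Hneg r" using finite_N'_Hneg[of "set xs"] xs by auto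
  define q where "q = max p r"
  have xq: "set xs \<subseteq> Hneg q" using r Hneg_mono[of r q] by (auto simp: q_def)
  have "bounded_form q m (\<lambda>ys. \<kappa> (xs @ ys))"
    by (intro bounded_form_append NC_tensorD \<kappa> xq)
  moreover have "hs_sum q (onb q) m (\<lambda>ys. \<kappa> (xs @ ys)) < \<infinity>"
  proof -
    have "hs_sum q (onb q) m (\<lambda>ys. \<kappa> (xs @ ys)) \<le>
        ennreal ((prod_list (map (negnorm q) xs))\<^sup>2) * ennreal ((tnorm q (length xs + m) \<kappa>)\<^sup>2)"
      using hs_sum_append_le[OF NC_tensorD(1,3)[OF \<kappa>] xq onb] NC_tensorD(4)[OF \<kappa>] by simp
    also have "\<dots> < \<infinity>" by (simp add: ennreal_mult_less_top)
    finally show ?thesis .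
  qed
  ultimately show "\<exists>q\<ge>p. bounded_form q m (\<lambda>ys. \<kappa> (xs @ ys)) \<and> hs_sum q (onb q) m (\<lambda>ys. \<kappa> (xs @ ys)) < \<infinity>"
    by (intro exI[of _ q]) (auto simp: q_def)
qed

lemma tnorm_append_le:
  assumes \<kappa>: "\<kappa> \<in> NC_tensor (length xs + m)" and xs: "set xs \<subseteq> Hneg p"
  shows "tnorm p m (\<lambda>ys. \<kappa> (xs @ ys)) \<le> prod_list (map (negnorm p) xs) * tnorm p (length xs + m) \<kappa>"
proof (rule tnorm_le)
  have "set xs \<subseteq> N'" using xs Hneg_N' by blast
  then show "hilbert_schmidt_form p m (\<lambda>ys. \<kappa> (xs @ ys))" by (intro NC_tensorD NC_tensor_append \<kappa>)
  show "hs_sum p (onb p) m (\<lambda>ys. \<kappa> (xs @ ys)) \<le> ennreal ((prod_list (map (negnorm p) xs) * tnorm p (length xs + m) \<kappa>)\<^sup>2)"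
    using hs_sum_append_le[OF NC_tensorD(1,3)[OF \<kappa>] xs onb] NC_tensorD(4)[OF \<kappa>]
    by (simp add: power_mult_distrib ennreal_mult)
qed (use prod_list_negnorm_nonneg[OF xs] tnorm_nonneg in auto)

lemma tnorm_0: "tnorm p 0 \<kappa> = cmod (\<kappa> [])"
proof -
  have "{es :: 'h list. length es = 0 \<and> set es \<subseteq> onb p} = {[]}" by auto
  then show ?thesis by (simp add: tnorm_def)
qed

text \<open>Freezing all arguments leaves a form of degree zero, whose norm is the modulus of its
  value.\<close>

lemma form_le_tnorm:
  assumes \<kappa>: "\<kappa> \<in> NC_tensor n" and xs: "length xs = n" "set xs \<subseteq> Hneg p"
  shows "cmod (\<kappa> xs) \<le> prod_list (map (negnorm p) xs) * tnorm p n \<kappa>"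
proof -
  have xN: "set xs \<subseteq> N'" using xs Hneg_N' by blast
  show ?thesis
    using tnorm_append_le[of \<kappa> xs 0 p] tnorm_0[of p "\<lambda>ys. \<kappa> (xs @ ys)"] \<kappa> xs xN by simp
qed

lemma NC_tensor_lincomb:
  assumes \<kappa>: "\<kappa> \<in> NC_tensor n" and \<kappa>': "\<kappa>' \<in> NC_tensor n"
  shows "(\<lambda>xs. a * \<kappa> xs + b * \<kappa>' xs) \<in> NC_tensor n"
proof (rule NC_tensorI)
  show "sym_form n (\<lambda>xs. a * \<kappa> xs + b * \<kappa>' xs)"
  proof (rule sym_formI)
    fix xs ys :: "('h \<Rightarrow> real) list" assume "mset xs = mset ys"
    then show "a * \<kappa> xs + b * \<kappa>' xs = a * \<kappa> ys + b * \<kappa>' ys"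
      using sym_form_mset[OF NC_tensorD(1)[OF \<kappa>], of xs ys] sym_form_mset[OF NC_tensorD(1)[OF \<kappa>'], of xs ys]
      by simp
  qed (auto simp: sym_form_vanish[OF NC_tensorD(1)[OF \<kappa>]] sym_form_vanish[OF NC_tensorD(1)[OF \<kappa>']]
      sym_form_linear[OF NC_tensorD(1)[OF \<kappa>]] sym_form_linear[OF NC_tensorD(1)[OF \<kappa>']] algebra_simps)
  fix p
  have "bounded_form p n (\<lambda>xs. a * \<kappa> xs + b * \<kappa>' xs)"
    unfolding bounded_form_def
  proof (intro exI[of _ "cmod a * tnorm p n \<kappa> + cmod b * tnorm p n \<kappa>'"] allI impI)
    fix xs :: "('h \<Rightarrow> real) list" assume xs: "length xs = n" "set xs \<subseteq> Hneg p"
    have "cmod (a * \<kappa> xs + b * \<kappa>' xs) \<le> cmod a * cmod (\<kappa> xs) + cmod b * cmod (\<kappa>' xs)"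
      using norm_triangle_ineq[of "a * \<kappa> xs" "b * \<kappa>' xs"] by (simp add: norm_mult)
    also have "\<dots> \<le> cmod a * (prod_list (map (negnorm p) xs) * tnorm p n \<kappa>) +
        cmod b * (prod_list (map (negnorm p) xs) * tnorm p n \<kappa>')"
      by (intro add_mono mult_left_mono form_le_tnorm \<kappa> \<kappa>' xs) auto
    finally show "cmod (a * \<kappa> xs + b * \<kappa>' xs) \<le>
        (cmod a * tnorm p n \<kappa> + cmod b * tnorm p n \<kappa>') * prod_list (map (negnorm p) xs)"
      by (simp add: algebra_simps)
  qed
  moreover have "hs_sum p (onb p) n (\<lambda>xs. a * \<kappa> xs + b * \<kappa>' xs) < \<infinity>"
  proof -
    \<comment> \<open>Only finiteness of the sum is wanted, so the loss of the factor 2 does not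
      matter.\<close>
    have sq: "(cmod (a * u + b * v))\<^sup>2 \<le> 2 * (cmod a)\<^sup>2 * (cmod u)\<^sup>2 + 2 * (cmod b)\<^sup>2 * (cmod v)\<^sup>2" for u v
    proof -
      have "(cmod (a * u + b * v))\<^sup>2 \<le> (cmod a * cmod u + cmod b * cmod v)\<^sup>2"
        using norm_triangle_ineq[of "a * u" "b * v"] by (intro power_mono) (auto simp: norm_mult)
      also have "\<dots> \<le> 2 * (cmod a * cmod u)\<^sup>2 + 2 * (cmod b * cmod v)\<^sup>2"
        using sum_squares_bound[of "cmod a * cmod u" "cmod b * cmod v"] by (simp add: power2_sum)
      finally show ?thesis by (simp add: power_mult_distrib)
    qed
    have "hs_sum p (onb p) n (\<lambda>xs. a * \<kappa> xs + b * \<kappa>' xs) \<le>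
        infsum (\<lambda>es. ennreal (2 * (cmod a)\<^sup>2) * ennreal ((cmod (\<kappa> (map (riesz p) es)))\<^sup>2) +
          ennreal (2 * (cmod b)\<^sup>2) * ennreal ((cmod (\<kappa>' (map (riesz p) es)))\<^sup>2)) (nlists n (onb p))"
      unfolding hs_sum_def
    proof (intro infsum_ennreal_mono)
      fix es
      show "ennreal ((cmod (a * \<kappa> (map (riesz p) es) + b * \<kappa>' (map (riesz p) es)))\<^sup>2)
        \<le> ennreal (2 * (cmod a)\<^sup>2) * ennreal ((cmod (\<kappa> (map (riesz p) es)))\<^sup>2) +
          ennreal (2 * (cmod b)\<^sup>2) * ennreal ((cmod (\<kappa>' (map (riesz p) es)))\<^sup>2)"
        using sq by (simp flip: ennreal_mult ennreal_plus add: ennreal_leI)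
    qed
    also have "\<dots> \<le> ennreal (2 * (cmod a)\<^sup>2) * hs_sum p (onb p) n \<kappa> + ennreal (2 * (cmod b)\<^sup>2) * hs_sum p (onb p) n \<kappa>'"
      unfolding hs_sum_def by (subst infsum_add) (auto intro!: add_mono infsum_ennreal_cmult_le nonneg_summable_on_complete)
    also have "\<dots> < \<infinity>"
      by (simp add: NC_tensorD(4)[OF \<kappa>] NC_tensorD(4)[OF \<kappa>'] ennreal_mult_less_top)
    finally show ?thesis .
  qed
  ultimately show "\<exists>q\<ge>p. bounded_form q n (\<lambda>xs. a * \<kappa> xs + b * \<kappa>' xs) \<and>
      hs_sum q (onb q) n (\<lambda>xs. a * \<kappa> xs + b * \<kappa>' xs) < \<infinity>"
    by blast
qed

lemma NC_tensor_zero: "(\<lambda>_. 0) \<in> NC_tensor n"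
proof (rule NC_tensorI)
  show "sym_form n (\<lambda>_. 0)" by (rule sym_formI) auto
  show "\<exists>q\<ge>p. bounded_form q n (\<lambda>_. 0) \<and> hs_sum q (onb q) n (\<lambda>_. 0) < \<infinity>" for p
    by (rule exI[of _ p]) (auto simp: hs_sum_def bounded_form_def intro!: exI[of _ 0])
qed

lemma NC_tensor_scale: "\<kappa> \<in> NC_tensor n \<Longrightarrow> (\<lambda>xs. c * \<kappa> xs) \<in> NC_tensor n"
  using NC_tensor_lincomb[of \<kappa> n \<kappa> c 0] by simp

lemma NC_tensor_sum:
  "finite J \<Longrightarrow> (\<And>j. j \<in> J \<Longrightarrow> \<kappa> j \<in> NC_tensor n) \<Longrightarrow> (\<lambda>xs. \<Sum>j\<in>J. c j * \<kappa> j xs) \<in> NC_tensor n"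
proof (induction J rule: finite_induct)
  case empty
  then show ?case by (simp add: NC_tensor_zero)
next
  case (insert j J)
  then show ?case using NC_tensor_lincomb[of "\<kappa> j" n "\<lambda>xs. \<Sum>j\<in>J. c j * \<kappa> j xs" "c j" 1] by simp
qed

lemma tnorm_scale: "tnorm p n (\<lambda>xs. c * \<kappa> xs) = cmod c * tnorm p n \<kappa>"
  by (simp add: tnorm_def norm_mult power_mult_distrib infsum_cmult_right' real_sqrt_mult)

end

subsection \<open>Functionals on tensor powers and their products\<close>

context nuclear_triple
begin

section \<open>Dual norms on tensor powers\<close>

lemma Hneg_tensor_lincomb:
  assumes "F \<in> Hneg_tensor p n" "\<kappa> \<in> NC_tensor n" "\<kappa>' \<in> NC_tensor n"
  shows "F (\<lambda>xs. a * \<kappa> xs + b * \<kappa>' xs) = a * F \<kappa> + b * F \<kappa>'"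
  using assms by (auto simp: Hneg_tensor_def linear_functional_on_def)

lemma Hneg_tensor_vanish: "F \<in> Hneg_tensor p n \<Longrightarrow> \<kappa> \<notin> NC_tensor n \<Longrightarrow> F \<kappa> = 0"
  by (auto simp: Hneg_tensor_def linear_functional_on_def vanishes_outside_def)

lemma Hneg_tensor_scale:
  assumes "F \<in> Hneg_tensor p n" "\<kappa> \<in> NC_tensor n"
  shows "F (\<lambda>xs. a * \<kappa> xs) = a * F \<kappa>"
  using Hneg_tensor_lincomb[OF assms assms(2), of a 0] by simp

lemma Hneg_tensor_0: "F \<in> Hneg_tensor p n \<Longrightarrow> F (\<lambda>xs. 0) = 0"
  using Hneg_tensor_scale[of F p n "\<lambda>_. 0" 0] NC_tensor_zero by simp

lemma Hneg_tensor_sum: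
  assumes "F \<in> Hneg_tensor p n" "finite J" "\<And>j. j \<in> J \<Longrightarrow> \<kappa> j \<in> NC_tensor n"
  shows "F (\<lambda>xs. \<Sum>j\<in>J. c j * \<kappa> j xs) = (\<Sum>j\<in>J. c j * F (\<kappa> j))"
  using assms(2,3)
proof (induction J rule: finite_induct)
  case empty
  then show ?case using Hneg_tensor_0[OF assms(1)] by simp
next
  case (insert j J)
  then show ?case
    using Hneg_tensor_lincomb[OF assms(1), of "\<kappa> j" "\<lambda>xs. \<Sum>j\<in>J. c j * \<kappa> j xs" "c j" 1]
      NC_tensor_sum[of J \<kappa> n c] by simp
qed

lemma negtnorm_bound:
  assumes "F \<in> Hneg_tensor p n" "\<kappa> \<in> NC_tensor n"
  shows "cmod (F \<kappa>) \<le> negtnorm p n F * tnorm p n \<kappa>"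
proof -
  obtain C where C: "\<And>\<kappa>. \<kappa> \<in> NC_tensor n \<Longrightarrow> cmod (F \<kappa>) \<le> C * tnorm p n \<kappa>"
    using assms(1) unfolding Hneg_tensor_def by blast
  have bdd: "bdd_above {cmod (F \<kappa>) |\<kappa>. \<kappa> \<in> NC_tensor n \<and> tnorm p n \<kappa> \<le> 1}"
  proof (rule bdd_aboveI)
    fix t assume "t \<in> {cmod (F \<kappa>) |\<kappa>. \<kappa> \<in> NC_tensor n \<and> tnorm p n \<kappa> \<le> 1}"
    then obtain \<nu> where z: "t = cmod (F \<nu>)" "\<nu> \<in> NC_tensor n" "tnorm p n \<nu> \<le> 1" by auto
    have "t \<le> \<bar>C\<bar> * tnorm p n \<nu>"
      using C[OF z(2)] z(1) tnorm_nonneg[of p n \<nu>] by (meson abs_ge_self mult_right_mono order_trans)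
    also have "\<dots> \<le> \<bar>C\<bar>" using z(3) by (simp add: mult_left_le)
    finally show "t \<le> \<bar>C\<bar>" .
  qed
  show ?thesis
  proof (cases "tnorm p n \<kappa> = 0")
    case True
    then show ?thesis using C[OF assms(2)] by simp
  next
    case False
    then have p: "0 < tnorm p n \<kappa>" using tnorm_nonneg[of p n \<kappa>] by simp
    define c where "c = complex_of_real (1 / tnorm p n \<kappa>)"
    have "cmod (F (\<lambda>xs. c * \<kappa> xs)) \<le> negtnorm p n F"
    proof -
      have "tnorm p n (\<lambda>xs. c * \<kappa> xs) \<le> 1"
        unfolding tnorm_scale using p by (simp add: c_def norm_divide)
      then show ?thesis
        unfolding negtnorm_def using NC_tensor_scale[OF assms(2)] by (intro cSup_upper[OF _ bdd]) blast
    qed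
    then have "cmod c * cmod (F \<kappa>) \<le> negtnorm p n F"
      unfolding Hneg_tensor_scale[OF assms] by (simp add: norm_mult)
    then show ?thesis using p by (simp add: c_def norm_divide field_simps)
  qed
qed

lemma negtnorm_le:
  assumes "\<And>\<kappa>. \<kappa> \<in> NC_tensor n \<Longrightarrow> cmod (F \<kappa>) \<le> C * tnorm p n \<kappa>" "0 \<le> C"
  shows "negtnorm p n F \<le> C"
  unfolding negtnorm_def
proof (rule cSup_least)
  have "tnorm p n (\<lambda>_. 0) = 0" using tnorm_scale[of p n 0 "\<lambda>_. 0"] by simp
  then show "{cmod (F \<kappa>) |\<kappa>. \<kappa> \<in> NC_tensor n \<and> tnorm p n \<kappa> \<le> 1} \<noteq> {}"
    using NC_tensor_zero by (auto intro!: exI[of _ "\<lambda>_. 0"])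
  fix t assume "t \<in> {cmod (F \<kappa>) |\<kappa>. \<kappa> \<in> NC_tensor n \<and> tnorm p n \<kappa> \<le> 1}"
  then obtain \<nu> where z: "t = cmod (F \<nu>)" "\<nu> \<in> NC_tensor n" "tnorm p n \<nu> \<le> 1" by auto
  then show "t \<le> C" using assms(1)[OF z(2)] assms(2) by (meson dual_order.trans mult_left_le)
qed

lemma negtnorm_nonneg:
  assumes "F \<in> Hneg_tensor p n"
  shows "0 \<le> negtnorm p n F"
proof (cases "\<exists>\<kappa>\<in>NC_tensor n. tnorm p n \<kappa> \<noteq> 0")
  case True
  then obtain \<kappa> where k: "\<kappa> \<in> NC_tensor n" "0 < tnorm p n \<kappa>"
    using tnorm_nonneg by (metis less_eq_real_def)
  have "0 \<le> negtnorm p n F * tnorm p n \<kappa>" using negtnorm_bound[OF assms k(1)] norm_ge_zero order_trans by blast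
  then show ?thesis using k(2) by (simp add: zero_le_mult_iff)
next
  case False
  have "tnorm p n (\<lambda>_. 0) = 0" using tnorm_scale[of p n 0 "\<lambda>_. 0"] by simp
  then have "{cmod (F \<kappa>) |\<kappa>. \<kappa> \<in> NC_tensor n \<and> tnorm p n \<kappa> \<le> 1} = {0}"
    using negtnorm_bound[OF assms] NC_tensor_zero False
    by (auto intro!: exI[of _ "\<lambda>_. 0"] simp: Hneg_tensor_0[OF assms])
  then show ?thesis by (simp add: negtnorm_def)
qed

lemma Hneg_tensorI:
  assumes "\<And>\<kappa>. \<kappa> \<notin> NC_tensor n \<Longrightarrow> F \<kappa> = 0"
    and "\<And>\<kappa> \<kappa>' a b. \<kappa> \<in> NC_tensor n \<Longrightarrow> \<kappa>' \<in> NC_tensor n \<Longrightarrow>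
      F (\<lambda>xs. a * \<kappa> xs + b * \<kappa>' xs) = a * F \<kappa> + b * F \<kappa>'"
    and "\<And>\<kappa>. \<kappa> \<in> NC_tensor n \<Longrightarrow> cmod (F \<kappa>) \<le> C * tnorm p n \<kappa>"
  shows "F \<in> Hneg_tensor p n"
  using assms unfolding Hneg_tensor_def linear_functional_on_def vanishes_outside_def by blast

lemma Hneg_tensor_mono:
  assumes "F \<in> Hneg_tensor p n" "p \<le> q"
  shows "F \<in> Hneg_tensor q n" "negtnorm q n F \<le> negtnorm p n F"
proof -
  have b: "cmod (F \<kappa>) \<le> negtnorm p n F * tnorm q n \<kappa>" if "\<kappa> \<in> NC_tensor n" for \<kappa>
    using negtnorm_bound[OF assms(1) that] tnorm_mono[OF that assms(2)] negtnorm_nonneg[OF assms(1)]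
    by (meson mult_left_mono order_trans)
  then show "F \<in> Hneg_tensor q n"
    by (intro Hneg_tensorI Hneg_tensor_vanish[OF assms(1)] Hneg_tensor_lincomb[OF assms(1)])
  show "negtnorm q n F \<le> negtnorm p n F"
    by (intro negtnorm_le b negtnorm_nonneg assms)
qed

lemma Hneg_tensor_lin:
  assumes F: "F \<in> Hneg_tensor p n" and G: "G \<in> Hneg_tensor p n"
  shows "(\<lambda>\<kappa>. a * F \<kappa> + b * G \<kappa>) \<in> Hneg_tensor p n"
    and "negtnorm p n (\<lambda>\<kappa>. a * F \<kappa> + b * G \<kappa>) \<le> cmod a * negtnorm p n F + cmod b * negtnorm p n G"
proof -
  have b: "cmod (a * F \<kappa> + b * G \<kappa>) \<le> (cmod a * negtnorm p n F + cmod b * negtnorm p n G) * tnorm p n \<kappa>"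
    if \<kappa>: "\<kappa> \<in> NC_tensor n" for \<kappa>
  proof -
    have "cmod (a * F \<kappa> + b * G \<kappa>) \<le> cmod a * cmod (F \<kappa>) + cmod b * cmod (G \<kappa>)"
      using norm_triangle_ineq[of "a * F \<kappa>" "b * G \<kappa>"] by (simp add: norm_mult)
    also have "\<dots> \<le> cmod a * (negtnorm p n F * tnorm p n \<kappa>) + cmod b * (negtnorm p n G * tnorm p n \<kappa>)"
      by (intro add_mono mult_left_mono negtnorm_bound F G \<kappa>) auto
    finally show ?thesis by (simp add: algebra_simps)
  qed
  show "(\<lambda>\<kappa>. a * F \<kappa> + b * G \<kappa>) \<in> Hneg_tensor p n"
    by (rule Hneg_tensorI[OF _ _ b])
      (auto simp: Hneg_tensor_vanish[OF F] Hneg_tensor_vanish[OF G] Hneg_tensor_lincomb[OF F]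
        Hneg_tensor_lincomb[OF G] algebra_simps)
  show "negtnorm p n (\<lambda>\<kappa>. a * F \<kappa> + b * G \<kappa>) \<le> cmod a * negtnorm p n F + cmod b * negtnorm p n G"
    using b negtnorm_nonneg[OF F] negtnorm_nonneg[OF G] by (intro negtnorm_le) auto
qed

lemma Hneg_tensor_zero: "(\<lambda>_. 0) \<in> Hneg_tensor p n" "negtnorm p n (\<lambda>_. 0) = 0"
proof -
  show z: "(\<lambda>_. 0) \<in> Hneg_tensor p n" by (rule Hneg_tensorI[where C = 0]) auto
  show "negtnorm p n (\<lambda>_. 0) = 0"
    using negtnorm_nonneg[OF z] negtnorm_le[of n "\<lambda>_. 0" 0 p] by simp
qed

lemma Hneg_tensor_sum_mem:
  assumes "finite J" "\<And>j. j \<in> J \<Longrightarrow> F j \<in> Hneg_tensor p n"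
  shows "(\<lambda>\<kappa>. \<Sum>j\<in>J. c j * F j \<kappa>) \<in> Hneg_tensor p n"
    and "negtnorm p n (\<lambda>\<kappa>. \<Sum>j\<in>J. c j * F j \<kappa>) \<le> (\<Sum>j\<in>J. cmod (c j) * negtnorm p n (F j))"
  using assms
proof (induction J rule: finite_induct)
  case empty
  { case 1 then show ?case by (simp add: Hneg_tensor_zero) }
  { case 2 then show ?case by (simp add: Hneg_tensor_zero) }
next
  case (insert j J)
  have m: "(\<lambda>\<kappa>. \<Sum>j\<in>J. c j * F j \<kappa>) \<in> Hneg_tensor p n" if "\<And>i. i \<in> insert j J \<Longrightarrow> F i \<in> Hneg_tensor p n"
    using insert that by blast
  { case 1
    show ?case using insert Hneg_tensor_lin(1)[OF _ m[OF 1], of "F j" "c j" 1] 1 by simp }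
  { case 2
    have "negtnorm p n (\<lambda>\<kappa>. \<Sum>j\<in>J. c j * F j \<kappa>) \<le> (\<Sum>j\<in>J. cmod (c j) * negtnorm p n (F j))"
      using insert 2 by blast
    then show ?case using insert Hneg_tensor_lin(2)[OF _ m[OF 2], of "F j" "c j" 1] 2 by simp }
qed

text \<open>The adjoint of multiplication by \<open>G\<close>: the functional \<open>G\<close> acts
  on the last slots of \<open>\<kappa>\<close> and the first \<open>k\<close> slots stay
  free.\<close>

definition contract :: "nat \<Rightarrow> ('h kernel \<Rightarrow> complex) \<Rightarrow> 'h kernel \<Rightarrow> 'h kernel" where
  "contract k G \<kappa> = (\<lambda>xs. if length xs = k \<and> set xs \<subseteq> N' then G (\<lambda>ys. \<kappa> (xs @ ys)) else 0)"

lemma sym_form_contract: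
  assumes G: "G \<in> Hneg_tensor p m" and \<kappa>: "\<kappa> \<in> NC_tensor (k + m)"
  shows "sym_form k (contract k G \<kappa>)"
proof (rule sym_formI)
  fix vs x y and a b :: real
  assume H: "length vs + 1 = k" "set vs \<subseteq> N'" "x \<in> N'" "y \<in> N'"
  have lin: "\<kappa> (((\<lambda>\<xi>. a * x \<xi> + b * y \<xi>) # vs) @ ys) =
      complex_of_real a * \<kappa> ((x # vs) @ ys) + complex_of_real b * \<kappa> ((y # vs) @ ys)" for ys
  proof (cases "length ys = m \<and> set ys \<subseteq> N'")
    case True
    then show ?thesis using sym_form_linear[OF NC_tensorD(1)[OF \<kappa>], of "vs @ ys" x y a b] H by simp
  next
    case False
    then show ?thesis using sym_form_vanish[OF NC_tensorD(1)[OF \<kappa>]] H by auto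
  qed
  have nc: "(\<lambda>ys. \<kappa> ((z # vs) @ ys)) \<in> NC_tensor m" if "z \<in> N'" for z
    using NC_tensor_append[of \<kappa> "z # vs" m] \<kappa> H that by auto
  have c: "contract k G \<kappa> (z # vs) = G (\<lambda>ys. \<kappa> ((z # vs) @ ys))" if "z \<in> N'" for z
    using H that by (simp add: contract_def)
  show "contract k G \<kappa> ((\<lambda>\<xi>. a * x \<xi> + b * y \<xi>) # vs) =
      complex_of_real a * contract k G \<kappa> (x # vs) + complex_of_real b * contract k G \<kappa> (y # vs)"
    unfolding c[OF H(3)] c[OF H(4)] c[OF N'_lincomb[OF H(3,4), of a b]] lin
    by (rule Hneg_tensor_lincomb[OF G nc[OF H(3)] nc[OF H(4)]])
next
  fix xs ys :: "('h \<Rightarrow> real) list" assume H: "length xs = k" "set xs \<subseteq> N'" "mset xs = mset ys"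
  then have "length ys = k" "set ys \<subseteq> N'" by (auto dest: mset_eq_length mset_eq_setD)
  moreover have "\<kappa> (xs @ zs) = \<kappa> (ys @ zs)" for zs
    using H by (intro sym_form_mset[OF NC_tensorD(1)[OF \<kappa>]]) simp
  ultimately show "contract k G \<kappa> xs = contract k G \<kappa> ys" using H by (simp add: contract_def)
qed (auto simp: contract_def)

text \<open>The arguments have index \<open>r\<close> and \<open>G\<close> has index
  \<open>p\<close>. Both are moved to the larger of the two, where the slice of
  \<open>\<kappa>\<close> is bounded by \<open>tnorm_append_le\<close>.\<close>

lemma contract_le:
  assumes G: "G \<in> Hneg_tensor p m" and \<kappa>: "\<kappa> \<in> NC_tensor (k + m)"
    and xs: "length xs = k" "set xs \<subseteq> Hneg r"
  shows "cmod (contract k G \<kappa> xs) \<le>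
    negtnorm p m G * tnorm (max r p) (k + m) \<kappa> * prod_list (map (negnorm r) xs)"
proof -
  let ?q = "max r p"
  have xq: "set xs \<subseteq> Hneg ?q" using xs Hneg_mono[of r ?q] by auto
  have xN: "set xs \<subseteq> N'" using xs Hneg_N' by blast
  have nc: "(\<lambda>ys. \<kappa> (xs @ ys)) \<in> NC_tensor m" using NC_tensor_append[of \<kappa> xs m] \<kappa> xs xN by simp
  have "cmod (contract k G \<kappa> xs) \<le> negtnorm p m G * tnorm p m (\<lambda>ys. \<kappa> (xs @ ys))"
    using negtnorm_bound[OF G nc] xs xN by (simp add: contract_def)
  also have "\<dots> \<le> negtnorm p m G * (prod_list (map (negnorm r) xs) * tnorm ?q (k + m) \<kappa>)"
  proof (rule mult_left_mono[OF _ negtnorm_nonneg[OF G]])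
    have "tnorm p m (\<lambda>ys. \<kappa> (xs @ ys)) \<le> tnorm ?q m (\<lambda>ys. \<kappa> (xs @ ys))"
      by (rule tnorm_mono[OF nc]) simp
    also have "\<dots> \<le> prod_list (map (negnorm ?q) xs) * tnorm ?q (k + m) \<kappa>"
      using tnorm_append_le[of \<kappa> xs m ?q] \<kappa> xs xq by simp
    also have "\<dots> \<le> prod_list (map (negnorm r) xs) * tnorm ?q (k + m) \<kappa>"
      using xs by (intro mult_right_mono prod_list_negnorm_antimono tnorm_nonneg) auto
    finally show "tnorm p m (\<lambda>ys. \<kappa> (xs @ ys)) \<le> prod_list (map (negnorm r) xs) * tnorm ?q (k + m) \<kappa>" .
  qed
  finally show ?thesis by (simp add: mult_ac)
qed

text \<open>The two groups of slots of \<open>\<kappa>\<close> carry different indices,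
  \<open>r\<close> and \<open>p\<close>. Each is raised separately to \<open>max r p\<close> at no
  cost, and then the double sum is the norm of \<open>\<kappa>\<close>. So the constant is just the
  norm of \<open>G\<close>.\<close>

lemma hs_sum_contract_le:
  assumes G: "G \<in> Hneg_tensor p m" and \<kappa>: "\<kappa> \<in> NC_tensor (k + m)"
  shows "hs_sum r (onb r) k (contract k G \<kappa>) \<le>
    ennreal ((negtnorm p m G * tnorm (max r p) (k + m) \<kappa>)\<^sup>2)"
proof -
  let ?q = "max r p" and ?c = "negtnorm p m G"
  have S: "onb t \<subseteq> Hp t" for t using onb[of t] by (simp add: is_onb_def)
  have nc: "(\<lambda>ys. \<kappa> (map (riesz r) es @ ys)) \<in> NC_tensor m" if "es \<in> nlists k (onb r)" for es
    using NC_tensor_append[of \<kappa> "map (riesz r) es" m] \<kappa> map_riesz_N'[OF that S] length_nlists[OF that] by simp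
  have "hs_sum r (onb r) k (contract k G \<kappa>) \<le>
      infsum (\<lambda>es. ennreal (?c\<^sup>2) * hs_sum p (onb p) m (\<lambda>ys. \<kappa> (map (riesz r) es @ ys))) (nlists k (onb r))"
    unfolding hs_sum_def[of r]
  proof (intro infsum_ennreal_mono)
    fix es assume es: "es \<in> nlists k (onb r)"
    have "contract k G \<kappa> (map (riesz r) es) = G (\<lambda>ys. \<kappa> (map (riesz r) es @ ys))"
      using map_riesz_N'[OF es S] length_nlists[OF es] by (simp add: contract_def)
    then have "(cmod (contract k G \<kappa> (map (riesz r) es)))\<^sup>2 \<le> (?c * tnorm p m (\<lambda>ys. \<kappa> (map (riesz r) es @ ys)))\<^sup>2"
      using negtnorm_bound[OF G nc[OF es]] by (intro power_mono) auto
    then show "ennreal ((cmod (contract k G \<kappa> (map (riesz r) es)))\<^sup>2) \<le>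
        ennreal (?c\<^sup>2) * hs_sum p (onb p) m (\<lambda>ys. \<kappa> (map (riesz r) es @ ys))"
      unfolding NC_tensorD(4)[OF nc[OF es]]
      by (simp add: power_mult_distrib ennreal_leI flip: ennreal_mult)
  qed
  also have "\<dots> \<le> ennreal (?c\<^sup>2) * infsum (\<lambda>es. hs_sum p (onb p) m (\<lambda>ys. \<kappa> (map (riesz r) es @ ys))) (nlists k (onb r))"
    by (rule infsum_ennreal_cmult_le)
  \<comment> \<open>The last \<open>m\<close> slots are raised from \<open>p\<close> to
    \<open>max r p\<close>.\<close>
  also have "infsum (\<lambda>es. hs_sum p (onb p) m (\<lambda>ys. \<kappa> (map (riesz r) es @ ys))) (nlists k (onb r)) \<le>
      infsum (\<lambda>es. hs_sum ?q (onb ?q) m (\<lambda>ys. \<kappa> (map (riesz r) es @ ys))) (nlists k (onb r))"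
    by (intro infsum_ennreal_mono hs_sum_mono[OF NC_tensorD(1,3)[OF nc] _ onb onb]) auto
  \<comment> \<open>The sums are interchanged and the slots swapped by symmetry, so that the first
    \<open>k\<close> slots, still at \<open>r\<close>, become the inner ones and can be raised
    next.\<close>
  also have "\<dots> = infsum (\<lambda>fs. hs_sum r (onb r) k (\<lambda>xs. \<kappa> (map (riesz ?q) fs @ xs))) (nlists m (onb ?q))"
  proof -
    have "\<kappa> (map (riesz r) es @ map (riesz ?q) fs) = \<kappa> (map (riesz ?q) fs @ map (riesz r) es)" for es fs
      by (rule sym_form_mset[OF NC_tensorD(1)[OF \<kappa>]]) simp
    then show ?thesis unfolding hs_sum_def by (subst infsum_ennreal_swap) simp
  qed
  also have "\<dots> \<le> infsum (\<lambda>fs. hs_sum ?q (onb ?q) k (\<lambda>xs. \<kappa> (map (riesz ?q) fs @ xs))) (nlists m (onb ?q))"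
  proof (intro infsum_ennreal_mono hs_sum_mono[OF NC_tensorD(1,3) _ onb onb])
    fix fs assume fs: "fs \<in> nlists m (onb ?q)"
    show "(\<lambda>xs. \<kappa> (map (riesz ?q) fs @ xs)) \<in> NC_tensor k"
      using NC_tensor_append[of \<kappa> "map (riesz ?q) fs" k] \<kappa> map_riesz_N'[OF fs S] length_nlists[OF fs]
      by (simp add: add.commute)
    then show "(\<lambda>xs. \<kappa> (map (riesz ?q) fs @ xs)) \<in> NC_tensor k" .
  qed auto
  also have "\<dots> = ennreal ((tnorm ?q (k + m) \<kappa>)\<^sup>2)"
    using hs_sum_add[of ?q "onb ?q" m k \<kappa>] NC_tensorD(4)[OF \<kappa>] by (simp add: add.commute)
  finally show ?thesis
    by (simp add: power_mult_distrib ennreal_mult mult_left_mono)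
qed

lemma contract_NC_tensor:
  assumes G: "G \<in> Hneg_tensor p m" and \<kappa>: "\<kappa> \<in> NC_tensor (k + m)"
  shows "contract k G \<kappa> \<in> NC_tensor k"
    and "tnorm r k (contract k G \<kappa>) \<le> negtnorm p m G * tnorm (max r p) (k + m) \<kappa>"
proof -
  have b: "bounded_form r k (contract k G \<kappa>)" for r
    unfolding bounded_form_def using contract_le[OF G \<kappa>] by blast
  show nc: "contract k G \<kappa> \<in> NC_tensor k"
  proof (intro NC_tensorI' sym_form_contract[OF G \<kappa>] b)
    show "hs_sum r (onb r) k (contract k G \<kappa>) < \<infinity>" for r
      using le_less_trans[OF hs_sum_contract_le[OF G \<kappa>]] by simp
  qed
  show "tnorm r k (contract k G \<kappa>) \<le> negtnorm p m G * tnorm (max r p) (k + m) \<kappa>"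
    by (intro tnorm_le NC_tensorD nc hs_sum_contract_le[OF G \<kappa>] mult_nonneg_nonneg negtnorm_nonneg[OF G] tnorm_nonneg)
qed

lemma contract_lincomb:
  assumes G: "G \<in> Hneg_tensor p m" and \<kappa>: "\<kappa> \<in> NC_tensor (k + m)" "\<kappa>' \<in> NC_tensor (k + m)"
  shows "contract k G (\<lambda>xs. a * \<kappa> xs + b * \<kappa>' xs) = (\<lambda>xs. a * contract k G \<kappa> xs + b * contract k G \<kappa>' xs)"
proof
  fix xs
  show "contract k G (\<lambda>xs. a * \<kappa> xs + b * \<kappa>' xs) xs = a * contract k G \<kappa> xs + b * contract k G \<kappa>' xs"
  proof (cases "length xs = k \<and> set xs \<subseteq> N'")
    case True
    then show ?thesis
      using Hneg_tensor_lincomb[OF G NC_tensor_append[of \<kappa> xs m] NC_tensor_append[of \<kappa>' xs m], of a b] \<kappa>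
      by (simp add: contract_def)
  qed (auto simp: contract_def)
qed

text \<open>The symmetric product of functionals. Kernels are symmetric, so no average over
  permutations appears.\<close>

definition tens :: "nat \<Rightarrow> nat \<Rightarrow> ('h kernel \<Rightarrow> complex) \<Rightarrow> ('h kernel \<Rightarrow> complex) \<Rightarrow> 'h kernel \<Rightarrow> complex" where
  "tens k m F G = (\<lambda>\<kappa>. if \<kappa> \<in> NC_tensor (k + m) then F (contract k G \<kappa>) else 0)"

lemma tens_Hneg_tensor:
  assumes F: "F \<in> Hneg_tensor p k" and G: "G \<in> Hneg_tensor r m"
  shows "tens k m F G \<in> Hneg_tensor (max p r) (k + m)"
    and "negtnorm (max p r) (k + m) (tens k m F G) \<le> negtnorm p k F * negtnorm r m G"
proof -
  have b: "cmod (tens k m F G \<kappa>) \<le> negtnorm p k F * negtnorm r m G * tnorm (max p r) (k + m) \<kappa>"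
    if \<kappa>: "\<kappa> \<in> NC_tensor (k + m)" for \<kappa>
  proof -
    have "cmod (tens k m F G \<kappa>) \<le> negtnorm p k F * tnorm p k (contract k G \<kappa>)"
      using negtnorm_bound[OF F contract_NC_tensor(1)[OF G \<kappa>]] \<kappa> by (simp add: tens_def)
    also have "\<dots> \<le> negtnorm p k F * (negtnorm r m G * tnorm (max p r) (k + m) \<kappa>)"
      by (intro mult_left_mono contract_NC_tensor(2)[OF G \<kappa>] negtnorm_nonneg[OF F])
    finally show ?thesis by (simp add: mult.assoc)
  qed
  show "tens k m F G \<in> Hneg_tensor (max p r) (k + m)"
  proof (rule Hneg_tensorI[OF _ _ b])
    fix \<kappa> \<kappa>' a b assume \<kappa>: "\<kappa> \<in> NC_tensor (k + m)" "\<kappa>' \<in> NC_tensor (k + m)"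
    then show "tens k m F G (\<lambda>xs. a * \<kappa> xs + b * \<kappa>' xs) = a * tens k m F G \<kappa> + b * tens k m F G \<kappa>'"
      by (simp add: tens_def NC_tensor_lincomb contract_lincomb[OF G \<kappa>]
          Hneg_tensor_lincomb[OF F contract_NC_tensor(1)[OF G] contract_NC_tensor(1)[OF G]])
  qed (auto simp: tens_def)
  show "negtnorm (max p r) (k + m) (tens k m F G) \<le> negtnorm p k F * negtnorm r m G"
    by (intro negtnorm_le b mult_nonneg_nonneg negtnorm_nonneg[OF F] negtnorm_nonneg[OF G])
qed

section \<open>Tensor powers of vectors\<close>

lemma cpnorm_nonneg: "0 \<le> cpnorm p \<theta>"
  by (simp add: cpnorm_def)

lemma NC_D: "\<theta> \<in> NC \<Longrightarrow> fst \<theta> \<in> N" "\<theta> \<in> NC \<Longrightarrow> snd \<theta> \<in> N"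
  by (auto simp: NC_def)

lemma pairing_le:
  assumes x: "x \<in> Hneg p" and \<theta>: "\<theta> \<in> NC"
  shows "cmod (pairing x \<theta>) \<le> negnorm p x * cpnorm p \<theta>"
proof -
  have "(cmod (pairing x \<theta>))\<^sup>2 = \<bar>x (fst \<theta>)\<bar>\<^sup>2 + \<bar>x (snd \<theta>)\<bar>\<^sup>2"
    by (simp add: pairing_def cmod_power2)
  also have "\<dots> \<le> (negnorm p x * pnorm p (fst \<theta>))\<^sup>2 + (negnorm p x * pnorm p (snd \<theta>))\<^sup>2"
    by (intro add_mono power_mono negnorm_bound[OF x] NC_D[OF \<theta>]) auto
  also have "\<dots> = (negnorm p x * cpnorm p \<theta>)\<^sup>2"
    by (simp add: cpnorm_def power_mult_distrib algebra_simps)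
  finally show ?thesis
    by (rule power2_le_imp_le) (intro mult_nonneg_nonneg negnorm_nonneg[OF x] cpnorm_nonneg)
qed

lemma pairing_lincomb:
  "pairing (\<lambda>\<xi>. a * x \<xi> + b * y \<xi>) \<theta> = complex_of_real a * pairing x \<theta> + complex_of_real b * pairing y \<theta>"
  by (simp add: pairing_def complex_eq_iff)

lemma sum_pairing_riesz_le:
  assumes \<theta>: "\<theta> \<in> NC" and B: "is_onb (Hp p) (ip p) B"
  shows "infsum (\<lambda>e. ennreal ((cmod (pairing (riesz p e) \<theta>))\<^sup>2)) B \<le> ennreal ((cpnorm p \<theta>)\<^sup>2)"
  unfolding infsum_ennreal_le_iff
proof (intro allI impI)
  fix J assume J: "finite J" "J \<subseteq> B"
  have "(\<Sum>e\<in>J. (cmod (pairing (riesz p e) \<theta>))\<^sup>2) = (\<Sum>e\<in>J. (ip p e (fst \<theta>))\<^sup>2) + (\<Sum>e\<in>J. (ip p e (snd \<theta>))\<^sup>2)"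
    using NC_D[OF \<theta>] by (simp add: pairing_def cmod_power2 riesz_def sum.distrib)
  also have "\<dots> \<le> (pnorm p (fst \<theta>))\<^sup>2 + (pnorm p (snd \<theta>))\<^sup>2"
    by (intro add_mono bessel[OF _ J B] N_Hp NC_D[OF \<theta>])
  also have "\<dots> = (cpnorm p \<theta>)\<^sup>2" by (simp add: cpnorm_def)
  finally show "(\<Sum>e\<in>J. ennreal ((cmod (pairing (riesz p e) \<theta>))\<^sup>2)) \<le> ennreal ((cpnorm p \<theta>)\<^sup>2)"
    by (simp add: ennreal_leI)
qed

lemma tensor_power_Cons:
  "x \<in> N' \<Longrightarrow> tensor_power (Suc n) \<theta> (x # xs) = pairing x \<theta> * tensor_power n \<theta> xs"
  by (simp add: tensor_power_def)

lemma tensor_power_append: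
  "length xs = k \<Longrightarrow> set xs \<subseteq> N' \<Longrightarrow>
    tensor_power (k + m) \<theta> (xs @ ys) = tensor_power k \<theta> xs * tensor_power m \<theta> ys"
  by (simp add: tensor_power_def)

lemma sym_form_tensor_power: "sym_form n (tensor_power n \<theta>)"
proof (rule sym_formI)
  fix xs ys :: "('h \<Rightarrow> real) list" assume H: "mset xs = mset ys"
  have "prod_list (map (\<lambda>x. pairing x \<theta>) xs) = prod_mset (image_mset (\<lambda>x. pairing x \<theta>) (mset xs))" for xs
    by (simp flip: prod_mset_prod_list)
  then show "tensor_power n \<theta> xs = tensor_power n \<theta> ys"
    using H mset_eq_length[OF H] mset_eq_setD[OF H] by (simp add: tensor_power_def)
qed (auto simp: tensor_power_def N'_lincomb pairing_lincomb algebra_simps)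

text \<open>The sum factors slot by slot, and each factor is bounded by Bessel's inequality for the
  real and the imaginary part of \<open>\<theta>\<close>.\<close>

lemma hs_sum_tensor_power_le:
  assumes \<theta>: "\<theta> \<in> NC"
  shows "hs_sum p (onb p) n (tensor_power n \<theta>) \<le> ennreal ((cpnorm p \<theta> ^ n)\<^sup>2)"
proof (induction n)
  case 0
  then show ?case by (simp add: hs_sum_def tensor_power_def)
next
  case (Suc n)
  have "hs_sum p (onb p) (Suc n) (tensor_power (Suc n) \<theta>) \<le>
      infsum (\<lambda>e. hs_sum p (onb p) n (tensor_power n \<theta>) * ennreal ((cmod (pairing (riesz p e) \<theta>))\<^sup>2)) (onb p)"
    unfolding hs_sum_Suc
  proof (intro infsum_ennreal_mono)
    fix e assume "e \<in> onb p"
    then have "riesz p e \<in> N'" using onb_Hp[OF onb] riesz_N' by blast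
    then have "hs_sum p (onb p) n (\<lambda>xs. tensor_power (Suc n) \<theta> (riesz p e # xs)) =
        infsum (\<lambda>es. ennreal ((cmod (pairing (riesz p e) \<theta>))\<^sup>2) * ennreal ((cmod (tensor_power n \<theta> (map (riesz p) es)))\<^sup>2)) (nlists n (onb p))"
      unfolding hs_sum_def by (simp add: tensor_power_Cons norm_mult power_mult_distrib ennreal_mult)
    also have "\<dots> \<le> ennreal ((cmod (pairing (riesz p e) \<theta>))\<^sup>2) * hs_sum p (onb p) n (tensor_power n \<theta>)"
      unfolding hs_sum_def by (rule infsum_ennreal_cmult_le)
    finally show "hs_sum p (onb p) n (\<lambda>xs. tensor_power (Suc n) \<theta> (riesz p e # xs)) \<le>
        hs_sum p (onb p) n (tensor_power n \<theta>) * ennreal ((cmod (pairing (riesz p e) \<theta>))\<^sup>2)"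
      by (simp add: mult.commute)
  qed
  also have "\<dots> \<le> hs_sum p (onb p) n (tensor_power n \<theta>) * infsum (\<lambda>e. ennreal ((cmod (pairing (riesz p e) \<theta>))\<^sup>2)) (onb p)"
    by (rule infsum_ennreal_cmult_le)
  also have "\<dots> \<le> ennreal ((cpnorm p \<theta> ^ n)\<^sup>2) * ennreal ((cpnorm p \<theta>)\<^sup>2)"
    by (intro mult_mono Suc.IH sum_pairing_riesz_le[OF \<theta> onb]) auto
  also have "\<dots> = ennreal ((cpnorm p \<theta> ^ Suc n)\<^sup>2)"
    by (simp add: power_mult_distrib mult.commute flip: ennreal_mult)
  finally show ?case .
qed

lemma tensor_power_NC_tensor:
  assumes \<theta>: "\<theta> \<in> NC"
  shows "tensor_power n \<theta> \<in> NC_tensor n" "tnorm p n (tensor_power n \<theta>) \<le> cpnorm p \<theta> ^ n"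
proof -
  have b: "bounded_form r n (tensor_power n \<theta>)" for r
    unfolding bounded_form_def
  proof (intro exI[of _ "cpnorm r \<theta> ^ n"] allI impI)
    fix xs :: "('h \<Rightarrow> real) list" assume xs: "length xs = n" "set xs \<subseteq> Hneg r"
    then have "set xs \<subseteq> N'" using Hneg_N' by blast
    then have "tensor_power n \<theta> xs = prod_list (map (\<lambda>x. pairing x \<theta>) xs)"
      using xs by (simp add: tensor_power_def)
    moreover have "cmod (prod_list (map (\<lambda>x. pairing x \<theta>) xs)) \<le>
        cpnorm r \<theta> ^ length xs * prod_list (map (negnorm r) xs)" if "set xs \<subseteq> Hneg r" for xs
      using that
    proof (induction xs)
      case (Cons x xs)
      then have "cmod (pairing x \<theta>) * cmod (prod_list (map (\<lambda>x. pairing x \<theta>) xs)) \<le>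
          (negnorm r x * cpnorm r \<theta>) * (cpnorm r \<theta> ^ length xs * prod_list (map (negnorm r) xs))"
        by (intro mult_mono pairing_le[OF _ \<theta>] Cons.IH mult_nonneg_nonneg negnorm_nonneg cpnorm_nonneg) auto
      then show ?case by (simp add: norm_mult mult_ac)
    qed simp
    ultimately show "cmod (tensor_power n \<theta> xs) \<le> cpnorm r \<theta> ^ n * prod_list (map (negnorm r) xs)"
      using xs by metis
  qed
  show nc: "tensor_power n \<theta> \<in> NC_tensor n"
  proof (intro NC_tensorI' sym_form_tensor_power b)
    show "hs_sum r (onb r) n (tensor_power n \<theta>) < \<infinity>" for r
      using le_less_trans[OF hs_sum_tensor_power_le[OF \<theta>]] by simp
  qed
  show "tnorm p n (tensor_power n \<theta>) \<le> cpnorm p \<theta> ^ n"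
    by (intro tnorm_le NC_tensorD nc hs_sum_tensor_power_le \<theta> zero_le_power cpnorm_nonneg)
qed

lemma contract_tensor_power:
  assumes G: "G \<in> Hneg_tensor p m" and \<theta>: "\<theta> \<in> NC"
  shows "contract k G (tensor_power (k + m) \<theta>) = (\<lambda>xs. G (tensor_power m \<theta>) * tensor_power k \<theta> xs)"
proof
  fix xs
  show "contract k G (tensor_power (k + m) \<theta>) xs = G (tensor_power m \<theta>) * tensor_power k \<theta> xs"
  proof (cases "length xs = k \<and> set xs \<subseteq> N'")
    case True
    then show ?thesis
      by (simp add: contract_def tensor_power_append Hneg_tensor_scale[OF G tensor_power_NC_tensor(1)[OF \<theta>]])
  qed (auto simp: contract_def tensor_power_def)
qed

text \<open>This multiplicativity turns convolutions of kernels into Cauchy products of scalar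
  series, both for the Appell system and for the S-transform.\<close>

lemma tens_tensor_power:
  assumes F: "F \<in> Hneg_tensor p k" and G: "G \<in> Hneg_tensor r m" and \<theta>: "\<theta> \<in> NC"
  shows "tens k m F G (tensor_power (k + m) \<theta>) = F (tensor_power k \<theta>) * G (tensor_power m \<theta>)"
  using tensor_power_NC_tensor(1)[OF \<theta>]
  by (simp add: tens_def contract_tensor_power[OF G \<theta>] Hneg_tensor_scale[OF F])

end

subsection \<open>Totality of the tensor powers\<close>

context nuclear_triple
begin

definition prod_tensor :: "'h list \<Rightarrow> 'h kernel" where
  "prod_tensor vs xs = prod_list (map2 (\<lambda>x v. complex_of_real (x v)) xs vs)"

text \<open>The sum over permutations is not normalized; this is the source of \<open>fact n\<close>
  in \<open>sym_tensor_replicate\<close> and in \<open>truncate\<close>.\<close>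

definition sym_tensor :: "nat \<Rightarrow> 'h list \<Rightarrow> 'h kernel" where
  "sym_tensor n vs xs = (if length xs = n \<and> set xs \<subseteq> N'
     then \<Sum>\<pi> | \<pi> permutes {..<n}. prod_tensor (permute_list \<pi> vs) xs else 0)"

lemma prod_tensor_Nil [simp]: "prod_tensor [] xs = 1" "prod_tensor vs [] = 1"
  by (auto simp: prod_tensor_def)

lemma prod_tensor_Cons [simp]: "prod_tensor (v # vs) (x # xs) = complex_of_real (x v) * prod_tensor vs xs"
  by (simp add: prod_tensor_def)

section \<open>Symmetrized elementary tensors\<close>

lemma prod_tensor_permute:
  assumes "\<pi> permutes {..<length xs}" "length vs = length xs"
  shows "prod_tensor (permute_list \<pi> vs) (permute_list \<pi> xs) = prod_tensor vs xs"
proof -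
  have "map2 (\<lambda>x v. complex_of_real (x v)) (permute_list \<pi> xs) (permute_list \<pi> vs) =
      map (\<lambda>(x, v). complex_of_real (x v)) (permute_list \<pi> (zip xs vs))"
    using assms by (subst permute_list_zip) auto
  moreover have "prod_list (map f (permute_list \<pi> (zip xs vs))) = prod_list (map f (zip xs vs))"
    for f :: "_ \<Rightarrow> complex"
    using assms by (simp flip: prod_mset_prod_list)
  ultimately show ?thesis by (simp add: prod_tensor_def)
qed

text \<open>Permuting the vectors is the same as permuting the arguments by the inverse. On the left
  the arguments stay in place, which exhibits linearity in the first argument; on the right the
  vectors do, which exhibits linearity in the first vector.\<close>

lemma sum_prod_tensor_transpose:
  assumes "length vs = n" "length xs = n"
  shows "(\<Sum>\<pi> | \<pi> permutes {..<n}. prod_tensor (permute_list \<pi> vs) xs) =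
    (\<Sum>\<pi> | \<pi> permutes {..<n}. prod_tensor vs (permute_list \<pi> xs))"
proof -
  have "(\<Sum>\<pi> | \<pi> permutes {..<n}. prod_tensor (permute_list \<pi> vs) xs) =
      (\<Sum>\<pi> | \<pi> permutes {..<n}. prod_tensor (permute_list (inv \<pi>) vs) xs)"
    by (rule sum_permutations_inverse)
  also have "\<dots> = (\<Sum>\<pi> | \<pi> permutes {..<n}. prod_tensor vs (permute_list \<pi> xs))"
  proof (intro sum.cong refl)
    fix \<pi> assume "\<pi> \<in> {\<pi>. \<pi> permutes {..<n}}"
    then have \<pi>: "\<pi> permutes {..<n}" by simp
    have "permute_list \<pi> (permute_list (inv \<pi>) vs) = vs"
      using \<pi> assms permute_list_compose[of \<pi> vs "inv \<pi>"] permutes_inv_o(2)[OF \<pi>] by simp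
    then show "prod_tensor (permute_list (inv \<pi>) vs) xs = prod_tensor vs (permute_list \<pi> xs)"
      using prod_tensor_permute[of \<pi> xs "permute_list (inv \<pi>) vs"] \<pi> assms by simp
  qed
  finally show ?thesis .
qed

lemma sym_tensor_mset:
  assumes "length vs = n" "mset vs = mset ws"
  shows "sym_tensor n vs xs = sym_tensor n ws xs"
proof -
  have lw: "length ws = n" using assms mset_eq_length by metis
  obtain \<sigma> where \<sigma>: "\<sigma> permutes {..<length ws}" "permute_list \<sigma> ws = vs"
    using mset_eq_permutation[OF assms(2)] by metis
  have "(\<Sum>\<pi> | \<pi> permutes {..<n}. prod_tensor (permute_list \<pi> vs) xs) =
      (\<Sum>\<pi> | \<pi> permutes {..<n}. prod_tensor (permute_list (\<sigma> \<circ> \<pi>) ws) xs)"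
    using \<sigma> lw by (intro sum.cong refl) (auto simp: permute_list_compose)
  also have "\<dots> = (\<Sum>\<pi> | \<pi> permutes {..<n}. prod_tensor (permute_list \<pi> ws) xs)"
    using \<sigma> lw by (intro setum_permutations_compose_left[symmetric]) simp
  finally show ?thesis by (simp add: sym_tensor_def)
qed

lemma sym_tensor_mset_arg:
  assumes "length vs = n" "mset xs = mset ys"
  shows "sym_tensor n vs xs = sym_tensor n vs ys"
proof -
  have l: "length xs = length ys" "set xs = set ys"
    using assms(2) mset_eq_length mset_eq_setD by metis+
  obtain \<sigma> where \<sigma>: "\<sigma> permutes {..<length ys}" "permute_list \<sigma> ys = xs"
    using mset_eq_permutation[OF assms(2)] by metis
  have "(\<Sum>\<pi> | \<pi> permutes {..<n}. prod_tensor vs (permute_list \<pi> xs)) =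
      (\<Sum>\<pi> | \<pi> permutes {..<n}. prod_tensor vs (permute_list \<pi> ys))" if "length ys = n"
  proof -
    have "(\<Sum>\<pi> | \<pi> permutes {..<n}. prod_tensor vs (permute_list \<pi> xs)) =
        (\<Sum>\<pi> | \<pi> permutes {..<n}. prod_tensor vs (permute_list (\<sigma> \<circ> \<pi>) ys))"
      using \<sigma> that by (intro sum.cong refl) (auto simp: permute_list_compose)
    also have "\<dots> = (\<Sum>\<pi> | \<pi> permutes {..<n}. prod_tensor vs (permute_list \<pi> ys))"
      using \<sigma> that by (intro setum_permutations_compose_left[symmetric]) simp
    finally show ?thesis .
  qed
  then show ?thesis using assms l by (simp add: sym_tensor_def sum_prod_tensor_transpose)
qed

lemma prod_tensor_arg_linear:
  assumes "ws \<noteq> []"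
  shows "prod_tensor ws ((\<lambda>\<xi>. a * x \<xi> + b * y \<xi>) # vs) =
    complex_of_real a * prod_tensor ws (x # vs) + complex_of_real b * prod_tensor ws (y # vs)"
  using assms by (cases ws) (auto simp: algebra_simps)

lemma sym_form_sym_tensor:
  assumes "length vs = n"
  shows "sym_form n (sym_tensor n vs)"
proof (rule sym_formI)
  fix us x y and a b :: real
  assume H: "length us + 1 = n" "set us \<subseteq> N'" "x \<in> N'" "y \<in> N'"
  then have "permute_list \<pi> vs \<noteq> []" for \<pi> using assms by (metis length_permute_list Suc_eq_plus1 list.size(3) nat.distinct(1))
  then show "sym_tensor n vs ((\<lambda>\<xi>. a * x \<xi> + b * y \<xi>) # us) =
      complex_of_real a * sym_tensor n vs (x # us) + complex_of_real b * sym_tensor n vs (y # us)"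
    using H N'_lincomb[OF H(3,4)]
    by (simp add: sym_tensor_def prod_tensor_arg_linear sum.distrib sum_distrib_left)
next
  fix xs ys :: "('h \<Rightarrow> real) list" assume "mset xs = mset ys"
  then show "sym_tensor n vs xs = sym_tensor n vs ys" by (rule sym_tensor_mset_arg[OF assms])
qed (auto simp: sym_tensor_def)

lemma sym_tensor_linear:
  assumes "length vs + 1 = n" "v \<in> N" "w \<in> N"
  shows "sym_tensor n ((a *\<^sub>R v + b *\<^sub>R w) # vs) =
    (\<lambda>xs. complex_of_real a * sym_tensor n (v # vs) xs + complex_of_real b * sym_tensor n (w # vs) xs)"
proof
  fix xs
  show "sym_tensor n ((a *\<^sub>R v + b *\<^sub>R w) # vs) xs =
      complex_of_real a * sym_tensor n (v # vs) xs + complex_of_real b * sym_tensor n (w # vs) xs"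
  proof (cases "length xs = n \<and> set xs \<subseteq> N'")
    case True
    have "prod_tensor ((a *\<^sub>R v + b *\<^sub>R w) # vs) ys = complex_of_real a * prod_tensor (v # vs) ys + complex_of_real b * prod_tensor (w # vs) ys"
      if l: "length ys = n" "set ys \<subseteq> N'" for ys
    proof -
      obtain y zs where ys: "ys = y # zs" using l assms by (cases ys) auto
      then obtain p where "y \<in> Hneg p" using l by (auto simp: N'_def)
      then show ?thesis using assms ys by (simp add: Hneg_linear algebra_simps)
    qed
    moreover have "set (permute_list \<pi> xs) \<subseteq> N'" if "\<pi> permutes {..<n}" for \<pi>
      using that True by simp
    ultimately show ?thesis
      using True assms by (simp add: sym_tensor_def sum_prod_tensor_transpose sum.distrib sum_distrib_left)
  qed (auto simp: sym_tensor_def)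
qed

lemma sym_tensor_replicate:
  "sym_tensor n (replicate n v) = (\<lambda>xs. fact n * tensor_power n (v, 0) xs)"
proof
  fix xs
  show "sym_tensor n (replicate n v) xs = fact n * tensor_power n (v, 0) xs"
  proof (cases "length xs = n \<and> set xs \<subseteq> N'")
    case True
    have "permute_list \<pi> (replicate n v) = replicate n v" if "\<pi> permutes {..<n}" for \<pi>
    proof (rule nth_equalityI)
      fix i assume "i < length (permute_list \<pi> (replicate n v))"
      then have i: "i < n" by simp
      then have "\<pi> i < n" using permutes_in_image[OF that, of i] by simp
      then show "permute_list \<pi> (replicate n v) ! i = replicate n v ! i"
        using i that by (simp add: permute_list_nth)
    qed simp
    moreover have "prod_tensor (replicate (length xs) v) xs = prod_list (map (\<lambda>x. pairing x (v, 0)) xs)" if "set xs \<subseteq> N'" for xs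
      using that
    proof (induction xs)
      case (Cons x xs)
      then obtain p where "x \<in> Hneg p" by (auto simp: N'_def)
      then show ?case using Cons by (simp add: pairing_def Hneg_zero complex_eq_iff)
    qed simp
    ultimately show ?thesis using True by (auto simp: sym_tensor_def tensor_power_def card_permutations)
  qed (auto simp: sym_tensor_def tensor_power_def)
qed

lemma prod_tensor_le:
  assumes "length vs = length xs" "set vs \<subseteq> N" "set xs \<subseteq> Hneg p"
  shows "cmod (prod_tensor vs xs) \<le> prod_list (map (pnorm p) vs) * prod_list (map (negnorm p) xs)"
  using assms
proof (induction vs xs rule: list_induct2)
  case (Cons v vs x xs)
  have "0 \<le> prod_list (map (pnorm p) vs)" if "set vs \<subseteq> N" for vs
    using that by (induction vs) (auto intro: mult_nonneg_nonneg pnorm_nonneg N_Hp)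
  then have "\<bar>x v\<bar> * cmod (prod_tensor vs xs) \<le>
      (negnorm p x * pnorm p v) * (prod_list (map (pnorm p) vs) * prod_list (map (negnorm p) xs))"
    using Cons by (intro mult_mono negnorm_bound) (auto intro!: mult_nonneg_nonneg negnorm_nonneg pnorm_nonneg N_Hp)
  then show ?case by (simp add: norm_mult mult_ac)
qed simp

lemma hs_sum_prod_tensor_le:
  assumes "set vs \<subseteq> N"
  shows "hs_sum p (onb p) (length vs) (prod_tensor vs) \<le> ennreal ((prod_list (map (pnorm p) vs))\<^sup>2)"
  using assms
proof (induction vs)
  case Nil
  then show ?case by (simp add: hs_sum_def)
next
  case (Cons v vs)
  have v: "v \<in> N" using Cons by simp
  have "hs_sum p (onb p) (Suc (length vs)) (prod_tensor (v # vs)) \<le>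
      infsum (\<lambda>e. hs_sum p (onb p) (length vs) (prod_tensor vs) * ennreal ((ip p e v)\<^sup>2)) (onb p)"
    unfolding hs_sum_Suc
  proof (intro infsum_ennreal_mono)
    fix e
    have "hs_sum p (onb p) (length vs) (\<lambda>xs. prod_tensor (v # vs) (riesz p e # xs)) =
        infsum (\<lambda>es. ennreal ((ip p e v)\<^sup>2) * ennreal ((cmod (prod_tensor vs (map (riesz p) es)))\<^sup>2)) (nlists (length vs) (onb p))"
      unfolding hs_sum_def using v by (simp add: norm_mult power_mult_distrib ennreal_mult riesz_def)
    also have "\<dots> \<le> ennreal ((ip p e v)\<^sup>2) * hs_sum p (onb p) (length vs) (prod_tensor vs)"
      unfolding hs_sum_def by (rule infsum_ennreal_cmult_le)
    finally show "hs_sum p (onb p) (length vs) (\<lambda>xs. prod_tensor (v # vs) (riesz p e # xs)) \<le>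
        hs_sum p (onb p) (length vs) (prod_tensor vs) * ennreal ((ip p e v)\<^sup>2)"
      by (simp add: mult.commute)
  qed
  also have "\<dots> \<le> hs_sum p (onb p) (length vs) (prod_tensor vs) * infsum (\<lambda>e. ennreal ((ip p e v)\<^sup>2)) (onb p)"
    by (rule infsum_ennreal_cmult_le)
  also have "\<dots> \<le> ennreal ((prod_list (map (pnorm p) vs))\<^sup>2) * ennreal ((pnorm p v)\<^sup>2)"
  proof (intro mult_mono Cons.IH)
    show "infsum (\<lambda>e. ennreal ((ip p e v)\<^sup>2)) (onb p) \<le> ennreal ((pnorm p v)\<^sup>2)"
      unfolding infsum_ennreal_le_iff
      using bessel[OF N_Hp[OF v] _ _ onb] by (auto intro!: ennreal_leI)
  qed (use Cons in auto)
  also have "\<dots> = ennreal ((prod_list (map (pnorm p) (v # vs)))\<^sup>2)"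
    by (simp add: power_mult_distrib mult.commute flip: ennreal_mult)
  finally show ?case by simp
qed

lemma sym_tensor_NC_tensor:
  assumes vs: "length vs = n" "set vs \<subseteq> N"
  shows "sym_tensor n vs \<in> NC_tensor n"
proof (intro NC_tensorI' sym_form_sym_tensor vs)
  fix p
  let ?P = "{\<pi>. \<pi> permutes {..<n}}"
  have fin: "finite ?P" by (simp add: finite_permutations)
  have perm: "length (permute_list \<pi> vs) = n" "set (permute_list \<pi> vs) \<subseteq> N" if "\<pi> \<in> ?P" for \<pi>
    using that vs by auto
  show "bounded_form p n (sym_tensor n vs)"
    unfolding bounded_form_def
  proof (intro exI[of _ "\<Sum>\<pi>\<in>?P. prod_list (map (pnorm p) (permute_list \<pi> vs))"] allI impI)
    fix xs :: "('h \<Rightarrow> real) list" assume xs: "length xs = n" "set xs \<subseteq> Hneg p"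
    have "cmod (sym_tensor n vs xs) \<le> (\<Sum>\<pi>\<in>?P. cmod (prod_tensor (permute_list \<pi> vs) xs))"
      using xs Hneg_N' by (auto simp: sym_tensor_def intro!: norm_sum sum_nonneg)
    also have "\<dots> \<le> (\<Sum>\<pi>\<in>?P. prod_list (map (pnorm p) (permute_list \<pi> vs)) * prod_list (map (negnorm p) xs))"
      using perm xs by (intro sum_mono prod_tensor_le) auto
    finally show "cmod (sym_tensor n vs xs) \<le>
        (\<Sum>\<pi>\<in>?P. prod_list (map (pnorm p) (permute_list \<pi> vs))) * prod_list (map (negnorm p) xs)"
      by (simp add: sum_distrib_right)
  qed
  show "hs_sum p (onb p) n (sym_tensor n vs) < \<infinity>"
  proof -
    have "hs_sum p (onb p) n (sym_tensor n vs) \<le>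
        infsum (\<lambda>es. \<Sum>\<pi>\<in>?P. ennreal (card ?P) * ennreal ((cmod (prod_tensor (permute_list \<pi> vs) (map (riesz p) es)))\<^sup>2)) (nlists n (onb p))"
      unfolding hs_sum_def
    proof (intro infsum_ennreal_mono)
      fix es assume "es \<in> nlists n (onb p)"
      have "(cmod (sym_tensor n vs (map (riesz p) es)))\<^sup>2 \<le> (\<Sum>\<pi>\<in>?P. cmod (prod_tensor (permute_list \<pi> vs) (map (riesz p) es)))\<^sup>2"
        by (auto simp: sym_tensor_def intro!: power_mono norm_sum sum_nonneg)
      \<comment> \<open>Cauchy-Schwarz over the finite set of permutations contributes its
        cardinality.\<close>
      also have "\<dots> \<le> (\<Sum>\<pi>\<in>?P. (cmod (prod_tensor (permute_list \<pi> vs) (map (riesz p) es)))\<^sup>2) * card ?P"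
        using sum_squared_le_sum_of_squares[of "\<lambda>\<pi>. cmod (prod_tensor (permute_list \<pi> vs) (map (riesz p) es))" ?P] by (simp add: mult.commute)
      finally show "ennreal ((cmod (sym_tensor n vs (map (riesz p) es)))\<^sup>2) \<le>
          (\<Sum>\<pi>\<in>?P. ennreal (card ?P) * ennreal ((cmod (prod_tensor (permute_list \<pi> vs) (map (riesz p) es)))\<^sup>2))"
        by (simp add: sum_distrib_left mult.commute ennreal_leI flip: ennreal_mult)
    qed
    also have "\<dots> = (\<Sum>\<pi>\<in>?P. infsum (\<lambda>es. ennreal (card ?P) * ennreal ((cmod (prod_tensor (permute_list \<pi> vs) (map (riesz p) es)))\<^sup>2)) (nlists n (onb p)))"
      by (rule sum_infsum_ennreal[OF fin, symmetric])
    also have "\<dots> \<le> (\<Sum>\<pi>\<in>?P. ennreal (card ?P) * ennreal ((prod_list (map (pnorm p) (permute_list \<pi> vs)))\<^sup>2))"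
    proof (intro sum_mono)
      fix \<pi> assume \<pi>: "\<pi> \<in> ?P"
      have "infsum (\<lambda>es. ennreal (card ?P) * ennreal ((cmod (prod_tensor (permute_list \<pi> vs) (map (riesz p) es)))\<^sup>2)) (nlists n (onb p))
          \<le> ennreal (card ?P) * hs_sum p (onb p) n (prod_tensor (permute_list \<pi> vs))"
        unfolding hs_sum_def by (rule infsum_ennreal_cmult_le)
      also have "\<dots> \<le> ennreal (card ?P) * ennreal ((prod_list (map (pnorm p) (permute_list \<pi> vs)))\<^sup>2)"
        using hs_sum_prod_tensor_le[OF perm(2)[OF \<pi>], of p] perm(1)[OF \<pi>] by (intro mult_left_mono) auto
      finally show "infsum (\<lambda>es. ennreal (card ?P) * ennreal ((cmod (prod_tensor (permute_list \<pi> vs) (map (riesz p) es)))\<^sup>2)) (nlists n (onb p))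
          \<le> ennreal (card ?P) * ennreal ((prod_list (map (pnorm p) (permute_list \<pi> vs)))\<^sup>2)" .
    qed
    also have "\<dots> < \<infinity>" by (simp add: fin ennreal_mult_less_top)
    finally show ?thesis .
  qed
qed

text \<open>Polarization is applied to \<open>F (sym_tensor n vs)\<close> as a symmetric form in the
  vectors \<open>vs\<close>. Its diagonal values are \<open>fact n\<close> times those of
  \<open>F\<close> on real tensor powers.\<close>

lemma dual_sym_tensor_eq_0:
  assumes F: "F \<in> Hneg_tensor p n" and z: "\<And>\<xi>. \<xi> \<in> N \<Longrightarrow> F (tensor_power n (\<xi>, 0)) = 0"
    and vs: "length vs = n" "set vs \<subseteq> N"
  shows "F (sym_tensor n vs) = 0"
proof (rule polarization_vanish[where \<kappa> = "\<lambda>vs. F (sym_tensor n vs)" and D = N and n = n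
      and cmb = "\<lambda>a x b y. a *\<^sub>R x + b *\<^sub>R y"])
  fix x y a b and us :: "'h list"
  assume H: "x \<in> N" "y \<in> N" "set us \<subseteq> N" "length us + 1 = n"
  then show "F (sym_tensor n ((a *\<^sub>R x + b *\<^sub>R y) # us)) =
      complex_of_real a * F (sym_tensor n (x # us)) + complex_of_real b * F (sym_tensor n (y # us))"
    by (simp add: sym_tensor_linear Hneg_tensor_lincomb[OF F sym_tensor_NC_tensor sym_tensor_NC_tensor])
next
  fix us ws :: "'h list" assume "length us = n" "mset us = mset ws"
  then have "sym_tensor n us = sym_tensor n ws" using sym_tensor_mset by blast
  then show "F (sym_tensor n us) = F (sym_tensor n ws)" by simp
next
  fix v assume v: "v \<in> N"
  then have "(v, 0) \<in> NC" by (simp add: NC_def)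
  then show "F (sym_tensor n (replicate n v)) = 0"
    using z[OF v] by (simp add: sym_tensor_replicate Hneg_tensor_scale[OF F] tensor_power_NC_tensor)
next
  show "N \<noteq> {}" using N_zero by blast
qed (use vs in \<open>auto intro: N_add N_scale\<close>)

text \<open>For orthonormal \<open>J\<close> this is the orthogonal projection of
  \<open>\<kappa>\<close> onto the tensors over \<open>J\<close>. Symmetrized tensors are used so
  that every summand is itself in \<open>NC_tensor n\<close>.\<close>

definition truncate :: "nat \<Rightarrow> nat \<Rightarrow> 'h set \<Rightarrow> 'h kernel \<Rightarrow> 'h kernel" where
  "truncate p n J \<kappa> = (\<lambda>xs. \<Sum>es\<in>nlists n J. (\<kappa> (map (riesz p) es) / fact n) * sym_tensor n es xs)"

lemma prod_tensor_riesz: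
  assumes "is_onb (Hp p) (ip p) B" "B \<subseteq> N" "es \<in> nlists n B" "fs \<in> nlists n B"
  shows "prod_tensor es (map (riesz p) fs) = (if es = fs then 1 else 0)"
  using assms(3,4)
proof (induction n arbitrary: es fs)
  case (Suc n)
  then obtain e es' f fs' where *: "es = e # es'" "fs = f # fs'" "e \<in> B" "f \<in> B"
    "es' \<in> nlists n B" "fs' \<in> nlists n B" by (auto simp: in_nlists_Suc)
  have "ip p f e = (if f = e then 1 else 0)" using assms(1) * by (auto simp: is_onb_def)
  then show ?case using Suc.IH[OF *(5,6)] * assms(2) by (auto simp: riesz_def subset_iff)
qed simp

lemma bij_betw_permute_list:
  assumes "\<pi> permutes {..<n}"
  shows "bij_betw (permute_list \<pi>) (nlists n J) (nlists n J)"
proof (rule bij_betw_byWitness[where f' = "permute_list (inv \<pi>)"])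
  have i: "inv \<pi> permutes {..<n}" using assms by (rule permutes_inv)
  show "\<forall>es\<in>nlists n J. permute_list (inv \<pi>) (permute_list \<pi> es) = es"
    using i permute_list_compose[of "inv \<pi>" _ \<pi>] permutes_inv_o(1)[OF assms]
    by (simp add: nlists_def flip: permute_list_compose)
  show "\<forall>es\<in>nlists n J. permute_list \<pi> (permute_list (inv \<pi>) es) = es"
    using assms permutes_inv_o(2)[OF assms]
    by (simp add: nlists_def flip: permute_list_compose)
  show "permute_list \<pi> ` nlists n J \<subseteq> nlists n J" "permute_list (inv \<pi>) ` nlists n J \<subseteq> nlists n J"
    using assms i by (auto simp: nlists_def)
qed

text \<open>The coefficients are symmetric in \<open>es\<close>, so all permutations contribute the
  same sum and the symmetrization cancels against \<open>fact n\<close>.\<close>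

lemma truncate_eq:
  assumes \<kappa>: "\<kappa> \<in> NC_tensor n" and J: "finite J" "J \<subseteq> Hp p" and xs: "length xs = n" "set xs \<subseteq> N'"
  shows "truncate p n J \<kappa> xs = (\<Sum>es\<in>nlists n J. \<kappa> (map (riesz p) es) * prod_tensor es xs)"
proof -
  let ?P = "{\<pi>. \<pi> permutes {..<n}}"
  let ?S = "\<Sum>es\<in>nlists n J. \<kappa> (map (riesz p) es) * prod_tensor es xs"
  have "(\<Sum>es\<in>nlists n J. \<kappa> (map (riesz p) es) * prod_tensor (permute_list \<pi> es) xs) = ?S" if \<pi>: "\<pi> \<in> ?P" for \<pi>
  proof -
    have "?S = (\<Sum>es\<in>nlists n J. \<kappa> (map (riesz p) (permute_list \<pi> es)) * prod_tensor (permute_list \<pi> es) xs)"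
      using \<pi> by (intro sum.reindex_bij_betw[OF bij_betw_permute_list, symmetric]) auto
    also have "\<dots> = (\<Sum>es\<in>nlists n J. \<kappa> (map (riesz p) es) * prod_tensor (permute_list \<pi> es) xs)"
    proof (intro sum.cong refl)
      fix es assume "es \<in> nlists n J"
      then have "mset (map (riesz p) (permute_list \<pi> es)) = mset (map (riesz p) es)"
        using \<pi> by (simp add: nlists_def)
      then show "\<kappa> (map (riesz p) (permute_list \<pi> es)) * prod_tensor (permute_list \<pi> es) xs =
          \<kappa> (map (riesz p) es) * prod_tensor (permute_list \<pi> es) xs"
        using sym_form_mset[OF NC_tensorD(1)[OF \<kappa>]] by metis
    qed
    finally show ?thesis by simp
  qed
  then have "(\<Sum>\<pi>\<in>?P. \<Sum>es\<in>nlists n J. \<kappa> (map (riesz p) es) * prod_tensor (permute_list \<pi> es) xs) = fact n * ?S"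
    by (simp add: card_permutations)
  moreover have "truncate p n J \<kappa> xs =
      (\<Sum>\<pi>\<in>?P. \<Sum>es\<in>nlists n J. \<kappa> (map (riesz p) es) * prod_tensor (permute_list \<pi> es) xs) / fact n"
    unfolding truncate_def using xs
    by (subst sum.swap) (simp add: sym_tensor_def sum_distrib_left sum_divide_distrib)
  ultimately show ?thesis by simp
qed

lemma truncate_NC_tensor:
  assumes "finite J" "J \<subseteq> N"
  shows "truncate p n J \<kappa> \<in> NC_tensor n"
  unfolding truncate_def using assms
  by (intro NC_tensor_sum finite_nlists sym_tensor_NC_tensor) (auto simp: nlists_def)

lemma truncate_approx:
  assumes \<kappa>: "\<kappa> \<in> NC_tensor n" and \<epsilon>: "0 < \<epsilon>"
  shows "\<exists>J. finite J \<and> J \<subseteq> N \<and> tnorm p n (\<lambda>xs. 1 * \<kappa> xs + (-1) * truncate p n J \<kappa> xs) \<le> \<epsilon>"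
proof -
  let ?B = "onbN p"
  have B: "?B \<subseteq> N" "is_onb (Hp p) (ip p) ?B" "?B \<subseteq> Hp p" using onbN[of p] N_subset_Hp by auto
  define f where "f es = (cmod (\<kappa> (map (riesz p) es)))\<^sup>2" for es
  have fin: "infsum (\<lambda>es. ennreal (f es)) (nlists n ?B) < \<infinity>"
    using hs_sum_NC_tensor[OF \<kappa> B(2)] by (simp add: hs_sum_def f_def)
  then have sm: "f summable_on nlists n ?B"
    by (subst summable_on_iff_infsum_ennreal) (auto simp: f_def)
  then have "(sum f \<longlongrightarrow> infsum f (nlists n ?B)) (finite_subsets_at_top (nlists n ?B))"
    using has_sum_infsum has_sum_def by blast
  then have "\<forall>\<^sub>F K in finite_subsets_at_top (nlists n ?B). dist (sum f K) (infsum f (nlists n ?B)) < \<epsilon>\<^sup>2"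
    using \<epsilon> by (intro tendstoD) auto
  then obtain K where K: "finite K" "K \<subseteq> nlists n ?B" "dist (sum f K) (infsum f (nlists n ?B)) < \<epsilon>\<^sup>2"
    unfolding eventually_finite_subsets_at_top by blast
  \<comment> \<open>The multi-indices in \<open>K\<close> carry all but
    \<open>\<epsilon>\<^sup>2\<close> of the norm and involve finitely many basis vectors.
    Truncating to \<open>J\<close> removes at least the entries in \<open>K\<close>.\<close>
  define J where "J = (\<Union>es\<in>K. set es)"
  have J: "finite J" "J \<subseteq> ?B" "K \<subseteq> nlists n J"
    using K by (auto simp: J_def nlists_def)
  then have JN: "J \<subseteq> N" "J \<subseteq> Hp p" using B by auto
  let ?\<tau> = "\<lambda>xs. 1 * \<kappa> xs + (-1) * truncate p n J \<kappa> xs"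
  have \<tau>: "?\<tau> \<in> NC_tensor n" by (intro NC_tensor_lincomb \<kappa> truncate_NC_tensor J JN)
  have val: "?\<tau> (map (riesz p) fs) = (if fs \<in> nlists n J then 0 else \<kappa> (map (riesz p) fs))"
    if fs: "fs \<in> nlists n ?B" for fs
  proof -
    have "truncate p n J \<kappa> (map (riesz p) fs) =
        (\<Sum>es\<in>nlists n J. \<kappa> (map (riesz p) es) * prod_tensor es (map (riesz p) fs))"
      using map_riesz_N'[OF fs B(3)] length_nlists[OF fs] by (intro truncate_eq \<kappa> J JN) auto
    also have "\<dots> = (\<Sum>es\<in>nlists n J. if es = fs then \<kappa> (map (riesz p) fs) else 0)"
    proof (intro sum.cong refl)
      fix es assume "es \<in> nlists n J"
      then have "es \<in> nlists n ?B" using J(2) by (auto simp: nlists_def)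
      then show "\<kappa> (map (riesz p) es) * prod_tensor es (map (riesz p) fs) = (if es = fs then \<kappa> (map (riesz p) fs) else 0)"
        using prod_tensor_riesz[OF B(2,1) _ fs] by simp
    qed
    finally show ?thesis using finite_nlists[OF J(1), of n] by simp
  qed
  have "hs_sum p ?B n ?\<tau> \<le> ennreal (\<epsilon>\<^sup>2)"
    unfolding hs_sum_def infsum_ennreal_le_iff
  proof (intro allI impI)
    fix G assume G: "finite G" "G \<subseteq> nlists n ?B"
    \<comment> \<open>Entries over \<open>J\<close> vanish after truncation and the others are
      unchanged; as \<open>K\<close> lies over \<open>J\<close>, only entries outside
      \<open>K\<close> remain.\<close>
    have "(\<Sum>fs\<in>G. (cmod (?\<tau> (map (riesz p) fs)))\<^sup>2) \<le> (\<Sum>fs\<in>G - K. f fs)"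
    proof -
      have "(\<Sum>fs\<in>G. (cmod (?\<tau> (map (riesz p) fs)))\<^sup>2) = (\<Sum>fs\<in>G - K. (cmod (?\<tau> (map (riesz p) fs)))\<^sup>2)"
      proof (intro sum.mono_neutral_right G(1) ballI)
        fix fs assume "fs \<in> G - (G - K)"
        then have "fs \<in> nlists n J" "fs \<in> nlists n ?B" using J G by auto
        then show "(cmod (?\<tau> (map (riesz p) fs)))\<^sup>2 = 0" using val by simp
      qed auto
      also have "\<dots> \<le> (\<Sum>fs\<in>G - K. f fs)"
      proof (intro sum_mono)
        fix fs assume "fs \<in> G - K"
        then have "fs \<in> nlists n ?B" using G by auto
        from val[OF this] show "(cmod (?\<tau> (map (riesz p) fs)))\<^sup>2 \<le> f fs"
          by (cases "fs \<in> nlists n J") (simp_all add: f_def)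
      qed
      finally show ?thesis .
    qed
    also have "\<dots> = sum f (G \<union> K) - sum f K"
      using sum.union_disjoint[of "G - K" K f] G K by (simp add: Un_Diff_cancel2 Diff_Int_distrib2)
    also have "\<dots> \<le> infsum f (nlists n ?B) - sum f K"
      using G K sm by (intro diff_right_mono finite_sum_le_infsum) (auto simp: f_def)
    also have "\<dots> \<le> \<epsilon>\<^sup>2" using K(3) by (simp add: dist_real_def)
    finally show "(\<Sum>fs\<in>G. ennreal ((cmod (?\<tau> (map (riesz p) fs)))\<^sup>2)) \<le> ennreal (\<epsilon>\<^sup>2)"
      by (simp add: ennreal_leI)
  qed
  then have "(tnorm p n ?\<tau>)\<^sup>2 \<le> \<epsilon>\<^sup>2"
    unfolding hs_sum_NC_tensor[OF \<tau> B(2)] by (simp only: ennreal_le_iff[OF zero_le_power2])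
  then have "tnorm p n ?\<tau> \<le> \<epsilon>" using \<epsilon> by (intro power2_le_imp_le[of "tnorm p n ?\<tau>"]) auto
  then show ?thesis using J JN by blast
qed

text \<open>Real vectors suffice because \<open>F\<close> is complex linear and the truncations are
  complex combinations of symmetrized tensors of real vectors.\<close>

lemma dual_eq_0:
  assumes F: "F \<in> NC_tensor_dual n" and z: "\<And>\<xi>. \<xi> \<in> N \<Longrightarrow> F (tensor_power n (\<xi>, 0)) = 0"
  shows "F = (\<lambda>_. 0)"
proof
  fix \<kappa>
  obtain p where p: "F \<in> Hneg_tensor p n" using F by (auto simp: NC_tensor_dual_def)
  show "F \<kappa> = 0"
  proof (cases "\<kappa> \<in> NC_tensor n")
    case False
    then show ?thesis using Hneg_tensor_vanish[OF p] by simp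
  next
    case \<kappa>: True
    have "cmod (F \<kappa>) \<le> 0 + \<epsilon>" if \<epsilon>: "0 < \<epsilon>" for \<epsilon>
    proof -
      define d where "d = \<epsilon> / (negtnorm p n F + 1)"
      have nn: "0 \<le> negtnorm p n F" by (rule negtnorm_nonneg[OF p])
      then have d: "0 < d" using \<epsilon> by (simp add: d_def)
      obtain J where J: "finite J" "J \<subseteq> N" "tnorm p n (\<lambda>xs. 1 * \<kappa> xs + (-1) * truncate p n J \<kappa> xs) \<le> d"
        using truncate_approx[OF \<kappa> d] by blast
      have t: "truncate p n J \<kappa> \<in> NC_tensor n" by (rule truncate_NC_tensor[OF J(1,2)])
      have "F (truncate p n J \<kappa>) = 0"
      proof -
        have J': "length es = n" "set es \<subseteq> N" if "es \<in> nlists n J" for es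
          using that J(2) by (auto simp: nlists_def)
        show ?thesis
          unfolding truncate_def
          by (subst Hneg_tensor_sum[OF p finite_nlists[OF J(1)] sym_tensor_NC_tensor[OF J']])
             (simp_all add: dual_sym_tensor_eq_0[OF p z J'])
      qed
      then have "F \<kappa> = F (\<lambda>xs. 1 * \<kappa> xs + (-1) * truncate p n J \<kappa> xs)"
        unfolding Hneg_tensor_lincomb[OF p \<kappa> t] by simp
      also have "cmod \<dots> \<le> negtnorm p n F * d"
        using negtnorm_bound[OF p NC_tensor_lincomb[OF \<kappa> t], of 1 "-1"] mult_left_mono[OF J(3) nn] by linarith
      also have "\<dots> \<le> \<epsilon>" using nn \<epsilon> by (simp add: d_def field_simps)
      finally show ?thesis by simp
    qed
    then have "cmod (F \<kappa>) \<le> 0" by (rule field_le_epsilon)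
    then show ?thesis by simp
  qed
qed

lemma NC_tensor_dual_lincomb:
  assumes "F \<in> NC_tensor_dual n" "G \<in> NC_tensor_dual n"
  shows "(\<lambda>\<kappa>. a * F \<kappa> + b * G \<kappa>) \<in> NC_tensor_dual n"
proof -
  obtain p r where "F \<in> Hneg_tensor p n" "G \<in> Hneg_tensor r n"
    using assms by (auto simp: NC_tensor_dual_def)
  then have "F \<in> Hneg_tensor (max p r) n" "G \<in> Hneg_tensor (max p r) n"
    using Hneg_tensor_mono(1) max.cobounded1 max.cobounded2 by blast+
  then show ?thesis
    unfolding NC_tensor_dual_def by (intro UN_I[of "max p r"] Hneg_tensor_lin(1)) auto
qed

lemma dual_eqI:
  assumes F: "F \<in> NC_tensor_dual n" "G \<in> NC_tensor_dual n"
    and z: "\<And>\<xi>. \<xi> \<in> N \<Longrightarrow> F (tensor_power n (\<xi>, 0)) = G (tensor_power n (\<xi>, 0))"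
  shows "F = G"
proof -
  have "(\<lambda>\<kappa>. 1 * F \<kappa> + (-1) * G \<kappa>) = (\<lambda>_. 0)"
    using z by (intro dual_eq_0[OF NC_tensor_dual_lincomb[OF F]]) simp
  then show ?thesis by (auto simp: fun_eq_iff)
qed

end

subsection \<open>Exponential moments\<close>

context nuclear_triple
begin

text \<open>The triple provides a basis with finite Hilbert-Schmidt sum, which need not consist of
  test vectors. The sum is transferred to \<open>onbN p'\<close>.\<close>

lemma hilbert_schmidt_onbN:
  obtains p' where "p < p'" "infsum (\<lambda>e. ennreal ((pnorm p e)\<^sup>2)) (onbN p') < \<infinity>"
proof -
  obtain p' E where E: "p < p'" "is_onb (Hp p') (ip p') E" "(\<lambda>e. ip p e e) summable_on E"
    using hilbert_schmidt[of p] by blast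
  have sub: "Hp p' \<subseteq> Hp p" using Hp_mono[of p p'] E(1) by simp
  have ES: "e \<in> Hp p" if "e \<in> E" for e using that E(2) sub by (auto simp: is_onb_def)
  have BS: "e \<in> Hp p" if "e \<in> onbN p'" for e using that onbN(1) N_Hp by blast
  have nn: "0 \<le> ip p e e" if "e \<in> E" for e using H.self_nonneg[OF ES[OF that]] .
  \<comment> \<open>Parseval in \<open>Hp p\<close> and an interchange of sums turn the
    Hilbert-Schmidt sum into a sum over \<open>g\<close> of sums of squares of the functional
    \<open>ip p g\<close>, to which \<open>onb_sum_le\<close> applies.\<close>
  have eq: "infsum (\<lambda>e. ennreal ((pnorm p e)\<^sup>2)) X = infsum (\<lambda>g. infsum (\<lambda>e. ennreal ((ip p g e)\<^sup>2)) X) (onbN p)"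
    if "\<And>e. e \<in> X \<Longrightarrow> e \<in> Hp p" for X
    using that by (subst infsum_ennreal_swap) (simp add: H.parseval[OF _ onbN(2)] pnorm_eq_nrm cong: infsum_cong)
  note eqs = eq[of "onbN p'", simplified BS, simplified] eq[of E, simplified ES, simplified]
  have "infsum (\<lambda>e. ennreal ((pnorm p e)\<^sup>2)) (onbN p') \<le> infsum (\<lambda>e. ennreal ((pnorm p e)\<^sup>2)) E"
    unfolding eqs
  proof (intro infsum_ennreal_mono)
    fix g assume "g \<in> onbN p"
    then have g: "g \<in> Hp p" using onbN(1) N_Hp by blast
    have lin: "H.lin_on p' (ip p g)"
      using g sub by (auto simp: H.lin_on_def H.add_right H.scale_right H.S_scale subset_iff)
    have b: "\<bar>ip p g v\<bar> \<le> pnorm p g * H.nrm p' v" if v: "v \<in> Hp p'" for v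
    proof -
      have "v \<in> Hp p" using sub v by blast
      then have "\<bar>ip p g v\<bar> \<le> pnorm p g * pnorm p v"
        using H.Cauchy_Schwarz[OF g] by (simp add: pnorm_eq_nrm)
      also have "\<dots> \<le> pnorm p g * pnorm p' v"
        using pnorm_mono[of p p' v] E(1) v pnorm_nonneg[OF g] by (intro mult_left_mono) auto
      finally show ?thesis by (simp add: pnorm_eq_nrm)
    qed
    show "infsum (\<lambda>e. ennreal ((ip p g e)\<^sup>2)) (onbN p') \<le> infsum (\<lambda>e. ennreal ((ip p g e)\<^sup>2)) E"
      by (rule H.onb_sum_le[OF lin b E(2) onbN(2)])
  qed
  also have "infsum (\<lambda>e. ennreal ((pnorm p e)\<^sup>2)) E = infsum (\<lambda>e. ennreal (ip p e e)) E"
    using nn by (intro infsum_cong) (simp add: pnorm_def)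
  also have "\<dots> < \<infinity>"
    using E(3) by (subst (asm) summable_on_iff_infsum_ennreal) (use nn in auto)
  finally show ?thesis using that E(1) by blast
qed

section \<open>Norm and scaling in the complexification\<close>

lemma cpnorm_mono: "p \<le> q \<Longrightarrow> \<theta> \<in> NC \<Longrightarrow> cpnorm p \<theta> \<le> cpnorm q \<theta>"
  unfolding cpnorm_def
  by (intro real_sqrt_le_mono add_mono power_mono pnorm_mono pnorm_nonneg N_Hp) (auto simp: NC_def)

lemma cpnorm_scaleR: "\<theta> \<in> NC \<Longrightarrow> cpnorm p (c *\<^sub>R \<theta>) = \<bar>c\<bar> * cpnorm p \<theta>"
proof -
  assume \<theta>: "\<theta> \<in> NC"
  have "cpnorm p (c *\<^sub>R \<theta>) = sqrt (c\<^sup>2 * ((pnorm p (fst \<theta>))\<^sup>2 + (pnorm p (snd \<theta>))\<^sup>2))"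
    using NC_D[OF \<theta>] by (simp add: cpnorm_def pnorm_scale N_Hp power_mult_distrib algebra_simps)
  then show ?thesis by (simp add: real_sqrt_mult cpnorm_def)
qed

lemma cpnorm_eq_0: "\<theta> \<in> NC \<Longrightarrow> cpnorm p \<theta> = 0 \<Longrightarrow> \<theta> = 0"
proof -
  assume \<theta>: "\<theta> \<in> NC" and z: "cpnorm p \<theta> = 0"
  have "pnorm p (fst \<theta>) = 0" "pnorm p (snd \<theta>) = 0"
    using z by (auto simp: cpnorm_def sum_power2_eq_zero_iff)
  then have "fst \<theta> = 0" "snd \<theta> = 0"
    using pnorm_pos[OF N_Hp[OF NC_D(1)[OF \<theta>]], of p] pnorm_pos[OF N_Hp[OF NC_D(2)[OF \<theta>]], of p] by fastforce+
  then show ?thesis by (simp add: prod_eq_iff)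
qed

lemma NC_zero: "0 \<in> NC" and NC_scaleR: "\<theta> \<in> NC \<Longrightarrow> c *\<^sub>R \<theta> \<in> NC" and NC_real: "\<xi> \<in> N \<Longrightarrow> (\<xi>, 0) \<in> NC"
  by (auto simp: NC_def mem_Times_iff intro: N_scale)

lemma pairing_scaleR: "x \<in> N' \<Longrightarrow> \<theta> \<in> NC \<Longrightarrow> pairing x (c *\<^sub>R \<theta>) = complex_of_real c * pairing x \<theta>"
  by (auto simp: N'_def pairing_def complex_eq_iff Hneg_scale NC_D)

lemma pairing_zero: "x \<in> N' \<Longrightarrow> pairing x 0 = 0"
  by (auto simp: N'_def pairing_def complex_eq_iff Hneg_zero)

lemma pairing_real: "x \<in> N' \<Longrightarrow> pairing x (\<xi>, 0) = complex_of_real (x \<xi>)"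
  by (auto simp: N'_def pairing_def complex_eq_iff Hneg_zero)

lemma cpnorm_real: "cpnorm p (\<xi>, 0) = \<bar>pnorm p \<xi>\<bar>"
  by (simp add: cpnorm_def) (simp add: pnorm_def)

lemma tensor_power_scaleR:
  assumes \<theta>: "\<theta> \<in> NC"
  shows "tensor_power n (c *\<^sub>R \<theta>) = (\<lambda>xs. complex_of_real (c ^ n) * tensor_power n \<theta> xs)"
proof
  fix xs
  have "prod_list (map (\<lambda>x. pairing x (c *\<^sub>R \<theta>)) xs) = complex_of_real (c ^ length xs) * prod_list (map (\<lambda>x. pairing x \<theta>) xs)"
    if "set xs \<subseteq> N'" for xs
    using that by (induction xs) (auto simp: pairing_scaleR[OF _ \<theta>])
  then show "tensor_power n (c *\<^sub>R \<theta>) xs = complex_of_real (c ^ n) * tensor_power n \<theta> xs"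
    by (auto simp: tensor_power_def)
qed

end

text \<open>A product is at most the corresponding power of its largest factor; the summand 1 covers
  the empty list.\<close>

lemma prod_list_le_sum_powers:
  fixes ys :: "real list"
  assumes "\<And>y. y \<in> set ys \<Longrightarrow> 0 \<le> y"
  shows "prod_list ys \<le> 1 + sum_list (map (\<lambda>y. y ^ length ys) ys)"
proof (cases "ys = []")
  case False
  define M where "M = Max (set ys)"
  have M: "M \<in> set ys" "\<And>y. y \<in> set ys \<Longrightarrow> y \<le> M" using False by (auto simp: M_def)
  have "prod_list zs \<le> M ^ length zs \<and> 0 \<le> prod_list zs" if "set zs \<subseteq> set ys" for zs
    using that
  proof (induction zs)
    case (Cons z zs)
    then show ?case using assms M by (auto intro!: mult_mono)
  qed simp
  then have "prod_list ys \<le> M ^ length ys" by blast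
  also have "\<dots> \<le> sum_list (map (\<lambda>y. y ^ length ys) ys)"
    using M(1) assms by (intro member_le_sum_list) auto
  finally show ?thesis by simp
qed simp

locale nuclear_measure = nuclear_triple Hp ip
  for Hp :: "nat \<Rightarrow> 'h::{real_inner, polish_space} set" and ip :: "nat \<Rightarrow> 'h \<Rightarrow> 'h \<Rightarrow> real" +
  fixes \<mu> :: "('h \<Rightarrow> real) measure"
  assumes M_a: "\<mu> \<in> M_a" and prob: "prob_space \<mu>"
begin

sublocale prob_space \<mu> by (rule prob)

lemma space_\<mu>: "space \<mu> = N'" and sets_\<mu>: "sets \<mu> = cylinder_sets"
  using M_a by (auto simp: M_a_def)

lemma measurable_eval:
  assumes \<xi>: "\<xi> \<in> N"
  shows "(\<lambda>x. x \<xi>) \<in> borel_measurable \<mu>"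
proof (rule measurableI)
  fix A :: "real set" assume A: "A \<in> sets borel"
  have "(\<lambda>x. x \<xi>) -` A \<inter> space \<mu> = {x \<in> N'. x \<xi> \<in> A}" by (auto simp: space_\<mu>)
  also have "\<dots> \<in> sets \<mu>" unfolding sets_\<mu> cylinder_sets_def using \<xi> A by (intro sigma_sets.Basic) blast
  finally show "(\<lambda>x. x \<xi>) -` A \<inter> space \<mu> \<in> sets \<mu>" .
qed simp

lemma measurable_pairing:
  assumes \<theta>: "\<theta> \<in> NC"
  shows "(\<lambda>x. pairing x \<theta>) \<in> borel_measurable \<mu>"
  unfolding pairing_def Complex_eq
  using measurable_eval[OF NC_D(1)[OF \<theta>]] measurable_eval[OF NC_D(2)[OF \<theta>]] by simp

text \<open>With the modulus inside the exponential, the bound dominates all absolute moments at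
  once.\<close>

definition exp_bound :: "nat \<Rightarrow> real \<Rightarrow> real \<Rightarrow> bool" where
  "exp_bound p \<delta> K \<longleftrightarrow> 0 < \<delta> \<and> 0 \<le> K \<and> (\<forall>\<theta>\<in>NC. cpnorm p \<theta> \<le> \<delta> \<longrightarrow>
     integrable \<mu> (\<lambda>x. exp (cmod (pairing x \<theta>))) \<and> (\<integral>x. exp (cmod (pairing x \<theta>)) \<partial>\<mu>) \<le> K)"

text \<open>At a real vector the integrand of the Laplace transform is positive, so its local
  boundedness at zero bounds exponential moments without cancellation. A general vector is dominated
  by real ones.\<close>

lemma exp_bound_exists: "\<exists>p \<delta> K. exp_bound p \<delta> K"
proof -
  obtain p1 \<epsilon> where 1: "0 < \<epsilon>"
      "\<And>\<theta>. \<theta> \<in> NC \<Longrightarrow> cpnorm p1 \<theta> < \<epsilon> \<Longrightarrow> integrable \<mu> (\<lambda>x. exp (pairing x \<theta>))"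
    and hol: "holomorphic_on_NC (laplace \<mu>) {\<theta> \<in> NC. cpnorm p1 \<theta> < \<epsilon>}"
    using M_a unfolding M_a_def by blast
  have "0 \<in> {\<theta> \<in> NC. cpnorm p1 \<theta> < \<epsilon>}"
    using 1(1) NC_zero by (simp add: cpnorm_def pnorm_def)
  then obtain p2 \<delta> C where 2: "0 < \<delta>"
      "\<And>\<theta>. \<theta> \<in> NC \<Longrightarrow> cpnorm p1 \<theta> < \<epsilon> \<Longrightarrow> cpnorm p2 (\<theta> - 0) < \<delta> \<Longrightarrow> cmod (laplace \<mu> \<theta>) \<le> C"
    using hol unfolding holomorphic_on_NC_def by blast
  define p where "p = max p1 p2"
  define d where "d = min \<epsilon> \<delta>"
  have d: "0 < d" using 1 2 by (simp add: d_def)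
  have real: "integrable \<mu> (\<lambda>x. exp (x \<xi>)) \<and> (\<integral>x. exp (x \<xi>) \<partial>\<mu>) \<le> C" if \<xi>: "\<xi> \<in> N" "pnorm p \<xi> < d" for \<xi>
  proof -
    have nc: "(\<xi>, 0) \<in> NC" using \<xi> NC_real by blast
    have "cpnorm p (\<xi>, 0) < d" using \<xi> pnorm_nonneg[OF N_Hp[OF \<xi>(1)], of p] by (simp add: cpnorm_real)
    then have small: "cpnorm p1 (\<xi>, 0) < \<epsilon>" "cpnorm p2 (\<xi>, 0) < \<delta>"
      using cpnorm_mono[OF _ nc, of p1 p] cpnorm_mono[OF _ nc, of p2 p] by (auto simp: p_def d_def)
    have e: "exp (pairing x (\<xi>, 0)) = complex_of_real (exp (x \<xi>))" if "x \<in> space \<mu>" for x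
      using that by (simp add: space_\<mu> pairing_real exp_of_real)
    have int: "integrable \<mu> (\<lambda>x. complex_of_real (exp (x \<xi>)))"
      using 1(2)[OF nc small(1)] e by (simp cong: Bochner_Integration.integrable_cong)
    have "laplace \<mu> (\<xi>, 0) = complex_of_real (\<integral>x. exp (x \<xi>) \<partial>\<mu>)"
      unfolding laplace_def using e by (simp cong: Bochner_Integration.integral_cong)
    then have "\<bar>\<integral>x. exp (x \<xi>) \<partial>\<mu>\<bar> \<le> C" using 2(2)[OF nc small(1)] small(2) by simp
    then show ?thesis using int integrable_Re[OF int] by simp
  qed
  have "0 \<le> C"
  proof -
    have "cmod (laplace \<mu> 0) \<le> C"
      using 2 1(1) NC_zero by (intro 2(2)) (auto simp: cpnorm_def pnorm_def)
    then show ?thesis using norm_ge_zero order_trans by blast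
  qed
  \<comment> \<open>The modulus of the pairing is at most twice the larger of its real and imaginary
    parts in absolute value, so four exponentials at the doubled vectors dominate, with total at
    most \<open>4 * C\<close>. The radius \<open>d / 3\<close> keeps the doubled vectors below
    \<open>d\<close>.\<close>
  have main: "integrable \<mu> (\<lambda>x. exp (cmod (pairing x \<theta>))) \<and> (\<integral>x. exp (cmod (pairing x \<theta>)) \<partial>\<mu>) \<le> 4 * C"
    if \<theta>: "\<theta> \<in> NC" "cpnorm p \<theta> \<le> d / 3" for \<theta>
  proof -
    let ?\<xi> = "fst \<theta>" and ?\<eta> = "snd \<theta>"
    have N: "?\<xi> \<in> N" "?\<eta> \<in> N" using NC_D[OF \<theta>(1)] by auto
    have "pnorm p ?\<xi> \<le> cpnorm p \<theta>" "pnorm p ?\<eta> \<le> cpnorm p \<theta>"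
      by (auto simp: cpnorm_def real_le_rsqrt)
    then have s: "pnorm p (c *\<^sub>R ?\<xi>) < d" "pnorm p (c *\<^sub>R ?\<eta>) < d" if "\<bar>c\<bar> = 2" for c
      using that \<theta>(2) d N by (auto simp: pnorm_scale N_Hp)
    define f where "f x = exp (x (2 *\<^sub>R ?\<xi>)) + exp (x ((-2) *\<^sub>R ?\<xi>)) + (exp (x (2 *\<^sub>R ?\<eta>)) + exp (x ((-2) *\<^sub>R ?\<eta>)))" for x :: "'h \<Rightarrow> real"
    have fi: "integrable \<mu> f" and fb: "(\<integral>x. f x \<partial>\<mu>) \<le> 4 * C"
      using real[OF N_scale[OF N(1)] s(1), of 2] real[OF N_scale[OF N(1)] s(1), of "-2"]
        real[OF N_scale[OF N(2)] s(2), of 2] real[OF N_scale[OF N(2)] s(2), of "-2"]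
      unfolding f_def by auto
    have le: "exp (cmod (pairing x \<theta>)) \<le> f x" if x: "x \<in> space \<mu>" for x
    proof -
      obtain r where r: "x \<in> Hneg r" using x by (auto simp: space_\<mu> N'_def)
      have e2: "exp (2 * \<bar>t\<bar>) \<le> exp (2 * t) + exp (- 2 * t)" for t :: real
        by (cases "0 \<le> t") (auto simp: add_increasing add_increasing2)
      have "cmod (pairing x \<theta>) \<le> \<bar>x ?\<xi>\<bar> + \<bar>x ?\<eta>\<bar>"
        using cmod_le[of "pairing x \<theta>"] by (simp add: pairing_def)
      also have "\<dots> \<le> max (2 * \<bar>x ?\<xi>\<bar>) (2 * \<bar>x ?\<eta>\<bar>)" by simp
      finally have "exp (cmod (pairing x \<theta>)) \<le> exp (max (2 * \<bar>x ?\<xi>\<bar>) (2 * \<bar>x ?\<eta>\<bar>))" by simp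
      also have "\<dots> \<le> exp (2 * \<bar>x ?\<xi>\<bar>) + exp (2 * \<bar>x ?\<eta>\<bar>)"
        by (auto simp: max_def add_increasing add_increasing2)
      also have "\<dots> \<le> f x"
        unfolding f_def Hneg_scale[OF r N(1)] Hneg_scale[OF r N(2)] by (intro add_mono e2)
      finally show ?thesis .
    qed
    have meas: "(\<lambda>x. exp (cmod (pairing x \<theta>))) \<in> borel_measurable \<mu>"
      using measurable_pairing[OF \<theta>(1)] by simp
    have int: "integrable \<mu> (\<lambda>x. exp (cmod (pairing x \<theta>)))"
      by (rule Bochner_Integration.integrable_bound[OF fi meas AE_I2]) (use le in force)
    moreover have "(\<integral>x. exp (cmod (pairing x \<theta>)) \<partial>\<mu>) \<le> (\<integral>x. f x \<partial>\<mu>)"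
      by (rule integral_mono[OF int fi le])
    ultimately show ?thesis using fb by simp
  qed
  show ?thesis
    unfolding exp_bound_def using d \<open>0 \<le> C\<close> main
    by (intro exI[of _ p] exI[of _ "d / 3"] exI[of _ "4 * C"]) auto
qed

lemma exp_lower_bound: "0 \<le> (t::real) \<Longrightarrow> t ^ n \<le> fact n * exp t"
proof -
  assume t: "0 \<le> t"
  have "(\<Sum>i\<in>{n}. t ^ i /\<^sub>R fact i) \<le> (\<Sum>i. t ^ i /\<^sub>R fact i)"
    using t sums_summable[OF exp_converges[of t]] by (intro sum_le_suminf) auto
  then show ?thesis using sums_unique[OF exp_converges[of t]] by (simp add: field_simps)
qed

lemma integral_sum_list:
  fixes f :: "'i \<Rightarrow> ('h \<Rightarrow> real) \<Rightarrow> real"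
  assumes "\<And>i. i \<in> set is \<Longrightarrow> integrable \<mu> (f i)"
  shows "integrable \<mu> (\<lambda>x. sum_list (map (\<lambda>i. f i x) is))"
    and "(\<integral>x. sum_list (map (\<lambda>i. f i x) is) \<partial>\<mu>) = sum_list (map (\<lambda>i. \<integral>x. f i x \<partial>\<mu>) is)"
proof -
  have "integrable \<mu> (\<lambda>x. sum_list (map (\<lambda>i. f i x) is)) \<and>
      (\<integral>x. sum_list (map (\<lambda>i. f i x) is) \<partial>\<mu>) = sum_list (map (\<lambda>i. \<integral>x. f i x \<partial>\<mu>) is)"
    using assms by (induction "is") auto
  then show "integrable \<mu> (\<lambda>x. sum_list (map (\<lambda>i. f i x) is))"
    "(\<integral>x. sum_list (map (\<lambda>i. f i x) is) \<partial>\<mu>) = sum_list (map (\<lambda>i. \<integral>x. f i x \<partial>\<mu>) is)" by auto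
qed

lemma measurable_prod_pairing:
  assumes "set \<theta>s \<subseteq> NC"
  shows "(\<lambda>x. prod_list (map (\<lambda>\<theta>. pairing x \<theta>) \<theta>s)) \<in> borel_measurable \<mu>"
  using assms by (induction \<theta>s) (auto intro!: borel_measurable_times measurable_pairing)

lemma prod_list_cpnorm_nonneg: "0 \<le> prod_list (map (cpnorm p) \<theta>s)"
  by (induction \<theta>s) (auto intro: mult_nonneg_nonneg cpnorm_nonneg)

text \<open>Mixed moments are needed, with a bound that is a product of norms. Each vector is first
  rescaled to norm \<open>\<delta>\<close>, after which the product of pairings is dominated by a
  sum of exponentials.\<close>

lemma moment_bound:
  assumes eb: "exp_bound p \<delta> K"
  shows "\<exists>D\<ge>0. \<forall>\<theta>s. length \<theta>s = n \<longrightarrow> set \<theta>s \<subseteq> NC \<longrightarrow>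
    integrable \<mu> (\<lambda>x. prod_list (map (\<lambda>\<theta>. pairing x \<theta>) \<theta>s)) \<and>
    (\<integral>x. cmod (prod_list (map (\<lambda>\<theta>. pairing x \<theta>) \<theta>s)) \<partial>\<mu>) \<le> D * prod_list (map (cpnorm p) \<theta>s)"
proof -
  have \<delta>: "0 < \<delta>" and K: "0 \<le> K" using eb by (auto simp: exp_bound_def)
  \<comment> \<open>The numerator bounds the integral of the dominating function: 1 from
    \<open>prod_list_le_sum_powers\<close> and \<open>n\<close> terms of size
    \<open>fact n * K\<close> from \<open>exp_lower_bound\<close>. The rescaling contributes the
    denominator.\<close>
  define D where "D = (1 + real n * (fact n * K)) / \<delta> ^ n"
  have D: "0 \<le> D" using \<delta> K by (simp add: D_def)
  have main: "integrable \<mu> (\<lambda>x. prod_list (map (\<lambda>\<theta>. pairing x \<theta>) \<theta>s)) \<and>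
      (\<integral>x. cmod (prod_list (map (\<lambda>\<theta>. pairing x \<theta>) \<theta>s)) \<partial>\<mu>) \<le> D * prod_list (map (cpnorm p) \<theta>s)"
    if \<theta>s: "length \<theta>s = n" "set \<theta>s \<subseteq> NC" for \<theta>s
  proof (cases "\<exists>\<theta>\<in>set \<theta>s. cpnorm p \<theta> = 0")
    case True
    \<comment> \<open>A vector of norm zero cannot be rescaled, but it is the zero vector and makes
      the product vanish.\<close>
    then have "0 \<in> set \<theta>s" using cpnorm_eq_0 \<theta>s by blast
    then have z: "prod_list (map (\<lambda>\<theta>. pairing x \<theta>) \<theta>s) = 0" if "x \<in> space \<mu>" for x
      using that by (auto simp: prod_list_zero_iff space_\<mu> pairing_zero image_iff intro!: bexI[of _ 0])
    have "integrable \<mu> (\<lambda>x. prod_list (map (\<lambda>\<theta>. pairing x \<theta>) \<theta>s))"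
      using z by (simp cong: Bochner_Integration.integrable_cong)
    moreover have "(\<integral>x. cmod (prod_list (map (\<lambda>\<theta>. pairing x \<theta>) \<theta>s)) \<partial>\<mu>) = 0"
      using z by (simp cong: Bochner_Integration.integral_cong)
    ultimately show ?thesis using D prod_list_cpnorm_nonneg by simp
  next
    case False
    define u where "u \<theta> = (\<delta> / cpnorm p \<theta>) *\<^sub>R \<theta>" for \<theta>
    have u: "u \<theta> \<in> NC" "cpnorm p (u \<theta>) \<le> \<delta>" "0 < cpnorm p \<theta>" if "\<theta> \<in> set \<theta>s" for \<theta>
    proof -
      have nc: "\<theta> \<in> NC" using that \<theta>s by auto
      show pos: "0 < cpnorm p \<theta>" using that False cpnorm_nonneg[of p \<theta>] by fastforce
      show "u \<theta> \<in> NC" using nc by (simp add: u_def NC_scaleR)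
      show "cpnorm p (u \<theta>) \<le> \<delta>" using pos \<delta> by (simp add: u_def cpnorm_scaleR[OF nc])
    qed
    have int: "integrable \<mu> (\<lambda>x. exp (cmod (pairing x (u \<theta>))))" "(\<integral>x. exp (cmod (pairing x (u \<theta>))) \<partial>\<mu>) \<le> K"
      if "\<theta> \<in> set \<theta>s" for \<theta>
      using eb u[OF that] by (auto simp: exp_bound_def)
    define g where "g x = 1 + sum_list (map (\<lambda>\<theta>. fact n * exp (cmod (pairing x (u \<theta>)))) \<theta>s)" for x
    have gi: "integrable \<mu> g"
      unfolding g_def using int
      by (intro Bochner_Integration.integrable_add integral_sum_list(1)) auto
    have "(\<integral>x. g x \<partial>\<mu>) = 1 + sum_list (map (\<lambda>\<theta>. fact n * (\<integral>x. exp (cmod (pairing x (u \<theta>))) \<partial>\<mu>)) \<theta>s)"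
      unfolding g_def using int by (subst Bochner_Integration.integral_add)
        (auto intro!: integral_sum_list(1) simp: integral_sum_list(2) prob_space)
    also have "\<dots> \<le> 1 + sum_list (map (\<lambda>\<theta>. fact n * K) \<theta>s)"
      using int by (intro add_left_mono sum_list_mono mult_left_mono) auto
    finally have gb: "(\<integral>x. g x \<partial>\<mu>) \<le> 1 + real n * (fact n * K)"
      using \<theta>s by (simp add: sum_list_triv)
    let ?P = "prod_list (map (cpnorm p) \<theta>s)"
    have le: "cmod (prod_list (map (\<lambda>\<theta>. pairing x \<theta>) \<theta>s)) \<le> ?P / \<delta> ^ n * g x" if x: "x \<in> space \<mu>" for x
    proof -
      have eq: "cmod (prod_list (map (\<lambda>\<theta>. pairing x \<theta>) zs)) =
          prod_list (map (cpnorm p) zs) / \<delta> ^ length zs * prod_list (map (\<lambda>\<theta>. cmod (pairing x (u \<theta>))) zs)"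
        if "set zs \<subseteq> set \<theta>s" for zs
        using that
      proof (induction zs)
        case (Cons z zs)
        have "pairing x (u z) = complex_of_real (\<delta> / cpnorm p z) * pairing x z"
          unfolding u_def using Cons.prems \<theta>s x by (intro pairing_scaleR) (auto simp: space_\<mu>)
        then have "cmod (pairing x z) = cpnorm p z / \<delta> * cmod (pairing x (u z))"
          using u(3)[of z] Cons.prems \<delta> by (simp add: norm_mult norm_divide)
        then show ?case using Cons by (simp add: norm_mult)
      qed simp
      have "prod_list (map (\<lambda>\<theta>. cmod (pairing x (u \<theta>))) \<theta>s) \<le>
          1 + sum_list (map (\<lambda>y. y ^ length (map (\<lambda>\<theta>. cmod (pairing x (u \<theta>))) \<theta>s)) (map (\<lambda>\<theta>. cmod (pairing x (u \<theta>))) \<theta>s))"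
        by (rule prod_list_le_sum_powers) auto
      also have "\<dots> \<le> g x"
        unfolding g_def map_map comp_def length_map \<theta>s(1) by (intro add_left_mono sum_list_mono exp_lower_bound) auto
      finally show ?thesis
        using eq[of \<theta>s] \<theta>s \<delta> prod_list_cpnorm_nonneg[of p \<theta>s]
        by (simp add: mult_left_mono divide_right_mono)
    qed
    have meas: "(\<lambda>x. prod_list (map (\<lambda>\<theta>. pairing x \<theta>) \<theta>s)) \<in> borel_measurable \<mu>"
      by (rule measurable_prod_pairing[OF \<theta>s(2)])
    have gi': "integrable \<mu> (\<lambda>x. ?P / \<delta> ^ n * g x)" using gi by simp
    have int': "integrable \<mu> (\<lambda>x. prod_list (map (\<lambda>\<theta>. pairing x \<theta>) \<theta>s))"
      by (rule Bochner_Integration.integrable_bound[OF gi' meas AE_I2])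
         (metis le abs_ge_self order_trans real_norm_def)
    have "(\<integral>x. cmod (prod_list (map (\<lambda>\<theta>. pairing x \<theta>) \<theta>s)) \<partial>\<mu>) \<le> (\<integral>x. ?P / \<delta> ^ n * g x \<partial>\<mu>)"
      by (rule integral_mono[OF integrable_norm[OF int'] gi' le])
    also have "\<dots> \<le> ?P / \<delta> ^ n * (1 + real n * (fact n * K))"
      using gb \<delta> prod_list_cpnorm_nonneg[of p \<theta>s] by (simp add: mult_left_mono divide_right_mono)
    also have "\<dots> = D * ?P" by (simp add: D_def)
    finally show ?thesis using int' by simp
  qed
  then show ?thesis using D by blast
qed

end

subsection \<open>Moment functionals\<close>

lemma infsum_Cauchy_Schwarz:
  fixes f g :: "'a \<Rightarrow> complex"
  assumes f: "infsum (\<lambda>x. ennreal ((cmod (f x))\<^sup>2)) A \<le> ennreal (s\<^sup>2)" "0 \<le> s"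
    and g: "infsum (\<lambda>x. ennreal ((cmod (g x))\<^sup>2)) A \<le> ennreal (t\<^sup>2)" "0 \<le> t"
  shows "(\<lambda>x. f x * g x) summable_on A" "cmod (infsum (\<lambda>x. f x * g x) A) \<le> s * t"
proof -
  have sq: "(\<Sum>x\<in>F. (cmod (h x))\<^sup>2) \<le> r\<^sup>2"
    if "infsum (\<lambda>x. ennreal ((cmod (h x))\<^sup>2)) A \<le> ennreal (r\<^sup>2)" "finite F" "F \<subseteq> A"
    for h :: "'a \<Rightarrow> complex" and r F
    using order_trans[OF sum_le_infsum_ennreal[OF that(2,3)] that(1)] by simp
  have fin: "(\<Sum>x\<in>F. cmod (f x * g x)) \<le> s * t" if F: "finite F" "F \<subseteq> A" for F
  proof -
    have "(\<Sum>x\<in>F. cmod (f x * g x)) \<le> sqrt (\<Sum>x\<in>F. (cmod (f x))\<^sup>2) * sqrt (\<Sum>x\<in>F. (cmod (g x))\<^sup>2)"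
      using L2_set_mult_ineq[of "\<lambda>x. cmod (f x)" "\<lambda>x. cmod (g x)" F] by (simp add: L2_set_def norm_mult)
    also have "\<dots> \<le> s * t"
      using sq[OF f(1) F] sq[OF g(1) F] f(2) g(2)
      by (intro mult_mono) (auto simp: real_le_lsqrt sum_nonneg)
    finally show ?thesis .
  qed
  have abs: "(\<lambda>x. cmod (f x * g x)) summable_on A"
    using fin by (intro nonneg_bdd_above_summable_on) (auto intro!: bdd_aboveI2)
  then show "(\<lambda>x. f x * g x) summable_on A" by (rule Infinite_Sum.abs_summable_summable)
  have "cmod (infsum (\<lambda>x. f x * g x) A) \<le> infsum (\<lambda>x. cmod (f x * g x)) A"
    by (rule norm_infsum_bound[OF abs])
  also have "\<dots> \<le> s * t" by (rule infsum_le_finite_sums[OF abs fin])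
  finally show "cmod (infsum (\<lambda>x. f x * g x) A) \<le> s * t" .
qed

lemma infsum_nlists_prod_le:
  fixes f :: "'a \<Rightarrow> real"
  assumes "\<And>e. 0 \<le> f e"
  shows "infsum (\<lambda>es. ennreal (prod_list (map f es))) (nlists n B) \<le> (infsum (\<lambda>e. ennreal (f e)) B) ^ n"
proof (induction n)
  case (Suc n)
  have "infsum (\<lambda>es. ennreal (prod_list (map f es))) (nlists (Suc n) B) =
      infsum (\<lambda>e. infsum (\<lambda>es. ennreal (f e) * ennreal (prod_list (map f es))) (nlists n B)) B"
    using assms by (simp add: infsum_nlists_Suc ennreal_mult')
  also have "\<dots> \<le> infsum (\<lambda>e. infsum (\<lambda>e. ennreal (f e)) B ^ n * ennreal (f e)) B"
  proof (intro infsum_ennreal_mono)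
    fix e
    have "infsum (\<lambda>es. ennreal (f e) * ennreal (prod_list (map f es))) (nlists n B) \<le>
        ennreal (f e) * infsum (\<lambda>es. ennreal (prod_list (map f es))) (nlists n B)"
      by (rule infsum_ennreal_cmult_le)
    also have "\<dots> \<le> ennreal (f e) * infsum (\<lambda>e. ennreal (f e)) B ^ n"
      by (intro mult_left_mono Suc.IH) simp
    finally show "infsum (\<lambda>es. ennreal (f e) * ennreal (prod_list (map f es))) (nlists n B) \<le>
        infsum (\<lambda>e. ennreal (f e)) B ^ n * ennreal (f e)" by (simp add: mult.commute)
  qed
  also have "\<dots> \<le> infsum (\<lambda>e. ennreal (f e)) B ^ n * infsum (\<lambda>e. ennreal (f e)) B"
    by (rule infsum_ennreal_cmult_le)
  finally show ?case by (simp add: mult.commute)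
qed simp

context nuclear_measure
begin

definition mixed_moment :: "('h \<times> 'h) list \<Rightarrow> complex" where
  "mixed_moment \<theta>s = (\<integral>x. prod_list (map (\<lambda>\<theta>. pairing x \<theta>) \<theta>s) \<partial>\<mu>)"

lemma integrable_prod_pairing:
  "set \<theta>s \<subseteq> NC \<Longrightarrow> integrable \<mu> (\<lambda>x. prod_list (map (\<lambda>\<theta>. pairing x \<theta>) \<theta>s))"
proof -
  assume \<theta>s: "set \<theta>s \<subseteq> NC"
  obtain p \<delta> K where "exp_bound p \<delta> K" using exp_bound_exists by blast
  from moment_bound[OF this, of "length \<theta>s"] show ?thesis using \<theta>s by blast
qed

lemma mixed_moment_bound:
  assumes "exp_bound p \<delta> K"
  obtains D where "0 \<le> D"
    "\<And>\<theta>s. length \<theta>s = n \<Longrightarrow> set \<theta>s \<subseteq> NC \<Longrightarrow> cmod (mixed_moment \<theta>s) \<le> D * prod_list (map (cpnorm p) \<theta>s)"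
proof -
  obtain D where D: "0 \<le> D" "\<And>\<theta>s. length \<theta>s = n \<Longrightarrow> set \<theta>s \<subseteq> NC \<Longrightarrow>
      (\<integral>x. cmod (prod_list (map (\<lambda>\<theta>. pairing x \<theta>) \<theta>s)) \<partial>\<mu>) \<le> D * prod_list (map (cpnorm p) \<theta>s)"
    using moment_bound[OF assms, of n] by blast
  have "cmod (mixed_moment \<theta>s) \<le> D * prod_list (map (cpnorm p) \<theta>s)"
    if "length \<theta>s = n" "set \<theta>s \<subseteq> NC" for \<theta>s
    unfolding mixed_moment_def by (rule order_trans[OF integral_norm_bound D(2)[OF that]])
  then show ?thesis using that D(1) by blast
qed

lemma mixed_moment_mset: "mset \<theta>s = mset \<theta>s' \<Longrightarrow> mixed_moment \<theta>s = mixed_moment \<theta>s'"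
  unfolding mixed_moment_def by (simp flip: prod_mset_prod_list)

text \<open>The Fourier expansion of one argument is pulled out of the integral: the mixed moment is
  bounded in that argument by its norm of index \<open>p\<close>, and the remainder tends to zero
  already in the larger norm of index \<open>q\<close>.\<close>

lemma mixed_moment_has_sum:
  assumes eb: "exp_bound p \<delta> K" and pq: "p \<le> q" and \<theta>: "\<theta> \<in> NC" and \<theta>s: "set \<theta>s \<subseteq> NC"
  shows "((\<lambda>e. pairing (riesz q e) \<theta> * mixed_moment ((e, 0) # \<theta>s)) has_sum mixed_moment (\<theta> # \<theta>s)) (onbN q)"
proof -
  obtain D where D: "0 \<le> D" "\<And>\<theta>s'. length \<theta>s' = Suc (length \<theta>s) \<Longrightarrow> set \<theta>s' \<subseteq> NC \<Longrightarrow>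
      cmod (mixed_moment \<theta>s') \<le> D * prod_list (map (cpnorm p) \<theta>s')"
    using mixed_moment_bound[OF eb, of "Suc (length \<theta>s)"] by blast
  \<comment> \<open>The remainder of the expansion, separately for the real and the imaginary
    part.\<close>
  define r where "r J = (fst \<theta> - (\<Sum>e\<in>J. ip q e (fst \<theta>) *\<^sub>R e), snd \<theta> - (\<Sum>e\<in>J. ip q e (snd \<theta>) *\<^sub>R e))" for J
  let ?P = "prod_list (map (cpnorm p) \<theta>s)"
  have "((\<lambda>J. H.nrm q (\<xi> - (\<Sum>e\<in>J. ip q e \<xi> *\<^sub>R e))) \<longlongrightarrow> 0) (finite_subsets_at_top (onbN q))" if "\<xi> \<in> N" for \<xi>
    by (rule H.onb_expansion_converges[OF onbN(2) N_Hp[OF that]])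
  note lim = this[OF NC_D(1)[OF \<theta>]] this[OF NC_D(2)[OF \<theta>]]
  have "((\<lambda>J. sqrt ((H.nrm q (fst (r J)))\<^sup>2 + (H.nrm q (snd (r J)))\<^sup>2)) \<longlongrightarrow> sqrt (0\<^sup>2 + 0\<^sup>2)) (finite_subsets_at_top (onbN q))"
    unfolding r_def fst_conv snd_conv by (intro tendsto_intros lim)
  then have "((\<lambda>J. cpnorm q (r J)) \<longlongrightarrow> 0) (finite_subsets_at_top (onbN q))"
    by (simp add: cpnorm_def pnorm_eq_nrm)
  then have "((\<lambda>J. D * (cpnorm q (r J) * ?P)) \<longlongrightarrow> D * (0 * ?P)) (finite_subsets_at_top (onbN q))"
    by (intro tendsto_intros)
  then have lim0: "((\<lambda>J. D * (cpnorm q (r J) * ?P)) \<longlongrightarrow> 0) (finite_subsets_at_top (onbN q))" by simp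
  have ev: "\<forall>\<^sub>F J in finite_subsets_at_top (onbN q).
      cmod ((\<Sum>e\<in>J. pairing (riesz q e) \<theta> * mixed_moment ((e, 0) # \<theta>s)) - mixed_moment (\<theta> # \<theta>s)) \<le>
      D * (cpnorm q (r J) * ?P)"
  proof (rule eventually_finite_subsets_at_top_weakI)
    fix J assume J: "finite J" "J \<subseteq> onbN q"
    have JN: "J \<subseteq> N" using J onbN(1) by blast
    have sN: "(\<Sum>e\<in>J. ip q e \<xi> *\<^sub>R e) \<in> N" for \<xi>
      using JN by (intro N_sum N_scale) auto
    have rN: "r J \<in> NC" using NC_D[OF \<theta>] sN by (auto simp: r_def NC_def intro: N_diff)
    have eN: "(e, 0) \<in> NC" if "e \<in> J" for e using that JN NC_real by blast
    have "pairing x (r J) = pairing x \<theta> - (\<Sum>e\<in>J. pairing (riesz q e) \<theta> * pairing x (e, 0))"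
      if x: "x \<in> space \<mu>" for x
    proof -
      obtain t where t: "x \<in> Hneg t" using x by (auto simp: space_\<mu> N'_def)
      have xs: "x (\<xi> - (\<Sum>e\<in>J. ip q e \<xi> *\<^sub>R e)) = x \<xi> - (\<Sum>e\<in>J. ip q e \<xi> * x e)" if "\<xi> \<in> N" for \<xi>
        using Hneg_diff[OF t that sN] Hneg_sum[OF t J(1), of "\<lambda>e. e"] JN by (simp add: subset_iff)
      show ?thesis
        using NC_D[OF \<theta>] x
        by (simp add: complex_eq_iff pairing_def r_def xs riesz_def Hneg_zero[OF t] Re_sum Im_sum)
    qed
    then have pt: "prod_list (map (\<lambda>\<theta>. pairing x \<theta>) (r J # \<theta>s)) =
        prod_list (map (\<lambda>\<theta>. pairing x \<theta>) (\<theta> # \<theta>s)) -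
        (\<Sum>e\<in>J. pairing (riesz q e) \<theta> * prod_list (map (\<lambda>\<theta>. pairing x \<theta>) ((e, 0) # \<theta>s)))"
      if "x \<in> space \<mu>" for x
      using that by (simp add: left_diff_distrib sum_distrib_right mult.assoc)
    have ii: "integrable \<mu> (\<lambda>x. prod_list (map (\<lambda>\<theta>. pairing x \<theta>) (\<theta>' # \<theta>s)))" if "\<theta>' \<in> NC" for \<theta>'
      using that \<theta>s by (intro integrable_prod_pairing) auto
    have "mixed_moment (r J # \<theta>s) = (\<integral>x. prod_list (map (\<lambda>\<theta>. pairing x \<theta>) (\<theta> # \<theta>s)) -
        (\<Sum>e\<in>J. pairing (riesz q e) \<theta> * prod_list (map (\<lambda>\<theta>. pairing x \<theta>) ((e, 0) # \<theta>s))) \<partial>\<mu>)"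
      unfolding mixed_moment_def by (intro Bochner_Integration.integral_cong refl pt)
    also have "\<dots> = mixed_moment (\<theta> # \<theta>s) - (\<Sum>e\<in>J. pairing (riesz q e) \<theta> * mixed_moment ((e, 0) # \<theta>s))"
      unfolding mixed_moment_def using ii[OF \<theta>] ii[OF eN]
      by (subst Bochner_Integration.integral_diff) (auto simp del: prod_list.Cons list.map)
    finally have "cmod ((\<Sum>e\<in>J. pairing (riesz q e) \<theta> * mixed_moment ((e, 0) # \<theta>s)) - mixed_moment (\<theta> # \<theta>s)) =
        cmod (mixed_moment (r J # \<theta>s))"
      by (simp add: norm_minus_commute)
    also have "\<dots> \<le> D * (cpnorm p (r J) * ?P)" using D(2)[of "r J # \<theta>s"] rN \<theta>s by simp
    also have "\<dots> \<le> D * (cpnorm q (r J) * ?P)"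
      by (intro mult_left_mono mult_right_mono cpnorm_mono pq rN D prod_list_cpnorm_nonneg)
    finally show "cmod ((\<Sum>e\<in>J. pairing (riesz q e) \<theta> * mixed_moment ((e, 0) # \<theta>s)) - mixed_moment (\<theta> # \<theta>s)) \<le>
        D * (cpnorm q (r J) * ?P)" .
  qed
  show ?thesis
    unfolding has_sum_def by (rule LIM_zero_cancel) (rule Lim_null_comparison[OF ev lim0])
qed

text \<open>The bound on mixed moments factors over the basis vectors, so the sum of squares is at
  most a constant times the \<open>n\<close>-th power of the Hilbert-Schmidt sum.\<close>

lemma mixed_moment_hs:
  assumes eb: "exp_bound p \<delta> K"
    and hs: "infsum (\<lambda>e. ennreal ((pnorm p e)\<^sup>2)) (onbN q) < \<infinity>" and \<theta>s: "set \<theta>s \<subseteq> NC"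
  obtains t where "0 \<le> t"
    "infsum (\<lambda>es. ennreal ((cmod (mixed_moment (map (\<lambda>e. (e, 0)) es @ \<theta>s)))\<^sup>2)) (nlists n (onbN q)) \<le> ennreal (t\<^sup>2)"
proof -
  obtain D where D: "0 \<le> D" "\<And>\<theta>s'. length \<theta>s' = n + length \<theta>s \<Longrightarrow> set \<theta>s' \<subseteq> NC \<Longrightarrow>
      cmod (mixed_moment \<theta>s') \<le> D * prod_list (map (cpnorm p) \<theta>s')"
    using mixed_moment_bound[OF eb, of "n + length \<theta>s"] by blast
  let ?P = "prod_list (map (cpnorm p) \<theta>s)" and ?S = "infsum (\<lambda>e. ennreal ((pnorm p e)\<^sup>2)) (onbN q)"
  have "infsum (\<lambda>es. ennreal ((cmod (mixed_moment (map (\<lambda>e. (e, 0)) es @ \<theta>s)))\<^sup>2)) (nlists n (onbN q)) \<le>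
      infsum (\<lambda>es. ennreal ((D * ?P)\<^sup>2) * ennreal (prod_list (map (\<lambda>e. (pnorm p e)\<^sup>2) es))) (nlists n (onbN q))"
  proof (intro infsum_ennreal_mono)
    fix es assume es: "es \<in> nlists n (onbN q)"
    have eN: "set es \<subseteq> N" "length es = n" using es onbN(1) by (auto simp: nlists_def)
    have "cmod (mixed_moment (map (\<lambda>e. (e, 0)) es @ \<theta>s)) \<le> D * prod_list (map (cpnorm p) (map (\<lambda>e. (e, 0)) es @ \<theta>s))"
      using eN \<theta>s NC_real by (intro D(2)) auto
    also have "\<dots> = D * ?P * prod_list (map (\<lambda>e. \<bar>pnorm p e\<bar>) es)"
      by (simp add: comp_def cpnorm_real)
    finally have "(cmod (mixed_moment (map (\<lambda>e. (e, 0)) es @ \<theta>s)))\<^sup>2 \<le> (D * ?P * prod_list (map (\<lambda>e. \<bar>pnorm p e\<bar>) es))\<^sup>2"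
      by (intro power_mono) auto
    also have "\<dots> = (D * ?P)\<^sup>2 * (prod_list (map (\<lambda>e. \<bar>pnorm p e\<bar>) es))\<^sup>2" by (rule power_mult_distrib)
    also have "(prod_list (map (\<lambda>e. \<bar>pnorm p e\<bar>) es))\<^sup>2 = prod_list (map (\<lambda>e. (pnorm p e)\<^sup>2) es)"
      by (induction es) (auto simp: power_mult_distrib)
    finally show "ennreal ((cmod (mixed_moment (map (\<lambda>e. (e, 0)) es @ \<theta>s)))\<^sup>2) \<le>
        ennreal ((D * ?P)\<^sup>2) * ennreal (prod_list (map (\<lambda>e. (pnorm p e)\<^sup>2) es))"
      by (simp add: ennreal_leI flip: ennreal_mult')
  qed
  also have "\<dots> \<le> ennreal ((D * ?P)\<^sup>2) * infsum (\<lambda>es. ennreal (prod_list (map (\<lambda>e. (pnorm p e)\<^sup>2) es))) (nlists n (onbN q))"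
    by (rule infsum_ennreal_cmult_le)
  also have "\<dots> \<le> ennreal ((D * ?P)\<^sup>2) * ?S ^ n"
    by (intro mult_left_mono infsum_nlists_prod_le) auto
  also have "\<dots> = ennreal ((D * ?P)\<^sup>2 * enn2real ?S ^ n)"
    using hs by (simp add: ennreal_mult ennreal_power[symmetric])
  also have "\<dots> = ennreal ((sqrt ((D * ?P)\<^sup>2 * enn2real ?S ^ n))\<^sup>2)" by simp
  finally show ?thesis
    by (rule that[rotated]) (simp add: enn2real_nonneg)
qed

text \<open>One argument after another is expanded along the basis. During the induction the vectors
  not being expanded are parked in \<open>\<theta>s\<close>.\<close>

lemma moment_expand:
  assumes eb: "exp_bound p \<delta> K" and pq: "p \<le> q"
    and hs: "infsum (\<lambda>e. ennreal ((pnorm p e)\<^sup>2)) (onbN q) < \<infinity>" and \<theta>: "\<theta> \<in> NC" and \<theta>s: "set \<theta>s \<subseteq> NC"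
  shows "infsum (\<lambda>es. tensor_power n \<theta> (map (riesz q) es) * mixed_moment (map (\<lambda>e. (e, 0)) es @ \<theta>s)) (nlists n (onbN q)) =
    mixed_moment (replicate n \<theta> @ \<theta>s)"
  using \<theta>s
proof (induction n arbitrary: \<theta>s)
  case 0
  then show ?case by (simp add: tensor_power_def)
next
  case (Suc n)
  let ?B = "onbN q"
  let ?f = "\<lambda>es. tensor_power (Suc n) \<theta> (map (riesz q) es) * mixed_moment (map (\<lambda>e. (e, 0)) es @ \<theta>s)"
  have BH: "e \<in> Hp q" "e \<in> N" if "e \<in> ?B" for e using that onbN(1) N_Hp by auto
  obtain t where t: "0 \<le> t" "infsum (\<lambda>es. ennreal ((cmod (mixed_moment (map (\<lambda>e. (e, 0)) es @ \<theta>s)))\<^sup>2)) (nlists (Suc n) ?B) \<le> ennreal (t\<^sup>2)"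
    using mixed_moment_hs[OF eb hs Suc.prems] by blast
  have "infsum (\<lambda>es. ennreal ((cmod (tensor_power (Suc n) \<theta> (map (riesz q) es)))\<^sup>2)) (nlists (Suc n) ?B) \<le>
      ennreal ((tnorm q (Suc n) (tensor_power (Suc n) \<theta>))\<^sup>2)"
    using hs_sum_NC_tensor[OF tensor_power_NC_tensor(1)[OF \<theta>] onbN(2), of q "Suc n"] by (simp add: hs_sum_def)
  \<comment> \<open>Summability of the whole family is what allows it to be summed iteratively
    below.\<close>
  then have "?f summable_on nlists (Suc n) ?B"
    by (rule infsum_Cauchy_Schwarz(1)[OF _ tnorm_nonneg t(2,1)])
  then have sm: "(\<lambda>(e, es). ?f (e # es)) summable_on (?B \<times> nlists n ?B)"
    by (subst (asm) summable_on_reindex_bij_betw[OF bij_betw_Cons_nlists, symmetric]) (simp add: case_prod_unfold)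
  have "infsum ?f (nlists (Suc n) ?B) = infsum (\<lambda>(e, es). ?f (e # es)) (?B \<times> nlists n ?B)"
    by (subst infsum_reindex_bij_betw[OF bij_betw_Cons_nlists, symmetric]) (simp add: case_prod_unfold)
  also have "\<dots> = infsum (\<lambda>e. infsum (\<lambda>es. ?f (e # es)) (nlists n ?B)) ?B"
    by (rule infsum_Sigma'_banach[OF sm, symmetric])
  also have "\<dots> = infsum (\<lambda>e. pairing (riesz q e) \<theta> * mixed_moment ((e, 0) # replicate n \<theta> @ \<theta>s)) ?B"
  proof (intro infsum_cong)
    fix e assume e: "e \<in> ?B"
    have "?f (e # es) = pairing (riesz q e) \<theta> *
        (tensor_power n \<theta> (map (riesz q) es) * mixed_moment (map (\<lambda>e. (e, 0)) es @ (e, 0) # \<theta>s))" for es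
    proof -
      have "mixed_moment ((e, 0) # map (\<lambda>e. (e, 0)) es @ \<theta>s) = mixed_moment (map (\<lambda>e. (e, 0)) es @ (e, 0) # \<theta>s)"
        by (rule mixed_moment_mset) simp
      then show ?thesis using tensor_power_Cons[OF riesz_N'[OF BH(1)[OF e]]] by simp
    qed
    then have "infsum (\<lambda>es. ?f (e # es)) (nlists n ?B) = pairing (riesz q e) \<theta> *
        infsum (\<lambda>es. tensor_power n \<theta> (map (riesz q) es) * mixed_moment (map (\<lambda>e. (e, 0)) es @ (e, 0) # \<theta>s)) (nlists n ?B)"
      by (simp add: infsum_cmult_right')
    also have "\<dots> = pairing (riesz q e) \<theta> * mixed_moment (replicate n \<theta> @ (e, 0) # \<theta>s)"
      using Suc.IH[of "(e, 0) # \<theta>s"] Suc.prems NC_real[OF BH(2)[OF e]] by simp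
    also have "mixed_moment (replicate n \<theta> @ (e, 0) # \<theta>s) = mixed_moment ((e, 0) # replicate n \<theta> @ \<theta>s)"
      by (rule mixed_moment_mset) simp
    finally show "infsum (\<lambda>es. ?f (e # es)) (nlists n ?B) =
        pairing (riesz q e) \<theta> * mixed_moment ((e, 0) # replicate n \<theta> @ \<theta>s)" .
  qed
  also have "\<dots> = mixed_moment (\<theta> # replicate n \<theta> @ \<theta>s)"
    using Suc.prems \<theta> by (intro infsumI mixed_moment_has_sum[OF eb pq]) auto
  finally show ?case by simp
qed

text \<open>
  The functional is defined by its series over an orthonormal basis in \<open>N\<close>; the Hilbert--Schmidt
  embedding makes the mixed moments square summable.
\<close>

lemma moment_functional_exists:
  "\<exists>q. \<forall>n. \<exists>F\<in>Hneg_tensor q n. \<forall>\<theta>\<in>NC. F (tensor_power n \<theta>) = (\<integral>x. pairing x \<theta> ^ n \<partial>\<mu>)"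
proof -
  obtain p \<delta> K where eb: "exp_bound p \<delta> K" using exp_bound_exists by blast
  obtain q where q: "p < q" "infsum (\<lambda>e. ennreal ((pnorm p e)\<^sup>2)) (onbN q) < \<infinity>"
    using hilbert_schmidt_onbN[of p] by blast
  let ?B = "onbN q"
  have "\<exists>F\<in>Hneg_tensor q n. \<forall>\<theta>\<in>NC. F (tensor_power n \<theta>) = (\<integral>x. pairing x \<theta> ^ n \<partial>\<mu>)" for n
  proof -
    obtain t where t: "0 \<le> t" "infsum (\<lambda>es. ennreal ((cmod (mixed_moment (map (\<lambda>e. (e, 0)) es @ [])))\<^sup>2)) (nlists n ?B) \<le> ennreal (t\<^sup>2)"
      using mixed_moment_hs[OF eb q(2), of "[]"] by auto
    let ?f = "\<lambda>\<kappa> es. \<kappa> (map (riesz q) es) * mixed_moment (map (\<lambda>e. (e, 0)) es @ [])"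
    define F where "F \<kappa> = (if \<kappa> \<in> NC_tensor n then infsum (?f \<kappa>) (nlists n ?B) else 0)" for \<kappa>
    have CS: "?f \<kappa> summable_on nlists n ?B" "cmod (infsum (?f \<kappa>) (nlists n ?B)) \<le> tnorm q n \<kappa> * t"
      if \<kappa>: "\<kappa> \<in> NC_tensor n" for \<kappa>
    proof -
      have "infsum (\<lambda>es. ennreal ((cmod (\<kappa> (map (riesz q) es)))\<^sup>2)) (nlists n ?B) \<le> ennreal ((tnorm q n \<kappa>)\<^sup>2)"
        using hs_sum_NC_tensor[OF \<kappa> onbN(2)] by (simp add: hs_sum_def)
      from infsum_Cauchy_Schwarz[OF this tnorm_nonneg t(2,1)]
      show "?f \<kappa> summable_on nlists n ?B" "cmod (infsum (?f \<kappa>) (nlists n ?B)) \<le> tnorm q n \<kappa> * t" by auto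
    qed
    have "F \<in> Hneg_tensor q n"
    proof (rule Hneg_tensorI[where C = t])
      fix \<kappa> \<kappa>' a b assume \<kappa>: "\<kappa> \<in> NC_tensor n" "\<kappa>' \<in> NC_tensor n"
      have "infsum (?f (\<lambda>xs. a * \<kappa> xs + b * \<kappa>' xs)) (nlists n ?B) =
          infsum (\<lambda>es. a * ?f \<kappa> es + b * ?f \<kappa>' es) (nlists n ?B)"
        by (simp add: algebra_simps)
      also have "\<dots> = a * infsum (?f \<kappa>) (nlists n ?B) + b * infsum (?f \<kappa>') (nlists n ?B)"
        using CS(1)[OF \<kappa>(1)] CS(1)[OF \<kappa>(2)]
        by (subst infsum_add) (auto intro!: summable_on_cmult_right simp: infsum_cmult_right')
      finally show "F (\<lambda>xs. a * \<kappa> xs + b * \<kappa>' xs) = a * F \<kappa> + b * F \<kappa>'"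
        using NC_tensor_lincomb[OF \<kappa>] \<kappa> by (simp add: F_def)
    qed (use CS(2) in \<open>auto simp: F_def mult.commute\<close>)
    moreover have "F (tensor_power n \<theta>) = (\<integral>x. pairing x \<theta> ^ n \<partial>\<mu>)" if \<theta>: "\<theta> \<in> NC" for \<theta>
    proof -
      have "F (tensor_power n \<theta>) = mixed_moment (replicate n \<theta> @ [])"
        using moment_expand[OF eb _ q(2) \<theta>, of "[]"] q(1) tensor_power_NC_tensor(1)[OF \<theta>] by (simp add: F_def)
      then show ?thesis by (simp add: mixed_moment_def prod_list_replicate)
    qed
    ultimately show ?thesis by blast
  qed
  then show ?thesis by blast
qed

end

subsection \<open>The Appell system\<close>

lemma real_powser_coeff_0:
  fixes c :: "nat \<Rightarrow> real"
  assumes r: "0 < r" and z: "\<And>s. \<bar>s\<bar> < r \<Longrightarrow> (\<lambda>n. c n * s ^ n) sums 0"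
  shows "c n = 0"
proof (rule ccontr)
  assume n: "c n \<noteq> 0"
  have "(\<lambda>n. c n * 0 ^ n) sums 0" using z[of 0] r by simp
  then have "c 0 = 0" using powser_sums_zero[of c] sums_unique2 by blast
  then have "n > 0" using n by (cases n) auto
  show False
  proof (rule powser_0_nonzero[of r 0 c "\<lambda>_. 0" n])
    fix s :: real assume "0 < s" and nz: "\<And>z. z \<in> cball (0::real) s - {0} \<Longrightarrow> (0::real) \<noteq> 0"
    then show False using nz[of s] by simp
  qed (use r z n \<open>n > 0\<close> in auto)
qed

lemma powser_coeff_0:
  fixes c :: "nat \<Rightarrow> complex"
  assumes r: "0 < r" and z: "\<And>s. \<bar>s\<bar> < r \<Longrightarrow> (\<lambda>n. c n * complex_of_real (s ^ n)) sums 0"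
  shows "c n = 0"
proof -
  have "Re (c n) = 0"
    using sums_Re[OF z] by (intro real_powser_coeff_0[OF r]) simp
  moreover have "Im (c n) = 0"
    using sums_Im[OF z] by (intro real_powser_coeff_0[OF r]) simp
  ultimately show ?thesis by (simp add: complex_eq_iff)
qed

text \<open>The recursion defines the inverse power series. Its coefficients obey a geometric bound
  with ratio \<open>(1 + K) * t\<close>, proved along the recursion, so the series converges
  absolutely and the Cauchy product can be formed.\<close>

lemma powser_inverse:
  fixes a r :: "nat \<Rightarrow> complex"
  assumes a0: "a 0 = 1" and r0: "r 0 = 1"
    and rec: "\<And>n. 0 < n \<Longrightarrow> r n = - (\<Sum>i<n. r i * a (n - i))"
    and a: "\<And>k. cmod (a k) \<le> K * t ^ k" and t: "0 \<le> t" "(1 + K) * t < 1" and K: "0 \<le> K"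
  shows "summable (\<lambda>n. cmod (r n))" "(\<Sum>n. r n) * (\<Sum>n. a n) = 1"
proof -
  have bound: "cmod (r n) \<le> ((1 + K) * t) ^ n" for n
  proof (induction n rule: less_induct)
    case (less n)
    show ?case
    proof (cases "n = 0")
      case True
      then show ?thesis by (simp add: r0)
    next
      case False
      have "cmod (r n) \<le> (\<Sum>i<n. cmod (r i * a (n - i)))"
        using rec[of n] False norm_sum[of "\<lambda>i. r i * a (n - i)" "{..<n}"] by simp
      also have "\<dots> \<le> (\<Sum>i<n. ((1 + K) * t) ^ i * (K * t ^ (n - i)))"
        using less t K by (intro sum_mono) (auto simp: norm_mult intro!: mult_mono a)
      also have "\<dots> = (\<Sum>i<n. t ^ n * (K * (1 + K) ^ i))"
      proof (intro sum.cong refl)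
        fix i assume "i \<in> {..<n}"
        then have "t ^ n = t ^ i * t ^ (n - i)" by (simp flip: power_add)
        then show "((1 + K) * t) ^ i * (K * t ^ (n - i)) = t ^ n * (K * (1 + K) ^ i)"
          by (simp add: power_mult_distrib)
      qed
      also have "\<dots> = t ^ n * (K * (\<Sum>i<n. (1 + K) ^ i))" by (simp add: sum_distrib_left)
      \<comment> \<open>This geometric sum is the reason for the ratio \<open>1 + K\<close>: it
        makes the induction close with constant one.\<close>
      also have "K * (\<Sum>i<n. (1 + K) ^ i) = (1 + K) ^ n - 1"
        using power_diff_1_eq[of "1 + K" n] by simp
      also have "t ^ n * ((1 + K) ^ n - 1) \<le> ((1 + K) * t) ^ n"
        using t by (simp add: power_mult_distrib right_diff_distrib mult.commute)
      finally show ?thesis .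
    qed
  qed
  have "t \<le> (1 + K) * t" using t K by (simp add: algebra_simps)
  then have t1: "t < 1" using t by linarith
  have "summable (\<lambda>n. ((1 + K) * t) ^ n)" using t K by (intro summable_geometric) auto
  then show sr: "summable (\<lambda>n. cmod (r n))"
    by (rule summable_comparison_test'[where N = 0]) (simp add: bound)
  have "summable (\<lambda>n. K * t ^ n)" using t t1 by (intro summable_mult summable_geometric) auto
  then have sa: "summable (\<lambda>n. cmod (a n))"
    by (rule summable_comparison_test'[where N = 0]) (simp add: a)
  have "(\<Sum>i\<le>n. r i * a (n - i)) = (if n = 0 then 1 else 0)" for n
    using rec[of n] by (cases "n = 0") (auto simp: a0 r0 simp flip: lessThan_Suc_atMost)
  then have "(\<lambda>n. if n = 0 then 1 else 0) sums ((\<Sum>n. r n) * (\<Sum>n. a n))"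
    using Cauchy_product_sums[OF sr sa] by simp
  moreover have "(\<lambda>n::nat. if n = 0 then 1 else 0 :: complex) sums 1"
    using sums_single[of 0 "\<lambda>_. 1::complex"] by simp
  ultimately show "(\<Sum>n. r n) * (\<Sum>n. a n) = 1" using sums_unique2 by blast
qed

context nuclear_triple
begin

text \<open>The functional given by the tensor power of \<open>x\<close>; the value zero outside
  \<open>NC_tensor k\<close> is demanded by \<open>linear_functional_on\<close>.\<close>

definition eval_power :: "('h \<Rightarrow> real) \<Rightarrow> nat \<Rightarrow> 'h kernel \<Rightarrow> complex" where
  "eval_power x k \<kappa> = (if \<kappa> \<in> NC_tensor k then \<kappa> (replicate k x) else 0)"

lemma eval_power_Hneg_tensor:
  assumes x: "x \<in> Hneg p"
  shows "eval_power x k \<in> Hneg_tensor p k"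
proof (rule Hneg_tensorI)
  fix \<kappa> assume \<kappa>: "\<kappa> \<in> NC_tensor k"
  have "set (replicate k x) \<subseteq> Hneg p" using x by auto
  then have "cmod (\<kappa> (replicate k x)) \<le> prod_list (map (negnorm p) (replicate k x)) * tnorm p k \<kappa>"
    by (intro form_le_tnorm[OF \<kappa>]) auto
  then show "cmod (eval_power x k \<kappa>) \<le> negnorm p x ^ k * tnorm p k \<kappa>"
    using \<kappa> by (simp add: eval_power_def prod_list_replicate)
qed (auto simp: eval_power_def NC_tensor_lincomb)

lemma eval_power_tensor_power:
  assumes "x \<in> N'" "\<theta> \<in> NC"
  shows "eval_power x k (tensor_power k \<theta>) = pairing x \<theta> ^ k"
proof -
  have "set (replicate k x) \<subseteq> N'" using assms by auto
  then have "tensor_power k \<theta> (replicate k x) = pairing x \<theta> ^ k"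
    by (simp add: tensor_power_def prod_list_replicate)
  then show ?thesis by (simp add: eval_power_def tensor_power_NC_tensor(1)[OF assms(2)])
qed

text \<open>Along a ray the expansion is a power series in the scaling parameter, so its
  coefficients are determined; totality of tensor powers then determines the functionals. The
  weights are factorials for the Appell system and 1 for the S-transform.\<close>

lemma dual_coeffs_unique:
  assumes F: "\<And>n. F n \<in> NC_tensor_dual n" and G: "\<And>n. G n \<in> NC_tensor_dual n"
    and c: "\<And>n. c n \<noteq> 0"
    and Fs: "0 < \<epsilon>" "\<And>\<theta>. \<theta> \<in> NC \<Longrightarrow> cpnorm p \<theta> < \<epsilon> \<Longrightarrow> (\<lambda>n. F n (tensor_power n \<theta>) / c n) sums f \<theta>"
    and Gs: "0 < \<epsilon>'" "\<And>\<theta>. \<theta> \<in> NC \<Longrightarrow> cpnorm p' \<theta> < \<epsilon>' \<Longrightarrow> (\<lambda>n. G n (tensor_power n \<theta>) / c n) sums f \<theta>"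
  shows "F = G"
proof
  fix n
  show "F n = G n"
  proof (rule dual_eqI[OF F G])
    fix \<xi> assume "\<xi> \<in> N"
    then have \<theta>: "(\<xi>, 0) \<in> NC" by (rule NC_real)
    \<comment> \<open>A common positive bound of both norms, so that
      \<open>\<bar>s\<bar> < r\<close> keeps the scaled vector in both neighbourhoods.\<close>
    define m where "m = max (cpnorm p (\<xi>, 0)) (cpnorm p' (\<xi>, 0)) + 1"
    have m: "0 < m" using cpnorm_nonneg[of p "(\<xi>, 0)"] by (simp add: m_def add_pos_nonneg max.coboundedI1 le_less_trans)
    define r where "r = min \<epsilon> \<epsilon>' / m"
    have r: "0 < r" using Fs(1) Gs(1) m by (simp add: r_def)
    have "(F n (tensor_power n (\<xi>, 0)) - G n (tensor_power n (\<xi>, 0))) / c n = 0"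
    proof (rule powser_coeff_0[OF r, where c = "\<lambda>n. (F n (tensor_power n (\<xi>, 0)) - G n (tensor_power n (\<xi>, 0))) / c n"])
      fix s :: real assume s: "\<bar>s\<bar> < r"
      have "\<bar>s\<bar> * cpnorm t (\<xi>, 0) < min \<epsilon> \<epsilon>'" if "t = p \<or> t = p'" for t
      proof -
        have "\<bar>s\<bar> * cpnorm t (\<xi>, 0) \<le> \<bar>s\<bar> * m"
          using that by (intro mult_left_mono) (auto simp: m_def)
        also have "\<dots> < min \<epsilon> \<epsilon>'" using s m by (simp add: r_def field_simps)
        finally show ?thesis .
      qed
      then have small: "cpnorm p (s *\<^sub>R (\<xi>, 0)) < \<epsilon>" "cpnorm p' (s *\<^sub>R (\<xi>, 0)) < \<epsilon>'"
        unfolding cpnorm_scaleR[OF \<theta>] by (metis min_less_iff_conj)+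
      have hom: "L (tensor_power k (s *\<^sub>R (\<xi>, 0))) = complex_of_real (s ^ k) * L (tensor_power k (\<xi>, 0))"
        if "L \<in> NC_tensor_dual k" for L k
        using that Hneg_tensor_scale[OF _ tensor_power_NC_tensor(1)[OF \<theta>]]
        unfolding tensor_power_scaleR[OF \<theta>] by (auto simp: NC_tensor_dual_def)
      have "(\<lambda>n. F n (tensor_power n (s *\<^sub>R (\<xi>, 0))) / c n - G n (tensor_power n (s *\<^sub>R (\<xi>, 0))) / c n) sums
          (f (s *\<^sub>R (\<xi>, 0)) - f (s *\<^sub>R (\<xi>, 0)))"
        by (intro sums_diff Fs(2) Gs(2) small NC_scaleR \<theta>)
      then show "(\<lambda>n. (F n (tensor_power n (\<xi>, 0)) - G n (tensor_power n (\<xi>, 0))) / c n * complex_of_real (s ^ n)) sums 0"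
        unfolding hom[OF F] hom[OF G] by (simp add: field_simps diff_divide_distrib)
    qed
    then show "F n (tensor_power n (\<xi>, 0)) = G n (tensor_power n (\<xi>, 0))" using c[of n] by simp
  qed
qed

end

context nuclear_measure
begin

text \<open>One index for all degrees: products of moment functionals keep the index, so the
  recursion for \<open>inv_moment\<close> stays at it.\<close>

definition moment_index :: nat where
  "moment_index = (SOME q. \<forall>n. \<exists>F\<in>Hneg_tensor q n. \<forall>\<theta>\<in>NC. F (tensor_power n \<theta>) = (\<integral>x. pairing x \<theta> ^ n \<partial>\<mu>))"

definition moment :: "nat \<Rightarrow> 'h kernel \<Rightarrow> complex" where
  "moment n = (SOME F. F \<in> Hneg_tensor moment_index n \<and> (\<forall>\<theta>\<in>NC. F (tensor_power n \<theta>) = (\<integral>x. pairing x \<theta> ^ n \<partial>\<mu>)))"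

lemma moment: "moment n \<in> Hneg_tensor moment_index n"
    "\<theta> \<in> NC \<Longrightarrow> moment n (tensor_power n \<theta>) = (\<integral>x. pairing x \<theta> ^ n \<partial>\<mu>)"
proof -
  have "\<forall>n. \<exists>F\<in>Hneg_tensor moment_index n. \<forall>\<theta>\<in>NC. F (tensor_power n \<theta>) = (\<integral>x. pairing x \<theta> ^ n \<partial>\<mu>)"
    unfolding moment_index_def using moment_functional_exists by (rule someI_ex)
  then have "\<exists>F. F \<in> Hneg_tensor moment_index n \<and> (\<forall>\<theta>\<in>NC. F (tensor_power n \<theta>) = (\<integral>x. pairing x \<theta> ^ n \<partial>\<mu>))"
    by blast
  from someI_ex[OF this] show "moment n \<in> Hneg_tensor moment_index n"
    "\<theta> \<in> NC \<Longrightarrow> moment n (tensor_power n \<theta>) = (\<integral>x. pairing x \<theta> ^ n \<partial>\<mu>)"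
    unfolding moment_def by auto
qed

text \<open>The values \<open>P\<^sub>n(0)\<close> of the Appell system: the coefficients of the inverse of the Laplace transform.\<close>

fun inv_moment :: "nat \<Rightarrow> 'h kernel \<Rightarrow> complex" where
  "inv_moment n = (if n = 0 then moment 0 else
     (\<lambda>\<kappa>. \<Sum>i<n. - of_nat (n choose i) * tens i (n - i) (inv_moment i) (moment (n - i)) \<kappa>))"

declare inv_moment.simps [simp del]

lemma inv_moment: "inv_moment n \<in> Hneg_tensor moment_index n"
proof (induction n rule: less_induct)
  case (less n)
  show ?case
  proof (cases "n = 0")
    case True
    then show ?thesis using moment(1)[of 0] by (simp add: inv_moment.simps[of 0])
  next
    case False
    have "tens i (n - i) (inv_moment i) (moment (n - i)) \<in> Hneg_tensor moment_index n" if "i \<in> {..<n}" for i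
      using tens_Hneg_tensor(1)[OF less moment(1), of i "n - i"] that by simp
    then show ?thesis
      unfolding inv_moment.simps[of n] using False
      by (simp only: if_False) (intro Hneg_tensor_sum_mem(1), auto)
  qed
qed

lemma moment_0: "\<theta> \<in> NC \<Longrightarrow> moment 0 (tensor_power 0 \<theta>) = 1"
  using moment(2)[of \<theta> 0] by (simp add: prob_space)

lemma inv_moment_tensor_power:
  assumes \<theta>: "\<theta> \<in> NC" and n: "0 < n"
  shows "inv_moment n (tensor_power n \<theta>) / fact n = - (\<Sum>i<n. inv_moment i (tensor_power i \<theta>) / fact i *
    (moment (n - i) (tensor_power (n - i) \<theta>) / fact (n - i)))"
proof -
  have tp: "tens i (n - i) (inv_moment i) (moment (n - i)) (tensor_power n \<theta>) =
      inv_moment i (tensor_power i \<theta>) * moment (n - i) (tensor_power (n - i) \<theta>)" if "i < n" for i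
    using tens_tensor_power[OF inv_moment moment(1) \<theta>, of i "n - i"] that by simp
  have "inv_moment n (tensor_power n \<theta>) =
      (\<Sum>i<n. - of_nat (n choose i) * (inv_moment i (tensor_power i \<theta>) * moment (n - i) (tensor_power (n - i) \<theta>)))"
    unfolding inv_moment.simps[of n] using n
    by (auto intro!: sum.cong simp: tp)
  then show ?thesis
    unfolding sum_negf[symmetric]
    by (simp only: sum_divide_distrib) (intro sum.cong refl, simp add: binomial_fact field_simps)
qed

text \<open>The inequality \<open>exp_lower_bound\<close> for the vector rescaled to norm
  \<open>\<delta>\<close> bounds the terms geometrically, which also justifies integrating the
  exponential series term by term.\<close>

lemma moment_series:
  assumes eb: "exp_bound p \<delta> K" and \<theta>: "\<theta> \<in> NC"
  shows "cmod (moment n (tensor_power n \<theta>) / fact n) \<le> K * (cpnorm p \<theta> / \<delta>) ^ n"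
    and "cpnorm p \<theta> < \<delta> \<Longrightarrow> (\<lambda>n. moment n (tensor_power n \<theta>) / fact n) sums laplace \<mu> \<theta>"
proof -
  have \<delta>: "0 < \<delta>" and K: "0 \<le> K" using eb by (auto simp: exp_bound_def)
  have int: "integrable \<mu> (\<lambda>x. pairing x \<theta> ^ n)" for n
    using integrable_prod_pairing[of "replicate n \<theta>"] \<theta> by (simp add: prod_list_replicate subset_iff)
  have b: "(\<integral>x. cmod (pairing x \<theta> ^ n / fact n) \<partial>\<mu>) \<le> K * (cpnorm p \<theta> / \<delta>) ^ n" for n
  proof (cases "cpnorm p \<theta> = 0")
    case True
    then have "\<theta> = 0" using cpnorm_eq_0[OF \<theta>] by blast
    then have z: "pairing x \<theta> = 0" if "x \<in> space \<mu>" for x using that by (simp add: space_\<mu> pairing_zero)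
    show ?thesis
    proof (cases "n = 0")
      case True
      \<comment> \<open>For \<open>n = 0\<close> the right-hand side is \<open>K\<close>, as the
        zeroth power is 1 even of zero.\<close>
      have "1 \<le> K"
      proof -
        have "(\<integral>x. exp (cmod (pairing x \<theta>)) \<partial>\<mu>) \<le> K" using eb \<theta> \<open>cpnorm p \<theta> = 0\<close> \<delta> by (simp add: exp_bound_def)
        moreover have "(\<integral>x. exp (cmod (pairing x \<theta>)) \<partial>\<mu>) = 1"
          using z by (simp add: prob_space cong: Bochner_Integration.integral_cong)
        ultimately show ?thesis by simp
      qed
      then show ?thesis using True by (simp add: prob_space)
    next
      case False
      then show ?thesis using z K \<open>cpnorm p \<theta> = 0\<close>
        by (simp add: norm_divide power_0_left cong: Bochner_Integration.integral_cong)
    qed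
  next
    case False
    define c where "c = \<delta> / cpnorm p \<theta>"
    have pos: "0 < cpnorm p \<theta>" using False cpnorm_nonneg[of p \<theta>] by simp
    then have c: "0 < c" using \<delta> by (simp add: c_def)
    have "cpnorm p (c *\<^sub>R \<theta>) \<le> \<delta>" using \<delta> pos by (simp add: cpnorm_scaleR[OF \<theta>] c_def)
    then have eb': "integrable \<mu> (\<lambda>x. exp (cmod (pairing x (c *\<^sub>R \<theta>))))" "(\<integral>x. exp (cmod (pairing x (c *\<^sub>R \<theta>))) \<partial>\<mu>) \<le> K"
      using eb NC_scaleR[OF \<theta>] by (auto simp: exp_bound_def)
    have "(\<integral>x. cmod (pairing x \<theta> ^ n / fact n) \<partial>\<mu>) \<le> (\<integral>x. (1 / c) ^ n * exp (cmod (pairing x (c *\<^sub>R \<theta>))) \<partial>\<mu>)"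
    proof (rule integral_mono)
      show "integrable \<mu> (\<lambda>x. cmod (pairing x \<theta> ^ n / fact n))" using int[of n] by (intro integrable_norm) simp
      show "integrable \<mu> (\<lambda>x. (1 / c) ^ n * exp (cmod (pairing x (c *\<^sub>R \<theta>))))" using eb'(1) by simp
      fix x assume x: "x \<in> space \<mu>"
      have "cmod (pairing x (c *\<^sub>R \<theta>)) = c * cmod (pairing x \<theta>)"
        using pairing_scaleR[OF _ \<theta>, of x c] x c by (simp add: space_\<mu> norm_mult)
      then have "(c * cmod (pairing x \<theta>)) ^ n \<le> fact n * exp (cmod (pairing x (c *\<^sub>R \<theta>)))"
        using exp_lower_bound[of "cmod (pairing x (c *\<^sub>R \<theta>))" n] c by simp
      then show "cmod (pairing x \<theta> ^ n / fact n) \<le> (1 / c) ^ n * exp (cmod (pairing x (c *\<^sub>R \<theta>)))"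
        using c by (simp add: norm_divide norm_power power_mult_distrib power_divide field_simps)
    qed
    also have "\<dots> \<le> (1 / c) ^ n * K" using eb'(2) c by (simp add: mult_left_mono)
    finally show ?thesis by (simp add: c_def mult.commute)
  qed
  have eq: "moment n (tensor_power n \<theta>) / fact n = (\<integral>x. pairing x \<theta> ^ n / fact n \<partial>\<mu>)" for n
    using moment(2)[OF \<theta>, of n] by simp
  show "cmod (moment n (tensor_power n \<theta>) / fact n) \<le> K * (cpnorm p \<theta> / \<delta>) ^ n"
    unfolding eq by (rule order_trans[OF integral_norm_bound b])
  assume small: "cpnorm p \<theta> < \<delta>"
  have "(\<lambda>n. \<integral>x. pairing x \<theta> ^ n / fact n \<partial>\<mu>) sums (\<integral>x. (\<Sum>n. pairing x \<theta> ^ n / fact n) \<partial>\<mu>)"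
  proof (rule sums_integral)
    show "integrable \<mu> (\<lambda>x. pairing x \<theta> ^ n / fact n)" for n using int[of n] by simp
    have "summable (\<lambda>n. norm (pairing x \<theta> ^ n / fact n))" for x
      using summable_norm_exp[of "pairing x \<theta>"] by (simp add: scaleR_conv_of_real divide_inverse norm_mult mult.commute norm_inverse)
    then show "AE x in \<mu>. summable (\<lambda>n. norm (pairing x \<theta> ^ n / fact n))" by simp
    have "summable (\<lambda>n. K * (cpnorm p \<theta> / \<delta>) ^ n)"
      using small \<delta> cpnorm_nonneg[of p \<theta>] by (intro summable_mult summable_geometric) auto
    then show "summable (\<lambda>n. \<integral>x. norm (pairing x \<theta> ^ n / fact n) \<partial>\<mu>)"
      by (rule summable_comparison_test'[where N = 0]) (use b in simp)
  qed
  moreover have "(\<Sum>n. z ^ n / fact n) = exp z" for z :: complex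
    using exp_converges[of z] by (simp add: sums_iff scaleR_conv_of_real divide_inverse mult.commute)
  ultimately show "(\<lambda>n. moment n (tensor_power n \<theta>) / fact n) sums laplace \<mu> \<theta>"
    unfolding eq laplace_def by simp
qed

lemma inv_moment_series:
  "\<exists>p. \<exists>\<epsilon>>0. \<forall>\<theta>\<in>NC. cpnorm p \<theta> < \<epsilon> \<longrightarrow>
    summable (\<lambda>n. cmod (inv_moment n (tensor_power n \<theta>) / fact n)) \<and>
    (\<Sum>n. inv_moment n (tensor_power n \<theta>) / fact n) = 1 / laplace \<mu> \<theta>"
proof -
  obtain p \<delta> K where eb: "exp_bound p \<delta> K" using exp_bound_exists by blast
  have \<delta>: "0 < \<delta>" and K: "0 \<le> K" using eb by (auto simp: exp_bound_def)
  show ?thesis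
  \<comment> \<open>The radius is \<open>\<delta>\<close> divided by the growth factor
    \<open>1 + K\<close> of \<open>powser_inverse\<close>.\<close>
  proof (intro exI[of _ p] exI[of _ "\<delta> / (1 + K)"] conjI ballI impI)
    show "0 < \<delta> / (1 + K)" using \<delta> K by simp
    fix \<theta> assume \<theta>: "\<theta> \<in> NC" and small: "cpnorm p \<theta> < \<delta> / (1 + K)"
    let ?a = "\<lambda>n. moment n (tensor_power n \<theta>) / fact n" and ?r = "\<lambda>n. inv_moment n (tensor_power n \<theta>) / fact n"
    have a0: "?a 0 = 1" "?r 0 = 1" using moment_0[OF \<theta>] by (auto simp: inv_moment.simps[of 0])
    have t: "0 \<le> cpnorm p \<theta> / \<delta>" "(1 + K) * (cpnorm p \<theta> / \<delta>) < 1"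
      using small \<delta> K cpnorm_nonneg[of p \<theta>] by (auto simp: field_simps)
    note inv = powser_inverse[of ?a ?r, OF a0 inv_moment_tensor_power[OF \<theta>] moment_series(1)[OF eb \<theta>] t K]
    show "summable (\<lambda>n. cmod (?r n))" by (rule inv(1))
    have "\<delta> / (1 + K) \<le> \<delta>" using \<delta> K by (simp add: field_simps)
    then have "(\<Sum>n. ?a n) = laplace \<mu> \<theta>"
      using moment_series(2)[OF eb \<theta>] small by (simp add: sums_iff)
    then have "(\<Sum>n. ?r n) * laplace \<mu> \<theta> = 1" using inv(2) by simp
    then show "(\<Sum>n. ?r n) = 1 / laplace \<mu> \<theta>" by (metis eq_divide_eq mult_zero_right zero_neq_one)
  qed
qed

text \<open>The Cauchy product of the series of the exponential and of the inverse Laplace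
  transform; the factorials combine to binomial coefficients.\<close>

definition appell_kernel :: "('h \<Rightarrow> real) \<Rightarrow> nat \<Rightarrow> 'h kernel \<Rightarrow> complex" where
  "appell_kernel x n \<kappa> = (\<Sum>k\<le>n. of_nat (n choose k) * tens k (n - k) (eval_power x k) (inv_moment (n - k)) \<kappa>)"

lemma appell_kernel_dual:
  assumes x: "x \<in> N'"
  shows "appell_kernel x n \<in> NC_tensor_dual n"
proof -
  obtain p where p: "x \<in> Hneg p" using x by (auto simp: N'_def)
  have "tens k (n - k) (eval_power x k) (inv_moment (n - k)) \<in> Hneg_tensor (max p moment_index) n" if "k \<in> {..n}" for k
    using tens_Hneg_tensor(1)[OF eval_power_Hneg_tensor[OF p] inv_moment, of k "n - k"] that by simp
  then have "appell_kernel x n \<in> Hneg_tensor (max p moment_index) n"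
    unfolding appell_kernel_def by (intro Hneg_tensor_sum_mem(1)) auto
  then show ?thesis by (auto simp: NC_tensor_dual_def)
qed

lemma appell_kernel_tensor_power:
  assumes x: "x \<in> N'" and \<theta>: "\<theta> \<in> NC"
  shows "appell_kernel x n (tensor_power n \<theta>) / fact n =
    (\<Sum>k\<le>n. pairing x \<theta> ^ k / fact k * (inv_moment (n - k) (tensor_power (n - k) \<theta>) / fact (n - k)))"
proof -
  obtain p where p: "x \<in> Hneg p" using x by (auto simp: N'_def)
  have "tens k (n - k) (eval_power x k) (inv_moment (n - k)) (tensor_power n \<theta>) =
      pairing x \<theta> ^ k * inv_moment (n - k) (tensor_power (n - k) \<theta>)" if "k \<le> n" for k
    using tens_tensor_power[OF eval_power_Hneg_tensor[OF p] inv_moment \<theta>, of k "n - k"] that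
    by (simp add: eval_power_tensor_power[OF x \<theta>])
  then show ?thesis
    unfolding appell_kernel_def sum_divide_distrib
    by (intro sum.cong refl) (simp add: binomial_fact field_simps)
qed

lemma appell_kernel_sums:
  assumes x: "x \<in> N'"
  shows "\<exists>p. \<exists>\<epsilon>>0. \<forall>\<theta>\<in>NC. cpnorm p \<theta> < \<epsilon> \<longrightarrow>
    (\<lambda>n. appell_kernel x n (tensor_power n \<theta>) / fact n) sums e_mu \<mu> \<theta> x"
proof -
  obtain p \<epsilon> where p0: "0 < \<epsilon>" "\<forall>\<theta>\<in>NC. cpnorm p \<theta> < \<epsilon> \<longrightarrow>
      summable (\<lambda>n. cmod (inv_moment n (tensor_power n \<theta>) / fact n)) \<and>
      (\<Sum>n. inv_moment n (tensor_power n \<theta>) / fact n) = 1 / laplace \<mu> \<theta>"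
    using inv_moment_series by (elim exE conjE)
  note p = p0(1) p0(2)[rule_format]
  have "(\<lambda>n. appell_kernel x n (tensor_power n \<theta>) / fact n) sums e_mu \<mu> \<theta> x"
    if \<theta>: "\<theta> \<in> NC" "cpnorm p \<theta> < \<epsilon>" for \<theta>
  proof -
    have s: "summable (\<lambda>n. cmod (pairing x \<theta> ^ n / fact n))"
      using summable_norm_exp[of "pairing x \<theta>"] by (simp add: scaleR_conv_of_real divide_inverse norm_mult mult.commute norm_inverse)
    have "(\<Sum>n. pairing x \<theta> ^ n / fact n) = exp (pairing x \<theta>)"
      using exp_converges[of "pairing x \<theta>"] by (simp add: sums_iff scaleR_conv_of_real divide_inverse mult.commute)
    then show ?thesis
      unfolding appell_kernel_tensor_power[OF x \<theta>(1)] e_mu_def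
      using Cauchy_product_sums[OF s conjunct1[OF p(2)[OF \<theta>]]] p(2)[OF \<theta>] by simp
  qed
  then show ?thesis using p(1) by (intro exI[of _ p] exI[of _ \<epsilon>]) simp
qed

text \<open>The description in \<open>appell\<close> is resolved here, with uniqueness from
  \<open>dual_coeffs_unique\<close>.\<close>

lemma appell_eq:
  assumes x: "x \<in> N'"
  shows "appell \<mu> x = appell_kernel x"
  unfolding appell_def
proof (rule the_equality)
  show "(\<forall>n. appell_kernel x n \<in> NC_tensor_dual n) \<and> (\<exists>p. \<exists>\<epsilon>>0. \<forall>\<theta>\<in>NC. cpnorm p \<theta> < \<epsilon> \<longrightarrow>
      (\<lambda>n. appell_kernel x n (tensor_power n \<theta>) / fact n) sums e_mu \<mu> \<theta> x)"
    using appell_kernel_dual[OF x] appell_kernel_sums[OF x] by blast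
  fix P assume P: "(\<forall>n. P n \<in> NC_tensor_dual n) \<and> (\<exists>p. \<exists>\<epsilon>>0. \<forall>\<theta>\<in>NC. cpnorm p \<theta> < \<epsilon> \<longrightarrow>
      (\<lambda>n. P n (tensor_power n \<theta>) / fact n) sums e_mu \<mu> \<theta> x)"
  then obtain p \<epsilon> where 1: "0 < \<epsilon>" "\<forall>\<theta>\<in>NC. cpnorm p \<theta> < \<epsilon> \<longrightarrow>
      (\<lambda>n. P n (tensor_power n \<theta>) / fact n) sums e_mu \<mu> \<theta> x" by (elim exE conjE)
  obtain p' \<epsilon>' where 2: "0 < \<epsilon>'" "\<forall>\<theta>\<in>NC. cpnorm p' \<theta> < \<epsilon>' \<longrightarrow>
      (\<lambda>n. appell_kernel x n (tensor_power n \<theta>) / fact n) sums e_mu \<mu> \<theta> x"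
    using appell_kernel_sums[OF x] by (elim exE conjE)
  have P1: "P n \<in> NC_tensor_dual n" for n using P by blast
  show "P = appell_kernel x"
    by (rule dual_coeffs_unique[where c = "fact", OF P1 appell_kernel_dual[OF x] _
          1(1) 1(2)[rule_format] 2(1) 2(2)[rule_format]]) auto
qed

end

subsection \<open>Appell expansions of polynomials\<close>

context nuclear_triple
begin

section \<open>Polynomials and their monomial coefficients\<close>

lemma monomial_lincomb:
  "monomial n (\<lambda>xs. a * \<kappa> xs + b * \<kappa>' xs) = (\<lambda>x. a * monomial n \<kappa> x + b * monomial n \<kappa>' x)"
  by (auto simp: monomial_def)

lemma monomial_scale: "monomial n (\<lambda>xs. a * \<kappa> xs) = (\<lambda>x. a * monomial n \<kappa> x)"
  by (auto simp: monomial_def)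

lemma polysE:
  assumes "\<phi> \<in> polys"
  obtains M \<kappa> where "\<And>n. \<kappa> n \<in> NC_tensor n" "\<phi> = (\<lambda>x. \<Sum>n<M. monomial n (\<kappa> n) x)"
proof -
  obtain M \<kappa> where *: "\<forall>n\<le>M. \<kappa> n \<in> NC_tensor n" "\<phi> = (\<lambda>x. \<Sum>n\<le>M. monomial n (\<kappa> n) x)"
    using assms unfolding polys_def by blast
  show ?thesis
  proof (rule that[of "\<lambda>n. if n \<le> M then \<kappa> n else (\<lambda>_. 0)" "Suc M"])
    show "(if n \<le> M then \<kappa> n else (\<lambda>_. 0)) \<in> NC_tensor n" for n using * NC_tensor_zero by simp
    show "\<phi> = (\<lambda>x. \<Sum>n<Suc M. monomial n (if n \<le> M then \<kappa> n else (\<lambda>_. 0)) x)"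
      unfolding *(2) lessThan_Suc_atMost by (intro ext sum.cong) auto
  qed
qed

lemma polysI:
  assumes "\<And>n. n < M \<Longrightarrow> \<kappa> n \<in> NC_tensor n"
  shows "(\<lambda>x. \<Sum>n<M. monomial n (\<kappa> n) x) \<in> polys"
proof (cases M)
  case 0
  have "(\<lambda>x. 0) = (\<lambda>x. \<Sum>n\<le>0. monomial n (\<lambda>_. 0) x)" by (auto simp: monomial_def)
  then have "\<exists>M \<kappa>. (\<forall>n\<le>M. \<kappa> n \<in> NC_tensor n) \<and> (\<lambda>x. 0) = (\<lambda>x. \<Sum>n\<le>M. monomial n (\<kappa> n) x)"
    using NC_tensor_zero by (intro exI[of _ "0::nat"] exI[of _ "\<lambda>_ _. 0"]) simp
  then show ?thesis using 0 unfolding polys_def by simp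
next
  case (Suc K)
  then have "\<forall>n\<le>K. \<kappa> n \<in> NC_tensor n" using assms by (simp add: less_Suc_eq_le)
  then show ?thesis unfolding polys_def Suc lessThan_Suc_atMost by blast
qed

lemma monomial_polys:
  assumes "\<kappa> \<in> NC_tensor n" shows "monomial n \<kappa> \<in> polys"
proof -
  have "monomial n \<kappa> = (\<lambda>x. \<Sum>k<Suc n. monomial k (if k = n then \<kappa> else (\<lambda>_. 0)) x)"
  proof
    fix x
    have "(\<Sum>k<Suc n. monomial k (if k = n then \<kappa> else (\<lambda>_. 0)) x) = (\<Sum>k<Suc n. if k = n then monomial n \<kappa> x else 0)"
      by (intro sum.cong) (auto simp: monomial_def)
    then show "monomial n \<kappa> x = (\<Sum>k<Suc n. monomial k (if k = n then \<kappa> else (\<lambda>_. 0)) x)" by simp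
  qed
  moreover have "(\<lambda>x. \<Sum>k<Suc n. monomial k (if k = n then \<kappa> else (\<lambda>_. 0)) x) \<in> polys"
    using assms NC_tensor_zero by (intro polysI) auto
  ultimately show ?thesis by simp
qed

lemma polys_lincomb:
  assumes "\<phi> \<in> polys" "\<psi> \<in> polys"
  shows "(\<lambda>x. a * \<phi> x + b * \<psi> x) \<in> polys"
proof -
  obtain M \<kappa> where 1: "\<And>n. \<kappa> n \<in> NC_tensor n" "\<phi> = (\<lambda>x. \<Sum>n<M. monomial n (\<kappa> n) x)" using polysE[OF assms(1)] by blast
  obtain M' \<kappa>' where 2: "\<And>n. \<kappa>' n \<in> NC_tensor n" "\<psi> = (\<lambda>x. \<Sum>n<M'. monomial n (\<kappa>' n) x)" using polysE[OF assms(2)] by blast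
  define \<nu> where "\<nu> n = (\<lambda>xs. (if n < M then a else 0) * \<kappa> n xs + (if n < M' then b else 0) * \<kappa>' n xs)" for n
  have "(\<lambda>x. a * \<phi> x + b * \<psi> x) = (\<lambda>x. \<Sum>n<max M M'. monomial n (\<nu> n) x)"
  proof
    fix x
    have "(\<Sum>n<max M M'. monomial n (\<nu> n) x) = (\<Sum>n<max M M'. if n < M then a * monomial n (\<kappa> n) x else 0) +
        (\<Sum>n<max M M'. if n < M' then b * monomial n (\<kappa>' n) x else 0)"
      unfolding \<nu>_def monomial_lincomb sum.distrib[symmetric] by (intro sum.cong) auto
    also have "(\<Sum>n<max M M'. if n < M then a * monomial n (\<kappa> n) x else 0) = (\<Sum>n<M. a * monomial n (\<kappa> n) x)"
      by (intro sum.mono_neutral_cong_right) auto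
    also have "(\<Sum>n<max M M'. if n < M' then b * monomial n (\<kappa>' n) x else 0) = (\<Sum>n<M'. b * monomial n (\<kappa>' n) x)"
      by (intro sum.mono_neutral_cong_right) auto
    finally show "a * \<phi> x + b * \<psi> x = (\<Sum>n<max M M'. monomial n (\<nu> n) x)"
      by (simp add: 1(2) 2(2) sum_distrib_left)
  qed
  moreover have "\<nu> n \<in> NC_tensor n" for n unfolding \<nu>_def by (intro NC_tensor_lincomb 1 2)
  ultimately show ?thesis using polysI[of "max M M'" \<nu>] by simp
qed

lemma polys_zero: "(\<lambda>x. 0) \<in> polys"
  using polysI[of 0] by simp

lemma polys_sum:
  "finite J \<Longrightarrow> (\<And>j. j \<in> J \<Longrightarrow> \<phi> j \<in> polys) \<Longrightarrow> (\<lambda>x. \<Sum>j\<in>J. c j * \<phi> j x) \<in> polys"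
proof (induction J rule: finite_induct)
  case (insert j J)
  then show ?case using polys_lincomb[of "\<phi> j" "\<lambda>x. \<Sum>j\<in>J. c j * \<phi> j x" "c j" 1] by simp
qed (simp add: polys_zero)

text \<open>The summand with factor \<open>0\<close> gives the scaled functional the shape of the
  two-term combination in \<open>sym_form_linear\<close>.\<close>

lemma sym_form_replicate_scale:
  assumes \<kappa>: "sym_form n \<kappa>" and x: "x \<in> N'"
  shows "\<kappa> (replicate n (\<lambda>\<xi>. t * x \<xi> + 0 * x \<xi>)) = complex_of_real (t ^ n) * \<kappa> (replicate n x)"
proof -
  let ?y = "\<lambda>\<xi>. t * x \<xi> + 0 * x \<xi>"
  have y: "?y \<in> N'" by (rule N'_lincomb[OF x x])
  have "\<kappa> (replicate j ?y @ replicate k x) = complex_of_real (t ^ j) * \<kappa> (replicate (j + k) x)" if "j + k = n" for j k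
    using that
  proof (induction j arbitrary: k)
    case (Suc j)
    have "set (replicate j ?y @ replicate k x) \<subseteq> N'" using x y by (auto split: if_splits)
    then have "\<kappa> (?y # replicate j ?y @ replicate k x) = complex_of_real t * \<kappa> (x # replicate j ?y @ replicate k x) +
        complex_of_real 0 * \<kappa> (x # replicate j ?y @ replicate k x)"
      using Suc.prems x by (intro sym_form_linear[OF \<kappa>]) auto
    then have "\<kappa> (replicate (Suc j) ?y @ replicate k x) = complex_of_real t * \<kappa> (x # replicate j ?y @ replicate k x)"
      by simp
    also have "\<kappa> (x # replicate j ?y @ replicate k x) = \<kappa> (replicate j ?y @ replicate (Suc k) x)"
      by (rule sym_form_mset[OF \<kappa>]) simp
    also have "\<dots> = complex_of_real (t ^ j) * \<kappa> (replicate (j + Suc k) x)"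
      using Suc.prems by (intro Suc.IH) simp
    finally show ?case by simp
  qed simp
  from this[of n 0] show ?thesis by simp
qed

text \<open>Scaling \<open>x\<close> separates the degrees by comparison of coefficients, which
  gives vanishing on the diagonal; polarization gives the rest.\<close>

lemma polys_coeffs_eq_0:
  assumes \<kappa>: "\<And>n. n < M \<Longrightarrow> \<kappa> n \<in> NC_tensor n"
    and z: "\<And>x. x \<in> N' \<Longrightarrow> (\<Sum>n<M. monomial n (\<kappa> n) x) = 0" and m: "m < M"
  shows "\<kappa> m = (\<lambda>_. 0)"
proof
  have diag: "\<kappa> m (replicate m x) = 0" if x: "x \<in> N'" for x
  proof -
    \<comment> \<open>Padding by zero turns the finite sum into a power series.\<close>
    define c where "c n = (if n < M then \<kappa> n (replicate n x) else 0)" for n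
    have "c m = 0"
    proof (rule powser_coeff_0[of 1])
      fix s :: real
      let ?y = "\<lambda>\<xi>. s * x \<xi> + 0 * x \<xi>"
      have "?y \<in> N'" by (rule N'_lincomb[OF x x])
      then have "(\<Sum>n<M. \<kappa> n (replicate n ?y)) = 0" using z[of ?y] by (simp add: monomial_def)
      then have "(\<Sum>n<M. complex_of_real (s ^ n) * \<kappa> n (replicate n x)) = 0"
        using sym_form_replicate_scale[OF NC_tensorD(1)[OF \<kappa>] x, of _ s] by simp
      then have "(\<Sum>n<M. c n * complex_of_real (s ^ n)) = 0" by (simp add: c_def mult.commute)
      then show "(\<lambda>n. c n * complex_of_real (s ^ n)) sums 0"
        using sums_finite[of "{..<M}" "\<lambda>n. c n * complex_of_real (s ^ n)"] by (simp add: c_def)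
    qed simp
    then show ?thesis using m by (simp add: c_def)
  qed
  fix xs
  show "\<kappa> m xs = 0"
  proof (cases "length xs = m \<and> set xs \<subseteq> N'")
    case True
    show ?thesis
    proof (rule polarization_vanish[where D = N' and cmb = "\<lambda>a x b y. (\<lambda>\<xi>. a * x \<xi> + b * y \<xi>)" and n = m])
      show "\<kappa> m ((\<lambda>\<xi>. a * x \<xi> + b * y \<xi>) # vs) = complex_of_real a * \<kappa> m (x # vs) + complex_of_real b * \<kappa> m (y # vs)"
        if "x \<in> N'" "y \<in> N'" "set vs \<subseteq> N'" "length vs + 1 = m" for x y a b vs
        using sym_form_linear[OF NC_tensorD(1)[OF \<kappa>[OF m]]] that by blast
      show "\<kappa> m us = \<kappa> m ws" if "mset us = mset ws" for us ws
        by (rule sym_form_mset[OF NC_tensorD(1)[OF \<kappa>[OF m]] that])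
      show "N' \<noteq> {}" using riesz_N'[of 0 0] by auto
    qed (use True diag N'_lincomb in auto)
  next
    case False
    then show ?thesis using sym_form_vanish[OF NC_tensorD(1)[OF \<kappa>[OF m]]] by blast
  qed
qed

end

context nuclear_measure
begin

text \<open>The Appell pairing as a combination of monomials: visibly an element of
  \<open>polys\<close>, with top term the monomial of \<open>\<kappa>\<close>.\<close>

definition appell_poly :: "nat \<Rightarrow> 'h kernel \<Rightarrow> ('h \<Rightarrow> real) \<Rightarrow> complex" where
  "appell_poly n \<kappa> = (\<lambda>x. \<Sum>k\<le>n. of_nat (n choose k) * monomial k (contract k (inv_moment (n - k)) \<kappa>) x)"

lemma contract_inv_moment:
  assumes "\<kappa> \<in> NC_tensor n" "k \<le> n"
  shows "contract k (inv_moment (n - k)) \<kappa> \<in> NC_tensor k"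
  using contract_NC_tensor(1)[OF inv_moment, of \<kappa> k "n - k"] assms by simp

lemma appell_poly_eq:
  assumes \<kappa>: "\<kappa> \<in> NC_tensor n" and x: "x \<in> N'"
  shows "appell_poly n \<kappa> x = appell \<mu> x n \<kappa>"
  unfolding appell_eq[OF x] appell_poly_def appell_kernel_def
  using \<kappa> x contract_inv_moment[OF \<kappa>]
  by (intro sum.cong refl) (simp add: tens_def eval_power_def monomial_def)

lemma moment_0_eval: assumes "\<kappa> \<in> NC_tensor 0" shows "moment 0 \<kappa> = \<kappa> []"
proof -
  have "\<kappa> = (\<lambda>xs. \<kappa> [] * tensor_power 0 0 xs)"
    using sym_form_vanish[OF NC_tensorD(1)[OF assms]] by (auto simp: fun_eq_iff tensor_power_def)
  then have "moment 0 \<kappa> = moment 0 (\<lambda>xs. \<kappa> [] * tensor_power 0 0 xs)" by simp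
  also have "\<dots> = \<kappa> [] * moment 0 (tensor_power 0 0)"
    by (rule Hneg_tensor_scale[OF moment(1) tensor_power_NC_tensor(1)[OF NC_zero]])
  finally show ?thesis using moment_0[OF NC_zero] by simp
qed

text \<open>The total mass of \<open>\<mu>\<close> is 1, so the zeroth functional is evaluation at
  the empty list and the top coefficient is unchanged.\<close>

lemma contract_inv_moment_0: assumes "\<kappa> \<in> NC_tensor n" shows "contract n (inv_moment 0) \<kappa> = \<kappa>"
proof
  fix xs
  show "contract n (inv_moment 0) \<kappa> xs = \<kappa> xs"
  proof (cases "length xs = n \<and> set xs \<subseteq> N'")
    case True
    then have "(\<lambda>ys. \<kappa> (xs @ ys)) \<in> NC_tensor 0" using NC_tensor_append[of \<kappa> xs 0] assms by simp
    then show ?thesis using True moment_0_eval[of "\<lambda>ys. \<kappa> (xs @ ys)"] by (simp add: contract_def inv_moment.simps[of 0])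
  next
    case False
    then show ?thesis using sym_form_vanish[OF NC_tensorD(1)[OF assms], of xs] by (auto simp: contract_def)
  qed
qed

lemma appell_poly_polys: assumes "\<kappa> \<in> NC_tensor n" shows "appell_poly n \<kappa> \<in> polys"
  unfolding appell_poly_def
  by (intro polys_sum monomial_polys contract_inv_moment assms) auto

lemma appell_poly_lincomb:
  assumes "\<kappa> \<in> NC_tensor n" "\<kappa>' \<in> NC_tensor n"
  shows "appell_poly n (\<lambda>xs. a * \<kappa> xs + b * \<kappa>' xs) = (\<lambda>x. a * appell_poly n \<kappa> x + b * appell_poly n \<kappa>' x)"
proof
  fix x
  have "contract k (inv_moment (n - k)) (\<lambda>xs. a * \<kappa> xs + b * \<kappa>' xs) =
      (\<lambda>xs. a * contract k (inv_moment (n - k)) \<kappa> xs + b * contract k (inv_moment (n - k)) \<kappa>' xs)" if "k \<le> n" for k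
    using that assms by (intro contract_lincomb[OF inv_moment]) auto
  then show "appell_poly n (\<lambda>xs. a * \<kappa> xs + b * \<kappa>' xs) x = a * appell_poly n \<kappa> x + b * appell_poly n \<kappa>' x"
    unfolding appell_poly_def sum_distrib_left sum.distrib[symmetric]
    by (intro sum.cong refl) (simp add: monomial_lincomb algebra_simps)
qed

lemma appell_poly_zero: "appell_poly n (\<lambda>_. 0) = (\<lambda>x. 0)"
  using appell_poly_lincomb[OF NC_tensor_zero NC_tensor_zero, of n 0 0] by simp

lemma appell_poly_leading:
  assumes "\<kappa> \<in> NC_tensor n"
  shows "appell_poly n \<kappa> x = monomial n \<kappa> x +
    (\<Sum>k<n. of_nat (n choose k) * monomial k (contract k (inv_moment (n - k)) \<kappa>) x)"
  using contract_inv_moment_0[OF assms] by (simp add: appell_poly_def flip: lessThan_Suc_atMost)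

text \<open>The passage from Appell polynomials to monomials is triangular with unit diagonal. The
  Appell polynomial of the leading kernel is split off and the lower degrees are treated by
  induction.\<close>

lemma appell_expansion_exists:
  assumes "\<And>n. \<kappa> n \<in> NC_tensor n"
  shows "\<exists>\<nu>. (\<forall>n. \<nu> n \<in> NC_tensor n) \<and> (\<forall>x. (\<Sum>n<M. monomial n (\<kappa> n) x) = (\<Sum>n<M. appell_poly n (\<nu> n) x))"
  using assms
proof (induction M arbitrary: \<kappa>)
  case 0
  then show ?case by auto
next
  case (Suc M)
  \<comment> \<open>The kernels of degree below \<open>M\<close> that remain after the Appell
    polynomial of \<open>\<kappa> M\<close> is subtracted.\<close>
  define \<kappa>' where "\<kappa>' n = (if n < M then (\<lambda>xs. 1 * \<kappa> n xs + (- of_nat (M choose n)) * contract n (inv_moment (M - n)) (\<kappa> M) xs) else (\<lambda>_. 0))" for n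
  have "\<kappa>' n \<in> NC_tensor n" for n
  proof (cases "n < M")
    case True
    then show ?thesis
      unfolding \<kappa>'_def if_P[OF True]
      by (intro NC_tensor_lincomb Suc.prems contract_inv_moment) auto
  qed (simp add: \<kappa>'_def NC_tensor_zero)
  then obtain \<nu> where \<nu>: "\<And>n. \<nu> n \<in> NC_tensor n"
    "\<And>x. (\<Sum>n<M. monomial n (\<kappa>' n) x) = (\<Sum>n<M. appell_poly n (\<nu> n) x)"
    using Suc.IH[of \<kappa>'] by blast
  have h: "(\<Sum>n<M. monomial n (\<kappa>' n) x) = (\<Sum>n<M. monomial n (\<kappa> n) x) -
      (\<Sum>n<M. of_nat (M choose n) * monomial n (contract n (inv_moment (M - n)) (\<kappa> M)) x)" for x
    unfolding sum_subtractf[symmetric] \<kappa>'_def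
    by (intro sum.cong refl) (simp only: monomial_lincomb lessThan_iff if_True, simp)
  have eq: "(\<Sum>n<M. monomial n (\<kappa> n) x) = (\<Sum>n<M. appell_poly n (\<nu> n) x) +
      (\<Sum>n<M. of_nat (M choose n) * monomial n (contract n (inv_moment (M - n)) (\<kappa> M)) x)" for x
    using trans[OF sym[OF h[of x]] \<nu>(2)[of x]] by (simp only: diff_eq_eq)
  have "(\<Sum>n<Suc M. monomial n (\<kappa> n) x) = (\<Sum>n<Suc M. appell_poly n ((\<nu>(M := \<kappa> M)) n) x)" for x
    using eq[of x] appell_poly_leading[OF Suc.prems, of M x] by simp
  then show ?case using \<nu>(1) Suc.prems by (intro exI[of _ "\<nu>(M := \<kappa> M)"]) auto
qed

lemma appell_expansion_unique:
  assumes "\<And>n. d n \<in> NC_tensor n" "\<And>x. x \<in> N' \<Longrightarrow> (\<Sum>n<M. appell_poly n (d n) x) = 0"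
  shows "n < M \<Longrightarrow> d n = (\<lambda>_. 0)"
  using assms(2)
proof (induction M arbitrary: n)
  case (Suc M)
  \<comment> \<open>The monomial kernels of the sum after regrouping by degree. In the top degree
    only \<open>d M\<close> contributes.\<close>
  define e where "e k = (\<lambda>xs. \<Sum>n\<in>{k..M}. of_nat (n choose k) * contract k (inv_moment (n - k)) (d n) xs)" for k
  have e: "e k \<in> NC_tensor k" for k
    unfolding e_def by (intro NC_tensor_sum contract_inv_moment assms) auto
  have "(\<Sum>k<Suc M. monomial k (e k) x) = 0" if x: "x \<in> N'" for x
  proof -
    have "(\<Sum>k<Suc M. monomial k (e k) x) =
        (\<Sum>k\<le>M. \<Sum>n\<in>{k..M}. of_nat (n choose k) * monomial k (contract k (inv_moment (n - k)) (d n)) x)"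
      using x by (simp add: monomial_def e_def lessThan_Suc_atMost)
    also have "\<dots> = (\<Sum>n\<le>M. \<Sum>k\<le>n. of_nat (n choose k) * monomial k (contract k (inv_moment (n - k)) (d n)) x)"
      by (subst sum.Sigma, simp, simp, subst sum.Sigma, simp, simp)
         (rule sum.reindex_bij_witness[of _ "\<lambda>(n, k). (k, n)" "\<lambda>(k, n). (n, k)"], auto)
    also have "\<dots> = 0" using Suc.prems(2)[OF x] by (simp add: appell_poly_def lessThan_Suc_atMost)
    finally show ?thesis .
  qed
  then have "e M = (\<lambda>_. 0)" by (intro polys_coeffs_eq_0[of "Suc M" e] e) auto
  moreover have "e M = d M" using contract_inv_moment_0[OF assms(1)] by (simp add: e_def)
  ultimately have dM: "d M = (\<lambda>_. 0)" by simp
  show ?case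
  proof (cases "n = M")
    case False
    then have "n < M" using Suc.prems(1) by simp
    moreover have "(\<Sum>n<M. appell_poly n (d n) x) = 0" if "x \<in> N'" for x
      using Suc.prems(2)[OF that] by (simp add: dM appell_poly_zero)
    ultimately show ?thesis by (rule Suc.IH)
  qed (use dM in simp)
qed simp

lemma appell_coeffs_eqI:
  assumes \<kappa>: "\<And>n. \<kappa> n \<in> NC_tensor n" "\<And>n. n \<ge> M \<Longrightarrow> \<kappa> n = (\<lambda>_. 0)"
    and \<phi>: "\<And>x. x \<in> N' \<Longrightarrow> \<phi> x = (\<Sum>n<M. appell_poly n (\<kappa> n) x)"
  shows "appell_coeffs \<mu> \<phi> = \<kappa>"
  unfolding appell_coeffs_def
proof (rule the_equality)
  \<comment> \<open>The description sums up to and including \<open>M\<close>; the extra term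
    belongs to the zero kernel.\<close>
  have "\<phi> x = (\<Sum>n\<le>M. appell \<mu> x n (\<kappa> n))" if "x \<in> N'" for x
    using \<phi>[OF that] appell_poly_eq[OF \<kappa>(1) that] \<kappa>(2)[of M] appell_poly_zero
    by (simp flip: lessThan_Suc_atMost) (metis \<kappa>(1))
  then show "(\<forall>n. \<kappa> n \<in> NC_tensor n) \<and> (\<exists>M. (\<forall>n>M. \<kappa> n = (\<lambda>_. 0)) \<and> (\<forall>x\<in>N'. \<phi> x = (\<Sum>n\<le>M. appell \<mu> x n (\<kappa> n))))"
    using \<kappa> by (intro conjI exI[of _ M]) auto
  fix \<nu> assume "(\<forall>n. \<nu> n \<in> NC_tensor n) \<and> (\<exists>M. (\<forall>n>M. \<nu> n = (\<lambda>_. 0)) \<and> (\<forall>x\<in>N'. \<phi> x = (\<Sum>n\<le>M. appell \<mu> x n (\<nu> n))))"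
  then obtain M' where \<nu>: "\<And>n. \<nu> n \<in> NC_tensor n" "\<And>n. n > M' \<Longrightarrow> \<nu> n = (\<lambda>_. 0)"
    "\<And>x. x \<in> N' \<Longrightarrow> \<phi> x = (\<Sum>n\<le>M'. appell \<mu> x n (\<nu> n))" by blast
  \<comment> \<open>Both expansions end below this length: the second may have a term of degree
    \<open>M'\<close>, hence the successor.\<close>
  let ?L = "max M (Suc M')"
  let ?d = "\<lambda>n xs. 1 * \<nu> n xs + (-1) * \<kappa> n xs"
  have d: "?d n \<in> NC_tensor n" for n by (intro NC_tensor_lincomb \<nu> \<kappa>)
  have dz: "(\<Sum>n<?L. appell_poly n (?d n) x) = 0" if x: "x \<in> N'" for x
  proof -
    have "(\<Sum>n<?L. appell_poly n (?d n) x) = (\<Sum>n<?L. appell_poly n (\<nu> n) x) - (\<Sum>n<?L. appell_poly n (\<kappa> n) x)"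
      unfolding appell_poly_lincomb[OF \<nu>(1) \<kappa>(1)] by (simp add: sum_subtractf)
    also have "(\<Sum>n<?L. appell_poly n (\<nu> n) x) = (\<Sum>n\<le>M'. appell_poly n (\<nu> n) x)"
      by (intro sum.mono_neutral_right) (auto simp: \<nu>(2) appell_poly_zero)
    also have "\<dots> = \<phi> x" using \<nu>(3)[OF x] appell_poly_eq[OF \<nu>(1) x] by simp
    also have "(\<Sum>n<?L. appell_poly n (\<kappa> n) x) = (\<Sum>n<M. appell_poly n (\<kappa> n) x)"
      by (intro sum.mono_neutral_right) (auto simp: \<kappa>(2) appell_poly_zero)
    also have "\<dots> = \<phi> x" using \<phi>[OF x] by simp
    finally show ?thesis by simp
  qed
  have u: "?d n = (\<lambda>_. 0)" if "n < ?L" for n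
    by (rule appell_expansion_unique[of ?d ?L, OF d dz that])
  show "\<nu> = \<kappa>"
  proof
    fix n
    show "\<nu> n = \<kappa> n"
    proof (cases "n < ?L")
      case True
      from u[OF True] show ?thesis by (auto simp: fun_eq_iff)
    next
      case False
      then show ?thesis using \<nu>(2)[of n] \<kappa>(2)[of n] by auto
    qed
  qed
qed

lemma appell_coeffs:
  assumes \<phi>: "\<phi> \<in> polys"
  obtains M where "\<And>n. appell_coeffs \<mu> \<phi> n \<in> NC_tensor n" "\<And>n. n \<ge> M \<Longrightarrow> appell_coeffs \<mu> \<phi> n = (\<lambda>_. 0)"
    "\<phi> = (\<lambda>x. \<Sum>n<M. appell_poly n (appell_coeffs \<mu> \<phi> n) x)"
proof -
  obtain M \<kappa> where 1: "\<And>n. \<kappa> n \<in> NC_tensor n" "\<phi> = (\<lambda>x. \<Sum>n<M. monomial n (\<kappa> n) x)" using polysE[OF \<phi>] by blast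
  obtain \<nu> where \<nu>: "\<And>n. \<nu> n \<in> NC_tensor n" "\<And>x. (\<Sum>n<M. monomial n (\<kappa> n) x) = (\<Sum>n<M. appell_poly n (\<nu> n) x)"
    using appell_expansion_exists[of \<kappa> M] 1(1) by blast
  define \<nu>' where "\<nu>' n = (if n < M then \<nu> n else (\<lambda>_. 0))" for n
  have e: "\<phi> = (\<lambda>x. \<Sum>n<M. appell_poly n (\<nu>' n) x)" by (simp add: 1(2) \<nu>(2) \<nu>'_def)
  have n: "\<nu>' n \<in> NC_tensor n" for n using \<nu>(1) NC_tensor_zero by (simp add: \<nu>'_def)
  have "appell_coeffs \<mu> \<phi> = \<nu>'"
    using n by (rule appell_coeffs_eqI[where M = M]) (auto simp: \<nu>'_def e)
  then show ?thesis using that[of M] n e by (auto simp: \<nu>'_def)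
qed

lemma appell_coeffs_NC_tensor: "\<phi> \<in> polys \<Longrightarrow> appell_coeffs \<mu> \<phi> n \<in> NC_tensor n"
  using appell_coeffs[of \<phi>] by metis

lemma appell_coeffs_appell_poly:
  assumes "\<kappa> \<in> NC_tensor n"
  shows "appell_coeffs \<mu> (appell_poly n \<kappa>) = (\<lambda>m. if m = n then \<kappa> else (\<lambda>_. 0))"
proof (rule appell_coeffs_eqI[where M = "Suc n"])
  fix x
  have "(\<Sum>m<Suc n. appell_poly m (if m = n then \<kappa> else (\<lambda>_. 0)) x) = (\<Sum>m<Suc n. if m = n then appell_poly n \<kappa> x else 0)"
    by (intro sum.cong) (auto simp: appell_poly_zero)
  then show "appell_poly n \<kappa> x = (\<Sum>m<Suc n. appell_poly m (if m = n then \<kappa> else (\<lambda>_. 0)) x)" by simp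
qed (use assms NC_tensor_zero in auto)

lemma appell_coeffs_lincomb:
  assumes "\<phi> \<in> polys" "\<psi> \<in> polys"
  shows "appell_coeffs \<mu> (\<lambda>x. a * \<phi> x + b * \<psi> x) n = (\<lambda>xs. a * appell_coeffs \<mu> \<phi> n xs + b * appell_coeffs \<mu> \<psi> n xs)"
proof -
  let ?c = "appell_coeffs \<mu> \<phi>" and ?d = "appell_coeffs \<mu> \<psi>"
  obtain M where 1: "\<And>n. ?c n \<in> NC_tensor n" "\<And>n. n \<ge> M \<Longrightarrow> ?c n = (\<lambda>_. 0)"
    "\<phi> = (\<lambda>x. \<Sum>n<M. appell_poly n (?c n) x)" using appell_coeffs[OF assms(1)] by metis
  obtain M' where 2: "\<And>n. ?d n \<in> NC_tensor n" "\<And>n. n \<ge> M' \<Longrightarrow> ?d n = (\<lambda>_. 0)"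
    "\<psi> = (\<lambda>x. \<Sum>n<M'. appell_poly n (?d n) x)" using appell_coeffs[OF assms(2)] by metis
  have "appell_coeffs \<mu> (\<lambda>x. a * \<phi> x + b * \<psi> x) = (\<lambda>n xs. a * ?c n xs + b * ?d n xs)"
  proof (rule appell_coeffs_eqI[where M = "max M M'"])
    show "(\<lambda>xs. a * ?c n xs + b * ?d n xs) \<in> NC_tensor n" for n by (intro NC_tensor_lincomb 1 2)
    show "(\<lambda>xs. a * ?c n xs + b * ?d n xs) = (\<lambda>_. 0)" if "n \<ge> max M M'" for n
      using 1(2)[of n] 2(2)[of n] that by simp
    fix x
    have "(\<Sum>n<max M M'. appell_poly n (\<lambda>xs. a * ?c n xs + b * ?d n xs) x) =
        a * (\<Sum>n<max M M'. appell_poly n (?c n) x) + b * (\<Sum>n<max M M'. appell_poly n (?d n) x)"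
      unfolding appell_poly_lincomb[OF 1(1) 2(1)] by (simp add: sum.distrib sum_distrib_left)
    also have "(\<Sum>n<max M M'. appell_poly n (?c n) x) = (\<Sum>n<M. appell_poly n (?c n) x)"
      by (intro sum.mono_neutral_right) (auto simp: 1(2) appell_poly_zero)
    also have "(\<Sum>n<max M M'. appell_poly n (?d n) x) = (\<Sum>n<M'. appell_poly n (?d n) x)"
      by (intro sum.mono_neutral_right) (auto simp: 2(2) appell_poly_zero)
    finally show "a * \<phi> x + b * \<psi> x = (\<Sum>n<max M M'. appell_poly n (\<lambda>xs. a * ?c n xs + b * ?d n xs) x)"
      using fun_cong[OF 1(3), of x] fun_cong[OF 2(3), of x] by simp
  qed
  then show ?thesis by simp
qed

end

subsection \<open>Kernels of functionals on polynomials\<close>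

context nuclear_triple
begin

section \<open>The topology of the polynomial space and its dual\<close>

lemma absolutely_convex_polys: "absolutely_convex polys"
  unfolding absolutely_convex_def using polys_lincomb by blast

lemma topspace_poly_topology: "topspace poly_topology = polys"
proof
  show "topspace poly_topology \<subseteq> polys"
    using openin_topspace[of poly_topology] unfolding openin_poly_topology lc_final_open_def by blast
  have "lc_final_open polys poly_nbhds polys"
    unfolding lc_final_open_def
  proof (intro conjI ballI exI[of _ polys] allI absolutely_convex_polys)
    fix \<phi> \<psi> assume "\<phi> \<in> polys" "\<psi> \<in> polys"
    then show "(\<lambda>x. \<phi> x + \<psi> x) \<in> polys" using polys_lincomb[of \<phi> \<psi> 1 1] by simp
  next
    fix n
    have "monomial n ` {\<kappa> \<in> NC_tensor n. \<forall>p\<le>0. tnorm p n \<kappa> < 1} \<in> poly_nbhds n"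
      unfolding poly_nbhds_def using zero_less_one by blast
    moreover have "monomial n ` {\<kappa> \<in> NC_tensor n. \<forall>p\<le>0. tnorm p n \<kappa> < 1} \<subseteq> polys"
      using monomial_polys by blast
    ultimately show "\<exists>w\<in>poly_nbhds n. w \<subseteq> polys" by blast
  qed auto
  then show "polys \<subseteq> topspace poly_topology"
    using openin_subset[of poly_topology polys] unfolding openin_poly_topology by blast
qed

lemma linear_functional_on_polysD:
  assumes "linear_functional_on polys \<Phi>"
  shows "\<phi> \<in> polys \<Longrightarrow> \<psi> \<in> polys \<Longrightarrow> \<Phi> (\<lambda>x. a * \<phi> x + b * \<psi> x) = a * \<Phi> \<phi> + b * \<Phi> \<psi>"
    and "\<phi> \<notin> polys \<Longrightarrow> \<Phi> \<phi> = 0" and "\<phi> \<in> polys \<Longrightarrow> \<Phi> (\<lambda>x. a * \<phi> x) = a * \<Phi> \<phi>" and "\<Phi> (\<lambda>x. 0) = 0"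
proof -
  show lin: "\<Phi> (\<lambda>x. a * \<phi> x + b * \<psi> x) = a * \<Phi> \<phi> + b * \<Phi> \<psi>" if "\<phi> \<in> polys" "\<psi> \<in> polys" for \<phi> \<psi> a b
    using assms that unfolding linear_functional_on_def by blast
  show "\<phi> \<notin> polys \<Longrightarrow> \<Phi> \<phi> = 0"
    using assms unfolding linear_functional_on_def vanishes_outside_def by blast
  show "\<phi> \<in> polys \<Longrightarrow> \<Phi> (\<lambda>x. a * \<phi> x) = a * \<Phi> \<phi>" using lin[of \<phi> \<phi> a 0] by simp
  show "\<Phi> (\<lambda>x. 0) = 0" using lin[OF polys_zero polys_zero, of 0 0] by simp
qed

lemma linear_functional_on_polys_sum:
  assumes \<Phi>: "linear_functional_on polys \<Phi>"
  shows "finite J \<Longrightarrow> (\<And>j. j \<in> J \<Longrightarrow> \<phi> j \<in> polys) \<Longrightarrow> \<Phi> (\<lambda>x. \<Sum>j\<in>J. c j * \<phi> j x) = (\<Sum>j\<in>J. c j * \<Phi> (\<phi> j))"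
proof (induction J rule: finite_induct)
  case empty
  then show ?case using linear_functional_on_polysD(4)[OF \<Phi>] by simp
next
  case (insert j J)
  then show ?case
    using linear_functional_on_polysD(1)[OF \<Phi>, of "\<phi> j" "\<lambda>x. \<Sum>j\<in>J. c j * \<phi> j x" "c j" 1] polys_sum[of J \<phi> c] by simp
qed

text \<open>Continuity at zero provides, in each degree, a neighbourhood given by finitely many
  norms; the largest of them dominates, and homogeneity turns smallness into a bound.\<close>

lemma poly_dual_monomial_bound:
  assumes "\<Phi> \<in> poly_dual"
  shows "\<exists>p C. \<forall>\<kappa>\<in>NC_tensor n. cmod (\<Phi> (monomial n \<kappa>)) \<le> C * tnorm p n \<kappa>"
proof -
  have lin: "linear_functional_on polys \<Phi>" and cont: "continuous_map poly_topology euclidean \<Phi>"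
    using assms by (auto simp: poly_dual_def)
  let ?U = "{\<phi> \<in> topspace poly_topology. \<Phi> \<phi> \<in> ball 0 1}"
  have "openin poly_topology ?U"
    by (rule openin_continuous_map_preimage[OF cont]) simp
  then have "\<forall>u\<in>?U. \<exists>V. V \<subseteq> polys \<and> absolutely_convex V \<and> (\<forall>i. \<exists>w\<in>poly_nbhds i. w \<subseteq> V) \<and>
      (\<forall>v\<in>V. (\<lambda>x. u x + v x) \<in> ?U)"
    unfolding openin_poly_topology lc_final_open_def by (rule conjunct2)
  moreover have "(\<lambda>x. 0) \<in> ?U"
    using polys_zero linear_functional_on_polysD(4)[OF lin] by (simp add: topspace_poly_topology)
  ultimately have "\<exists>V. V \<subseteq> polys \<and> absolutely_convex V \<and> (\<forall>i. \<exists>w\<in>poly_nbhds i. w \<subseteq> V) \<and>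
      (\<forall>v\<in>V. (\<lambda>x. 0 + v x) \<in> ?U)"
    by (rule bspec)
  then obtain V where V: "\<forall>i. \<exists>w\<in>poly_nbhds i. w \<subseteq> V" "\<forall>v\<in>V. (\<lambda>x. 0 + v x) \<in> ?U"
    by (elim exE conjE)
  obtain w where w: "w \<in> poly_nbhds n" "w \<subseteq> V" using V(1) by blast
  obtain m \<epsilon> where e: "0 < \<epsilon>" "w = monomial n ` {\<kappa> \<in> NC_tensor n. \<forall>p\<le>m. tnorm p n \<kappa> < \<epsilon>}"
    using w(1) unfolding poly_nbhds_def by blast
  have small: "cmod (\<Phi> (monomial n \<kappa>)) < 1" if "\<kappa> \<in> NC_tensor n" "tnorm m n \<kappa> < \<epsilon>" for \<kappa>
  proof -
    have "\<forall>p\<le>m. tnorm p n \<kappa> < \<epsilon>" using tnorm_mono[OF that(1)] that(2) le_less_trans by blast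
    then have "monomial n \<kappa> \<in> V" using w(2) e(2) that(1) by blast
    then show ?thesis using V(2) by (auto simp: dist_norm)
  qed
  have "cmod (\<Phi> (monomial n \<kappa>)) \<le> (2 / \<epsilon>) * tnorm m n \<kappa>" if \<kappa>: "\<kappa> \<in> NC_tensor n" for \<kappa>
  proof (rule field_le_epsilon)
    fix d :: real assume d: "0 < d"
    \<comment> \<open>The summand \<open>d\<close> keeps the scaling factor positive when the norm
      of \<open>\<kappa>\<close> is zero.\<close>
    define T where "T = (2 / \<epsilon>) * tnorm m n \<kappa> + d"
    have nn: "0 \<le> (2 / \<epsilon>) * tnorm m n \<kappa>" using e tnorm_nonneg[of m n \<kappa>] by simp
    then have T: "0 < T" using d by (simp add: T_def)
    let ?c = "complex_of_real (1 / T)"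
    have "tnorm m n \<kappa> < \<epsilon> * T"
    proof -
      have "\<epsilon> * T = 2 * tnorm m n \<kappa> + \<epsilon> * d" using e by (simp add: T_def field_simps)
      then show ?thesis using e d tnorm_nonneg[of m n \<kappa>] mult_pos_pos[OF e(1) d] by linarith
    qed
    then have "tnorm m n (\<lambda>xs. ?c * \<kappa> xs) < \<epsilon>"
      unfolding tnorm_scale using T by (simp add: norm_divide field_simps)
    then have "cmod (\<Phi> (monomial n (\<lambda>xs. ?c * \<kappa> xs))) < 1"
      by (intro small NC_tensor_scale \<kappa>)
    then have "cmod (?c * \<Phi> (monomial n \<kappa>)) < 1"
      unfolding monomial_scale linear_functional_on_polysD(3)[OF lin monomial_polys[OF \<kappa>]] .
    then show "cmod (\<Phi> (monomial n \<kappa>)) \<le> 2 / \<epsilon> * tnorm m n \<kappa> + d"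
      using T unfolding T_def[symmetric] by (simp add: norm_mult norm_divide field_simps)
  qed
  then show ?thesis by blast
qed

text \<open>A linear functional on the direct sum is continuous as soon as it is continuous in each
  degree: the preimage of a disc is absolutely convex and contains a neighbourhood from every
  degree.\<close>

lemma poly_dualI:
  assumes lin: "linear_functional_on polys \<Phi>"
    and b: "\<And>n. \<exists>p C. \<forall>\<kappa>\<in>NC_tensor n. cmod (\<Phi> (monomial n \<kappa>)) \<le> C * tnorm p n \<kappa>"
  shows "\<Phi> \<in> poly_dual"
proof -
  have "lc_final_open polys poly_nbhds {\<phi> \<in> polys. \<Phi> \<phi> \<in> U}" if U: "open U" for U
    unfolding lc_final_open_def
  proof (intro conjI ballI)
    fix u assume u: "u \<in> {\<phi> \<in> polys. \<Phi> \<phi> \<in> U}"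
    then obtain \<rho> where \<rho>: "0 < \<rho>" "ball (\<Phi> u) \<rho> \<subseteq> U" using U open_contains_ball by blast
    let ?V = "{v \<in> polys. cmod (\<Phi> v) < \<rho>}"
    have "absolutely_convex ?V"
      unfolding absolutely_convex_def
    proof (intro ballI allI impI)
      fix v w a b assume vw: "v \<in> ?V" "w \<in> ?V" and ab: "cmod a + cmod b \<le> 1"
      have "cmod (a * \<Phi> v + b * \<Phi> w) \<le> cmod a * cmod (\<Phi> v) + cmod b * cmod (\<Phi> w)"
        using norm_triangle_ineq[of "a * \<Phi> v" "b * \<Phi> w"] by (simp add: norm_mult)
      also have "\<dots> \<le> cmod a * max (cmod (\<Phi> v)) (cmod (\<Phi> w)) + cmod b * max (cmod (\<Phi> v)) (cmod (\<Phi> w))"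
        by (intro add_mono mult_left_mono) auto
      also have "\<dots> \<le> 1 * max (cmod (\<Phi> v)) (cmod (\<Phi> w))"
        unfolding distrib_right[symmetric] using ab by (intro mult_right_mono) (auto simp: max_def)
      also have "\<dots> < \<rho>" using vw by simp
      finally show "(\<lambda>x. a * v x + b * w x) \<in> ?V"
        using vw linear_functional_on_polysD(1)[OF lin, of v w a b] by (simp add: polys_lincomb)
    qed
    moreover have "\<exists>w\<in>poly_nbhds i. w \<subseteq> ?V" for i
    proof -
      obtain p C where C: "\<forall>\<kappa>\<in>NC_tensor i. cmod (\<Phi> (monomial i \<kappa>)) \<le> C * tnorm p i \<kappa>" using b by blast
      let ?w = "monomial i ` {\<kappa> \<in> NC_tensor i. \<forall>r\<le>p. tnorm r i \<kappa> < \<rho> / (\<bar>C\<bar> + 1)}"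
      have pos: "0 < \<bar>C\<bar> + 1" by simp
      then have "0 < \<rho> / (\<bar>C\<bar> + 1)" using \<rho> by simp
      then have "?w \<in> poly_nbhds i" unfolding poly_nbhds_def by blast
      moreover have "?w \<subseteq> ?V"
      proof
        fix v assume "v \<in> ?w"
        then obtain \<kappa> where \<kappa>: "v = monomial i \<kappa>" "\<kappa> \<in> NC_tensor i" "tnorm p i \<kappa> < \<rho> / (\<bar>C\<bar> + 1)" by auto
        have "cmod (\<Phi> v) \<le> C * tnorm p i \<kappa>" using C \<kappa> by blast
        also have "\<dots> \<le> (\<bar>C\<bar> + 1) * tnorm p i \<kappa>" by (intro mult_right_mono tnorm_nonneg) auto
        also have "\<dots> < \<rho>" using \<kappa>(3) pos by (simp add: pos_less_divide_eq mult.commute)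
        finally show "v \<in> ?V" using \<kappa> monomial_polys by simp
      qed
      ultimately show ?thesis by blast
    qed
    moreover have "(\<lambda>x. u x + v x) \<in> {\<phi> \<in> polys. \<Phi> \<phi> \<in> U}" if v: "v \<in> ?V" for v
    proof -
      have uv: "(\<lambda>x. u x + v x) \<in> polys" using u v polys_lincomb[of u v 1 1] by simp
      have "\<Phi> (\<lambda>x. u x + v x) = \<Phi> u + \<Phi> v" using linear_functional_on_polysD(1)[OF lin, of u v 1 1] u v by simp
      then have "\<Phi> (\<lambda>x. u x + v x) \<in> ball (\<Phi> u) \<rho>" using v by (simp add: dist_norm)
      then show ?thesis using \<rho> uv by blast
    qed
    ultimately show "\<exists>V\<subseteq>polys. absolutely_convex V \<and> (\<forall>i. \<exists>w\<in>poly_nbhds i. w \<subseteq> V) \<and>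
        (\<forall>v\<in>V. (\<lambda>x. u x + v x) \<in> {\<phi> \<in> polys. \<Phi> \<phi> \<in> U})"
      by (intro exI[of _ ?V]) auto
  qed auto
  then have "continuous_map poly_topology euclidean \<Phi>"
    unfolding continuous_map_def by (simp add: topspace_poly_topology openin_poly_topology)
  then show ?thesis using lin by (simp add: poly_dual_def)
qed

lemma poly_dual_lincomb:
  assumes \<Phi>: "\<Phi> \<in> poly_dual" and \<Psi>: "\<Psi> \<in> poly_dual"
  shows "(\<lambda>\<phi>. a * \<Phi> \<phi> + b * \<Psi> \<phi>) \<in> poly_dual"
proof (rule poly_dualI)
  have l: "linear_functional_on polys \<Phi>" "linear_functional_on polys \<Psi>" using assms by (auto simp: poly_dual_def)
  show "linear_functional_on polys (\<lambda>\<phi>. a * \<Phi> \<phi> + b * \<Psi> \<phi>)"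
    unfolding linear_functional_on_def vanishes_outside_def
    by (auto simp: linear_functional_on_polysD[OF l(1)] linear_functional_on_polysD[OF l(2)] algebra_simps)
  fix n
  obtain p C where 1: "\<forall>\<kappa>\<in>NC_tensor n. cmod (\<Phi> (monomial n \<kappa>)) \<le> C * tnorm p n \<kappa>"
    using poly_dual_monomial_bound[OF \<Phi>] by blast
  obtain r D where 2: "\<forall>\<kappa>\<in>NC_tensor n. cmod (\<Psi> (monomial n \<kappa>)) \<le> D * tnorm r n \<kappa>"
    using poly_dual_monomial_bound[OF \<Psi>] by blast
  have up: "c * tnorm s n \<kappa> \<le> \<bar>c\<bar> * tnorm (max p r) n \<kappa>" if "\<kappa> \<in> NC_tensor n" "s \<le> max p r" for c s \<kappa>
    using tnorm_mono[OF that] tnorm_nonneg[of s n \<kappa>] by (intro mult_mono) auto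
  show "\<exists>p C. \<forall>\<kappa>\<in>NC_tensor n. cmod (a * \<Phi> (monomial n \<kappa>) + b * \<Psi> (monomial n \<kappa>)) \<le> C * tnorm p n \<kappa>"
  proof (intro exI[of _ "max p r"] exI[of _ "cmod a * \<bar>C\<bar> + cmod b * \<bar>D\<bar>"] ballI)
    fix \<kappa> assume \<kappa>: "\<kappa> \<in> NC_tensor n"
    have "cmod (a * \<Phi> (monomial n \<kappa>) + b * \<Psi> (monomial n \<kappa>)) \<le> cmod a * cmod (\<Phi> (monomial n \<kappa>)) + cmod b * cmod (\<Psi> (monomial n \<kappa>))"
      using norm_triangle_ineq[of "a * \<Phi> (monomial n \<kappa>)" "b * \<Psi> (monomial n \<kappa>)"] by (simp add: norm_mult)
    also have "\<dots> \<le> cmod a * (\<bar>C\<bar> * tnorm (max p r) n \<kappa>) + cmod b * (\<bar>D\<bar> * tnorm (max p r) n \<kappa>)"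
    proof (intro add_mono mult_left_mono)
      show "cmod (\<Phi> (monomial n \<kappa>)) \<le> \<bar>C\<bar> * tnorm (max p r) n \<kappa>"
        using 1 \<kappa> up[OF \<kappa>, of p C] by force
      show "cmod (\<Psi> (monomial n \<kappa>)) \<le> \<bar>D\<bar> * tnorm (max p r) n \<kappa>"
        using 2 \<kappa> up[OF \<kappa>, of r D] by force
    qed auto
    finally show "cmod (a * \<Phi> (monomial n \<kappa>) + b * \<Psi> (monomial n \<kappa>)) \<le> (cmod a * \<bar>C\<bar> + cmod b * \<bar>D\<bar>) * tnorm (max p r) n \<kappa>"
      by (simp add: algebra_simps)
  qed
qed

end

context nuclear_measure
begin

text \<open>Pairing with an Appell polynomial of degree \<open>n\<close> picks out
  \<open>fact n\<close> times the \<open>n\<close>-th kernel, whence the division.\<close>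

definition appell_functional :: "'h functional \<Rightarrow> nat \<Rightarrow> 'h kernel \<Rightarrow> complex" where
  "appell_functional \<Phi> n \<kappa> = (if \<kappa> \<in> NC_tensor n then \<Phi> (appell_poly n \<kappa>) / fact n else 0)"

lemma appell_functional_dual:
  assumes \<Phi>: "\<Phi> \<in> poly_dual"
  shows "appell_functional \<Phi> n \<in> NC_tensor_dual n"
proof -
  have lin: "linear_functional_on polys \<Phi>" using assms by (auto simp: poly_dual_def)
  have "\<forall>k. \<exists>p C. \<forall>\<kappa>\<in>NC_tensor k. cmod (\<Phi> (monomial k \<kappa>)) \<le> C * tnorm p k \<kappa>"
    using poly_dual_monomial_bound[OF \<Phi>] by blast
  then obtain p C where pC: "\<And>k \<kappa>. \<kappa> \<in> NC_tensor k \<Longrightarrow> cmod (\<Phi> (monomial k \<kappa>)) \<le> C k * tnorm (p k) k \<kappa>"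
    by metis
  \<comment> \<open>Contraction with \<open>inv_moment\<close> needs \<open>moment_index\<close>,
    and the monomials of degree at most \<open>n\<close> need the finitely many
    \<open>p k\<close>.\<close>
  define q where "q = max (Max (p ` {..n})) moment_index"
  have q: "max (p k) moment_index \<le> q" if "k \<le> n" for k
  proof -
    have "p k \<le> Max (p ` {..n})" using that by (intro Max_ge) auto
    then show ?thesis by (auto simp: q_def)
  qed
  define D where "D = (\<Sum>k\<le>n. real (n choose k) * (\<bar>C k\<bar> * negtnorm moment_index (n - k) (inv_moment (n - k))))"
  have b: "cmod (\<Phi> (appell_poly n \<kappa>)) \<le> D * tnorm q n \<kappa>" if \<kappa>: "\<kappa> \<in> NC_tensor n" for \<kappa>
  proof -
    let ?c = "\<lambda>k. contract k (inv_moment (n - k)) \<kappa>"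
    have "\<Phi> (appell_poly n \<kappa>) = (\<Sum>k\<le>n. of_nat (n choose k) * \<Phi> (monomial k (?c k)))"
      unfolding appell_poly_def
      by (rule linear_functional_on_polys_sum[OF lin]) (auto intro!: monomial_polys contract_inv_moment \<kappa>)
    then have "cmod (\<Phi> (appell_poly n \<kappa>)) \<le> (\<Sum>k\<le>n. real (n choose k) * cmod (\<Phi> (monomial k (?c k))))"
      using norm_sum[of "\<lambda>k. of_nat (n choose k) * \<Phi> (monomial k (?c k))" "{..n}"] by (simp add: norm_mult)
    also have "\<dots> \<le> (\<Sum>k\<le>n. real (n choose k) * (\<bar>C k\<bar> * (negtnorm moment_index (n - k) (inv_moment (n - k)) * tnorm q n \<kappa>)))"
    proof (intro sum_mono mult_left_mono)
      fix k assume "k \<in> {..n}"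
      then have k: "k \<le> n" by simp
      have "cmod (\<Phi> (monomial k (?c k))) \<le> C k * tnorm (p k) k (?c k)"
        by (rule pC[OF contract_inv_moment[OF \<kappa> k]])
      also have "\<dots> \<le> \<bar>C k\<bar> * tnorm (p k) k (?c k)" by (intro mult_right_mono tnorm_nonneg) auto
      also have "\<dots> \<le> \<bar>C k\<bar> * (negtnorm moment_index (n - k) (inv_moment (n - k)) * tnorm q n \<kappa>)"
      proof (intro mult_left_mono)
        have "tnorm (p k) k (?c k) \<le> negtnorm moment_index (n - k) (inv_moment (n - k)) * tnorm (max (p k) moment_index) n \<kappa>"
          using contract_NC_tensor(2)[OF inv_moment, of \<kappa> k "n - k" "p k"] \<kappa> k by simp
        also have "\<dots> \<le> negtnorm moment_index (n - k) (inv_moment (n - k)) * tnorm q n \<kappa>"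
          by (intro mult_left_mono tnorm_mono \<kappa> q[OF k] negtnorm_nonneg[OF inv_moment])
        finally show "tnorm (p k) k (?c k) \<le> negtnorm moment_index (n - k) (inv_moment (n - k)) * tnorm q n \<kappa>" .
      qed auto
      finally show "cmod (\<Phi> (monomial k (?c k))) \<le> \<bar>C k\<bar> * (negtnorm moment_index (n - k) (inv_moment (n - k)) * tnorm q n \<kappa>)" .
    qed auto
    also have "\<dots> = D * tnorm q n \<kappa>"
      unfolding D_def sum_distrib_right by (intro sum.cong refl) (simp add: mult_ac)
    finally show ?thesis .
  qed
  have "appell_functional \<Phi> n \<in> Hneg_tensor q n"
  proof (rule Hneg_tensorI[where C = "D / fact n"])
    fix \<kappa> \<kappa>' a b assume \<kappa>: "\<kappa> \<in> NC_tensor n" "\<kappa>' \<in> NC_tensor n"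
    show "appell_functional \<Phi> n (\<lambda>xs. a * \<kappa> xs + b * \<kappa>' xs) = a * appell_functional \<Phi> n \<kappa> + b * appell_functional \<Phi> n \<kappa>'"
      using \<kappa> by (simp add: appell_functional_def NC_tensor_lincomb appell_poly_lincomb
          linear_functional_on_polysD(1)[OF lin appell_poly_polys appell_poly_polys] add_divide_distrib)
  next
    fix \<kappa> assume \<kappa>: "\<kappa> \<in> NC_tensor n"
    show "cmod (appell_functional \<Phi> n \<kappa>) \<le> D / fact n * tnorm q n \<kappa>"
      using b[OF \<kappa>] \<kappa> by (simp add: appell_functional_def norm_divide divide_right_mono)
  qed (simp add: appell_functional_def)
  then show ?thesis by (auto simp: NC_tensor_dual_def)
qed

lemma NC_tensor_dual_0: "F \<in> NC_tensor_dual n \<Longrightarrow> F (\<lambda>_. 0) = 0"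
  using Hneg_tensor_0 by (auto simp: NC_tensor_dual_def)

lemma Q_mu_sums:
  assumes F: "\<And>n. F n \<in> NC_tensor_dual n" and \<phi>: "\<phi> \<in> polys"
    and M: "\<And>n. n \<ge> M \<Longrightarrow> appell_coeffs \<mu> \<phi> n = (\<lambda>_. 0)"
  shows "(\<lambda>n. Q_mu \<mu> n (F n) \<phi>) sums (\<Sum>n<M. fact n * F n (appell_coeffs \<mu> \<phi> n))"
proof -
  have "(\<lambda>n. Q_mu \<mu> n (F n) \<phi>) sums (\<Sum>n<M. Q_mu \<mu> n (F n) \<phi>)"
    using \<phi> M NC_tensor_dual_0[OF F] by (intro sums_finite) (auto simp: Q_mu_def)
  then show ?thesis using \<phi> by (simp add: Q_mu_def)
qed

lemma Q_mu_appell_poly: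
  assumes F: "\<And>n. F n \<in> NC_tensor_dual n" and \<kappa>: "\<kappa> \<in> NC_tensor n"
  shows "Q_mu \<mu> m (F m) (appell_poly n \<kappa>) = (if m = n then fact n * F n \<kappa> else 0)"
  using NC_tensor_dual_0[OF F] \<kappa> by (simp add: Q_mu_def appell_poly_polys appell_coeffs_appell_poly)

lemma appell_functional_sums:
  assumes \<Phi>: "\<Phi> \<in> poly_dual" and \<phi>: "\<phi> \<in> polys"
  shows "(\<lambda>n. Q_mu \<mu> n (appell_functional \<Phi> n) \<phi>) sums \<Phi> \<phi>"
proof -
  have lin: "linear_functional_on polys \<Phi>" using assms by (auto simp: poly_dual_def)
  let ?c = "appell_coeffs \<mu> \<phi>"
  obtain M where M: "\<And>n. ?c n \<in> NC_tensor n" "\<And>n. n \<ge> M \<Longrightarrow> ?c n = (\<lambda>_. 0)"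
    "\<phi> = (\<lambda>x. \<Sum>n<M. appell_poly n (?c n) x)" using appell_coeffs[OF \<phi>] by metis
  have "\<Phi> \<phi> = \<Phi> (\<lambda>x. \<Sum>n<M. 1 * appell_poly n (?c n) x)" using M(3) by simp
  also have "\<dots> = (\<Sum>n<M. 1 * \<Phi> (appell_poly n (?c n)))"
    by (rule linear_functional_on_polys_sum[OF lin]) (auto intro: appell_poly_polys M)
  also have "\<dots> = (\<Sum>n<M. fact n * appell_functional \<Phi> n (?c n))"
    using M(1) by (simp add: appell_functional_def)
  finally show ?thesis
    using Q_mu_sums[of "appell_functional \<Phi>", OF appell_functional_dual[OF \<Phi>] \<phi> M(2)] by simp
qed

text \<open>Testing on a single Appell polynomial leaves one term of the series, which determines
  the kernel of that degree.\<close>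

lemma kernels_eqI:
  assumes F: "\<And>n. F n \<in> NC_tensor_dual n" and s: "\<And>\<phi>. \<phi> \<in> polys \<Longrightarrow> (\<lambda>n. Q_mu \<mu> n (F n) \<phi>) sums \<Phi> \<phi>"
  shows "kernels \<mu> \<Phi> = F"
  unfolding kernels_def
proof (rule the_equality)
  show "(\<forall>n. F n \<in> NC_tensor_dual n) \<and> (\<forall>\<phi>\<in>polys. (\<lambda>n. Q_mu \<mu> n (F n) \<phi>) sums \<Phi> \<phi>)" using assms by blast
  fix G assume G: "(\<forall>n. G n \<in> NC_tensor_dual n) \<and> (\<forall>\<phi>\<in>polys. (\<lambda>n. Q_mu \<mu> n (G n) \<phi>) sums \<Phi> \<phi>)"
  have val: "fact n * L n \<kappa> = \<Phi> (appell_poly n \<kappa>)"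
    if L: "\<forall>n. L n \<in> NC_tensor_dual n" "\<forall>\<phi>\<in>polys. (\<lambda>n. Q_mu \<mu> n (L n) \<phi>) sums \<Phi> \<phi>" and \<kappa>: "\<kappa> \<in> NC_tensor n" for L n \<kappa>
  proof -
    have "(\<lambda>m. if m = n then fact n * L n \<kappa> else 0) sums \<Phi> (appell_poly n \<kappa>)"
      using L(2)[rule_format, OF appell_poly_polys[OF \<kappa>]] Q_mu_appell_poly[OF L(1)[rule_format] \<kappa>] by simp
    then show ?thesis using sums_single[of n "\<lambda>_. fact n * L n \<kappa>"] sums_unique2 by blast
  qed
  show "G = F"
  proof (intro ext)
    fix n \<kappa>
    show "G n \<kappa> = F n \<kappa>"
    proof (cases "\<kappa> \<in> NC_tensor n")
      case True
      have "fact n * G n \<kappa> = fact n * F n \<kappa>" using val[of G, OF _ _ True] val[of F, OF _ _ True] assms G by simp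
      then show ?thesis by simp
    next
      case False
      have z: "L \<kappa> = 0" if "L \<in> NC_tensor_dual n" for L
        using that Hneg_tensor_vanish False by (auto simp: NC_tensor_dual_def)
      show ?thesis using z[OF F] z[of "G n"] G by metis
    qed
  qed
qed

lemma kernels_eq: "\<Phi> \<in> poly_dual \<Longrightarrow> kernels \<mu> \<Phi> = appell_functional \<Phi>"
  by (intro kernels_eqI appell_functional_dual appell_functional_sums)

lemma kernels_dual: "\<Phi> \<in> poly_dual \<Longrightarrow> kernels \<mu> \<Phi> n \<in> NC_tensor_dual n"
  by (simp add: kernels_eq appell_functional_dual)

lemma kernels_lincomb:
  assumes "\<Phi> \<in> poly_dual" "\<Psi> \<in> poly_dual"
  shows "kernels \<mu> (\<lambda>\<phi>. a * \<Phi> \<phi> + b * \<Psi> \<phi>) n = (\<lambda>\<kappa>. a * kernels \<mu> \<Phi> n \<kappa> + b * kernels \<mu> \<Psi> n \<kappa>)"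
  using assms by (auto simp: kernels_eq poly_dual_lincomb appell_functional_def add_divide_distrib)

text \<open>Identities between distributions, such as bilinearity of the Wick product, are reduced
  to their kernels by this.\<close>

lemma poly_dual_eqI:
  assumes \<Phi>: "\<Phi> \<in> poly_dual" and \<Psi>: "\<Psi> \<in> poly_dual" and eq: "kernels \<mu> \<Phi> = kernels \<mu> \<Psi>"
  shows "\<Phi> = \<Psi>"
proof
  fix \<phi>
  show "\<Phi> \<phi> = \<Psi> \<phi>"
  proof (cases "\<phi> \<in> polys")
    case True
    have "(\<lambda>n. Q_mu \<mu> n (kernels \<mu> \<Phi> n) \<phi>) sums \<Phi> \<phi>" "(\<lambda>n. Q_mu \<mu> n (kernels \<mu> \<Psi> n) \<phi>) sums \<Psi> \<phi>"
      using appell_functional_sums[OF \<Phi> True] appell_functional_sums[OF \<Psi> True] by (simp_all add: kernels_eq \<Phi> \<Psi>)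
    then show ?thesis unfolding eq using sums_unique2 by blast
  next
    case False
    then show ?thesis using \<Phi> \<Psi> by (simp add: poly_dual_def linear_functional_on_polysD(2))
  qed
qed

definition of_kernels :: "(nat \<Rightarrow> 'h kernel \<Rightarrow> complex) \<Rightarrow> 'h functional" where
  "of_kernels F \<phi> = (\<Sum>n. Q_mu \<mu> n (F n) \<phi>)"

lemma of_kernels_sums:
  assumes F: "\<And>n. F n \<in> NC_tensor_dual n"
  shows "(\<lambda>n. Q_mu \<mu> n (F n) \<phi>) sums of_kernels F \<phi>"
proof (cases "\<phi> \<in> polys")
  case True
  obtain M where "\<And>n. n \<ge> M \<Longrightarrow> appell_coeffs \<mu> \<phi> n = (\<lambda>_. 0)" using appell_coeffs[OF True] by metis
  from Q_mu_sums[OF F True this] show ?thesis by (simp add: of_kernels_def sums_iff)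
next
  case False
  then show ?thesis by (simp add: of_kernels_def Q_mu_def)
qed

text \<open>Continuity is required on monomials, while the functional is explicit on Appell
  polynomials. A monomial is an Appell polynomial minus monomials of lower degree, so the bounds
  follow by strong induction on the degree.\<close>

lemma of_kernels_poly_dual:
  assumes F: "\<And>n. F n \<in> NC_tensor_dual n"
  shows "of_kernels F \<in> poly_dual"
proof (rule poly_dualI)
  have Flin: "F n (\<lambda>xs. a * \<kappa> xs + b * \<kappa>' xs) = a * F n \<kappa> + b * F n \<kappa>'"
    if "\<kappa> \<in> NC_tensor n" "\<kappa>' \<in> NC_tensor n" for n \<kappa> \<kappa>' a b
    using F[of n] Hneg_tensor_lincomb[OF _ that] by (auto simp: NC_tensor_dual_def)
  show lin: "linear_functional_on polys (of_kernels F)"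
    unfolding linear_functional_on_def vanishes_outside_def
  proof (intro conjI ballI allI impI)
    show "of_kernels F \<phi> = 0" if "\<phi> \<notin> polys" for \<phi> using that by (simp add: of_kernels_def Q_mu_def)
    fix \<phi> \<psi> a b assume p: "\<phi> \<in> polys" "\<psi> \<in> polys"
    have "Q_mu \<mu> n (F n) (\<lambda>x. a * \<phi> x + b * \<psi> x) = a * Q_mu \<mu> n (F n) \<phi> + b * Q_mu \<mu> n (F n) \<psi>" for n
      using p by (simp add: Q_mu_def polys_lincomb appell_coeffs_lincomb Flin appell_coeffs_NC_tensor algebra_simps)
    then have "(\<lambda>n. Q_mu \<mu> n (F n) (\<lambda>x. a * \<phi> x + b * \<psi> x)) sums (a * of_kernels F \<phi> + b * of_kernels F \<psi>)"
      by (simp add: sums_add sums_mult of_kernels_sums[OF F])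
    then show "of_kernels F (\<lambda>x. a * \<phi> x + b * \<psi> x) = a * of_kernels F \<phi> + b * of_kernels F \<psi>"
      using of_kernels_sums[OF F] sums_unique2 by blast
  qed
  fix n
  show "\<exists>p C. \<forall>\<kappa>\<in>NC_tensor n. cmod (of_kernels F (monomial n \<kappa>)) \<le> C * tnorm p n \<kappa>"
  proof (induction n rule: less_induct)
    case (less n)
    then have "\<forall>k\<in>{..<n}. \<exists>p C. \<forall>\<kappa>\<in>NC_tensor k. cmod (of_kernels F (monomial k \<kappa>)) \<le> C * tnorm p k \<kappa>" by blast
    then obtain p C where pC: "\<And>k \<kappa>. k < n \<Longrightarrow> \<kappa> \<in> NC_tensor k \<Longrightarrow> cmod (of_kernels F (monomial k \<kappa>)) \<le> C k * tnorm (p k) k \<kappa>"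
      by (metis lessThan_iff)
    obtain r where r: "F n \<in> Hneg_tensor r n" using F[of n] by (auto simp: NC_tensor_dual_def)
    \<comment> \<open>The inserted \<open>0\<close> makes the maximum meaningful for
      \<open>n = 0\<close>.\<close>
    define q where "q = max r (max (Max (insert 0 (p ` {..<n}))) moment_index)"
    have q: "max (p k) moment_index \<le> q" if "k < n" for k
    proof -
      have "p k \<le> Max (insert 0 (p ` {..<n}))" using that by (intro Max_ge) auto
      then show ?thesis by (auto simp: q_def)
    qed
    let ?B = "\<lambda>k. negtnorm moment_index (n - k) (inv_moment (n - k))"
    define D where "D = fact n * negtnorm r n (F n) + (\<Sum>k<n. real (n choose k) * (\<bar>C k\<bar> * ?B k))"
    have "cmod (of_kernels F (monomial n \<kappa>)) \<le> D * tnorm q n \<kappa>" if \<kappa>: "\<kappa> \<in> NC_tensor n" for \<kappa>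
    proof -
      let ?c = "\<lambda>k. contract k (inv_moment (n - k)) \<kappa>"
      let ?rest = "\<lambda>x. \<Sum>k<n. of_nat (n choose k) * monomial k (?c k) x"
      have ck: "?c k \<in> NC_tensor k" if "k < n" for k using contract_inv_moment[OF \<kappa>, of k] that by simp
      have rest: "?rest \<in> polys" by (intro polys_sum) (auto intro!: monomial_polys ck)
      have "monomial n \<kappa> = (\<lambda>x. 1 * appell_poly n \<kappa> x + (-1) * ?rest x)"
        using appell_poly_leading[OF \<kappa>] by (simp add: fun_eq_iff)
      then have "of_kernels F (monomial n \<kappa>) = 1 * of_kernels F (appell_poly n \<kappa>) + (-1) * of_kernels F ?rest"
        using linear_functional_on_polysD(1)[OF lin appell_poly_polys[OF \<kappa>] rest, of 1 "-1"] by simp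
      also have "of_kernels F ?rest = (\<Sum>k<n. of_nat (n choose k) * of_kernels F (monomial k (?c k)))"
        by (rule linear_functional_on_polys_sum[OF lin]) (auto intro!: monomial_polys ck)
      also have "of_kernels F (appell_poly n \<kappa>) = fact n * F n \<kappa>"
      proof -
        have "(\<lambda>m. if m = n then fact n * F n \<kappa> else 0) sums of_kernels F (appell_poly n \<kappa>)"
          using of_kernels_sums[OF F, of "appell_poly n \<kappa>"] by (simp add: Q_mu_appell_poly[OF F \<kappa>])
        then show ?thesis using sums_single[of n "\<lambda>_. fact n * F n \<kappa>"] sums_unique2 by blast
      qed
      finally have "cmod (of_kernels F (monomial n \<kappa>)) \<le> cmod (fact n * F n \<kappa>) + cmod (\<Sum>k<n. of_nat (n choose k) * of_kernels F (monomial k (?c k)))"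
        using norm_triangle_ineq4[of "fact n * F n \<kappa>" "\<Sum>k<n. of_nat (n choose k) * of_kernels F (monomial k (?c k))"] by simp
      also have "\<dots> \<le> fact n * (negtnorm r n (F n) * tnorm q n \<kappa>) + (\<Sum>k<n. real (n choose k) * (\<bar>C k\<bar> * (?B k * tnorm q n \<kappa>)))"
      proof (rule add_mono)
        have "cmod (F n \<kappa>) \<le> negtnorm r n (F n) * tnorm r n \<kappa>" by (rule negtnorm_bound[OF r \<kappa>])
        also have "\<dots> \<le> negtnorm r n (F n) * tnorm q n \<kappa>"
          by (intro mult_left_mono tnorm_mono \<kappa> negtnorm_nonneg[OF r]) (simp add: q_def)
        finally show "cmod (fact n * F n \<kappa>) \<le> fact n * (negtnorm r n (F n) * tnorm q n \<kappa>)"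
          by (simp add: norm_mult)
        have "cmod (\<Sum>k<n. of_nat (n choose k) * of_kernels F (monomial k (?c k))) \<le>
            (\<Sum>k<n. real (n choose k) * cmod (of_kernels F (monomial k (?c k))))"
          using norm_sum[of "\<lambda>k. of_nat (n choose k) * of_kernels F (monomial k (?c k))" "{..<n}"] by (simp add: norm_mult)
        also have "\<dots> \<le> (\<Sum>k<n. real (n choose k) * (\<bar>C k\<bar> * (?B k * tnorm q n \<kappa>)))"
        proof (intro sum_mono mult_left_mono)
          fix k assume "k \<in> {..<n}"
          then have k: "k < n" by simp
          have "cmod (of_kernels F (monomial k (?c k))) \<le> C k * tnorm (p k) k (?c k)"
            by (rule pC[OF k ck[OF k]])
          also have "\<dots> \<le> \<bar>C k\<bar> * tnorm (p k) k (?c k)" by (intro mult_right_mono tnorm_nonneg) auto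
          also have "\<dots> \<le> \<bar>C k\<bar> * (?B k * tnorm q n \<kappa>)"
          proof (intro mult_left_mono)
            have "tnorm (p k) k (?c k) \<le> ?B k * tnorm (max (p k) moment_index) n \<kappa>"
              using contract_NC_tensor(2)[OF inv_moment, of \<kappa> k "n - k" "p k"] \<kappa> k by simp
            also have "\<dots> \<le> ?B k * tnorm q n \<kappa>"
              by (intro mult_left_mono tnorm_mono \<kappa> q[OF k] negtnorm_nonneg[OF inv_moment])
            finally show "tnorm (p k) k (?c k) \<le> ?B k * tnorm q n \<kappa>" .
          qed auto
          finally show "cmod (of_kernels F (monomial k (?c k))) \<le> \<bar>C k\<bar> * (?B k * tnorm q n \<kappa>)" .
        qed auto
        finally show "cmod (\<Sum>k<n. of_nat (n choose k) * of_kernels F (monomial k (?c k))) \<le>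
            (\<Sum>k<n. real (n choose k) * (\<bar>C k\<bar> * (?B k * tnorm q n \<kappa>)))" .
      qed
      also have "\<dots> = D * tnorm q n \<kappa>"
        unfolding D_def distrib_right sum_distrib_right by (simp add: mult_ac)
      finally show ?thesis .
    qed
    then show ?case by blast
  qed
qed

lemma kernels_of_kernels:
  assumes "\<And>n. F n \<in> NC_tensor_dual n"
  shows "kernels \<mu> (of_kernels F) = F"
  using assms of_kernels_sums[OF assms] by (intro kernels_eqI)

end

subsection \<open>The Wick product of distributions\<close>

lemma summable_cauchy_product_nonneg:
  fixes A B :: "nat \<Rightarrow> real"
  assumes "summable A" "summable B" "\<And>n. 0 \<le> A n" "\<And>n. 0 \<le> B n"
  shows "(\<lambda>n. \<Sum>k\<le>n. A k * B (n - k)) sums ((\<Sum>n. A n) * (\<Sum>n. B n))"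
  using assms by (intro Cauchy_product_sums) auto

lemma weighted_convolution_le:
  fixes a b :: "nat \<Rightarrow> real"
  shows "(1/2) ^ ((q1 + q2 + 1) * n) * (\<Sum>k\<le>n. a k * b (n - k))\<^sup>2 \<le>
    (\<Sum>k\<le>n. ((1/2) ^ (q1 * k) * (a k)\<^sup>2) * ((1/2) ^ (q2 * (n - k)) * (b (n - k))\<^sup>2))"
proof -
  have n: "real (n + 1) \<le> 2 ^ n" by (induction n) auto
  have "(\<Sum>k\<le>n. a k * b (n - k))\<^sup>2 \<le> (\<Sum>k\<le>n. (a k * b (n - k))\<^sup>2) * real (n + 1)"
    using sum_squared_le_sum_of_squares[of "\<lambda>k. a k * b (n - k)" "{..n}"] by (simp add: mult.commute)
  also have "\<dots> \<le> (\<Sum>k\<le>n. (a k * b (n - k))\<^sup>2) * 2 ^ n"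
    using n by (intro mult_left_mono sum_nonneg) auto
  finally have "(1/2) ^ ((q1 + q2 + 1) * n) * (\<Sum>k\<le>n. a k * b (n - k))\<^sup>2 \<le>
      (1/2) ^ ((q1 + q2 + 1) * n) * ((\<Sum>k\<le>n. (a k * b (n - k))\<^sup>2) * 2 ^ n)"
    by (intro mult_left_mono) auto
  also have "\<dots> = (\<Sum>k\<le>n. (1/2) ^ ((q1 + q2) * n) * (a k * b (n - k))\<^sup>2)"
  proof -
    have "(1/2 :: real) ^ ((q1 + q2 + 1) * n) * 2 ^ n = (1/2) ^ ((q1 + q2) * n) * ((1/2) ^ n * 2 ^ n)"
      by (simp add: power_add algebra_simps)
    also have "(1/2 :: real) ^ n * 2 ^ n = 1" by (simp flip: power_mult_distrib)
    finally show ?thesis by (simp add: sum_distrib_left[symmetric] mult_ac)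
  qed
  also have "\<dots> \<le> (\<Sum>k\<le>n. ((1/2) ^ (q1 * k) * (a k)\<^sup>2) * ((1/2) ^ (q2 * (n - k)) * (b (n - k))\<^sup>2))"
  proof (intro sum_mono)
    fix k assume "k \<in> {..n}"
    \<comment> \<open>Each factor keeps only the weight of its own degree; the rest of the combined
      weight is at most 1 and is dropped.\<close>
    then have "q1 * k + q2 * (n - k) \<le> (q1 + q2) * n"
      by (simp add: distrib_right add_mono)
    then have "(1/2 :: real) ^ ((q1 + q2) * n) \<le> (1/2) ^ (q1 * k + q2 * (n - k))"
      by (intro power_decreasing) auto
    then have "(1/2) ^ ((q1 + q2) * n) * (a k * b (n - k))\<^sup>2 \<le> (1/2) ^ (q1 * k + q2 * (n - k)) * (a k * b (n - k))\<^sup>2"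
      by (intro mult_right_mono) auto
    then show "(1/2) ^ ((q1 + q2) * n) * (a k * b (n - k))\<^sup>2 \<le>
        ((1/2) ^ (q1 * k) * (a k)\<^sup>2) * ((1/2) ^ (q2 * (n - k)) * (b (n - k))\<^sup>2)"
      by (simp add: power_add power_mult_distrib mult_ac)
  qed
  finally show ?thesis .
qed

context nuclear_measure
begin

section \<open>The steps of the distribution space and their norms\<close>

lemma dist_spaceD:
  assumes "\<Phi> \<in> dist_space \<mu> p q"
  shows "\<Phi> \<in> poly_dual" "kernels \<mu> \<Phi> n \<in> Hneg_tensor p n"
    "summable (\<lambda>n. (1/2) ^ (q * n) * (negtnorm p n (kernels \<mu> \<Phi> n))\<^sup>2)"
  using assms by (auto simp: dist_space_def)

lemma dist_norm_nonneg: "\<Phi> \<in> dist_space \<mu> p q \<Longrightarrow> 0 \<le> dist_norm \<mu> p q \<Phi>"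
  using dist_spaceD(3) by (auto simp: dist_norm_def intro!: suminf_nonneg)

lemma dist_norm_sq:
  "\<Phi> \<in> dist_space \<mu> p q \<Longrightarrow>
    (dist_norm \<mu> p q \<Phi>)\<^sup>2 = (\<Sum>n. (1/2) ^ (q * n) * (negtnorm p n (kernels \<mu> \<Phi> n))\<^sup>2)"
  using dist_spaceD(3) by (auto simp: dist_norm_def intro!: real_sqrt_pow2 suminf_nonneg)

lemma dist_space_mono:
  assumes \<Phi>: "\<Phi> \<in> dist_space \<mu> p q" and pq: "p \<le> p'" "q \<le> q'"
  shows "\<Phi> \<in> dist_space \<mu> p' q'"
proof -
  have "(1/2) ^ (q' * n) * (negtnorm p' n (kernels \<mu> \<Phi> n))\<^sup>2 \<le> (1/2) ^ (q * n) * (negtnorm p n (kernels \<mu> \<Phi> n))\<^sup>2" for n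
    using Hneg_tensor_mono[OF dist_spaceD(2)[OF \<Phi>] pq(1), of n] negtnorm_nonneg[of _ p' n] pq(2)
    by (intro mult_mono power_decreasing power_mono) auto
  then have "summable (\<lambda>n. (1/2) ^ (q' * n) * (negtnorm p' n (kernels \<mu> \<Phi> n))\<^sup>2)"
    by (intro summable_comparison_test'[OF dist_spaceD(3)[OF \<Phi>], of 0]) simp
  then show ?thesis
    using \<Phi> Hneg_tensor_mono(1)[OF dist_spaceD(2)[OF \<Phi>] pq(1)] by (simp add: dist_space_def)
qed

lemma dist_space_lincomb:
  assumes \<Phi>: "\<Phi> \<in> dist_space \<mu> p q" and \<Psi>: "\<Psi> \<in> dist_space \<mu> p q"
  shows "(\<lambda>\<phi>. a * \<Phi> \<phi> + b * \<Psi> \<phi>) \<in> dist_space \<mu> p q"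
proof -
  let ?L = "\<lambda>n \<kappa>. a * kernels \<mu> \<Phi> n \<kappa> + b * kernels \<mu> \<Psi> n \<kappa>"
  note k = kernels_lincomb[OF dist_spaceD(1)[OF \<Phi>] dist_spaceD(1)[OF \<Psi>]]
  have L: "?L n \<in> Hneg_tensor p n" for n by (intro Hneg_tensor_lin(1) dist_spaceD(2)[OF \<Phi>] dist_spaceD(2)[OF \<Psi>])
  let ?f = "\<lambda>n. negtnorm p n (kernels \<mu> \<Phi> n)" and ?g = "\<lambda>n. negtnorm p n (kernels \<mu> \<Psi> n)"
  have "(1/2) ^ (q * n) * (negtnorm p n (?L n))\<^sup>2 \<le>
      2 * (cmod a)\<^sup>2 * ((1/2) ^ (q * n) * (?f n)\<^sup>2) + 2 * (cmod b)\<^sup>2 * ((1/2) ^ (q * n) * (?g n)\<^sup>2)" for n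
  proof -
    have "(negtnorm p n (?L n))\<^sup>2 \<le> (cmod a * ?f n + cmod b * ?g n)\<^sup>2"
      by (intro power_mono Hneg_tensor_lin(2) negtnorm_nonneg[OF L] dist_spaceD(2)[OF \<Phi>] dist_spaceD(2)[OF \<Psi>])
    also have "\<dots> \<le> 2 * (cmod a * ?f n)\<^sup>2 + 2 * (cmod b * ?g n)\<^sup>2"
      using sum_squares_bound[of "cmod a * ?f n" "cmod b * ?g n"] by (simp add: power2_sum)
    finally have "(1/2) ^ (q * n) * (negtnorm p n (?L n))\<^sup>2 \<le> (1/2) ^ (q * n) * (2 * (cmod a * ?f n)\<^sup>2 + 2 * (cmod b * ?g n)\<^sup>2)"
      by (intro mult_left_mono) auto
    then show ?thesis by (simp add: power_mult_distrib algebra_simps)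
  qed
  then have "summable (\<lambda>n. (1/2) ^ (q * n) * (negtnorm p n (?L n))\<^sup>2)"
    by (intro summable_comparison_test'[where N = 0, OF summable_add[OF summable_mult[OF dist_spaceD(3)[OF \<Phi>], of "2 * (cmod a)\<^sup>2"]
          summable_mult[OF dist_spaceD(3)[OF \<Psi>], of "2 * (cmod b)\<^sup>2"]]]) simp
  then show ?thesis
    using poly_dual_lincomb[OF dist_spaceD(1)[OF \<Phi>] dist_spaceD(1)[OF \<Psi>]] L by (simp add: dist_space_def k)
qed

lemma distributions_lincomb:
  assumes "\<Phi> \<in> distributions \<mu>" "\<Psi> \<in> distributions \<mu>"
  shows "(\<lambda>\<phi>. a * \<Phi> \<phi> + b * \<Psi> \<phi>) \<in> distributions \<mu>"
proof -
  obtain p q p' q' where "\<Phi> \<in> dist_space \<mu> p q" "\<Psi> \<in> dist_space \<mu> p' q'"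
    using assms by (auto simp: distributions_def)
  then have "\<Phi> \<in> dist_space \<mu> (max p p') (max q q')" "\<Psi> \<in> dist_space \<mu> (max p p') (max q q')"
    using dist_space_mono by (meson max.cobounded1 max.cobounded2)+
  from dist_space_lincomb[OF this, of a b] show ?thesis unfolding distributions_def by blast
qed

lemma distributions_poly_dual: "\<Phi> \<in> distributions \<mu> \<Longrightarrow> \<Phi> \<in> poly_dual"
  by (auto simp: distributions_def dist_space_def)

lemma dist_norm_scale_le:
  assumes \<Phi>: "\<Phi> \<in> dist_space \<mu> p q"
  shows "(\<lambda>\<phi>. c * \<Phi> \<phi>) \<in> dist_space \<mu> p q" "dist_norm \<mu> p q (\<lambda>\<phi>. c * \<Phi> \<phi>) \<le> cmod c * dist_norm \<mu> p q \<Phi>"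
proof -
  show c: "(\<lambda>\<phi>. c * \<Phi> \<phi>) \<in> dist_space \<mu> p q" using dist_space_lincomb[OF \<Phi> \<Phi>, of c 0] by simp
  have k: "kernels \<mu> (\<lambda>\<phi>. c * \<Phi> \<phi>) n = (\<lambda>\<kappa>. c * kernels \<mu> \<Phi> n \<kappa> + 0 * kernels \<mu> \<Phi> n \<kappa>)" for n
    using kernels_lincomb[OF dist_spaceD(1)[OF \<Phi>] dist_spaceD(1)[OF \<Phi>], of c 0 n] by simp
  have le: "(1/2) ^ (q * n) * (negtnorm p n (kernels \<mu> (\<lambda>\<phi>. c * \<Phi> \<phi>) n))\<^sup>2 \<le>
      (cmod c)\<^sup>2 * ((1/2) ^ (q * n) * (negtnorm p n (kernels \<mu> \<Phi> n))\<^sup>2)" for n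
  proof -
    have "negtnorm p n (kernels \<mu> (\<lambda>\<phi>. c * \<Phi> \<phi>) n) \<le> cmod c * negtnorm p n (kernels \<mu> \<Phi> n)"
      unfolding k using Hneg_tensor_lin(2)[OF dist_spaceD(2)[OF \<Phi>] dist_spaceD(2)[OF \<Phi>], of n c 0] by simp
    then have "(negtnorm p n (kernels \<mu> (\<lambda>\<phi>. c * \<Phi> \<phi>) n))\<^sup>2 \<le> (cmod c * negtnorm p n (kernels \<mu> \<Phi> n))\<^sup>2"
      by (intro power_mono negtnorm_nonneg dist_spaceD(2)[OF c])
    then have "(1/2) ^ (q * n) * (negtnorm p n (kernels \<mu> (\<lambda>\<phi>. c * \<Phi> \<phi>) n))\<^sup>2 \<le>
        (1/2) ^ (q * n) * (cmod c * negtnorm p n (kernels \<mu> \<Phi> n))\<^sup>2" by (intro mult_left_mono) auto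
    then show ?thesis by (simp add: power_mult_distrib mult_ac)
  qed
  have "(dist_norm \<mu> p q (\<lambda>\<phi>. c * \<Phi> \<phi>))\<^sup>2 \<le> (\<Sum>n. (cmod c)\<^sup>2 * ((1/2) ^ (q * n) * (negtnorm p n (kernels \<mu> \<Phi> n))\<^sup>2))"
    unfolding dist_norm_sq[OF c] by (intro suminf_le le dist_spaceD(3)[OF c] summable_mult dist_spaceD(3)[OF \<Phi>])
  also have "\<dots> = (cmod c * dist_norm \<mu> p q \<Phi>)\<^sup>2"
    unfolding power_mult_distrib dist_norm_sq[OF \<Phi>] by (rule suminf_mult[OF dist_spaceD(3)[OF \<Phi>]])
  finally show "dist_norm \<mu> p q (\<lambda>\<phi>. c * \<Phi> \<phi>) \<le> cmod c * dist_norm \<mu> p q \<Phi>"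
    by (rule power2_le_imp_le) (intro mult_nonneg_nonneg norm_ge_zero dist_norm_nonneg[OF \<Phi>])
qed

text \<open>The factor \<open>1\<close> makes the sum an instance of
  \<open>Hneg_tensor_sum_mem\<close>.\<close>

definition wick_kernels :: "'h functional \<Rightarrow> 'h functional \<Rightarrow> nat \<Rightarrow> 'h kernel \<Rightarrow> complex" where
  "wick_kernels \<Phi> \<Psi> n = (\<lambda>\<kappa>. \<Sum>k\<le>n. 1 * tens k (n - k) (kernels \<mu> \<Phi> k) (kernels \<mu> \<Psi> (n - k)) \<kappa>)"

lemma wick_kernels_Hneg_tensor:
  assumes \<Phi>: "\<Phi> \<in> dist_space \<mu> p1 q1" and \<Psi>: "\<Psi> \<in> dist_space \<mu> p2 q2"
  shows "wick_kernels \<Phi> \<Psi> n \<in> Hneg_tensor (max p1 p2) n"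
    and "negtnorm (max p1 p2) n (wick_kernels \<Phi> \<Psi> n) \<le>
      (\<Sum>k\<le>n. negtnorm p1 k (kernels \<mu> \<Phi> k) * negtnorm p2 (n - k) (kernels \<mu> \<Psi> (n - k)))"
proof -
  let ?T = "\<lambda>k. tens k (n - k) (kernels \<mu> \<Phi> k) (kernels \<mu> \<Psi> (n - k))"
  have T: "?T k \<in> Hneg_tensor (max p1 p2) n"
    "negtnorm (max p1 p2) n (?T k) \<le> negtnorm p1 k (kernels \<mu> \<Phi> k) * negtnorm p2 (n - k) (kernels \<mu> \<Psi> (n - k))" if "k \<le> n" for k
    using tens_Hneg_tensor[OF dist_spaceD(2)[OF \<Phi>, of k] dist_spaceD(2)[OF \<Psi>, of "n - k"]] that by auto
  show "wick_kernels \<Phi> \<Psi> n \<in> Hneg_tensor (max p1 p2) n"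
    unfolding wick_kernels_def using T by (intro Hneg_tensor_sum_mem(1)) auto
  have "negtnorm (max p1 p2) n (wick_kernels \<Phi> \<Psi> n) \<le> (\<Sum>k\<le>n. cmod 1 * negtnorm (max p1 p2) n (?T k))"
    unfolding wick_kernels_def using T by (intro Hneg_tensor_sum_mem(2)) auto
  also have "\<dots> \<le> (\<Sum>k\<le>n. negtnorm p1 k (kernels \<mu> \<Phi> k) * negtnorm p2 (n - k) (kernels \<mu> \<Psi> (n - k)))"
    using T by (intro sum_mono) auto
  finally show "negtnorm (max p1 p2) n (wick_kernels \<Phi> \<Psi> n) \<le>
      (\<Sum>k\<le>n. negtnorm p1 k (kernels \<mu> \<Phi> k) * negtnorm p2 (n - k) (kernels \<mu> \<Psi> (n - k)))" .
qed

text \<open>The squared norms of the kernels of the product are dominated by a Cauchy product of the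
  two defining series, whose sum is the product of the squared norms.\<close>

lemma wick_kernels_estimate:
  assumes \<Phi>: "\<Phi> \<in> dist_space \<mu> p1 q1" and \<Psi>: "\<Psi> \<in> dist_space \<mu> p2 q2"
  defines "p \<equiv> max p1 p2" and "q \<equiv> q1 + q2 + 1"
  shows "of_kernels (wick_kernels \<Phi> \<Psi>) \<in> dist_space \<mu> p q"
    and "dist_norm \<mu> p q (of_kernels (wick_kernels \<Phi> \<Psi>)) \<le> dist_norm \<mu> p1 q1 \<Phi> * dist_norm \<mu> p2 q2 \<Psi>"
    and "kernels \<mu> (of_kernels (wick_kernels \<Phi> \<Psi>)) = wick_kernels \<Phi> \<Psi>"
proof -
  let ?W = "wick_kernels \<Phi> \<Psi>"
  let ?a = "\<lambda>k. negtnorm p1 k (kernels \<mu> \<Phi> k)" and ?b = "\<lambda>k. negtnorm p2 k (kernels \<mu> \<Psi> k)"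
  have W: "?W n \<in> Hneg_tensor p n" "negtnorm p n (?W n) \<le> (\<Sum>k\<le>n. ?a k * ?b (n - k))" for n
    using wick_kernels_Hneg_tensor[OF \<Phi> \<Psi>] by (auto simp: p_def)
  have Wd: "?W n \<in> NC_tensor_dual n" for n using W(1) by (auto simp: NC_tensor_dual_def)
  show k: "kernels \<mu> (of_kernels ?W) = ?W" by (rule kernels_of_kernels[OF Wd])
  define A where "A n = (1/2) ^ (q1 * n) * (?a n)\<^sup>2" for n
  define B where "B n = (1/2) ^ (q2 * n) * (?b n)\<^sup>2" for n
  have AB: "(\<lambda>n. \<Sum>k\<le>n. A k * B (n - k)) sums ((\<Sum>n. A n) * (\<Sum>n. B n))"
    using dist_spaceD(3)[OF \<Phi>] dist_spaceD(3)[OF \<Psi>]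
    by (intro summable_cauchy_product_nonneg) (auto simp: A_def B_def)
  have le: "(1/2) ^ (q * n) * (negtnorm p n (?W n))\<^sup>2 \<le> (\<Sum>k\<le>n. A k * B (n - k))" for n
  proof -
    have "(1/2) ^ (q * n) * (negtnorm p n (?W n))\<^sup>2 \<le> (1/2) ^ (q * n) * (\<Sum>k\<le>n. ?a k * ?b (n - k))\<^sup>2"
      by (intro mult_left_mono power_mono W(2) negtnorm_nonneg[OF W(1)]) auto
    also have "\<dots> \<le> (\<Sum>k\<le>n. A k * B (n - k))"
      unfolding A_def B_def q_def by (rule weighted_convolution_le)
    finally show ?thesis .
  qed
  have sm: "summable (\<lambda>n. (1/2) ^ (q * n) * (negtnorm p n (?W n))\<^sup>2)"
    using le by (intro summable_comparison_test'[OF sums_summable[OF AB], of 0]) simp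
  show mem: "of_kernels ?W \<in> dist_space \<mu> p q"
    using of_kernels_poly_dual[OF Wd] W(1) sm by (simp add: dist_space_def k)
  have "(dist_norm \<mu> p q (of_kernels ?W))\<^sup>2 \<le> (\<Sum>n. \<Sum>k\<le>n. A k * B (n - k))"
    unfolding dist_norm_sq[OF mem] k by (intro suminf_le le sm sums_summable[OF AB])
  also have "\<dots> = (dist_norm \<mu> p1 q1 \<Phi> * dist_norm \<mu> p2 q2 \<Psi>)\<^sup>2"
    unfolding power_mult_distrib dist_norm_sq[OF \<Phi>] dist_norm_sq[OF \<Psi>]
    using sums_unique[OF AB] by (simp add: A_def B_def)
  finally show "dist_norm \<mu> p q (of_kernels ?W) \<le> dist_norm \<mu> p1 q1 \<Phi> * dist_norm \<mu> p2 q2 \<Psi>"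
    by (rule power2_le_imp_le) (intro mult_nonneg_nonneg dist_norm_nonneg[OF \<Phi>] dist_norm_nonneg[OF \<Psi>])
qed

text \<open>The kernels grow at most like \<open>(2 ^ q) ^ n\<close>, so the radius
  \<open>1 / 2 ^ Suc q\<close> leaves a geometric series with ratio one half.\<close>

lemma S_transform_summable:
  assumes \<Phi>: "\<Phi> \<in> dist_space \<mu> p q" and \<theta>: "\<theta> \<in> NC" "cpnorm p \<theta> < 1 / 2 ^ Suc q"
  shows "summable (\<lambda>n. cmod (kernels \<mu> \<Phi> n (tensor_power n \<theta>)))"
proof -
  define s where "s = (\<Sum>n. (1/2) ^ (q * n) * (negtnorm p n (kernels \<mu> \<Phi> n))\<^sup>2)"
  have s: "0 \<le> s" unfolding s_def using dist_spaceD(3)[OF \<Phi>] by (intro suminf_nonneg) auto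
  \<comment> \<open>A single term of the norm series is at most \<open>s\<close>. The bound is
    coarsened to avoid square roots.\<close>
  have b: "negtnorm p n (kernels \<mu> \<Phi> n) \<le> (s + 1) * (2 ^ q) ^ n" for n
  proof (rule power2_le_imp_le)
    have "(\<Sum>i\<in>{n}. (1/2) ^ (q * i) * (negtnorm p i (kernels \<mu> \<Phi> i))\<^sup>2) \<le> s"
      unfolding s_def using dist_spaceD(3)[OF \<Phi>] by (intro sum_le_suminf) auto
    then have "1 / (2 ^ q) ^ n * (negtnorm p n (kernels \<mu> \<Phi> n))\<^sup>2 \<le> s"
      by (simp add: power_one_over flip: power_mult)
    then have "(negtnorm p n (kernels \<mu> \<Phi> n))\<^sup>2 \<le> s * (2 ^ q) ^ n"
      by (simp add: pos_divide_le_eq)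
    also have "\<dots> \<le> (s + 1)\<^sup>2 * ((2 ^ q) ^ n)\<^sup>2"
    proof (intro mult_mono)
      show "s \<le> (s + 1)\<^sup>2" using s by (simp add: power2_sum)
      have "(1::real) \<le> (2 ^ q) ^ n" by simp
      then show "((2::real) ^ q) ^ n \<le> ((2 ^ q) ^ n)\<^sup>2" by (simp add: power2_eq_square)
    qed auto
    finally show "(negtnorm p n (kernels \<mu> \<Phi> n))\<^sup>2 \<le> ((s + 1) * (2 ^ q) ^ n)\<^sup>2" by (simp add: power_mult_distrib)
  qed (use s in auto)
  have "cmod (kernels \<mu> \<Phi> n (tensor_power n \<theta>)) \<le> (s + 1) * (1 / 2) ^ n" for n
  proof -
    have "cmod (kernels \<mu> \<Phi> n (tensor_power n \<theta>)) \<le> negtnorm p n (kernels \<mu> \<Phi> n) * tnorm p n (tensor_power n \<theta>)"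
      by (intro negtnorm_bound dist_spaceD(2)[OF \<Phi>] tensor_power_NC_tensor(1) \<theta>(1))
    also have "\<dots> \<le> ((s + 1) * (2 ^ q) ^ n) * (1 / 2 ^ Suc q) ^ n"
    proof (intro mult_mono b tnorm_nonneg)
      have "tnorm p n (tensor_power n \<theta>) \<le> cpnorm p \<theta> ^ n" by (rule tensor_power_NC_tensor(2)[OF \<theta>(1)])
      also have "\<dots> \<le> (1 / 2 ^ Suc q) ^ n" using \<theta>(2) cpnorm_nonneg by (intro power_mono) auto
      finally show "tnorm p n (tensor_power n \<theta>) \<le> (1 / 2 ^ Suc q) ^ n" .
    qed (use s in auto)
    also have "\<dots> = (s + 1) * (2 ^ q * (1 / 2 ^ Suc q)) ^ n" by (simp only: power_mult_distrib mult.assoc)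
    also have "(2::real) ^ q * (1 / 2 ^ Suc q) = 1 / 2" by simp
    finally show ?thesis .
  qed
  moreover have "summable (\<lambda>n. (s + 1) * (1 / 2) ^ n)" by (intro summable_mult summable_geometric) auto
  ultimately show ?thesis
    using summable_comparison_test'[of "\<lambda>n. (s + 1) * (1 / 2) ^ n" 0 "\<lambda>n. cmod (kernels \<mu> \<Phi> n (tensor_power n \<theta>))"]
    by simp
qed

lemma wick_kernels_tensor_power:
  assumes \<Phi>: "\<Phi> \<in> dist_space \<mu> p1 q1" and \<Psi>: "\<Psi> \<in> dist_space \<mu> p2 q2" and \<theta>: "\<theta> \<in> NC"
  shows "wick_kernels \<Phi> \<Psi> n (tensor_power n \<theta>) =
    (\<Sum>k\<le>n. kernels \<mu> \<Phi> k (tensor_power k \<theta>) * kernels \<mu> \<Psi> (n - k) (tensor_power (n - k) \<theta>))"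
proof -
  have "tens k (n - k) (kernels \<mu> \<Phi> k) (kernels \<mu> \<Psi> (n - k)) (tensor_power n \<theta>) =
      kernels \<mu> \<Phi> k (tensor_power k \<theta>) * kernels \<mu> \<Psi> (n - k) (tensor_power (n - k) \<theta>)" if "k \<le> n" for k
    using tens_tensor_power[OF dist_spaceD(2)[OF \<Phi>, of k] dist_spaceD(2)[OF \<Psi>, of "n - k"] \<theta>] that by simp
  then show ?thesis by (simp add: wick_kernels_def)
qed

lemma wick_eq:
  assumes \<Phi>: "\<Phi> \<in> dist_space \<mu> p1 q1" and \<Psi>: "\<Psi> \<in> dist_space \<mu> p2 q2"
  shows "wick \<mu> \<Phi> \<Psi> = of_kernels (wick_kernels \<Phi> \<Psi>)"
  unfolding wick_def
proof (rule the_equality)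
  let ?W = "of_kernels (wick_kernels \<Phi> \<Psi>)"
  note W = wick_kernels_estimate[OF \<Phi> \<Psi>]
  define p where "p = max p1 p2"
  \<comment> \<open>Small enough for the convergence of both S-transforms.\<close>
  define \<epsilon> where "\<epsilon> = (1 / 2 ^ Suc (q1 + q2) :: real)"
  have \<epsilon>: "0 < \<epsilon>" by (simp add: \<epsilon>_def)
  have conv: "(\<lambda>n. wick_kernels \<Phi> \<Psi> n (tensor_power n \<theta>)) sums (S_transform \<mu> \<Phi> \<theta> * S_transform \<mu> \<Psi> \<theta>)"
    if \<theta>: "\<theta> \<in> NC" "cpnorm p \<theta> < \<epsilon>" for \<theta>
  proof -
    have le: "\<epsilon> \<le> 1 / 2 ^ Suc q1" "\<epsilon> \<le> 1 / 2 ^ Suc q2"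
      unfolding \<epsilon>_def by (intro divide_left_mono power_increasing; simp)+
    have "cpnorm p1 \<theta> \<le> cpnorm p \<theta>" "cpnorm p2 \<theta> \<le> cpnorm p \<theta>" by (auto simp: p_def intro!: cpnorm_mono \<theta>)
    then have "cpnorm p1 \<theta> < 1 / 2 ^ Suc q1" "cpnorm p2 \<theta> < 1 / 2 ^ Suc q2" using le \<theta>(2) by linarith+
    then show ?thesis
      unfolding wick_kernels_tensor_power[OF \<Phi> \<Psi> \<theta>(1)] S_transform_def
      by (intro Cauchy_product_sums S_transform_summable[OF \<Phi> \<theta>(1)] S_transform_summable[OF \<Psi> \<theta>(1)])
  qed
  have Wd: "?W \<in> distributions \<mu>" using W(1) unfolding distributions_def by blast
  have "S_transform \<mu> ?W \<theta> = S_transform \<mu> \<Phi> \<theta> * S_transform \<mu> \<Psi> \<theta>" if "\<theta> \<in> NC" "cpnorm p \<theta> < \<epsilon>" for \<theta>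
    using conv[OF that] by (simp add: S_transform_def[of \<mu> ?W] W(3) sums_iff)
  then show "?W \<in> distributions \<mu> \<and> (\<exists>p. \<exists>\<epsilon>>0. \<forall>\<theta>\<in>NC. cpnorm p \<theta> < \<epsilon> \<longrightarrow>
      S_transform \<mu> ?W \<theta> = S_transform \<mu> \<Phi> \<theta> * S_transform \<mu> \<Psi> \<theta>)"
    using Wd \<epsilon> by (intro conjI exI[of _ p] exI[of _ \<epsilon>]) auto
  fix \<Xi> assume \<Xi>: "\<Xi> \<in> distributions \<mu> \<and> (\<exists>p. \<exists>\<epsilon>>0. \<forall>\<theta>\<in>NC. cpnorm p \<theta> < \<epsilon> \<longrightarrow>
      S_transform \<mu> \<Xi> \<theta> = S_transform \<mu> \<Phi> \<theta> * S_transform \<mu> \<Psi> \<theta>)"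
  then obtain r \<delta> where r: "0 < \<delta>" "\<forall>\<theta>\<in>NC. cpnorm r \<theta> < \<delta> \<longrightarrow>
      S_transform \<mu> \<Xi> \<theta> = S_transform \<mu> \<Phi> \<theta> * S_transform \<mu> \<Psi> \<theta>" by (elim exE conjE)
  obtain p3 q3 where \<Xi>3: "\<Xi> \<in> dist_space \<mu> p3 q3" using \<Xi> by (auto simp: distributions_def)
  define t where "t = max r p3"
  \<comment> \<open>Both kernel sequences expand the product of the two S-transforms near zero. The
    radius for \<open>\<Xi>\<close> is also limited by the convergence of its own series.\<close>
  have "kernels \<mu> \<Xi> = wick_kernels \<Phi> \<Psi>"
  proof (rule dual_coeffs_unique[where c = "\<lambda>_. 1" and f = "\<lambda>\<theta>. S_transform \<mu> \<Phi> \<theta> * S_transform \<mu> \<Psi> \<theta>"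
        and \<epsilon> = "min \<delta> (1 / 2 ^ Suc q3)" and p = t and \<epsilon>' = \<epsilon> and p' = p])
    show "kernels \<mu> \<Xi> n \<in> NC_tensor_dual n" for n by (rule kernels_dual[OF dist_spaceD(1)[OF \<Xi>3]])
    show "wick_kernels \<Phi> \<Psi> n \<in> NC_tensor_dual n" for n
      using wick_kernels_Hneg_tensor(1)[OF \<Phi> \<Psi>] by (auto simp: NC_tensor_dual_def)
    fix \<theta> assume \<theta>: "\<theta> \<in> NC" "cpnorm t \<theta> < min \<delta> (1 / 2 ^ Suc q3)"
    have "cpnorm r \<theta> \<le> cpnorm t \<theta>" "cpnorm p3 \<theta> \<le> cpnorm t \<theta>" by (auto simp: t_def intro!: cpnorm_mono \<theta>)
    then have small: "cpnorm r \<theta> < \<delta>" "cpnorm p3 \<theta> < 1 / 2 ^ Suc q3" using \<theta>(2) by linarith+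
    have "(\<lambda>n. kernels \<mu> \<Xi> n (tensor_power n \<theta>)) sums S_transform \<mu> \<Xi> \<theta>"
      unfolding S_transform_def
      by (rule summable_sums[OF summable_norm_cancel[OF S_transform_summable[OF \<Xi>3 \<theta>(1) small(2)]]])
    then show "(\<lambda>n. kernels \<mu> \<Xi> n (tensor_power n \<theta>) / 1) sums (S_transform \<mu> \<Phi> \<theta> * S_transform \<mu> \<Psi> \<theta>)"
      using r(2) \<theta>(1) small(1) by simp
  qed (use r(1) \<epsilon> conv in auto)
  then show "\<Xi> = ?W"
    using W(3) by (intro poly_dual_eqI dist_spaceD(1)[OF \<Xi>3] dist_spaceD(1)[OF W(1)]) simp
qed

lemma wick_estimate:
  assumes "\<Phi> \<in> dist_space \<mu> p1 q1" "\<Psi> \<in> dist_space \<mu> p2 q2"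
  shows "wick \<mu> \<Phi> \<Psi> \<in> dist_space \<mu> (max p1 p2) (q1 + q2 + 1)"
    and "dist_norm \<mu> (max p1 p2) (q1 + q2 + 1) (wick \<mu> \<Phi> \<Psi>) \<le> dist_norm \<mu> p1 q1 \<Phi> * dist_norm \<mu> p2 q2 \<Psi>"
    and "kernels \<mu> (wick \<mu> \<Phi> \<Psi>) = wick_kernels \<Phi> \<Psi>"
  using wick_kernels_estimate[OF assms] by (simp_all add: wick_eq[OF assms])

lemma wick_distributions:
  assumes "\<Phi> \<in> distributions \<mu>" "\<Psi> \<in> distributions \<mu>"
  shows "wick \<mu> \<Phi> \<Psi> \<in> distributions \<mu>" "kernels \<mu> (wick \<mu> \<Phi> \<Psi>) = wick_kernels \<Phi> \<Psi>"
proof -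
  obtain p q p' q' where *: "\<Phi> \<in> dist_space \<mu> p q" "\<Psi> \<in> dist_space \<mu> p' q'"
    using assms by (auto simp: distributions_def)
  show "wick \<mu> \<Phi> \<Psi> \<in> distributions \<mu>" using wick_estimate(1)[OF *] unfolding distributions_def by blast
  show "kernels \<mu> (wick \<mu> \<Phi> \<Psi>) = wick_kernels \<Phi> \<Psi>" by (rule wick_estimate(3)[OF *])
qed

section \<open>Bilinearity of the Wick product\<close>

lemma tens_lin_left:
  "tens k m (\<lambda>\<kappa>. a * F \<kappa> + b * F' \<kappa>) G \<kappa> = a * tens k m F G \<kappa> + b * tens k m F' G \<kappa>"
  by (simp add: tens_def)

lemma tens_lin_right:
  assumes F: "F \<in> Hneg_tensor p k" and G: "G \<in> Hneg_tensor r m" "G' \<in> Hneg_tensor r' m"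
  shows "tens k m F (\<lambda>\<kappa>. a * G \<kappa> + b * G' \<kappa>) \<kappa> = a * tens k m F G \<kappa> + b * tens k m F G' \<kappa>"
proof (cases "\<kappa> \<in> NC_tensor (k + m)")
  case True
  have "contract k (\<lambda>\<kappa>. a * G \<kappa> + b * G' \<kappa>) \<kappa> = (\<lambda>xs. a * contract k G \<kappa> xs + b * contract k G' \<kappa> xs)"
    by (auto simp: contract_def)
  then show ?thesis
    using True Hneg_tensor_lincomb[OF F contract_NC_tensor(1)[OF G(1) True] contract_NC_tensor(1)[OF G(2) True], of a b]
    by (simp add: tens_def)
qed (simp add: tens_def)

text \<open>The Wick product is a description, so bilinearity is read off the kernels, where it is
  that of \<open>tens\<close>.\<close>

lemma wick_lin:
  assumes \<Phi>: "\<Phi> \<in> distributions \<mu>" and \<Phi>': "\<Phi>' \<in> distributions \<mu>" and \<Psi>: "\<Psi> \<in> distributions \<mu>"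
  shows "wick \<mu> (\<lambda>\<phi>. a * \<Phi> \<phi> + b * \<Phi>' \<phi>) \<Psi> = (\<lambda>\<phi>. a * wick \<mu> \<Phi> \<Psi> \<phi> + b * wick \<mu> \<Phi>' \<Psi> \<phi>)"
    and "wick \<mu> \<Psi> (\<lambda>\<phi>. a * \<Phi> \<phi> + b * \<Phi>' \<phi>) = (\<lambda>\<phi>. a * wick \<mu> \<Psi> \<Phi> \<phi> + b * wick \<mu> \<Psi> \<Phi>' \<phi>)"
proof -
  note pd = distributions_poly_dual
  have L: "(\<lambda>\<phi>. a * \<Phi> \<phi> + b * \<Phi>' \<phi>) \<in> distributions \<mu>" by (rule distributions_lincomb[OF \<Phi> \<Phi>'])
  note k = kernels_lincomb[OF pd[OF \<Phi>] pd[OF \<Phi>'], of a b]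
  have H: "\<exists>p. \<forall>n. kernels \<mu> \<Theta> n \<in> Hneg_tensor p n" if "\<Theta> \<in> distributions \<mu>" for \<Theta>
    using that by (auto simp: distributions_def dist_space_def)
  obtain p where p: "\<And>n. kernels \<mu> \<Phi> n \<in> Hneg_tensor p n" using H[OF \<Phi>] by blast
  obtain p' where p': "\<And>n. kernels \<mu> \<Phi>' n \<in> Hneg_tensor p' n" using H[OF \<Phi>'] by blast
  obtain r where r: "\<And>n. kernels \<mu> \<Psi> n \<in> Hneg_tensor r n" using H[OF \<Psi>] by blast
  show "wick \<mu> (\<lambda>\<phi>. a * \<Phi> \<phi> + b * \<Phi>' \<phi>) \<Psi> = (\<lambda>\<phi>. a * wick \<mu> \<Phi> \<Psi> \<phi> + b * wick \<mu> \<Phi>' \<Psi> \<phi>)"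
  proof (rule poly_dual_eqI)
    show "wick \<mu> (\<lambda>\<phi>. a * \<Phi> \<phi> + b * \<Phi>' \<phi>) \<Psi> \<in> poly_dual" by (intro pd wick_distributions L \<Psi>)
    show "(\<lambda>\<phi>. a * wick \<mu> \<Phi> \<Psi> \<phi> + b * wick \<mu> \<Phi>' \<Psi> \<phi>) \<in> poly_dual"
      by (intro poly_dual_lincomb pd wick_distributions \<Phi> \<Phi>' \<Psi>)
    show "kernels \<mu> (wick \<mu> (\<lambda>\<phi>. a * \<Phi> \<phi> + b * \<Phi>' \<phi>) \<Psi>) = kernels \<mu> (\<lambda>\<phi>. a * wick \<mu> \<Phi> \<Psi> \<phi> + b * wick \<mu> \<Phi>' \<Psi> \<phi>)"
    proof (intro ext)
      fix n \<kappa>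
      show "kernels \<mu> (wick \<mu> (\<lambda>\<phi>. a * \<Phi> \<phi> + b * \<Phi>' \<phi>) \<Psi>) n \<kappa> = kernels \<mu> (\<lambda>\<phi>. a * wick \<mu> \<Phi> \<Psi> \<phi> + b * wick \<mu> \<Phi>' \<Psi> \<phi>) n \<kappa>"
        unfolding kernels_lincomb[OF pd[OF wick_distributions(1)[OF \<Phi> \<Psi>]] pd[OF wick_distributions(1)[OF \<Phi>' \<Psi>]]]
          wick_distributions(2)[OF L \<Psi>] wick_distributions(2)[OF \<Phi> \<Psi>] wick_distributions(2)[OF \<Phi>' \<Psi>]
          wick_kernels_def k tens_lin_left
        by (simp add: sum.distrib sum_distrib_left)
    qed
  qed
  show "wick \<mu> \<Psi> (\<lambda>\<phi>. a * \<Phi> \<phi> + b * \<Phi>' \<phi>) = (\<lambda>\<phi>. a * wick \<mu> \<Psi> \<Phi> \<phi> + b * wick \<mu> \<Psi> \<Phi>' \<phi>)"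
  proof (rule poly_dual_eqI)
    show "wick \<mu> \<Psi> (\<lambda>\<phi>. a * \<Phi> \<phi> + b * \<Phi>' \<phi>) \<in> poly_dual" by (intro pd wick_distributions L \<Psi>)
    show "(\<lambda>\<phi>. a * wick \<mu> \<Psi> \<Phi> \<phi> + b * wick \<mu> \<Psi> \<Phi>' \<phi>) \<in> poly_dual"
      by (intro poly_dual_lincomb pd wick_distributions \<Phi> \<Phi>' \<Psi>)
    show "kernels \<mu> (wick \<mu> \<Psi> (\<lambda>\<phi>. a * \<Phi> \<phi> + b * \<Phi>' \<phi>)) = kernels \<mu> (\<lambda>\<phi>. a * wick \<mu> \<Psi> \<Phi> \<phi> + b * wick \<mu> \<Psi> \<Phi>' \<phi>)"
    proof (intro ext)
      fix n \<kappa>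
      show "kernels \<mu> (wick \<mu> \<Psi> (\<lambda>\<phi>. a * \<Phi> \<phi> + b * \<Phi>' \<phi>)) n \<kappa> = kernels \<mu> (\<lambda>\<phi>. a * wick \<mu> \<Psi> \<Phi> \<phi> + b * wick \<mu> \<Psi> \<Phi>' \<phi>) n \<kappa>"
        unfolding kernels_lincomb[OF pd[OF wick_distributions(1)[OF \<Psi> \<Phi>]] pd[OF wick_distributions(1)[OF \<Psi> \<Phi>']]]
          wick_distributions(2)[OF \<Psi> L] wick_distributions(2)[OF \<Psi> \<Phi>] wick_distributions(2)[OF \<Psi> \<Phi>']
          wick_kernels_def k tens_lin_right[OF r p p']
        by (simp add: sum.distrib sum_distrib_left)
    qed
  qed
qed

end

subsection \<open>Joint continuity\<close>

context nuclear_measure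
begin

text \<open>The basic neighbourhoods of zero of the inductive limit, written with the norms;
  \<open>zero_nbhd_iff\<close> identifies them.\<close>

definition zero_nbhd :: "'h functional set \<Rightarrow> bool" where
  "zero_nbhd V \<longleftrightarrow> V \<subseteq> distributions \<mu> \<and> absolutely_convex V \<and>
     (\<forall>p q. \<exists>\<epsilon>>0. \<forall>\<Phi>\<in>dist_space \<mu> p q. dist_norm \<mu> p q \<Phi> < \<epsilon> \<longrightarrow> \<Phi> \<in> V)"

lemma zero_nbhdD:
  assumes "zero_nbhd V"
  shows "V \<subseteq> distributions \<mu>" "absolutely_convex V"
    "\<exists>\<epsilon>>0. \<forall>\<Phi>\<in>dist_space \<mu> p q. dist_norm \<mu> p q \<Phi> < \<epsilon> \<longrightarrow> \<Phi> \<in> V"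
  using assms unfolding zero_nbhd_def by blast+

lemma zero_nbhd_iff:
  "zero_nbhd V \<longleftrightarrow> V \<subseteq> distributions \<mu> \<and> absolutely_convex V \<and> (\<forall>i. \<exists>w\<in>dist_nbhds \<mu> i. w \<subseteq> V)"
proof -
  have "(\<exists>w\<in>dist_nbhds \<mu> (p, q). w \<subseteq> V) \<longleftrightarrow>
      (\<exists>\<epsilon>>0. \<forall>\<Phi>\<in>dist_space \<mu> p q. dist_norm \<mu> p q \<Phi> < \<epsilon> \<longrightarrow> \<Phi> \<in> V)" for p q
    unfolding dist_nbhds_def by auto
  then show ?thesis unfolding zero_nbhd_def by (simp add: split_paired_all)
qed

lemma openin_dist_topology_iff:
  "openin (dist_topology \<mu>) U \<longleftrightarrow> U \<subseteq> distributions \<mu> \<and>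
    (\<forall>u\<in>U. \<exists>V. zero_nbhd V \<and> (\<forall>v\<in>V. (\<lambda>\<phi>. u \<phi> + v \<phi>) \<in> U))"
  unfolding openin_dist_topology lc_final_open_def zero_nbhd_iff by (simp add: conj_assoc)

section \<open>Calculus of neighbourhoods of zero\<close>

lemma absolutely_convexD:
  "absolutely_convex V \<Longrightarrow> u \<in> V \<Longrightarrow> v \<in> V \<Longrightarrow> cmod a + cmod b \<le> 1 \<Longrightarrow> (\<lambda>\<phi>. a * u \<phi> + b * v \<phi>) \<in> V"
  unfolding absolutely_convex_def by blast

lemma zero_nbhd_distributions: "zero_nbhd (distributions \<mu>)"
  unfolding zero_nbhd_def
proof (intro conjI allI)
  show "absolutely_convex (distributions \<mu>)"
    unfolding absolutely_convex_def using distributions_lincomb by blast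
  show "\<exists>\<epsilon>>0. \<forall>\<Phi>\<in>dist_space \<mu> p q. dist_norm \<mu> p q \<Phi> < \<epsilon> \<longrightarrow> \<Phi> \<in> distributions \<mu>" for p q
    by (intro exI[of _ 1]) (auto simp: distributions_def)
qed simp

lemma topspace_dist_topology: "topspace (dist_topology \<mu>) = distributions \<mu>"
proof
  show "topspace (dist_topology \<mu>) \<subseteq> distributions \<mu>"
    using openin_topspace[of "dist_topology \<mu>"] unfolding openin_dist_topology_iff by blast
  have "(\<lambda>\<phi>. u \<phi> + v \<phi>) \<in> distributions \<mu>" if "u \<in> distributions \<mu>" "v \<in> distributions \<mu>" for u v
    using distributions_lincomb[OF that, of 1 1] by simp
  then have "openin (dist_topology \<mu>) (distributions \<mu>)"
    unfolding openin_dist_topology_iff using zero_nbhd_distributions by auto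
  then show "distributions \<mu> \<subseteq> topspace (dist_topology \<mu>)" by (rule openin_subset)
qed

text \<open>An element of some ball is needed first. The functional built from zero kernels serves,
  because its kernels, and so its norm, are known.\<close>

lemma zero_nbhd_zero: assumes V: "zero_nbhd V" shows "(\<lambda>\<phi>. 0) \<in> V"
proof -
  obtain \<epsilon> where e: "0 < \<epsilon>" "\<forall>\<Phi>\<in>dist_space \<mu> 0 0. dist_norm \<mu> 0 0 \<Phi> < \<epsilon> \<longrightarrow> \<Phi> \<in> V"
    using zero_nbhdD(3)[OF V] by blast
  have z: "of_kernels (\<lambda>n \<kappa>. 0) \<in> poly_dual"
    by (rule of_kernels_poly_dual) (auto simp: NC_tensor_dual_def Hneg_tensor_zero)
  have k: "kernels \<mu> (of_kernels (\<lambda>n \<kappa>. 0)) = (\<lambda>n \<kappa>. 0)"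
    by (rule kernels_of_kernels) (auto simp: NC_tensor_dual_def Hneg_tensor_zero)
  have "of_kernels (\<lambda>n \<kappa>. 0) \<in> dist_space \<mu> 0 0"
    using z by (simp add: dist_space_def k Hneg_tensor_zero)
  moreover have "dist_norm \<mu> 0 0 (of_kernels (\<lambda>n \<kappa>. 0)) = 0"
    by (simp add: dist_norm_def k Hneg_tensor_zero)
  ultimately have "of_kernels (\<lambda>n \<kappa>. 0) \<in> V" using e by auto
  from absolutely_convexD[OF zero_nbhdD(2)[OF V] this this, of 0 0] show ?thesis by simp
qed

lemma zero_nbhd_Int:
  assumes V: "zero_nbhd V" and W: "zero_nbhd W"
  shows "zero_nbhd (V \<inter> W)"
  unfolding zero_nbhd_def
proof (intro conjI allI)
  show "V \<inter> W \<subseteq> distributions \<mu>" using zero_nbhdD(1)[OF V] by blast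
  show "absolutely_convex (V \<inter> W)"
    using zero_nbhdD(2)[OF V] zero_nbhdD(2)[OF W] unfolding absolutely_convex_def by blast
  fix p q
  obtain \<epsilon> where e: "0 < \<epsilon>" "\<forall>\<Phi>\<in>dist_space \<mu> p q. dist_norm \<mu> p q \<Phi> < \<epsilon> \<longrightarrow> \<Phi> \<in> V"
    using zero_nbhdD(3)[OF V] by blast
  obtain \<delta> where d: "0 < \<delta>" "\<forall>\<Phi>\<in>dist_space \<mu> p q. dist_norm \<mu> p q \<Phi> < \<delta> \<longrightarrow> \<Phi> \<in> W"
    using zero_nbhdD(3)[OF W] by blast
  show "\<exists>\<epsilon>>0. \<forall>\<Phi>\<in>dist_space \<mu> p q. dist_norm \<mu> p q \<Phi> < \<epsilon> \<longrightarrow> \<Phi> \<in> V \<inter> W"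
    using e d by (intro exI[of _ "min \<epsilon> \<delta>"]) auto
qed

lemma zero_nbhd_scale:
  assumes V: "zero_nbhd V"
  shows "zero_nbhd {v \<in> distributions \<mu>. (\<lambda>\<phi>. c * v \<phi>) \<in> V}"
  unfolding zero_nbhd_def
proof (intro conjI allI)
  show "absolutely_convex {v \<in> distributions \<mu>. (\<lambda>\<phi>. c * v \<phi>) \<in> V}"
    unfolding absolutely_convex_def
  proof (intro ballI allI impI)
    fix u v a b assume uv: "u \<in> {v \<in> distributions \<mu>. (\<lambda>\<phi>. c * v \<phi>) \<in> V}"
      "v \<in> {v \<in> distributions \<mu>. (\<lambda>\<phi>. c * v \<phi>) \<in> V}" and ab: "cmod a + cmod b \<le> 1"
    have "(\<lambda>\<phi>. a * (c * u \<phi>) + b * (c * v \<phi>)) \<in> V"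
      using absolutely_convexD[OF zero_nbhdD(2)[OF V] _ _ ab, of "\<lambda>\<phi>. c * u \<phi>" "\<lambda>\<phi>. c * v \<phi>"] uv by simp
    then show "(\<lambda>\<phi>. a * u \<phi> + b * v \<phi>) \<in> {v \<in> distributions \<mu>. (\<lambda>\<phi>. c * v \<phi>) \<in> V}"
      using uv by (simp add: distributions_lincomb algebra_simps)
  qed
  fix p q
  obtain \<epsilon> where e: "0 < \<epsilon>" "\<forall>\<Phi>\<in>dist_space \<mu> p q. dist_norm \<mu> p q \<Phi> < \<epsilon> \<longrightarrow> \<Phi> \<in> V"
    using zero_nbhdD(3)[OF V] by blast
  have pos: "0 < cmod c + 1" by (simp add: add_nonneg_pos)
  have "(\<lambda>\<phi>. c * \<Phi> \<phi>) \<in> V" if \<Phi>: "\<Phi> \<in> dist_space \<mu> p q" "dist_norm \<mu> p q \<Phi> < \<epsilon> / (cmod c + 1)" for \<Phi>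
  proof -
    have "dist_norm \<mu> p q (\<lambda>\<phi>. c * \<Phi> \<phi>) \<le> cmod c * dist_norm \<mu> p q \<Phi>" by (rule dist_norm_scale_le(2)[OF \<Phi>(1)])
    also have "\<dots> \<le> (cmod c + 1) * dist_norm \<mu> p q \<Phi>"
      using dist_norm_nonneg[OF \<Phi>(1)] by (intro mult_right_mono) auto
    also have "\<dots> < \<epsilon>" using \<Phi>(2) pos by (simp add: pos_less_divide_eq mult.commute)
    finally show ?thesis using e(2) dist_norm_scale_le(1)[OF \<Phi>(1)] by blast
  qed
  then show "\<exists>\<epsilon>>0. \<forall>\<Phi>\<in>dist_space \<mu> p q. dist_norm \<mu> p q \<Phi> < \<epsilon> \<longrightarrow> \<Phi> \<in> {v \<in> distributions \<mu>. (\<lambda>\<phi>. c * v \<phi>) \<in> V}"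
    using e(1) pos by (intro exI[of _ "\<epsilon> / (cmod c + 1)"]) (auto simp: distributions_def)
qed auto

text \<open>The open set \<open>G\<close> is the interior of the translate of \<open>V\<close> by
  \<open>u\<close>: the points around which some translated neighbourhood stays inside.\<close>

lemma zero_nbhd_open:
  assumes V: "zero_nbhd V" and u: "u \<in> distributions \<mu>"
  shows "\<exists>G. openin (dist_topology \<mu>) G \<and> u \<in> G \<and> (\<forall>w\<in>G. (\<lambda>\<phi>. w \<phi> - u \<phi>) \<in> V)"
proof -
  define G where "G = {w \<in> distributions \<mu>. \<exists>V'. zero_nbhd V' \<and> (\<forall>v\<in>V'. (\<lambda>\<phi>. w \<phi> - u \<phi> + v \<phi>) \<in> V)}"
  have "openin (dist_topology \<mu>) G"
    unfolding openin_dist_topology_iff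
  proof (intro conjI ballI)
    show "G \<subseteq> distributions \<mu>" by (auto simp: G_def)
    fix w assume "w \<in> G"
    then obtain V' where w: "w \<in> distributions \<mu>" and V': "zero_nbhd V'" "\<And>v. v \<in> V' \<Longrightarrow> (\<lambda>\<phi>. w \<phi> - u \<phi> + v \<phi>) \<in> V"
      by (auto simp: G_def)
    \<comment> \<open>Half of \<open>V'\<close>: by convexity the sum of two elements of this set
      lies in \<open>V'\<close>.\<close>
    let ?H = "{v \<in> distributions \<mu>. (\<lambda>\<phi>. 2 * v \<phi>) \<in> V'}"
    have H: "zero_nbhd ?H" by (rule zero_nbhd_scale[OF V'(1)])
    have "(\<lambda>\<phi>. w \<phi> + v \<phi>) \<in> G" if v: "v \<in> ?H" for v
    proof -
      have "(\<lambda>\<phi>. w \<phi> + v \<phi> - u \<phi> + v' \<phi>) \<in> V" if v': "v' \<in> ?H" for v'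
      proof -
        have "(\<lambda>\<phi>. 1/2 * (2 * v \<phi>) + 1/2 * (2 * v' \<phi>)) \<in> V'"
          using v v' by (intro absolutely_convexD[OF zero_nbhdD(2)[OF V'(1)]]) (auto simp: norm_divide)
        then have "(\<lambda>\<phi>. v \<phi> + v' \<phi>) \<in> V'" by simp
        from V'(2)[OF this] show ?thesis by (simp add: algebra_simps)
      qed
      moreover have "(\<lambda>\<phi>. w \<phi> + v \<phi>) \<in> distributions \<mu>"
        using distributions_lincomb[OF w, of v 1 1] v by simp
      ultimately show ?thesis using H unfolding G_def by blast
    qed
    then show "\<exists>V. zero_nbhd V \<and> (\<forall>v\<in>V. (\<lambda>\<phi>. w \<phi> + v \<phi>) \<in> G)" using H by blast
  qed
  moreover have "u \<in> G" using u V unfolding G_def by auto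
  moreover have "(\<lambda>\<phi>. w \<phi> - u \<phi>) \<in> V" if wG: "w \<in> G" for w
  proof -
    obtain V' where V': "zero_nbhd V'" "\<forall>v\<in>V'. (\<lambda>\<phi>. w \<phi> - u \<phi> + v \<phi>) \<in> V" using wG by (auto simp: G_def)
    from V'(2)[rule_format, OF zero_nbhd_zero[OF V'(1)]] show ?thesis by simp
  qed
  ultimately show ?thesis by blast
qed

lemma absolutely_convex_wick:
  assumes W: "absolutely_convex W" and X: "X \<subseteq> distributions \<mu>"
  shows "absolutely_convex {v \<in> distributions \<mu>. \<forall>u\<in>X. wick \<mu> u v \<in> W}"
    and "absolutely_convex {v \<in> distributions \<mu>. \<forall>u\<in>X. wick \<mu> v u \<in> W}"
  unfolding absolutely_convex_def
proof (safe intro!: distributions_lincomb)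
  fix u v a b x
  assume H: "u \<in> distributions \<mu>" "v \<in> distributions \<mu>" "x \<in> X" "cmod a + cmod b \<le> 1"
  then have x: "x \<in> distributions \<mu>" using X by blast
  show "wick \<mu> x (\<lambda>\<phi>. a * u \<phi> + b * v \<phi>) \<in> W" if "\<forall>x\<in>X. wick \<mu> x u \<in> W" "\<forall>x\<in>X. wick \<mu> x v \<in> W"
    unfolding wick_lin(2)[OF H(1,2) x] using that H by (intro absolutely_convexD[OF W]) auto
  show "wick \<mu> (\<lambda>\<phi>. a * u \<phi> + b * v \<phi>) x \<in> W" if "\<forall>x\<in>X. wick \<mu> u x \<in> W" "\<forall>x\<in>X. wick \<mu> v x \<in> W"
    unfolding wick_lin(1)[OF H(1,2) x] using that H by (intro absolutely_convexD[OF W]) auto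
qed

text \<open>Separate continuity at zero, directly from the norm estimate. The singleton gives the
  sets the shape of \<open>absolutely_convex_wick\<close>.\<close>

lemma zero_nbhd_wick_fixed:
  assumes W: "zero_nbhd W" and \<Phi>: "\<Phi> \<in> distributions \<mu>"
  shows "zero_nbhd {v \<in> distributions \<mu>. \<forall>u\<in>{\<Phi>}. wick \<mu> u v \<in> W}"
    and "zero_nbhd {v \<in> distributions \<mu>. \<forall>u\<in>{\<Phi>}. wick \<mu> v u \<in> W}"
proof -
  have X: "{\<Phi>} \<subseteq> distributions \<mu>" using \<Phi> by simp
  obtain p0 q0 where p0: "\<Phi> \<in> dist_space \<mu> p0 q0" using \<Phi> by (auto simp: distributions_def)
  have "\<exists>\<epsilon>>0. \<forall>v\<in>dist_space \<mu> p q. dist_norm \<mu> p q v < \<epsilon> \<longrightarrow> wick \<mu> \<Phi> v \<in> W \<and> wick \<mu> v \<Phi> \<in> W" for p q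
  proof -
    let ?p = "max p0 p" and ?q = "q0 + q + 1"
    obtain \<epsilon> where e: "0 < \<epsilon>" "\<forall>\<Theta>\<in>dist_space \<mu> ?p ?q. dist_norm \<mu> ?p ?q \<Theta> < \<epsilon> \<longrightarrow> \<Theta> \<in> W"
      using zero_nbhdD(3)[OF W] by blast
    let ?c = "dist_norm \<mu> p0 q0 \<Phi>"
    have c: "0 \<le> ?c" by (rule dist_norm_nonneg[OF p0])
    have "wick \<mu> \<Phi> v \<in> W \<and> wick \<mu> v \<Phi> \<in> W" if v: "v \<in> dist_space \<mu> p q" "dist_norm \<mu> p q v < \<epsilon> / (?c + 1)" for v
    proof -
      have "?c * dist_norm \<mu> p q v \<le> (?c + 1) * dist_norm \<mu> p q v"
        using dist_norm_nonneg[OF v(1)] by (intro mult_right_mono) auto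
      also have "\<dots> < \<epsilon>" using v(2) c by (simp add: pos_less_divide_eq mult.commute)
      finally have lt: "?c * dist_norm \<mu> p q v < \<epsilon>" .
      have "wick \<mu> v \<Phi> \<in> dist_space \<mu> ?p ?q" "dist_norm \<mu> ?p ?q (wick \<mu> v \<Phi>) \<le> ?c * dist_norm \<mu> p q v"
        using wick_estimate(1,2)[OF v(1) p0] by (simp_all add: max.commute add.commute mult.commute)
      then show ?thesis using wick_estimate(1,2)[OF p0 v(1)] lt e(2) by (meson le_less_trans)
    qed
    then show ?thesis using e(1) c by (intro exI[of _ "\<epsilon> / (?c + 1)"]) auto
  qed
  note ball = this
  show "zero_nbhd {v \<in> distributions \<mu>. \<forall>u\<in>{\<Phi>}. wick \<mu> u v \<in> W}"
    unfolding zero_nbhd_def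
  proof (intro conjI allI absolutely_convex_wick zero_nbhdD(2)[OF W] X)
    fix p q
    show "\<exists>\<epsilon>>0. \<forall>v\<in>dist_space \<mu> p q. dist_norm \<mu> p q v < \<epsilon> \<longrightarrow> v \<in> {v \<in> distributions \<mu>. \<forall>u\<in>{\<Phi>}. wick \<mu> u v \<in> W}"
      using ball[of p q] by (auto simp: distributions_def)
  qed auto
  show "zero_nbhd {v \<in> distributions \<mu>. \<forall>u\<in>{\<Phi>}. wick \<mu> v u \<in> W}"
    unfolding zero_nbhd_def
  proof (intro conjI allI absolutely_convex_wick zero_nbhdD(2)[OF W] X)
    fix p q
    show "\<exists>\<epsilon>>0. \<forall>v\<in>dist_space \<mu> p q. dist_norm \<mu> p q v < \<epsilon> \<longrightarrow> v \<in> {v \<in> distributions \<mu>. \<forall>u\<in>{\<Phi>}. wick \<mu> v u \<in> W}"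
      using ball[of p q] by (auto simp: distributions_def)
  qed auto
qed

text \<open>
  The index set is countable, so the radii \<open>\<delta>\<close> can be chosen such that the product of the balls of
  any two indices lies in \<open>W\<close>: the radius of the later index takes care of all the earlier ones.
  Passing twice to polars, instead of to a convex hull, makes the two sets absolutely convex.
\<close>

lemma zero_nbhd_wick_pair:
  assumes W: "zero_nbhd W"
  shows "\<exists>U1 U2. zero_nbhd U1 \<and> zero_nbhd U2 \<and> (\<forall>u\<in>U1. \<forall>v\<in>U2. wick \<mu> u v \<in> W)"
proof -
  have "\<forall>p q. \<exists>\<epsilon>>0. \<forall>\<Phi>\<in>dist_space \<mu> p q. dist_norm \<mu> p q \<Phi> < \<epsilon> \<longrightarrow> \<Phi> \<in> W"
    using zero_nbhdD(3)[OF W] by blast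
  then obtain \<epsilon> where \<epsilon>: "\<And>p q. 0 < \<epsilon> p q"
      "\<And>p q \<Phi>. \<Phi> \<in> dist_space \<mu> p q \<Longrightarrow> dist_norm \<mu> p q \<Phi> < \<epsilon> p q \<Longrightarrow> \<Phi> \<in> W"
    by metis
  \<comment> \<open>Pairs are ordered by \<open>p + q\<close>, so only finitely many are not later
    than a given one. The inserted 1 keeps all radii at most 1, so that a product of two norms is at
    most either factor.\<close>
  define A where "A p q = insert 1 ((\<lambda>(p', q'). \<epsilon> (max p p') (q + q' + 1)) ` ({..p + q} \<times> {..p + q}))" for p q
  define \<delta> where "\<delta> p q = Min (A p q)" for p q
  have A: "finite (A p q)" "A p q \<noteq> {}" for p q by (auto simp: A_def)
  have \<delta>0: "0 < \<delta> p q" for p q unfolding \<delta>_def using A by (subst Min_gr_iff) (auto simp: A_def \<epsilon>(1))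
  have \<delta>1: "\<delta> p q \<le> 1" for p q unfolding \<delta>_def using A by (intro Min_le) (auto simp: A_def)
  have \<delta>\<epsilon>: "\<delta> p q \<le> \<epsilon> (max p p') (q + q' + 1)" if "p' + q' \<le> p + q" for p q p' q'
    unfolding \<delta>_def using A that by (intro Min_le) (auto simp: A_def intro!: image_eqI[of _ _ "(p', q')"])
  define B where "B = {u. \<exists>p q. u \<in> dist_space \<mu> p q \<and> dist_norm \<mu> p q u < \<delta> p q}"
  have BD: "B \<subseteq> distributions \<mu>" by (auto simp: B_def distributions_def)
  have BB: "wick \<mu> u v \<in> W" if uv: "u \<in> B" "v \<in> B" for u v
  proof -
    obtain p1 q1 where u: "u \<in> dist_space \<mu> p1 q1" "dist_norm \<mu> p1 q1 u < \<delta> p1 q1" using uv by (auto simp: B_def)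
    obtain p2 q2 where v: "v \<in> dist_space \<mu> p2 q2" "dist_norm \<mu> p2 q2 v < \<delta> p2 q2" using uv by (auto simp: B_def)
    let ?x = "dist_norm \<mu> p1 q1 u" and ?y = "dist_norm \<mu> p2 q2 v"
    have nn: "0 \<le> ?x" "0 \<le> ?y" by (rule dist_norm_nonneg[OF u(1)], rule dist_norm_nonneg[OF v(1)])
    have le1: "?x \<le> 1" "?y \<le> 1" using u(2) v(2) \<delta>1[of p1 q1] \<delta>1[of p2 q2] by linarith+
    \<comment> \<open>The factor with the larger \<open>p + q\<close> is kept and the other is
      estimated by 1; the radius of the kept one was chosen for this pair.\<close>
    have "?x * ?y < \<epsilon> (max p1 p2) (q1 + q2 + 1)"
    proof (cases "p2 + q2 \<le> p1 + q1")
      case True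
      have "?x * ?y \<le> ?x" using nn le1 by (simp add: mult_left_le)
      then show ?thesis using u(2) \<delta>\<epsilon>[OF True] by linarith
    next
      case False
      have "?x * ?y \<le> ?y" using nn le1 by (simp add: mult_left_le_one_le)
      moreover have "\<delta> p2 q2 \<le> \<epsilon> (max p1 p2) (q1 + q2 + 1)"
        using \<delta>\<epsilon>[of p1 q1 p2 q2] False by (simp add: max.commute add.commute)
      ultimately show ?thesis using v(2) by linarith
    qed
    then show ?thesis using wick_estimate(1,2)[OF u(1) v(1)] \<epsilon>(2) by (meson le_less_trans)
  qed
  \<comment> \<open>\<open>U2\<close> is the polar of \<open>B\<close> and \<open>U1\<close> that of
    \<open>U2\<close>. Both contain \<open>B\<close>, hence a ball of every step, and polars of
    \<open>W\<close> inherit its absolute convexity by bilinearity.\<close>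
  define U2 where "U2 = {v \<in> distributions \<mu>. \<forall>u\<in>B. wick \<mu> u v \<in> W}"
  define U1 where "U1 = {u \<in> distributions \<mu>. \<forall>v\<in>U2. wick \<mu> u v \<in> W}"
  have "U2 \<subseteq> distributions \<mu>" by (auto simp: U2_def)
  have "B \<subseteq> U2" using BB BD by (auto simp: U2_def)
  have "B \<subseteq> U1" using BD by (auto simp: U1_def U2_def)
  have nb: "zero_nbhd U" if "U \<subseteq> distributions \<mu>" "absolutely_convex U" "B \<subseteq> U" for U
    unfolding zero_nbhd_def
  proof (intro conjI allI that)
    show "\<exists>\<epsilon>>0. \<forall>\<Phi>\<in>dist_space \<mu> p q. dist_norm \<mu> p q \<Phi> < \<epsilon> \<longrightarrow> \<Phi> \<in> U" for p q
      using that(3) \<delta>0[of p q] by (intro exI[of _ "\<delta> p q"]) (auto simp: B_def)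
  qed
  show ?thesis
  proof (rule exI[of _ U1], rule exI[of _ U2], intro conjI)
    show "zero_nbhd U1"
      using absolutely_convex_wick(2)[OF zero_nbhdD(2)[OF W] \<open>U2 \<subseteq> distributions \<mu>\<close>] \<open>B \<subseteq> U1\<close>
      by (intro nb) (auto simp: U1_def)
    show "zero_nbhd U2"
      using absolutely_convex_wick(1)[OF zero_nbhdD(2)[OF W] BD] \<open>B \<subseteq> U2\<close>
      by (intro nb) (auto simp: U2_def)
  qed (auto simp: U1_def)
qed

lemma wick_add_expand:
  assumes "\<Phi> \<in> distributions \<mu>" "\<Psi> \<in> distributions \<mu>" "u \<in> distributions \<mu>" "v \<in> distributions \<mu>"
  shows "wick \<mu> (\<lambda>\<phi>. 1 * \<Phi> \<phi> + 1 * u \<phi>) (\<lambda>\<phi>. 1 * \<Psi> \<phi> + 1 * v \<phi>) =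
    (\<lambda>\<phi>. wick \<mu> \<Phi> \<Psi> \<phi> + (wick \<mu> \<Phi> v \<phi> + (wick \<mu> u \<Psi> \<phi> + wick \<mu> u v \<phi>)))"
  unfolding wick_lin(1)[OF assms(1,3) distributions_lincomb[OF assms(2,4)]]
    wick_lin(2)[OF assms(2,4,1)] wick_lin(2)[OF assms(2,4,3)] by (simp add: algebra_simps)

lemma wick_continuous:
  "continuous_map (prod_topology (dist_topology \<mu>) (dist_topology \<mu>)) (dist_topology \<mu>) (\<lambda>(\<Phi>, \<Psi>). wick \<mu> \<Phi> \<Psi>)"
  unfolding continuous_map_def topspace_prod_topology topspace_dist_topology
proof (intro conjI allI impI)
  show "(\<lambda>(\<Phi>, \<Psi>). wick \<mu> \<Phi> \<Psi>) \<in> distributions \<mu> \<times> distributions \<mu> \<rightarrow> distributions \<mu>"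
    using wick_distributions(1) by auto
  fix G assume G: "openin (dist_topology \<mu>) G"
  show "openin (prod_topology (dist_topology \<mu>) (dist_topology \<mu>))
      {x \<in> distributions \<mu> \<times> distributions \<mu>. (case x of (\<Phi>, \<Psi>) \<Rightarrow> wick \<mu> \<Phi> \<Psi>) \<in> G}"
    unfolding openin_prod_topology_alt
  proof (intro allI impI)
    fix \<Phi> \<Psi> assume "(\<Phi>, \<Psi>) \<in> {x \<in> distributions \<mu> \<times> distributions \<mu>. (case x of (\<Phi>, \<Psi>) \<Rightarrow> wick \<mu> \<Phi> \<Psi>) \<in> G}"
    then have \<Phi>: "\<Phi> \<in> distributions \<mu>" and \<Psi>: "\<Psi> \<in> distributions \<mu>" and inG: "wick \<mu> \<Phi> \<Psi> \<in> G" by auto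
    obtain V where V: "zero_nbhd V" "\<And>v. v \<in> V \<Longrightarrow> (\<lambda>\<phi>. wick \<mu> \<Phi> \<Psi> \<phi> + v \<phi>) \<in> G"
      using G inG unfolding openin_dist_topology_iff by blast
    \<comment> \<open>The increment of a bilinear map has three terms. With the factor 4 their sum
      is an absolutely convex combination of elements of \<open>V\<close>.\<close>
    let ?W = "{v \<in> distributions \<mu>. (\<lambda>\<phi>. 4 * v \<phi>) \<in> V}"
    have W: "zero_nbhd ?W" by (rule zero_nbhd_scale[OF V(1)])
    obtain U1 U2 where U: "zero_nbhd U1" "zero_nbhd U2" "\<forall>u\<in>U1. \<forall>v\<in>U2. wick \<mu> u v \<in> ?W"
      using zero_nbhd_wick_pair[OF W] by (elim exE conjE)
    let ?L = "{v \<in> distributions \<mu>. \<forall>u\<in>{\<Phi>}. wick \<mu> u v \<in> ?W}" and ?R = "{u \<in> distributions \<mu>. \<forall>v\<in>{\<Psi>}. wick \<mu> u v \<in> ?W}"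
    have V1: "zero_nbhd (U1 \<inter> ?R)" by (intro zero_nbhd_Int U zero_nbhd_wick_fixed(2) W \<Psi>)
    have V2: "zero_nbhd (U2 \<inter> ?L)" by (intro zero_nbhd_Int U zero_nbhd_wick_fixed(1) W \<Phi>)
    obtain G1 where G1: "openin (dist_topology \<mu>) G1" "\<Phi> \<in> G1" "\<forall>w\<in>G1. (\<lambda>\<phi>. w \<phi> - \<Phi> \<phi>) \<in> U1 \<inter> ?R"
      using zero_nbhd_open[OF V1 \<Phi>] by (elim exE conjE)
    obtain G2 where G2: "openin (dist_topology \<mu>) G2" "\<Psi> \<in> G2" "\<forall>w\<in>G2. (\<lambda>\<phi>. w \<phi> - \<Psi> \<phi>) \<in> U2 \<inter> ?L"
      using zero_nbhd_open[OF V2 \<Psi>] by (elim exE conjE)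
    have "wick \<mu> w z \<in> G" if wz: "w \<in> G1" "z \<in> G2" for w z
    proof -
      define u where "u = (\<lambda>\<phi>. w \<phi> - \<Phi> \<phi>)"
      define v where "v = (\<lambda>\<phi>. z \<phi> - \<Psi> \<phi>)"
      have u: "u \<in> U1" "u \<in> ?R" and v: "v \<in> U2" "v \<in> ?L" using bspec[OF G1(3) wz(1)] bspec[OF G2(3) wz(2)] by (auto simp: u_def v_def)
      have ud: "u \<in> distributions \<mu>" and vd: "v \<in> distributions \<mu>" using u v by auto
      let ?a = "wick \<mu> \<Phi> v" and ?b = "wick \<mu> u \<Psi>" and ?c = "wick \<mu> u v"
      have abc: "(\<lambda>\<phi>. 4 * ?a \<phi>) \<in> V" "(\<lambda>\<phi>. 4 * ?b \<phi>) \<in> V" "(\<lambda>\<phi>. 4 * ?c \<phi>) \<in> V"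
        using u v U(3) by auto
      note ac = absolutely_convexD[OF zero_nbhdD(2)[OF V(1)]]
      have "(\<lambda>\<phi>. 1/2 * (4 * ?b \<phi>) + 1/2 * (4 * ?c \<phi>)) \<in> V" by (rule ac[OF abc(2,3)]) (simp add: norm_divide)
      \<comment> \<open>The weights add up to \<open>3/4\<close>; the quarter restores the first
        term, the half the other two.\<close>
      from ac[OF abc(1) this, of "1/4" "1/2"] have "(\<lambda>\<phi>. ?a \<phi> + (?b \<phi> + ?c \<phi>)) \<in> V"
        by (simp add: norm_divide algebra_simps)
      from V(2)[OF this] have "wick \<mu> (\<lambda>\<phi>. 1 * \<Phi> \<phi> + 1 * u \<phi>) (\<lambda>\<phi>. 1 * \<Psi> \<phi> + 1 * v \<phi>) \<in> G"
        unfolding wick_add_expand[OF \<Phi> \<Psi> ud vd] .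
      then show ?thesis by (simp add: u_def v_def)
    qed
    moreover have "G1 \<subseteq> distributions \<mu>" "G2 \<subseteq> distributions \<mu>"
      using G1(1) G2(1) unfolding openin_dist_topology_iff by blast+
    ultimately have "G1 \<times> G2 \<subseteq> {x \<in> distributions \<mu> \<times> distributions \<mu>. (case x of (\<Phi>, \<Psi>) \<Rightarrow> wick \<mu> \<Phi> \<Psi>) \<in> G}"
      by auto
    then show "\<exists>U V. openin (dist_topology \<mu>) U \<and> openin (dist_topology \<mu>) V \<and> \<Phi> \<in> U \<and> \<Psi> \<in> V \<and>
        U \<times> V \<subseteq> {x \<in> distributions \<mu> \<times> distributions \<mu>. (case x of (\<Phi>, \<Psi>) \<Rightarrow> wick \<mu> \<Phi> \<Psi>) \<in> G}"
      using G1(1,2) G2(1,2) by blast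
  qed
qed

end

theorem proposition38:
  fixes Hp :: "nat \<Rightarrow> 'h::{real_inner, polish_space} set"
    and ip :: "nat \<Rightarrow> 'h \<Rightarrow> 'h \<Rightarrow> real"
    and \<mu> :: "('h \<Rightarrow> real) measure"
  assumes "nuclear_triple Hp ip"
    and "\<mu> \<in> nuclear_triple.M_a Hp ip"
    and "prob_space \<mu>"
    and "nuclear_triple.nondegenerate Hp ip \<mu>"
  shows "continuous_map
      (prod_topology (nuclear_triple.dist_topology Hp ip \<mu>) (nuclear_triple.dist_topology Hp ip \<mu>))
      (nuclear_triple.dist_topology Hp ip \<mu>)
      (\<lambda>(\<Phi>, \<Psi>). nuclear_triple.wick Hp ip \<mu> \<Phi> \<Psi>)
    \<and> (\<forall>p\<^sub>1 p\<^sub>2 q\<^sub>1 q\<^sub>2 p q.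
        \<forall>\<Phi> \<in> nuclear_triple.dist_space Hp ip \<mu> p\<^sub>1 q\<^sub>1.
        \<forall>\<Psi> \<in> nuclear_triple.dist_space Hp ip \<mu> p\<^sub>2 q\<^sub>2.
          p = max p\<^sub>1 p\<^sub>2 \<longrightarrow> q = q\<^sub>1 + q\<^sub>2 + 1 \<longrightarrow>
          nuclear_triple.wick Hp ip \<mu> \<Phi> \<Psi> \<in> nuclear_triple.dist_space Hp ip \<mu> p q \<and>
          nuclear_triple.dist_norm Hp ip \<mu> p q (nuclear_triple.wick Hp ip \<mu> \<Phi> \<Psi>)
            \<le> nuclear_triple.dist_norm Hp ip \<mu> p\<^sub>1 q\<^sub>1 \<Phi> * nuclear_triple.dist_norm Hp ip \<mu> p\<^sub>2 q\<^sub>2 \<Psi>)"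
proof -
  interpret nuclear_measure Hp ip \<mu>
    by (intro nuclear_measure.intro nuclear_measure_axioms.intro assms)
  show ?thesis
    by (intro conjI allI ballI impI wick_continuous; hypsubst; intro wick_estimate)
qed

end
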